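(* Let $\ell>3$ be prime. Let $1\le\beta_\ell\le\ell-1$ be defined by $24\beta_\ell\equiv 1\pmod{\ell}$ and let $r_\ell:=\frac{24\beta_\ell-1}{\ell}$. (1) The second rank moment satisfies $$\sum_{n\ge0}N_2(\ell n+\beta_\ell)q^{24n+r_\ell}\equiv \eta^{r_\ell}(24z)\,G_{\ell,2}(24z)\pmod{\ell},$$ where $G_{\ell,2}(z)$ is a sum of level $1$ modular forms with $\ell$-integral coefficients, each of weight at most $\frac{\ell(\ell+3)-r_\ell-1}{2}$. (2) For $2\le k\le\frac{\ell-3}{2}$, $$\sum_{n\ge0}N_{2k}(\ell n+\beta_\ell)q^{24n+r_\ell}\equiv c_k\sum_{n\ge0}N_2(\ell n+\beta_\ell)q^{24n+r_\ell}+\eta^{r_\ell}(24z)\,G_{\ell,2k}(24z)\pmod{\ell},$$ where $c_k$ is an integer and $G_{\ell,2k}(z)$ is a sum of level $1$ modular forms with $\ell$-integral coefficients and weight at most $k(\ell+1)-1+\frac12(\ell-r_\ell)$. (3) Finally, $$\sum_{n\ge0}N_{\ell-1}(\ell n+\beta_\ell)q^{24n+r_\ell}\equiv c_{\ell-1}\sum_{n\ge0}N_2(\ell n+\beta_\ell)q^{24n+r_\ell}+\eta^{r_\ell}(24z)G_{\ell,\ell-1}(24z)+\frac1\ell\,\eta^{r_\ell}(24z)\big(H_{1,\ell}(24z)-H_{2,\ell}(24z)\big)\pmod{\ell},$$ where $G_{\ell,\ell-1}(z)$ is a sum of level $1$ modular forms with integer coefficients of weight at most $\frac{\ell(\ell+1)-r_\ell-3}{2}$,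 $c_{\ell-1}$ is an integer, and $H_{1,\ell}(z)$, $H_{2,\ell}(z)$ are level $1$ modular forms with integer coefficients of weights $\frac{\ell(\ell-1)-r_\ell-1}{2}$ and $\frac{\ell(\ell+1)-r_\ell-3}{2}$ respectively, such that $H_{1,\ell}(z)\equiv H_{2,\ell}(z)\pmod{\ell}$.
   Context: $q=e^{2\pi i z}$, $z\in\mathbb{H}$, and $\eta(z):=q^{1/24}\prod_{n\ge1}(1-q^n)$ is Dedekind's eta function. The rank of a partition is its largest part minus its number of parts; $N(m,n)$ is the number of partitions of $n$ with rank $m$, and the $k$-th rank moment is $N_k(n):=\sum_{m\in\mathbb{Z}}m^kN(m,n)$. A rational number is $\ell$-integral if its denominator is not divisible by $\ell$; a congruence modulo $\ell$ between $q$-series with $\ell$-integral coefficients means coefficientwise congruence. "Level 1 modular forms" are holomorphic modular forms on $SL_2(\mathbb{Z})$. *)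

theory Defs
  imports Complex_Main "HOL-Library.Multiset" "HOL-Number_Theory.Number_Theory"
    "HOL-Computational_Algebra.Formal_Power_Series"
begin

definition partitions :: "nat \<Rightarrow> nat multiset set" where
  "partitions n = {M. (\<forall>x\<in>#M. 0 < x) \<and> sum_mset M = n}"

definition prank :: "nat multiset \<Rightarrow> int" where
  "prank M = (if M = {#} then 0 else int (Max (set_mset M))) - int (size M)"

definition Nrank :: "int \<Rightarrow> nat \<Rightarrow> nat" where
  "Nrank m n = card {M \<in> partitions n. prank M = m}"

text \<open>k-th rank moment. N(m,n) = 0 for |m| > n, so the sum over all integers m
  reduces to the finite range -n..n.\<close>
definition rank_moment :: "nat \<Rightarrow> nat \<Rightarrow> int" where
  "rank_moment k n = (\<Sum>m\<in>{-int n..int n}. m ^ k * int (Nrank m n))"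

definition l_integral :: "nat \<Rightarrow> rat \<Rightarrow> bool" where
  "l_integral l x \<longleftrightarrow> \<not> (int l dvd snd (quotient_of x))"

definition fps_cong :: "nat \<Rightarrow> rat fps \<Rightarrow> rat fps \<Rightarrow> bool" where
  "fps_cong l A B \<longleftrightarrow> (\<forall>j. l_integral l (fps_nth A j) \<and> l_integral l (fps_nth B j)
      \<and> l_integral l ((fps_nth A j - fps_nth B j) / of_nat l))"

definition qexp :: "(nat \<Rightarrow> complex) \<Rightarrow> complex \<Rightarrow> complex" where
  "qexp a z = (\<Sum>n. a n * exp (2 * of_real pi * \<i> * of_nat n * z))"

text \<open>A holomorphic modular form of weight k on SL2(Z) with q-expansion coefficients a:
  the q-series converges on the upper half-plane (so defines a holomorphic function there,
  holomorphic at the cusp since only n >= 0 occur) and satisfies the transformation law.\<close>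
definition is_modular_form :: "int \<Rightarrow> (nat \<Rightarrow> complex) \<Rightarrow> bool" where
  "is_modular_form k a \<longleftrightarrow>
     (\<forall>z. 0 < Im z \<longrightarrow> summable (\<lambda>n. a n * exp (2 * of_real pi * \<i> * of_nat n * z))) \<and>
     (\<forall>(p::int) (q::int) (c::int) (d::int) z. p * d - q * c = 1 \<longrightarrow> 0 < Im z \<longrightarrow>
        qexp a ((of_int p * z + of_int q) / (of_int c * z + of_int d))
          = (of_int c * z + of_int d) powi k * qexp a z)"

definition sum_mf_bounded :: "(rat \<Rightarrow> bool) \<Rightarrow> real \<Rightarrow> (nat \<Rightarrow> rat) \<Rightarrow> bool" where
  "sum_mf_bounded P W g \<longleftrightarrow>
     (\<exists>fs :: (int \<times> (nat \<Rightarrow> rat)) list.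
        (\<forall>(k, f) \<in> set fs. (\<forall>n. P (f n)) \<and> is_modular_form k (\<lambda>n. of_rat (f n))
                            \<and> real_of_int k \<le> W)
        \<and> g = (\<lambda>n. sum_list (map (\<lambda>(k, f). f n) fs)))"

text \<open>q-expansion of eta(24z)^r = q^r prod_{n>=1} (1 - q^(24n))^r.\<close>
definition eta24 :: "nat \<Rightarrow> rat fps" where
  "eta24 r = Abs_fps (\<lambda>m. fps_nth (fps_X ^ r * (\<Prod>n\<in>{1..m}. (1 - fps_X ^ (24 * n))) ^ r) m)"

definition dil24 :: "(nat \<Rightarrow> rat) \<Rightarrow> rat fps" where
  "dil24 g = Abs_fps (\<lambda>j. if 24 dvd j then g (j div 24) else 0)"

definition rank_gen :: "nat \<Rightarrow> nat \<Rightarrow> nat \<Rightarrow> nat \<Rightarrow> rat fps" where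
  "rank_gen k l \<beta> r = Abs_fps (\<lambda>j. if r \<le> j \<and> 24 dvd (j - r)
      then of_int (rank_moment k (l * ((j - r) div 24) + \<beta>)) else 0)"

end

theory Submission
  imports Defs "HOL-Complex_Analysis.Complex_Analysis" "HOL-Library.Poly_Mapping"
    "HOL-Computational_Algebra.Polynomial"
begin

text \<open>
  Rank moments are combinations of the odd moments \<open>Y\<^sub>a(n)\<close> of the numbers of partitions of \<open>n\<close> with
  rank at least \<open>m\<close>. The rank-crank relation turns into \<open>(24 n - 1) Y\<^sub>a + Y\<^bsub>a+2\<^esub> = 2 [P W\<^sub>a]\<^sub>n\<close>, where
  \<open>P\<close> is the generating function of partitions and \<open>W\<^sub>a\<close> is a polynomial in the divisor sum series
  \<open>S\<^bsub>2k\<^esub> = \<Sum> \<sigma>\<^bsub>2k-1\<^esub>(n) q\<^sup>n\<close>. On the progression \<open>n \<equiv> \<beta>\<close> the factor \<open>24 n - 1\<close> vanishes modulo \<open>l\<close>,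
  so \<open>Y\<^bsub>a+2\<^esub> \<equiv> 2 [P W\<^sub>a]\<^sub>n\<close> there; moreover \<open>Y\<^sub>1 \<equiv> Y\<^sub>l\<close> by Fermat, which expresses the second moment itself.
  Modulo \<open>l\<close> the series \<open>S\<^sub>2\<close> may be replaced by \<open>S\<^bsub>l+1\<^esub>\<close>, hence \<open>W\<^sub>a\<close> by a sum of level one forms \<open>F\<close>.
  Finally \<open>P F\<close> restricted to the progression is computed from \<open>\<eta>\<^sup>s F\<close> with \<open>s = l - 1\<close> (modulo \<open>l\<close>) or
  \<open>s = l\<^sup>2 - 1\<close> (modulo \<open>l\<^sup>2\<close>): the Hecke operator of index \<open>l\<close> maps it to \<open>\<eta>\<^sup>t\<close> times a level one form.
  The series \<open>S\<^bsub>l-1\<^esub>\<close>, whose constant term has denominator \<open>l\<close>, gives the forms \<open>H\<^sub>1\<close> and \<open>H\<^sub>2\<close>; in the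
  second moment its contributions cancel. The Eisenstein series are shown to be modular by a recursion
  coming from Liouville's elementary identities, starting from the transformation law of \<open>E\<^sub>2\<close>.
\<close>

section \<open>Ranks of partitions\<close>

text \<open>The second moment is the hard case, because the recursion yields every odd moment except
  the first. Reaching it through \<open>Y_l\<close> costs a denominator: the top coefficient of
  \<open>W_{l-2}\<close> contains \<open>1/l\<close>, so the series \<open>P W\<close> must be
  controlled modulo \<open>l^2\<close>, and this is why the Hecke operator is also applied with
  \<open>s = l^2 - 1\<close>. The other source of \<open>l\<close> in a denominator is the Bernoulli
  number of index \<open>l - 1\<close>, hence the special role of \<open>S_{l-1}\<close>. It leaves
  the second moment because q d/dq S_{l-1} is congruent to S_2(q) - S_2(q^l), which trades S_2
  S_{l-1} for S_{l-1} on the progression, and because the two leading coefficients of one explicit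
  polynomial then match. The rank-crank relation rests on two recursions with the same step: tails
  of the rank distribution are linked at \<rho> and \<rho> + 3 by a bijection, tails of the cubed
  crank product by its symmetry under z -> q/z.\<close>

lemma partitions_size_le: "M \<in> partitions n \<Longrightarrow> size M \<le> n"
proof -
  have "size M \<le> sum_mset M" if "\<forall>x\<in>#M. 0 < x" for M :: "nat multiset"
    using that by (induction M) auto
  thus "M \<in> partitions n \<Longrightarrow> size M \<le> n" by (auto simp: partitions_def)
qed

lemma partitions_elem_le: "M \<in> partitions n \<Longrightarrow> x \<in># M \<Longrightarrow> x \<le> n"
  by (auto simp: partitions_def dest: multi_member_split)

lemma finite_partitions [simp]: "finite (partitions n)"
proof -
  have "partitions n \<subseteq> {M. size M \<le> n \<and> set_mset M \<subseteq> {..n}}"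
    using partitions_size_le partitions_elem_le by auto
  moreover have "finite {M. size M \<le> n \<and> set_mset M \<subseteq> {..n}}"
  proof -
    have "{M. size M \<le> n \<and> set_mset M \<subseteq> {..n}} \<subseteq> mset ` {xs. set xs \<subseteq> {..n} \<and> length xs \<le> n}"
    proof
      fix M assume "M \<in> {M. size M \<le> n \<and> set_mset M \<subseteq> {..n}}"
      thus "M \<in> mset ` {xs. set xs \<subseteq> {..n} \<and> length xs \<le> n}"
        by (intro image_eqI[of _ _ "sorted_list_of_multiset M"]) (auto simp flip: size_mset)
    qed
    thus ?thesis using finite_lists_length_le[of "{..n}" n] finite_subset by blast
  qed
  ultimately show ?thesis by (rule finite_subset)
qed

definition pn :: "nat \<Rightarrow> nat" where "pn n = card (partitions n)"

definition rank_ge :: "int \<Rightarrow> nat \<Rightarrow> nat" where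
  "rank_ge \<rho> n = card {M \<in> partitions n. prank M \<ge> \<rho>}"

lemma Max_part_le: "M \<in> partitions n \<Longrightarrow> M \<noteq> {#} \<Longrightarrow> Max (set_mset M) \<le> n"
  using partitions_elem_le by (metis Max_in finite_set_mset set_mset_eq_empty_iff)

lemma prank_nonempty: "M \<noteq> {#} \<Longrightarrow> prank M = int (Max (set_mset M)) - int (size M)"
  by (simp add: prank_def)

lemma prank_bounds:
  assumes "M \<in> partitions n"
  shows "prank M \<le> int n" "prank M \<ge> - int n"
proof -
  have "prank M \<le> int n \<and> prank M \<ge> - int n"
  proof (cases "M = {#}")
    case False
    thus ?thesis using Max_part_le[OF assms False] prank_nonempty[OF False] partitions_size_le[OF assms] by linarith
  qed (auto simp: prank_def)
  thus "prank M \<le> int n" "prank M \<ge> - int n" by auto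
qed

lemma rank_ge_eq_0: "\<rho> \<ge> 1 \<Longrightarrow> int n < \<rho> + 1 \<Longrightarrow> rank_ge \<rho> n = 0"
proof -
  assume r: "\<rho> \<ge> 1" "int n < \<rho> + 1"
  have "{M \<in> partitions n. prank M \<ge> \<rho>} = {}"
  proof safe
    fix M assume M: "M \<in> partitions n" "\<rho> \<le> prank M"
    hence ne: "M \<noteq> {#}" using r by (auto simp: prank_def)
    hence "size M \<ge> 1" by (simp add: Suc_le_eq nonempty_has_size)
    hence False using M r Max_part_le[OF M(1) ne] prank_nonempty[OF ne] by linarith
    thus "M \<in> {}" ..
  qed
  thus ?thesis by (simp add: rank_ge_def)
qed

text \<open>Remove the largest part and add a first column of length (largest part - \<rho> - 1).\<close>

lemma rank_ge_rec:
  assumes r: "\<rho> \<ge> 1" and n: "n \<ge> \<rho> + 1"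
  shows "rank_ge (int \<rho>) n = pn (n - \<rho> - 1) - rank_ge (int \<rho> + 3) (n - \<rho> - 1)"
proof -
  define A where "A = {M \<in> partitions n. prank M \<ge> int \<rho>}"
  define B where "B = {M \<in> partitions (n - \<rho> - 1). prank M \<le> int \<rho> + 2}"
  define f where "f M = (let a = Max (set_mset M); N = image_mset Suc (M - {#a#}) in N + replicate_mset (a - \<rho> - 1 - size N) 1)" for M :: "nat multiset"
  define g where "g M = filter_mset (\<lambda>x. x > 0) (image_mset (\<lambda>x. x - 1) M) + {#size M + \<rho> + 1#}" for M :: "nat multiset"
  have fA: "f M \<in> B \<and> g (f M) = M" if M: "M \<in> A" for M
  proof -
    have Mp: "M \<in> partitions n" "prank M \<ge> int \<rho>" using M by (auto simp: A_def)
    have ne: "M \<noteq> {#}" using Mp r by (auto simp: prank_def)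
    define a where "a = Max (set_mset M)"
    have a: "a \<in># M" using ne by (simp add: a_def)
    define N where "N = M - {#a#}"
    have MN: "M = add_mset a N" using a by (simp add: N_def)
    have Nle: "x \<le> a" if "x \<in># N" for x using that ne a_def by (auto simp: N_def dest: in_diffD)
    have sz: "a \<ge> \<rho> + 1 + size N" using Mp prank_nonempty[OF ne, folded a_def] MN by simp
    define k where "k = a - \<rho> - 1 - size N"
    have fM: "f M = image_mset Suc N + replicate_mset k 1"
      by (simp add: f_def Let_def a_def[symmetric] N_def[symmetric] k_def)
    have ss: "sum_mset (image_mset Suc N) = sum_mset N + size N" by (induction N) auto
    have sumM: "a + sum_mset N = n" and Npos: "\<forall>x\<in>#N. 0 < x" using Mp by (auto simp: partitions_def MN)
    have szf: "size (f M) = a - \<rho> - 1" using sz by (simp add: fM k_def)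
    have "sum_mset (f M) = n - \<rho> - 1" using sz sumM by (simp add: fM ss k_def)
    hence fp: "f M \<in> partitions (n - \<rho> - 1)" by (auto simp: partitions_def fM)
    \<comment> \<open>The new column raises every remaining part to at most a + 1 and brings the
      number of parts to a - \<rho> - 1. The image is therefore everything outside rank \<ge> \<rho>
      + 3, which is where the step 3 of the recursion comes from.\<close>
    have "prank (f M) \<le> int \<rho> + 2"
    proof (cases "f M = {#}")
      case False
      have "Max (set_mset (f M)) \<le> a + 1" using False Nle by (subst Max_le_iff) (auto simp: fM split: if_splits)
      moreover have "int (size (f M)) = int a - int \<rho> - 1" using szf sz by simp
      ultimately show ?thesis using prank_nonempty[OF False] by linarith
    qed (auto simp: prank_def)
    moreover have "g (f M) = M"
    proof -
      have i1: "image_mset (\<lambda>x. x - 1) (f M) = N + replicate_mset k 0" by (simp add: fM multiset.map_comp o_def)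
      have f1: "filter_mset (\<lambda>x. x > 0) N = N" using Npos by (simp add: filter_mset_eq_conv)
      have f2: "filter_mset (\<lambda>x. 0 < x) (replicate_mset k 0) = ({#} :: nat multiset)" by auto
      have c: "size (f M) + \<rho> + 1 = a" using szf sz by simp
      have "g (f M) = N + {#a#}" unfolding g_def i1 filter_union_mset f1 f2 c by simp
      also have "\<dots> = M" by (subst MN) simp
      finally show ?thesis .
    qed
    ultimately show ?thesis using fp by (simp add: B_def)
  qed
  have gB: "g M \<in> A \<and> f (g M) = M" if M: "M \<in> B" for M
  proof -
    have Mp: "M \<in> partitions (n - \<rho> - 1)" "prank M \<le> int \<rho> + 2" using M by (auto simp: B_def)
    define N where "N = filter_mset (\<lambda>x. x > 0) (image_mset (\<lambda>x. x - 1) M)"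
    define c where "c = size M + \<rho> + 1"
    have gM: "g M = add_mset c N" by (simp add: g_def N_def c_def)
    have pos: "\<forall>x\<in>#M. 0 < x" and sM: "sum_mset M = n - \<rho> - 1" using Mp by (auto simp: partitions_def)
    \<comment> \<open>The parts equal to 1 vanish when the first column is removed; their number is
      what \<open>f\<close> restores.\<close>
    define k where "k = count M 1"
    have decomp: "M = image_mset Suc N + replicate_mset k 1" using pos unfolding N_def k_def
    proof (induction M)
      case (add x M)
      thus ?case by (cases "x = 1") (auto simp: )
    qed auto
    have ss: "sum_mset (image_mset Suc N) = sum_mset N + size N" by (induction N) auto
    have sum: "sum_mset M = sum_mset N + size M" using arg_cong[OF decomp, of sum_mset] arg_cong[OF decomp, of size] ss by simp
    have szM: "size M = size N + k" using arg_cong[OF decomp, of size] by simp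
    have "sum_mset (g M) = n" using sum sM n by (simp add: gM c_def)
    hence gp: "g M \<in> partitions n" by (auto simp: partitions_def gM N_def c_def)
    have Nle: "x \<le> c" if "x \<in># N" for x
    proof -
      have "Suc x \<in># M" using that by (subst decomp) auto
      hence "Suc x \<le> Max (set_mset M)" "M \<noteq> {#}" by auto
      thus ?thesis using Mp by (simp add: prank_def c_def)
    qed
    hence mx: "Max (set_mset (g M)) = c" by (auto simp: gM intro!: Max_eqI)
    have "prank (g M) \<ge> int \<rho>" using szM mx by (simp add: prank_def gM) (simp add: c_def)
    moreover have "f (g M) = M"
      using szM by (subst (2) decomp) (simp add: f_def Let_def mx, simp add: gM c_def)
    ultimately show ?thesis using gp by (simp add: A_def)
  qed
  have "card A = card B"
    by (rule bij_betw_same_card[of f]) (rule bij_betw_byWitness[where f' = g], use fA gB in auto)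
  also have "B = partitions (n - \<rho> - 1) - {M \<in> partitions (n - \<rho> - 1). prank M \<ge> int \<rho> + 3}"
    by (auto simp: B_def)
  also have "card \<dots> = pn (n - \<rho> - 1) - rank_ge (int \<rho> + 3) (n - \<rho> - 1)"
    by (subst card_Diff_subset) (auto simp: pn_def rank_ge_def)
  finally show ?thesis by (simp add: A_def rank_ge_def)
qed

lemma rank_ge_le_pn: "rank_ge \<rho> n \<le> pn n"
  unfolding rank_ge_def pn_def by (rule card_mono) auto

section \<open>Conjugation of partitions and the symmetry of ranks\<close>

definition conj_part :: "nat multiset \<Rightarrow> nat multiset" where
  "conj_part M = (if M = {#} then {#} else mset (map (\<lambda>i. size (filter_mset (\<lambda>x. x \<ge> i) M)) [1..<Suc (Max (set_mset M))]))"

text \<open>The Young diagram counted by columns instead of rows.\<close>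

lemma sum_mset_eq_sum_tails:
  assumes "\<forall>x\<in>#M. x \<le> K"
  shows "sum_mset M = (\<Sum>i=1..K. size (filter_mset (\<lambda>x. x \<ge> i) M))"
  using assms
proof (induction M)
  case (add x M)
  have "(\<Sum>i=1..K. if i \<le> x then 1 else (0::nat)) = card {i\<in>{1..K}. i \<le> x}" by (simp add: sum.If_cases Int_def)
  also have "{i\<in>{1..K}. i \<le> x} = {1..x}" using add.prems by auto
  finally have "(\<Sum>i=1..K. if i \<le> x then 1 else (0::nat)) = x" by simp
  moreover have "(\<Sum>i=1..K. size (filter_mset (\<lambda>x. x \<ge> i) (add_mset x M))) = (\<Sum>i=1..K. (if i \<le> x then 1 else 0) + size (filter_mset (\<lambda>x. x \<ge> i) M))"
    by (intro sum.cong) auto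
  ultimately show ?case using add by (simp add: sum.distrib)
qed auto

lemma conj_part_props:
  assumes "M \<in> partitions n"
  shows "conj_part M \<in> partitions n" "prank (conj_part M) = - prank M"
proof -
  have "conj_part M \<in> partitions n \<and> prank (conj_part M) = - prank M"
  proof (cases "M = {#}")
    case True thus ?thesis using assms by (auto simp: conj_part_def partitions_def prank_def)
  next
    case False
    define K where "K = Max (set_mset M)"
    define c where "c i = size (filter_mset (\<lambda>x. x \<ge> i) M)" for i
    have K: "K \<in># M" using False by (simp add: K_def)
    have pos: "\<forall>x\<in>#M. 0 < x" using assms by (auto simp: partitions_def)
    hence K0: "K > 0" using K by auto
    have le: "\<forall>x\<in>#M. x \<le> K" by (simp add: K_def)
    have cm: "conj_part M = mset (map c [1..<Suc K])" using False by (simp only: conj_part_def c_def[abs_def] K_def if_False)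
    have c1: "c 1 = size M" using pos by (simp add: c_def Suc_le_eq filter_mset_eq_conv flip: size_eq_0_iff_empty) (metis (mono_tags, lifting) filter_mset_cong filter_mset_True)
    have cpos: "c i > 0" if "i \<le> K" for i 
    proof -
      have "K \<in># filter_mset (\<lambda>x. x \<ge> i) M" using that K by simp
      thus ?thesis by (auto simp: c_def dest!: multi_member_split)
    qed
    have cle: "c i \<le> size M" for i by (simp add: c_def size_filter_mset_lesseq)
    have "sum_mset (conj_part M) = (\<Sum>i\<leftarrow>[1..<Suc K]. c i)" by (simp only: cm sum_mset_sum_list)
    also have "\<dots> = (\<Sum>i=1..K. c i)" by (simp add: interv_sum_list_conv_sum_set_nat atLeastLessThanSuc_atLeastAtMost del: upt_Suc)
    also have "\<dots> = n" using sum_mset_eq_sum_tails[OF le] assms by (simp add: c_def partitions_def)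
    finally have "conj_part M \<in> partitions n" using cpos by (auto simp: partitions_def cm simp del: upt_Suc)
    moreover have szK: "size (conj_part M) = K" by (simp add: cm del: upt_Suc)
    moreover have ne: "conj_part M \<noteq> {#}" using K0 szK by auto
    moreover have "Max (set_mset (conj_part M)) = size M"
      using K0 c1 cle by (intro Max_eqI) (auto simp: cm simp del: upt_Suc intro!: image_eqI[of _ c 1])
    ultimately show ?thesis using False by (simp add: prank_def K_def)
  qed
  thus "conj_part M \<in> partitions n" "prank (conj_part M) = - prank M" by auto
qed

text \<open>The tail counts are weakly decreasing in i, so the multiset of their values determines
  the whole list, and differences of consecutive tail counts are the multiplicities of the
  parts.\<close>

lemma inj_on_conj_part: "inj_on conj_part (partitions n)"
proof (rule inj_onI)
  fix M N assume M: "M \<in> partitions n" and N: "N \<in> partitions n" and eq: "conj_part M = conj_part N"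
  define c where "c X i = size (filter_mset (\<lambda>x. x \<ge> i) X)" for X :: "nat multiset" and i
  have sorted: "rev (map (c X) [1..<Suc K]) = sorted_list_of_multiset (mset (map (c X) [1..<Suc K]))" for X K
  proof -
    have "c X j \<le> c X i" if "i \<le> j" for i j using that unfolding c_def
      by (intro size_mset_mono) (auto simp: subseteq_mset_def)
    hence "sorted (rev (map (c X) [1..<Suc K]))"
      by (simp add: sorted_wrt_rev sorted_wrt_map sorted_wrt_upt del: upt_Suc)
         (rule sorted_wrt_mono_rel[OF _ sorted_wrt_upt], auto)
    thus ?thesis by (metis mset_rev sorted_list_of_multiset_mset sorted_sort_id)
  qed
  show "M = N"
  proof (cases "M = {#} \<or> N = {#}")
    case True
    have "size (conj_part X) = 0 \<longleftrightarrow> X = {#}" if X: "X \<in> partitions n" for X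
    proof (cases "X = {#}")
      case ne: False
      hence "Max (set_mset X) \<in># X" by simp
      hence "Max (set_mset X) > 0" using X by (auto simp: partitions_def simp del: Max_in)
      moreover have "size (conj_part X) = Max (set_mset X)" using ne by (simp add: conj_part_def del: upt_Suc)
      ultimately show ?thesis using ne by simp
    qed (auto simp: conj_part_def)
    with True M N eq show ?thesis by metis
  next
    case False
    define K where "K = Max (set_mset M)"
    define L where "L = Max (set_mset N)"
    have cM: "conj_part M = mset (map (c M) [1..<Suc K])" "conj_part N = mset (map (c N) [1..<Suc L])"
      using False by (simp_all only: conj_part_def c_def[abs_def] K_def L_def if_False de_Morgan_disj)
    have "rev (map (c M) [1..<Suc K]) = rev (map (c N) [1..<Suc L])" using eq sorted cM by metis
    hence maps: "map (c M) [1..<Suc K] = map (c N) [1..<Suc L]" by (metis rev_rev_ident)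
    have KL: "K = L" using arg_cong[OF maps, of length] by (simp del: upt_Suc)
    have ceq: "c M i = c N i" if "i \<ge> 1" for i
    proof (cases "i \<le> K")
      case True
      thus ?thesis using maps KL that by (auto simp: list_eq_iff_nth_eq simp del: upt_Suc) (metis (no_types) map_eq_conv KL atLeastLessThan_iff less_Suc_eq_le maps set_upt One_nat_def)
    next
      case gt: False
      have "c X i = 0" if "K = Max (set_mset X)" "X \<noteq> {#}" for X
        using gt that by (auto simp: c_def dest!: Max_ge[OF finite_set_mset])
      thus ?thesis using False KL by (simp add: K_def L_def)
    qed
    show ?thesis
    proof (rule multiset_eqI)
      fix i
      have cnt: "count X i = c X i - c X (Suc i)" for X
      proof -
        have "filter_mset (\<lambda>x. x \<ge> i) X = filter_mset (\<lambda>x. x \<ge> Suc i) X + replicate_mset (count X i) i"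
          by (rule multiset_eqI) auto
        from arg_cong[OF this, of size] show ?thesis by (simp add: c_def)
      qed
      show "count M i = count N i"
      proof (cases i)
        case 0
        have "0 \<notin># M" "0 \<notin># N" using M N by (auto simp: partitions_def)
        thus ?thesis using 0 by (simp add: not_in_iff)
      qed (use ceq cnt in simp)
    qed
  qed
qed

lemma Nrank_minus: "Nrank (- m) n = Nrank m n"
proof -
  \<comment> \<open>Injectivity of conjugation gives one inequality; using it for both signs gives
    equality.\<close>
  have le: "Nrank m n \<le> Nrank (- m) n" for m
    unfolding Nrank_def
    by (rule card_inj_on_le[of conj_part]) (auto intro: inj_on_subset[OF inj_on_conj_part] simp: conj_part_props)
  from le[of m] le[of "- m"] show ?thesis by simp
qed

lemma rank_ge_eq_sum: "rank_ge \<rho> n = (\<Sum>m\<in>{\<rho>..int n}. Nrank m n)"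
proof -
  have "{M \<in> partitions n. prank M \<ge> \<rho>} = (\<Union>m\<in>{\<rho>..int n}. {M \<in> partitions n. prank M = m})"
    using prank_bounds by auto
  thus ?thesis unfolding rank_ge_def Nrank_def by (simp only:) (rule card_UN_disjoint, auto)
qed

lemma Nrank_eq_diff: "int (Nrank m n) = int (rank_ge m n) - int (rank_ge (m + 1) n)"
proof (cases "m \<le> int n")
  case True
  have "{m..int n} = insert m {m+1..int n}" using True by auto
  thus ?thesis by (simp add: rank_ge_eq_sum)
next
  case False
  hence "Nrank m n = 0" using prank_bounds by (auto simp: Nrank_def)
  thus ?thesis using False by (simp add: rank_ge_eq_sum)
qed

text \<open>Symmetry folds the sum onto positive ranks, and Abel summation replaces the count at
  each rank by the count of ranks at least as large. The boundary term disappears since no partition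
  of n has rank above n.\<close>

lemma rank_moment_even:
  assumes k: "k \<ge> 1"
  shows "rank_moment (2 * k) n = 2 * (\<Sum>M<n. (int (M + 1) ^ (2 * k) - int M ^ (2 * k)) * int (rank_ge (int M + 1) n))"
proof -
  let ?f = "\<lambda>m::int. m ^ (2 * k) * int (Nrank m n)"
  have f0: "?f 0 = 0" using k by simp
  have fm: "?f (- m) = ?f m" for m by (simp add: Nrank_minus)
  have sym: "(\<Sum>m\<in>{- int K..int K}. ?f m) = 2 * (\<Sum>m=1..K. ?f (int m))" for K
  proof (induction K)
    case 0 thus ?case using f0 by simp
  next
    case (Suc K)
    have "{- int (Suc K)..int (Suc K)} = insert (- int (Suc K)) (insert (int (Suc K)) {- int K..int K})" by auto
    thus ?case using Suc fm[of "int (Suc K)"] by simp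
  qed
  have abel: "(\<Sum>m=1..K. ?f (int m)) = (\<Sum>M<K. (int (M + 1) ^ (2 * k) - int M ^ (2 * k)) * int (rank_ge (int M + 1) n)) - int K ^ (2 * k) * int (rank_ge (int K + 1) n)" for K
  proof (induction K)
    case 0 thus ?case using k by simp
  next
    case (Suc K)
    show ?case using Suc by (simp add: Nrank_eq_diff algebra_simps)
  qed
  have "rank_ge (int n + 1) n = 0" by (simp add: rank_ge_eq_sum)
  thus ?thesis unfolding rank_moment_def sym abel by simp
qed

section \<open>The cubed crank product\<close>

definition sig :: "nat \<Rightarrow> nat \<Rightarrow> nat" where "sig k n = (\<Sum>d | d dvd n. d ^ k)"

lemma sig_0 [simp]: "sig k 0 = 0" by (simp add: sig_def)

text \<open>Indexed by the exponent of the divisors: the S_{2k} of the overview is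
  \<open>Sf (2 * k - 1)\<close>, so S_2 is \<open>Sf 1\<close>, S_{l-1} is \<open>Sf (l - 2)\<close>
  and S_{l+1} is \<open>Sf l\<close>.\<close>

definition Sf :: "nat \<Rightarrow> rat fps" where "Sf k = Abs_fps (\<lambda>n. of_nat (sig k n))"

section \<open>Laurent polynomials in the elliptic variable z\<close>

type_synonym laurent = "int \<Rightarrow>\<^sub>0 rat"

lemma laurent_sum_single: "(p :: laurent) = (\<Sum>i\<in>Poly_Mapping.keys p. Poly_Mapping.single i (Poly_Mapping.lookup p i))"
  by (rule poly_mapping_eqI) (simp add: lookup_sum lookup_single when_def in_keys_iff sum.delta)

text \<open>The k-fold derivative z d/dz evaluated at z = 1.\<close>

definition lmom :: "nat \<Rightarrow> laurent \<Rightarrow> rat" where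
  "lmom k p = (\<Sum>i\<in>Poly_Mapping.keys p. of_int i ^ k * Poly_Mapping.lookup p i)"

lemma lmom_superset: "finite S \<Longrightarrow> Poly_Mapping.keys p \<subseteq> S \<Longrightarrow> lmom k p = (\<Sum>i\<in>S. of_int i ^ k * Poly_Mapping.lookup p i)"
  unfolding lmom_def by (rule sum.mono_neutral_left) (auto simp: in_keys_iff)

lemma lmom_add: "lmom k (p + q) = lmom k p + lmom k q"
proof -
  let ?S = "Poly_Mapping.keys p \<union> Poly_Mapping.keys q"
  have "lmom k (p + q) = (\<Sum>i\<in>?S. of_int i ^ k * Poly_Mapping.lookup (p + q) i)"
    by (rule lmom_superset) (use keys_add[of p q] in auto)
  also have "\<dots> = lmom k p + lmom k q"
    by (subst (1 2) lmom_superset[of ?S]) (auto simp: lookup_add algebra_simps sum.distrib)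
  finally show ?thesis .
qed

lemma lmom_diff: "lmom k (p - q) = lmom k p - lmom k q"
  using lmom_add[of k "p - q" q] by simp

lemma lmom_0 [simp]: "lmom k 0 = 0" by (simp add: lmom_def)

lemma lmom_sum: "lmom k (sum f S) = (\<Sum>s\<in>S. lmom k (f s))"
  by (induction S rule: infinite_finite_induct) (auto simp: lmom_add)

lemma lmom_single: "lmom k (Poly_Mapping.single i c) = of_int i ^ k * c"
  by (subst lmom_superset[of "{i}"]) auto

text \<open>The Leibniz rule for k-fold derivatives at z = 1.\<close>

lemma lmom_mult: "lmom k (p * q) = (\<Sum>j\<le>k. of_nat (k choose j) * lmom j p * lmom (k - j) q)"
proof -
  have "p * q = (\<Sum>i\<in>Poly_Mapping.keys p. \<Sum>j\<in>Poly_Mapping.keys q. Poly_Mapping.single (i + j) (Poly_Mapping.lookup p i * Poly_Mapping.lookup q j))"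
    by (subst laurent_sum_single[of p], subst laurent_sum_single[of q]) (simp add: sum_product mult_single)
  hence "lmom k (p * q) = (\<Sum>i\<in>Poly_Mapping.keys p. \<Sum>j\<in>Poly_Mapping.keys q. of_int (i + j) ^ k * (Poly_Mapping.lookup p i * Poly_Mapping.lookup q j))"
    by (simp add: lmom_sum lmom_single)
  also have "\<dots> = (\<Sum>i\<in>Poly_Mapping.keys p. \<Sum>j\<in>Poly_Mapping.keys q. \<Sum>m\<le>k. of_nat (k choose m) * (of_int i ^ m * Poly_Mapping.lookup p i) * (of_int j ^ (k - m) * Poly_Mapping.lookup q j))"
    by (simp add: binomial_ring sum_distrib_right sum_distrib_left mult_ac)
  also have "\<dots> = (\<Sum>i\<in>Poly_Mapping.keys p. \<Sum>m\<le>k. \<Sum>j\<in>Poly_Mapping.keys q. of_nat (k choose m) * (of_int i ^ m * Poly_Mapping.lookup p i) * (of_int j ^ (k - m) * Poly_Mapping.lookup q j))"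
    by (intro sum.cong refl) (rule sum.swap)
  also have "\<dots> = (\<Sum>m\<le>k. \<Sum>i\<in>Poly_Mapping.keys p. \<Sum>j\<in>Poly_Mapping.keys q. of_nat (k choose m) * (of_int i ^ m * Poly_Mapping.lookup p i) * (of_int j ^ (k - m) * Poly_Mapping.lookup q j))"
    by (rule sum.swap)
  also have "\<dots> = (\<Sum>m\<le>k. of_nat (k choose m) * lmom m p * lmom (k - m) q)"
    unfolding lmom_def by (intro sum.cong refl) (simp add: sum_distrib_left sum_distrib_right mult_ac)
  finally show ?thesis .
qed

text \<open>The derivation z d/dz; \<open>euler_op\<close> below is its counterpart q d/dq.\<close>

definition lderiv :: "laurent \<Rightarrow> laurent" where
  "lderiv p = (\<Sum>i\<in>Poly_Mapping.keys p. Poly_Mapping.single i (of_int i * Poly_Mapping.lookup p i))"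

lemma lookup_lderiv [simp]: "Poly_Mapping.lookup (lderiv p) i = of_int i * Poly_Mapping.lookup p i"
  by (simp add: lderiv_def lookup_sum lookup_single when_def sum.delta in_keys_iff)

lemma lderiv_add: "lderiv (p + q) = lderiv p + lderiv q"
  by (rule poly_mapping_eqI) (simp add: lookup_add algebra_simps)

lemma lderiv_diff: "lderiv (p - q) = lderiv p - lderiv q"
  by (rule poly_mapping_eqI) (simp add: lookup_minus algebra_simps)

lemma lderiv_0 [simp]: "lderiv 0 = 0" by (rule poly_mapping_eqI) simp

lemma lderiv_sum: "lderiv (sum f S) = (\<Sum>s\<in>S. lderiv (f s))"
  by (induction S rule: infinite_finite_induct) (auto simp: lderiv_add)

lemma lderiv_single: "lderiv (Poly_Mapping.single i c) = Poly_Mapping.single i (of_int i * c)"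
  by (rule poly_mapping_eqI) (simp add: lookup_single when_def)

lemma lderiv_mult: "lderiv (p * q) = lderiv p * q + p * lderiv q"
proof -
  have "lderiv (P * Q) = lderiv P * Q + P * lderiv Q"
    if "P = (\<Sum>i\<in>S. Poly_Mapping.single i (a i))" "Q = (\<Sum>j\<in>T. Poly_Mapping.single j (b j))" for P Q S T a b
  proof -
    have "lderiv (P * Q) = (\<Sum>i\<in>S. \<Sum>j\<in>T. Poly_Mapping.single (i + j) (of_int (i + j) * (a i * b j)))"
      by (simp add: that sum_product mult_single lderiv_sum lderiv_single)
    moreover have "lderiv P * Q = (\<Sum>i\<in>S. \<Sum>j\<in>T. Poly_Mapping.single (i + j) (of_int i * a i * b j))"
      by (simp add: that sum_product mult_single lderiv_sum lderiv_single)
    moreover have "P * lderiv Q = (\<Sum>i\<in>S. \<Sum>j\<in>T. Poly_Mapping.single (i + j) (a i * (of_int j * b j)))"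
      by (simp add: that sum_product mult_single lderiv_sum lderiv_single)
    ultimately show ?thesis
      by (simp only: sum.distrib[symmetric] single_add[symmetric]) (simp add: algebra_simps)
  qed
  from this[OF laurent_sum_single[of p] laurent_sum_single[of q]] show ?thesis .
qed

lemma of_nat_laurent: "(of_nat n :: laurent) = Poly_Mapping.single 0 (of_nat n)"
  by simp

lemma lookup_single_mult: "Poly_Mapping.lookup (Poly_Mapping.single m c * (p :: laurent)) i = c * Poly_Mapping.lookup p (i - m)"
proof -
  have "Poly_Mapping.lookup (Poly_Mapping.single m c * P) i = c * Poly_Mapping.lookup P (i - m)"
    if "P = (\<Sum>i\<in>S. Poly_Mapping.single i (a i))" for P :: laurent and S a
    by (auto simp: that sum_distrib_left mult_single lookup_sum lookup_single when_def intro!: sum.cong)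
  from this[OF laurent_sum_single[of p]] show ?thesis .
qed

lemma lookup_of_nat_mult: "Poly_Mapping.lookup (of_nat n * (p :: laurent)) i = of_nat n * Poly_Mapping.lookup p i"
  using lookup_single_mult[of 0 "of_nat n" p i] by (simp add: of_nat_laurent del: single_of_nat)

lemma lderiv_of_nat_mult: "lderiv (of_nat n * p) = of_nat n * lderiv p"
  by (rule poly_mapping_eqI) (simp add: lookup_of_nat_mult)

lemma of_nat_mult_laurent_cancel: "of_nat n * (p :: laurent) = 0 \<Longrightarrow> n > 0 \<Longrightarrow> p = 0"
  by (rule poly_mapping_eqI) (metis lookup_of_nat_mult lookup_zero mult_eq_0_iff of_nat_eq_0_iff less_irrefl)

definition euler_op :: "'a :: comm_ring_1 fps \<Rightarrow> 'a fps" where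
  "euler_op f = Abs_fps (\<lambda>n. of_nat n * fps_nth f n)"

lemma euler_op_nth [simp]: "fps_nth (euler_op f) n = of_nat n * fps_nth f n"
  by (simp add: euler_op_def)

lemma euler_op_eq: "euler_op f = fps_X * fps_deriv f"
  by (rule fps_ext) (auto simp: fps_X_mult_nth split: nat.splits)

lemma euler_op_mult: "euler_op (f * g) = euler_op f * g + f * euler_op g"
  by (simp add: euler_op_eq algebra_simps)

lemma euler_op_diff: "euler_op (f - g) = euler_op f - euler_op g"
  by (rule fps_ext) (simp add: algebra_simps)

lemma euler_op_add: "euler_op (f + g) = euler_op f + euler_op g"
  by (rule fps_ext) (simp add: algebra_simps)

section \<open>The cubed crank product, built from its logarithmic derivatives\<close>

definition ldq :: "laurent fps \<Rightarrow> laurent fps" where "ldq f = Abs_fps (\<lambda>n. lderiv (fps_nth f n))"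

lemma ldq_nth [simp]: "fps_nth (ldq f) n = lderiv (fps_nth f n)" by (simp add: ldq_def)

lemma ldq_mult: "ldq (f * g) = ldq f * g + f * ldq g"
  by (rule fps_ext) (simp add: fps_mult_nth lderiv_sum lderiv_mult sum.distrib)

lemma ldq_euler: "ldq (euler_op f) = euler_op (ldq f)"
  by (rule fps_ext) (simp add: lderiv_of_nat_mult)

text \<open>q d/dq of the logarithm of the product over n \<ge> 1 of (1 - q^n)^6 / ((1 - z q^n)^3 (1
  - q^n/z)^3). This is the cube of the crank product normalised to be 1 at z = 1.\<close>

definition lLam :: "laurent fps" where
  "lLam = Abs_fps (\<lambda>N. if N = 0 then 0 else \<Sum>m | m dvd N. 
      Poly_Mapping.single (int m) (3 * of_nat (N div m)) + Poly_Mapping.single (- int m) (3 * of_nat (N div m)) - Poly_Mapping.single 0 (6 * of_nat (N div m)))"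

text \<open>z d/dz of the same logarithm.\<close>

definition lPsi :: "laurent fps" where
  "lPsi = Abs_fps (\<lambda>N. if N = 0 then 0 else \<Sum>m | m dvd N. 
      Poly_Mapping.single (int m) 3 - Poly_Mapping.single (- int m) 3)"

text \<open>The mixed second derivative of the logarithm, computed in both orders; coefficientwise
  it says m (N/m) = N.\<close>

lemma ldq_lLam: "ldq lLam = euler_op lPsi"
proof (rule fps_ext)
  fix N
  show "fps_nth (ldq lLam) N = fps_nth (euler_op lPsi) N"
  proof (cases "N = 0")
    case False
    have "fps_nth (ldq lLam) N = (\<Sum>m | m dvd N. Poly_Mapping.single (int m) (of_nat N * 3) - Poly_Mapping.single (- int m) (of_nat N * 3))"
      unfolding ldq_nth lLam_def using False
      by (auto simp: lderiv_sum lderiv_add lderiv_diff lderiv_single single_uminus mult_ac intro!: sum.cong elim!: dvdE)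
    also have "\<dots> = fps_nth (euler_op lPsi) N"
      using False by (simp add: lPsi_def sum_distrib_left right_diff_distrib mult_single of_nat_laurent del: single_of_nat)
    finally show ?thesis .
  qed (simp add: lLam_def lPsi_def)
qed

text \<open>The product is recovered from its logarithmic derivative by n c_n = \<Sum> \<lambda>_k
  c_{n-k}, so that no infinite product over Laurent polynomials has to be formed.\<close>

fun cE :: "nat \<Rightarrow> laurent" where
  "cE n = (if n = 0 then 1 else Poly_Mapping.single 0 (1 / of_nat n) * (\<Sum>k\<in>{1..n}. fps_nth lLam k * cE (n - k)))"

declare cE.simps [simp del]

definition crankE :: "laurent fps" where "crankE = Abs_fps cE"

lemma lLam_0 [simp]: "fps_nth lLam 0 = 0" by (simp add: lLam_def)
lemma lPsi_0 [simp]: "fps_nth lPsi 0 = 0" by (simp add: lPsi_def)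

lemma euler_crankE: "euler_op crankE = lLam * crankE"
proof (rule fps_ext)
  fix n
  show "fps_nth (euler_op crankE) n = fps_nth (lLam * crankE) n"
  proof (cases "n = 0")
    case False
    have "fps_nth (lLam * crankE) n = (\<Sum>k=0..n. fps_nth lLam k * cE (n - k))"
      by (simp add: fps_mult_nth crankE_def)
    also have "\<dots> = (\<Sum>k=1..n. fps_nth lLam k * cE (n - k))"
      by (simp add: sum.atLeast_Suc_atMost)
    finally have 1: "fps_nth (lLam * crankE) n = (\<Sum>k=1..n. fps_nth lLam k * cE (n - k))" .
    have "of_nat n * cE n = (of_nat n * Poly_Mapping.single 0 (1 / of_nat n)) * (\<Sum>k\<in>{1..n}. fps_nth lLam k * cE (n - k))"
      using False by (subst cE.simps) (simp add: mult.assoc)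
    also have "of_nat n * Poly_Mapping.single 0 (1 / of_nat n) = (1 :: laurent)"
      using False by (simp add: of_nat_laurent mult_single del: single_of_nat)
    finally show ?thesis using 1 by (simp add: crankE_def)
  qed simp
qed

lemma euler_uniq_0:
  assumes "euler_op y = lLam * y" "fps_nth y 0 = 0"
  shows "y = 0"
proof (rule fps_ext)
  fix n show "fps_nth y n = fps_nth 0 n"
  proof (induction n rule: less_induct)
    case (less n)
    show ?case
    proof (cases "n = 0")
      case False
      have "of_nat n * fps_nth y n = (\<Sum>k=0..n. fps_nth lLam k * fps_nth y (n - k))"
        using arg_cong[OF assms(1), of "\<lambda>f. fps_nth f n"] by (simp add: fps_mult_nth)
      also have "\<dots> = 0"
        by (rule sum.neutral) (use less False in \<open>auto intro: gr0I\<close>, metis diff_less fps_zero_nth gr0I lLam_0 mult_zero_left mult_zero_right)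
      finally show ?thesis using of_nat_mult_laurent_cancel False by simp
    qed (use assms in simp)
  qed
qed

text \<open>By \<open>ldq_lLam\<close> the difference of the two sides solves the same first-order
  equation in q as the product itself, and its constant term is zero.\<close>

lemma ldq_crankE: "ldq crankE = crankE * lPsi"
proof -
  have "euler_op (ldq crankE - crankE * lPsi) = ldq (lLam * crankE) - (lLam * crankE * lPsi + crankE * euler_op lPsi)"
    by (simp add: euler_op_diff euler_op_mult euler_crankE flip: ldq_euler)
  also have "\<dots> = lLam * (ldq crankE - crankE * lPsi)"
    by (simp add: ldq_mult ldq_lLam algebra_simps)
  finally have "ldq crankE - crankE * lPsi = 0"
    by (rule euler_uniq_0) (simp add: crankE_def cE.simps, rule poly_mapping_eqI, simp add: lookup_one when_def)
  thus ?thesis by simp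
qed

definition cf :: "int \<Rightarrow> nat \<Rightarrow> rat" where "cf i n = Poly_Mapping.lookup (cE n) i"

lemma lookup_lLam_mult:
  "k > 0 \<Longrightarrow> Poly_Mapping.lookup (fps_nth lLam k * p) i = (\<Sum>m | m dvd k. 3 * of_nat (k div m) * (Poly_Mapping.lookup p (i - int m) + Poly_Mapping.lookup p (i + int m) - 2 * Poly_Mapping.lookup p i))"
  by (simp add: lLam_def sum_distrib_right lookup_sum lookup_add lookup_minus lookup_single_mult ring_distribs) (simp add: algebra_simps)

lemma lookup_lPsi_mult:
  "k > 0 \<Longrightarrow> Poly_Mapping.lookup (fps_nth lPsi k * p) i = (\<Sum>m | m dvd k. 3 * (Poly_Mapping.lookup p (i - int m) - Poly_Mapping.lookup p (i + int m)))"
  by (simp add: lPsi_def sum_distrib_right lookup_sum lookup_add lookup_minus lookup_single_mult ring_distribs)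

lemma cf_rec: "n > 0 \<Longrightarrow> cf i n = 1 / of_nat n * (\<Sum>k=1..n. \<Sum>m | m dvd k. 3 * of_nat (k div m) * (cf (i - int m) (n - k) + cf (i + int m) (n - k) - 2 * cf i (n - k)))"
  unfolding cf_def by (subst cE.simps) (simp add: lookup_single_mult lookup_sum lookup_lLam_mult)

lemma cf_0: "cf i 0 = (if i = 0 then 1 else 0)"
  by (simp add: cf_def cE.simps lookup_one when_def)

lemma cf_minus: "cf (- i) n = cf i n"
proof (induction n arbitrary: i rule: less_induct)
  case (less n)
  show ?case
  proof (cases "n = 0")
    case False
    have a: "cf (- i - int m) (n - k) = cf (i + int m) (n - k)" "cf (- i + int m) (n - k) = cf (i - int m) (n - k)" "cf (- i) (n - k) = cf i (n - k)" "cf (int m - i) (n - k) = cf (i - int m) (n - k)" if "k \<in> {1..n}" for k m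
      using less[of "n - k" "i + int m"] less[of "n - k" "i - int m"] less[of "n - k" i] that by (simp_all add: algebra_simps)
    show ?thesis using False
      by (subst (1 2) cf_rec) (auto intro!: sum.cong simp: a)
  qed (simp add: cf_0)
qed

text \<open>Each factor z^m or z^(-m) is accompanied by some q^k with m dividing k, hence m \<le>
  k.\<close>

lemma cf_support: "\<bar>i\<bar> > int n \<Longrightarrow> cf i n = 0"
proof (induction n arbitrary: i rule: less_induct)
  case (less n)
  show ?case
  proof (cases "n = 0")
    case False
    have "(\<Sum>k=1..n. \<Sum>m | m dvd k. 3 * of_nat (k div m) * (cf (i - int m) (n - k) + cf (i + int m) (n - k) - 2 * cf i (n - k))) = 0"
    proof (intro sum.neutral ballI)
      fix k m assume "k \<in> {1..n}" "m \<in> {m. m dvd k}"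
      hence km: "1 \<le> k" "k \<le> n" "m \<le> k" by (auto dest: dvd_imp_le)
      thus "3 * of_nat (k div m) * (cf (i - int m) (n - k) + cf (i + int m) (n - k) - 2 * cf i (n - k)) = 0"
        using less.prems by (subst (1 2 3) less.IH) auto
    qed
    thus ?thesis using False by (simp only: cf_rec)
  qed (use less in \<open>simp add: cf_0\<close>)
qed

lemma keys_cE: "Poly_Mapping.keys (cE n) \<subseteq> {- int n..int n}"
proof
  fix i assume "i \<in> Poly_Mapping.keys (cE n)"
  hence "cf i n \<noteq> 0" by (simp add: cf_def in_keys_iff)
  hence "\<not> \<bar>i\<bar> > int n" using cf_support by blast
  thus "i \<in> {- int n..int n}" by auto
qed

lemma cf_deriv:
  "of_int i * cf i n = (\<Sum>k=1..n. \<Sum>m | m dvd k. 3 * (cf (i - int m) (n - k) - cf (i + int m) (n - k)))"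
proof -
  have "of_int i * cf i n = Poly_Mapping.lookup (fps_nth (lPsi * crankE) n) i"
    using arg_cong[OF ldq_crankE, of "\<lambda>f. Poly_Mapping.lookup (fps_nth f n) i"]
    by (simp add: cf_def crankE_def mult.commute)
  also have "fps_nth (lPsi * crankE) n = (\<Sum>k=1..n. fps_nth lPsi k * cE (n - k))"
    by (simp add: fps_mult_nth crankE_def sum.atLeast_Suc_atMost)
  finally show ?thesis by (simp add: lookup_sum lookup_lPsi_mult cf_def)
qed

definition mu :: "nat \<Rightarrow> rat fps" where "mu p = Abs_fps (\<lambda>n. \<Sum>i=-int n..int n. of_int i ^ p * cf i n)"

lemma mu_eq_lmom: "fps_nth (mu p) n = lmom p (cE n)"
  unfolding mu_def fps_nth_Abs_fps cf_def by (subst lmom_superset[OF _ keys_cE]) auto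

lemma lmom_lLam: "k > 0 \<Longrightarrow> lmom 0 (fps_nth lLam k) = 0"
  by (simp add: lLam_def lmom_sum lmom_add lmom_single lmom_diff)

lemma lmom_lPsi: "lmom p (fps_nth lPsi k) = (if odd p then 6 * of_nat (sig p k) else 0)"
proof (cases "k = 0")
  case False
  have "lmom p (fps_nth lPsi k) = (\<Sum>m | m dvd k. 3 * (of_nat m ^ p - (- of_nat m) ^ p))"
    using False by (simp add: lPsi_def lmom_sum lmom_diff lmom_single algebra_simps)
  also have "\<dots> = (if odd p then 6 * of_nat (sig p k) else 0)"
    by (simp add: sig_def sum_distrib_left)
  finally show ?thesis .
qed auto

text \<open>At z = 1 numerator and denominator of the product cancel.\<close>

lemma mu_0: "mu 0 = 1"
proof (rule fps_ext)
  fix n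
  show "fps_nth (mu 0) n = fps_nth 1 n"
  proof (cases "n = 0")
    case True thus ?thesis by (simp add: mu_def cf_0)
  next
    case False
    have "lmom 0 (cE n) = lmom 0 (Poly_Mapping.single 0 (1 / of_nat n)) * (\<Sum>k\<in>{1..n}. lmom 0 (fps_nth lLam k) * lmom 0 (cE (n - k)))"
      using False by (subst cE.simps) (simp add: lmom_mult lmom_sum)
    thus ?thesis using False by (simp add: mu_eq_lmom lmom_lLam)
  qed
qed

text \<open>The Leibniz rule for \<open>ldq_crankE\<close> at z = 1. Only odd derivatives of the
  logarithm survive there, and they are 6 times divisor sum series; so every \<open>mu p\<close> is
  a polynomial in these series.\<close>

lemma mu_Suc: "mu (Suc p) = (\<Sum>j\<le>p. if odd j then fps_const (of_nat (p choose j)) * mu (p - j) * (6 * Sf j) else 0)"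
proof (rule fps_ext)
  fix n
  have "fps_nth (mu (Suc p)) n = lmom p (lderiv (cE n))"
  proof -
    have "Poly_Mapping.keys (lderiv (cE n)) \<subseteq> {- int n..int n}"
      using keys_cE[of n] by (auto simp: in_keys_iff)
    thus ?thesis unfolding mu_def fps_nth_Abs_fps cf_def
      by (subst lmom_superset[of "{- int n..int n}"]) (auto simp: algebra_simps)
  qed
  also have "lderiv (cE n) = fps_nth (lPsi * crankE) n"
    using arg_cong[OF ldq_crankE, of "\<lambda>f. fps_nth f n"] by (simp add: crankE_def mult.commute)
  also have "lmom p \<dots> = (\<Sum>k=0..n. \<Sum>j\<le>p. of_nat (p choose j) * lmom j (fps_nth lPsi k) * lmom (p - j) (cE (n - k)))"
    by (simp add: fps_mult_nth lmom_sum lmom_mult crankE_def)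
  also have "\<dots> = (\<Sum>j\<le>p. \<Sum>k=0..n. of_nat (p choose j) * lmom j (fps_nth lPsi k) * lmom (p - j) (cE (n - k)))"
    by (rule sum.swap)
  also have "\<dots> = fps_nth (\<Sum>j\<le>p. if odd j then fps_const (of_nat (p choose j)) * mu (p - j) * (6 * Sf j) else 0) n"
    unfolding fps_sum_nth
  proof (intro sum.cong refl)
    fix j
    show "(\<Sum>k=0..n. of_nat (p choose j) * lmom j (fps_nth lPsi k) * lmom (p - j) (cE (n - k))) =
       fps_nth (if odd j then fps_const (of_nat (p choose j)) * mu (p - j) * (6 * Sf j) else 0) n"
    proof (cases "odd j")
      case True
      have "fps_const (of_nat (p choose j)) * mu (p - j) * (6 * Sf j) = fps_const (of_nat (p choose j) * 6) * (Sf j * mu (p - j))"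
        by (simp only: fps_const_mult[symmetric] fps_numeral_fps_const[symmetric] mult_ac)
      hence "fps_nth (if odd j then fps_const (of_nat (p choose j)) * mu (p - j) * (6 * Sf j) else 0) n
          = of_nat (p choose j) * 6 * fps_nth (Sf j * mu (p - j)) n"
        using True by (simp only: if_True fps_mult_left_const_nth not_False_eq_True)
      also have "fps_nth (Sf j * mu (p - j)) n = (\<Sum>k=0..n. of_nat (sig j k) * lmom (p - j) (cE (n - k)))"
        by (simp add: fps_mult_nth Sf_def mu_eq_lmom)
      finally show ?thesis using True by (simp add: sum_distrib_left lmom_lPsi mult_ac)
    qed (simp add: lmom_lPsi)
  qed
  finally show "fps_nth (mu (Suc p)) n = fps_nth (\<Sum>j\<le>p. if odd j then fps_const (of_nat (p choose j)) * mu (p - j) * (6 * Sf j) else 0) n" .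
qed

section \<open>The symmetry of the completed product under z -> q/z\<close>

lemma sum_divisor_pairs:
  fixes f :: "nat \<Rightarrow> nat \<Rightarrow> 'a :: comm_monoid_add"
  assumes "K \<ge> n" "\<And>m k. k > n \<Longrightarrow> f m k = 0"
  shows "(\<Sum>k=1..n. \<Sum>m | m dvd k. f m k) = (\<Sum>m=1..K. \<Sum>j=1..K. f m (m * j))"
proof -
  have "(\<Sum>k=1..n. \<Sum>m | m dvd k. f m k) = (\<Sum>(k, m)\<in>Sigma {1..n} (\<lambda>k. {m. m dvd k}). f m k)"
    by (rule sum.Sigma) auto
  also have "\<dots> = (\<Sum>(m, j)\<in>{(m, j). m \<ge> 1 \<and> j \<ge> 1 \<and> m * j \<le> n}. f m (m * j))"
  proof (rule sum.reindex_bij_witness[where i = "\<lambda>(m, j). (m * j, m)" and j = "\<lambda>(k, m). (m, k div m)"], goal_cases)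
    case (2 a) thus ?case by (auto elim!: dvdE intro: gr0I)
  next
    case (4 b) thus ?case by (auto simp: Suc_le_eq)
  qed (auto elim!: dvdE)
  also have "\<dots> = (\<Sum>(m, j)\<in>{1..K} \<times> {1..K}. f m (m * j))"
  proof (rule sum.mono_neutral_left)
    have "m \<le> K \<and> j \<le> K" if "m \<ge> 1" "j \<ge> 1" "m * j \<le> n" for m j
      using that assms(1) by (metis le_trans mult_le_mono mult.right_neutral nat_mult_1 order_refl)
    thus "{(m, j). m \<ge> 1 \<and> j \<ge> 1 \<and> m * j \<le> n} \<subseteq> {1..K} \<times> {1..K}" by auto
  qed (auto simp: not_le intro!: assms(2))
  finally show ?thesis by (simp add: sum.cartesian_product)
qed

text \<open>The coefficient of z^i q^n in the cubed product divided by (1 - z)^3, expanded in powers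
  of z. The extra factor completes the denominator to the cube of the product of (1 - z q^n) over n
  \<ge> 0 and (1 - q^n/z) over n \<ge> 1, which is invariant under z -> q/z. The sum stops at n + i
  because beyond it the support of \<open>cf\<close> has been left.\<close>

definition vc :: "int \<Rightarrow> int \<Rightarrow> rat" where
  "vc i n = (if n < 0 then 0 else \<Sum>t\<le>nat (n + i). of_nat ((t + 2) choose 2) * cf (i - int t) (nat n))"

lemma vc_bound: "n \<ge> 0 \<Longrightarrow> int T \<ge> n + i \<Longrightarrow> vc i n = (\<Sum>t\<le>T. of_nat ((t + 2) choose 2) * cf (i - int t) (nat n))"
  unfolding vc_def by (simp, intro sum.mono_neutral_left) (auto intro!: cf_support)

lemma vc_zero: "n < 0 \<or> n + i < 0 \<Longrightarrow> vc i n = 0"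
  by (auto simp: vc_def intro!: cf_support sum.neutral)

lemma choose_rat: "8 * of_nat ((t + 2) choose 2) = (4 * (of_nat t + 1) * (of_nat t + 2) :: rat)"
proof -
  have "2 * ((t + 2) choose 2) = (t + 2) * (t + 1)" by (simp add: choose_two)
  hence "of_nat (2 * ((t + 2) choose 2)) = (of_nat ((t + 2) * (t + 1)) :: rat)" by (simp only:)
  thus ?thesis by (simp add: field_simps)
qed

text \<open>The coefficient form of z d/dz (1 - z)^(-3) = 3 z/(1 - z) (1 - z)^(-3).\<close>

lemma weighted_binomial_sum: "of_nat (3 * (\<Sum>s<t. (s + 2) choose 2)) = (of_nat t * of_nat ((t + 2) choose 2) :: rat)"
proof (induction t)
  case (Suc t)
  have c: "of_nat ((t + 2) choose 2) = (of_nat t + 2) * (of_nat t + 1) / (2 :: rat)" for t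
    using choose_rat[of t] by (simp add: field_simps del: binomial_Suc_Suc add_2_eq_Suc')
  have "of_nat (3 * (\<Sum>s<Suc t. (s + 2) choose 2)) = (of_nat (3 * (\<Sum>s<t. (s + 2) choose 2)) + 3 * of_nat ((t + 2) choose 2) :: rat)"
    by (simp only: sum.lessThan_Suc distrib_left of_nat_add of_nat_mult of_nat_numeral)
  also have "\<dots> = of_nat (Suc t) * of_nat ((Suc t + 2) choose 2)"
    unfolding Suc by (simp only: c of_nat_Suc) (simp add: field_simps)
  finally show ?case .
qed auto

text \<open>z d/dz of the completed product: the first sum is the logarithmic derivative 3z/(1 - z)
  of the new factor, the second that of the cubed crank product.\<close>

lemma vc_deriv:
  assumes n: "n \<ge> 0" and K: "int K \<ge> n" "int K \<ge> n + i"
  shows "of_int i * vc i n = 3 * (\<Sum>m=1..K. vc (i - int m) n) + 3 * (\<Sum>k=1..nat n. \<Sum>m | m dvd k. vc (i - int m) (n - int k) - vc (i + int m) (n - int k))"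
proof -
  let ?b = "\<lambda>t. of_nat ((t + 2) choose 2) :: rat"
  let ?n = "nat n"
  have "of_int i * vc i n = (\<Sum>t\<le>K. ?b t * (of_int (i - int t) * cf (i - int t) ?n)) + (\<Sum>t\<le>K. of_nat t * ?b t * cf (i - int t) ?n)"
    using n K by (simp add: vc_bound[where T = K] sum_distrib_left algebra_simps flip: sum.distrib)
  also have "(\<Sum>t\<le>K. ?b t * (of_int (i - int t) * cf (i - int t) ?n)) = 3 * (\<Sum>k=1..?n. \<Sum>m | m dvd k. vc (i - int m) (n - int k) - vc (i + int m) (n - int k))"
  proof -
    have "(\<Sum>t\<le>K. ?b t * (of_int (i - int t) * cf (i - int t) ?n)) = (\<Sum>t\<le>K. \<Sum>k=1..?n. \<Sum>m | m dvd k. 3 * (?b t * cf (i - int m - int t) (?n - k) - ?b t * cf (i + int m - int t) (?n - k)))"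
      unfolding cf_deriv by (simp add: sum_distrib_left algebra_simps)
    also have "\<dots> = (\<Sum>k=1..?n. \<Sum>m | m dvd k. \<Sum>t\<le>K. 3 * (?b t * cf (i - int m - int t) (?n - k) - ?b t * cf (i + int m - int t) (?n - k)))"
      by (subst sum.swap) (intro sum.cong refl sum.swap)
    also have "\<dots> = (\<Sum>k=1..?n. \<Sum>m | m dvd k. 3 * (vc (i - int m) (n - int k) - vc (i + int m) (n - int k)))"
    proof (intro sum.cong refl)
      fix k m assume "k \<in> {1..?n}" "m \<in> {m. m dvd k}"
      hence km: "1 \<le> k" "int k \<le> n" "int m \<le> int k" "nat (n - int k) = ?n - k" by (auto dest: dvd_imp_le)
      have "vc (i - int m) (n - int k) = (\<Sum>t\<le>K. ?b t * cf (i - int m - int t) (?n - k))"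
        using km K by (subst vc_bound[where T = K]) auto
      moreover have "vc (i + int m) (n - int k) = (\<Sum>t\<le>K. ?b t * cf (i + int m - int t) (?n - k))"
        using km K by (subst vc_bound[where T = K]) auto
      ultimately show "(\<Sum>t\<le>K. 3 * (?b t * cf (i - int m - int t) (?n - k) - ?b t * cf (i + int m - int t) (?n - k))) = 3 * (vc (i - int m) (n - int k) - vc (i + int m) (n - int k))"
        by (simp add: sum_subtractf flip: sum_distrib_left)
    qed
    finally show ?thesis by (simp add: sum_distrib_left)
  qed
  also have "(\<Sum>t\<le>K. of_nat t * ?b t * cf (i - int t) ?n) = 3 * (\<Sum>m=1..K. vc (i - int m) n)"
  proof -
    have "(\<Sum>m=1..K. vc (i - int m) n) = (\<Sum>m=1..K. \<Sum>s\<le>K - m. ?b s * cf (i - int (m + s)) ?n)"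
    proof (intro sum.cong refl)
      fix m assume "m \<in> {1..K}"
      thus "vc (i - int m) n = (\<Sum>s\<le>K - m. ?b s * cf (i - int (m + s)) ?n)"
        using n K by (subst vc_bound[where T = "K - m"]) (auto simp: algebra_simps)
    qed
    also have "\<dots> = (\<Sum>(m, s)\<in>Sigma {1..K} (\<lambda>m. {..K - m}). ?b s * cf (i - int (m + s)) ?n)"
      by (rule sum.Sigma) auto
    also have "\<dots> = (\<Sum>(t, s)\<in>Sigma {..K} (\<lambda>t. {..<t}). ?b s * cf (i - int t) ?n)"
      by (rule sum.reindex_bij_witness[where i = "\<lambda>(t, s). (t - s, s)" and j = "\<lambda>(m, s). (m + s, s)"]) auto
    also have "\<dots> = (\<Sum>t\<le>K. \<Sum>s<t. ?b s * cf (i - int t) ?n)"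
      by (rule sum.Sigma[symmetric]) auto
    finally have "3 * (\<Sum>m=1..K. vc (i - int m) n) = (\<Sum>t\<le>K. of_nat (3 * (\<Sum>s<t. (s + 2) choose 2)) * cf (i - int t) ?n)"
      by (simp add: sum_distrib_left sum_distrib_right mult_ac del: binomial_Suc_Suc add_2_eq_Suc')
    thus ?thesis unfolding weighted_binomial_sum by simp
  qed
  finally show ?thesis by simp
qed

text \<open>The geometric series of the new factor supplies exactly the terms j = 0 of the z^m part.
  In this form z -> q/z exchanges the two double sums up to sign.\<close>

lemma vc_deriv':
  assumes n: "n \<ge> 0" and K: "int K \<ge> n" "int K \<ge> n + i"
  shows "of_int i * vc i n = 3 * (\<Sum>m=1..K. \<Sum>j=0..K. vc (i - int m) (n - int (m * j))) - 3 * (\<Sum>m=1..K. \<Sum>j=1..K. vc (i + int m) (n - int (m * j)))"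
proof -
  have "(\<Sum>k=1..nat n. \<Sum>m | m dvd k. vc (i - int m) (n - int k) - vc (i + int m) (n - int k)) =
     (\<Sum>m=1..K. \<Sum>j=1..K. vc (i - int m) (n - int (m * j)) - vc (i + int m) (n - int (m * j)))"
    by (rule sum_divisor_pairs) (use K in \<open>simp, subst (1 2) vc_zero, auto\<close>)
  moreover have "(\<Sum>j=0..K. vc (i - int m) (n - int (m * j))) = vc (i - int m) n + (\<Sum>j=1..K. vc (i - int m) (n - int (m * j)))" for m
    by (simp add: sum.atLeast_Suc_atMost)
  ultimately show ?thesis unfolding vc_deriv[OF n K] by (simp add: sum_subtractf sum.distrib algebra_simps)
qed

text \<open>The difference \<open>d\<close> of both sides satisfies the relation of
  \<open>vc_deriv'\<close> as well. There every term has smaller n, or the same n and smaller i, so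
  the relation forces \<open>d\<close> to vanish by induction, starting from the region where all
  coefficients are zero.\<close>

lemma vc_symmetry: "vc (- i) (n + i) = vc i n"
proof -
  define d where "d i n = vc i n - vc (- i) (n + i)" for i n
  have dz: "d i n = 0" if "n < 0 \<or> n + i < 0" for i n using that by (auto simp: d_def vc_zero)
  have de: "of_int i * d i n = 3 * (\<Sum>m=1..K. \<Sum>j=0..K. d (i - int m) (n - int (m * j))) - 3 * (\<Sum>m=1..K. \<Sum>j=1..K. d (i + int m) (n - int (m * j)))"
    if n: "n \<ge> 0" "n + i \<ge> 0" and K: "int K > n" "int K > n + i" for i n K
  proof -
    have K0: "K > 0" using n K by linarith
    have e2: "of_int (- i) * vc (- i) (n + i) = 3 * (\<Sum>m=1..K. \<Sum>j=0..K. vc (- i - int m) (n + i - int (m * j))) - 3 * (\<Sum>m=1..K. \<Sum>j=1..K. vc (- i + int m) (n + i - int (m * j)))"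
      by (rule vc_deriv') (use n K in auto)
    \<comment> \<open>Under the substitution the index j moves by one; the extra term at the end of
      the range lies outside the support.\<close>
    have s1: "(\<Sum>j=0..K. vc (- i - int m) (n + i - int (m * j))) = (\<Sum>j=1..K. vc (- (i + int m)) (n - int (m * j) + (i + int m)))" if "m \<in> {1..K}" for m
    proof -
      have "(\<Sum>j=0..K. vc (- i - int m) (n + i - int (m * j))) = (\<Sum>j=0..K. vc (- (i + int m)) (n - int (m * Suc j) + (i + int m)))"
        by (intro sum.cong refl) (simp add: algebra_simps)
      also have "\<dots> = (\<Sum>j=1..Suc K. vc (- (i + int m)) (n - int (m * j) + (i + int m)))"
        by (subst sum.shift_bounds_cl_Suc_ivl[symmetric]) simp
      also have "\<dots> = (\<Sum>j=1..K. vc (- (i + int m)) (n - int (m * j) + (i + int m)))"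
      proof -
        have "int (m * Suc K) \<ge> int (Suc K)" using that by (intro of_nat_mono) (cases m, auto)
        hence z: "vc (- (i + int m)) (n - int (m * Suc K) + (i + int m)) = 0" using K by (intro vc_zero) simp
        have g: "(\<Sum>j=1..Suc K. g j) = (\<Sum>j=1..K. g j)" if "g (Suc K) = 0" for g :: "nat \<Rightarrow> rat" using that by simp
        show ?thesis by (rule g) (rule z)
      qed
      finally show ?thesis .
    qed
    have s2: "(\<Sum>j=1..K. vc (- i + int m) (n + i - int (m * j))) = (\<Sum>j=0..K. vc (- (i - int m)) (n - int (m * j) + (i - int m)))" if "m \<in> {1..K}" for m
    proof -
      obtain K' where K': "K = Suc K'" using K0 gr0_conv_Suc by blast
      have "(\<Sum>j=1..K. vc (- i + int m) (n + i - int (m * j))) = (\<Sum>j=0..K'. vc (- i + int m) (n + i - int (m * Suc j)))"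
        unfolding K' by (subst sum.shift_bounds_cl_Suc_ivl[symmetric]) simp
      also have "\<dots> = (\<Sum>j=0..K'. vc (- (i - int m)) (n - int (m * j) + (i - int m)))"
        by (intro sum.cong refl) (simp add: algebra_simps)
      also have "\<dots> = (\<Sum>j=0..K. vc (- (i - int m)) (n - int (m * j) + (i - int m)))"
      proof -
        have "int (m * K) \<ge> int K" using that by (intro of_nat_mono) (cases m, auto)
        hence z: "vc (- (i - int m)) (n - int (m * K) + (i - int m)) = 0" using K by (intro vc_zero) simp
        have g: "(\<Sum>j=0..K'. g j) = (\<Sum>j=0..K. g j)" if "g K = 0" for g :: "nat \<Rightarrow> rat" using that by (simp add: K')
        show ?thesis by (rule g) (rule z)
      qed
      finally show ?thesis .
    qed
    have e1: "of_int i * vc i n = 3 * (\<Sum>m=1..K. \<Sum>j=0..K. vc (i - int m) (n - int (m * j))) - 3 * (\<Sum>m=1..K. \<Sum>j=1..K. vc (i + int m) (n - int (m * j)))"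
      by (rule vc_deriv') (use n K in auto)
    have e2': "of_int i * vc (- i) (n + i) = 3 * (\<Sum>m=1..K. \<Sum>j=0..K. vc (- (i - int m)) (n - int (m * j) + (i - int m))) - 3 * (\<Sum>m=1..K. \<Sum>j=1..K. vc (- (i + int m)) (n - int (m * j) + (i + int m)))"
    proof -
      have S1: "(\<Sum>m=1..K. \<Sum>j=0..K. vc (- i - int m) (n + i - int (m * j))) = (\<Sum>m=1..K. \<Sum>j=1..K. vc (- (i + int m)) (n - int (m * j) + (i + int m)))"
        by (rule sum.cong[OF refl s1])
      have S2: "(\<Sum>m=1..K. \<Sum>j=1..K. vc (- i + int m) (n + i - int (m * j))) = (\<Sum>m=1..K. \<Sum>j=0..K. vc (- (i - int m)) (n - int (m * j) + (i - int m)))"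
        by (rule sum.cong[OF refl s2])
      show ?thesis using e2[unfolded S1 S2 of_int_minus mult_minus_left] by linarith
    qed
    show ?thesis unfolding d_def by (simp only: right_diff_distrib e1 e2' sum_subtractf)
  qed
  have "d i n = 0" for i n
  proof (cases "n < 0")
    case False
    have "\<forall>i. d i (int N) = 0" for N
    proof (induction N rule: less_induct)
      case (less N)
      have dn: "d i' n' = 0" if "n' < int N" for i' n'
      proof (cases "n' < 0")
        case False
        thus ?thesis using less[of "nat n'"] that by auto
      qed (use dz in auto)
      have "d (int M - int N) (int N) = 0" for M
      proof (induction M rule: less_induct)
        case (less M)
        have dm: "d i' (int N) = 0" if "i' < int M - int N" for i'
        proof (cases "i' + int N < 0")
          case False
          thus ?thesis using less[of "nat (i' + int N)"] that by auto
        qed (use dz in auto)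
        let ?i = "int M - int N"
        have "of_int ?i * d ?i (int N) = 3 * (\<Sum>m=1..Suc (M+N). \<Sum>j=0..Suc (M+N). d (?i - int m) (int N - int (m * j))) - 3 * (\<Sum>m=1..Suc (M+N). \<Sum>j=1..Suc (M+N). d (?i + int m) (int N - int (m * j)))"
          by (rule de) auto
        moreover have "(\<Sum>m=1..Suc (M+N). \<Sum>j=0..Suc (M+N). d (?i - int m) (int N - int (m * j))) = 0"
        proof (intro sum.neutral ballI)
          fix m j assume "m \<in> {1..Suc (M+N)}" "j \<in> {0..Suc (M+N)}"
          thus "d (?i - int m) (int N - int (m * j)) = 0"
            by (cases "j = 0") (simp_all add: dm dn)
        qed
        moreover have "(\<Sum>m=1..Suc (M+N). \<Sum>j=1..Suc (M+N). d (?i + int m) (int N - int (m * j))) = 0"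
          by (intro sum.neutral ballI dn) auto
        ultimately have "of_int ?i * d ?i (int N) = 0" by simp
        hence "?i = 0 \<or> d ?i (int N) = 0" by (simp del: of_int_diff)
        \<comment> \<open>At i = 0 the relation says nothing, but there the two sides of the
          symmetry are literally the same coefficient.\<close>
        moreover have "d 0 (int N) = 0" by (simp add: d_def)
        ultimately show ?case by auto
      qed
      note * = this
      show ?case
      proof
        fix i show "d i (int N) = 0"
          by (cases "int N + i < 0") (use dz *[of "nat (int N + i)"] in auto)
      qed
    qed
    from this[of "nat n"] False show ?thesis by auto
  qed (use dz in auto)
  thus ?thesis by (simp add: d_def)
qed

text \<open>At i = \<rho> + 1 + t the weight is 8 times the binomial (t + 2 choose 2), the expansion
  coefficient of (1 - z)^(-3). Up to the factor 8 this is thus the coefficient of z^(-\<rho>-1) in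
  the completed product.\<close>

definition Bf :: "nat \<Rightarrow> rat fps" where
  "Bf \<rho> = Abs_fps (\<lambda>n. \<Sum>i\<in>{\<rho>+1..n}. 4 * (of_nat i - of_nat \<rho>) * (of_nat i - of_nat \<rho> + 1) * cf (int i) n)"

lemma Bf_eq_vc: "fps_nth (Bf \<rho>) n = 8 * vc (- int (\<rho> + 1)) (int n)"
proof (cases "n \<ge> \<rho> + 1")
  case True
  have "8 * vc (- int (\<rho> + 1)) (int n) = (\<Sum>t\<le>n - (\<rho> + 1). 8 * of_nat ((t + 2) choose 2) * cf (- int (\<rho> + 1) - int t) n)"
    using True by (subst vc_bound[where T = "n - (\<rho> + 1)"]) (auto simp: sum_distrib_left mult.assoc)
  also have "\<dots> = (\<Sum>t\<le>n - (\<rho> + 1). 4 * (of_nat t + 1) * (of_nat t + 2) * cf (int (\<rho> + 1 + t)) n)"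
  proof (intro sum.cong refl)
    fix t
    have "cf (- int (\<rho> + 1) - int t) n = cf (int (\<rho> + 1 + t)) n"
      by (subst cf_minus[symmetric]) (simp add: algebra_simps)
    thus "8 * of_nat ((t + 2) choose 2) * cf (- int (\<rho> + 1) - int t) n = 4 * (of_nat t + 1) * (of_nat t + 2) * cf (int (\<rho> + 1 + t)) n"
      by (simp only: choose_rat)
  qed
  also have "\<dots> = fps_nth (Bf \<rho>) n"
    unfolding Bf_def fps_nth_Abs_fps
    by (rule sum.reindex_bij_witness[where i = "\<lambda>i. i - (\<rho> + 1)" and j = "\<lambda>t. \<rho> + 1 + t"]) (use True in \<open>auto simp: algebra_simps of_nat_diff\<close>)
  finally show ?thesis by simp
qed (simp add: Bf_def vc_zero)

text \<open>Both summands weight \<open>cf j n\<close> by the same quadratic in j, and that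
  quadratic vanishes at the two values j = \<rho> + 2 and j = \<rho> + 3 lying between their ranges.
  Together they form a complete moment, which \<open>mu 0\<close>, \<open>mu 1\<close> and
  \<open>mu 2\<close> evaluate.\<close>

lemma vc_pos_plus_Bf:
  "8 * vc (int (\<rho> + 1)) (int n) + fps_nth (Bf (\<rho> + 3)) n = 
     fps_nth (fps_const ((2 * of_nat \<rho> + 5)\<^sup>2 - 1) + 24 * Sf 1) n"
proof -
  let ?p = "\<lambda>j::int. 4 * (of_nat \<rho> + 2 - of_int j) * (of_nat \<rho> + 3 - of_int j) :: rat"
  have "8 * vc (int (\<rho> + 1)) (int n) = (\<Sum>t\<le>n + (\<rho> + 1). 8 * of_nat ((t + 2) choose 2) * cf (int (\<rho> + 1) - int t) n)"
    by (subst vc_bound[where T = "n + (\<rho> + 1)"]) (auto simp: sum_distrib_left mult.assoc)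
  also have "\<dots> = (\<Sum>j\<in>{- int n..int (\<rho> + 1)}. ?p j * cf j n)"
    unfolding choose_rat
    by (rule sum.reindex_bij_witness[where j = "\<lambda>t. int (\<rho> + 1) - int t" and i = "\<lambda>j. nat (int (\<rho> + 1) - j)"]) (auto simp: algebra_simps)
  finally have 1: "8 * vc (int (\<rho> + 1)) (int n) = (\<Sum>j\<in>{- int n..int (\<rho> + 1)}. ?p j * cf j n)" .
  have 2: "fps_nth (Bf (\<rho> + 3)) n = (\<Sum>j\<in>{int (\<rho> + 4)..int n}. ?p j * cf j n)"
    unfolding Bf_def fps_nth_Abs_fps
    by (rule sum.reindex_bij_witness[where j = int and i = nat]) (auto simp: algebra_simps)
  let ?S = "{- int n..int (n + \<rho> + 4)}"
  have "(\<Sum>j\<in>{- int n..int (\<rho> + 1)}. ?p j * cf j n) + (\<Sum>j\<in>{int (\<rho> + 4)..int n}. ?p j * cf j n) = (\<Sum>j\<in>{- int n..int (\<rho> + 1)} \<union> {int (\<rho> + 4)..int n}. ?p j * cf j n)"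
    by (rule sum.union_disjoint[symmetric]) auto
  also have "\<dots> = (\<Sum>j\<in>?S. ?p j * cf j n)"
  proof (rule sum.mono_neutral_left)
    show "\<forall>j\<in>?S - ({- int n..int (\<rho> + 1)} \<union> {int (\<rho> + 4)..int n}). ?p j * cf j n = 0"
    proof
      fix j assume "j \<in> ?S - ({- int n..int (\<rho> + 1)} \<union> {int (\<rho> + 4)..int n})"
      hence "j = int \<rho> + 2 \<or> j = int \<rho> + 3 \<or> \<bar>j\<bar> > int n" by auto
      thus "?p j * cf j n = 0" using cf_support by auto
    qed
  qed auto
  also have "\<dots> = (\<Sum>j\<in>{- int n..int n}. ?p j * cf j n)"
    by (rule sum.mono_neutral_right) (auto intro!: cf_support)
  also have "\<dots> = 4 * (of_nat \<rho> + 2) * (of_nat \<rho> + 3) * fps_nth (mu 0) n - 4 * (2 * of_nat \<rho> + 5) * fps_nth (mu 1) n + 4 * fps_nth (mu 2) n"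
    unfolding mu_def fps_nth_Abs_fps sum_distrib_left
    by (simp add: algebra_simps power2_eq_square flip: sum.distrib sum_subtractf)
  also have "mu 1 = 0" using mu_Suc[of 0] by simp
  also have "mu 2 = 6 * Sf 1" using mu_Suc[of 1] by (simp add: mu_0 numeral_2_eq_2 atMost_Suc)
  finally show ?thesis using 1 2 by (simp add: mu_0 power2_eq_square algebra_simps fps_numeral_fps_const)
qed

text \<open>The symmetry moves the coefficient at -(\<rho> + 1) to the one at \<rho> + 1, at the
  cost of q^(\<rho>+1), and \<open>vc_pos_plus_Bf\<close> expresses the latter through \<rho> + 3.
  This is the recursion of the rank tails with a different inhomogeneity.\<close>

lemma Bf_rec: "Bf \<rho> = fps_X ^ (\<rho> + 1) * (fps_const ((2 * of_nat \<rho> + 5)\<^sup>2 - 1) + 24 * Sf 1 - Bf (\<rho> + 3))"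
proof (rule fps_ext)
  fix n
  show "fps_nth (Bf \<rho>) n = fps_nth (fps_X ^ (\<rho> + 1) * (fps_const ((2 * of_nat \<rho> + 5)\<^sup>2 - 1) + 24 * Sf 1 - Bf (\<rho> + 3))) n"
  proof (cases "n < \<rho> + 1")
    case True
    thus ?thesis by (subst fps_X_power_mult_nth) (simp add: Bf_def)
  next
    case False
    have "fps_nth (Bf \<rho>) n = 8 * vc (int (\<rho> + 1)) (int (n - (\<rho> + 1)))"
      using vc_symmetry[of "int (\<rho> + 1)" "int (n - (\<rho> + 1))"] False by (simp add: Bf_eq_vc of_nat_diff)
    thus ?thesis using vc_pos_plus_Bf[of \<rho> "n - (\<rho> + 1)"] False
      by (subst fps_X_power_mult_nth) simp
  qed
qed

section \<open>The rank-crank relation\<close>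

text \<open>Euler's product: coefficient m is read off a partial product in which it has already
  stabilised.\<close>

definition Phi :: "rat fps" where "Phi = Abs_fps (\<lambda>m. fps_nth (\<Prod>n\<in>{1..m}. 1 - fps_X ^ n) m)"

definition Pf :: "rat fps" where "Pf = Abs_fps (\<lambda>n. of_nat (pn n))"

definition Phim :: "nat \<Rightarrow> rat fps" where "Phim m = (\<Prod>n\<in>{1..m}. 1 - fps_X ^ n)"

lemma Phim_Suc: "Phim (Suc m) = Phim m * (1 - fps_X ^ Suc m)"
  by (simp add: Phim_def mult.commute)

lemma Phim_stable:
  assumes "k \<le> m" "m \<le> m'"
  shows "fps_nth (Phim m') k = fps_nth (Phim m) k"
  using assms(2)
proof (induction m' rule: dec_induct)
  case (step j)
  have "fps_nth (Phim (Suc j)) k = fps_nth (Phim j) k - fps_nth (Phim j * fps_X ^ Suc j) k"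
    by (simp only: Phim_Suc right_diff_distrib mult_1_right fps_sub_nth)
  also have "fps_nth (Phim j * fps_X ^ Suc j) k = 0"
    using step assms by (subst fps_X_power_mult_right_nth) auto
  finally show ?case using step by simp
qed auto

lemma Phi_eq_Phim: "k \<le> m \<Longrightarrow> fps_nth Phi k = fps_nth (Phim m) k"
  using Phim_stable[of k k m] by (simp add: Phi_def Phim_def)

definition lambert_term :: "nat \<Rightarrow> rat fps" where
  "lambert_term n = Abs_fps (\<lambda>k. if n dvd k \<and> k > 0 then of_nat n else 0)"

lemma lambert_term_mult: "n > 0 \<Longrightarrow> lambert_term n * (1 - fps_X ^ n) = fps_const (of_nat n) * fps_X ^ n"
proof (rule fps_ext)
  fix k assume n: "n > 0"
  have "fps_nth (lambert_term n * (1 - fps_X ^ n)) k = fps_nth (lambert_term n) k - fps_nth (lambert_term n * fps_X ^ n) k"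
    by (simp only: right_diff_distrib mult_1_right fps_sub_nth)
  also have "\<dots> = (if k = n then of_nat n else 0)"
    using n by (subst fps_X_power_mult_right_nth) (auto simp: lambert_term_def dvd_minus_self dest: dvd_imp_le)
  finally show "fps_nth (lambert_term n * (1 - fps_X ^ n)) k = fps_nth (fps_const (of_nat n) * fps_X ^ n) k"
    by simp
qed

lemma euler_Phim: "euler_op (Phim m) = - Phim m * (\<Sum>n\<in>{1..m}. lambert_term n)"
proof (induction m)
  case 0 thus ?case by (simp add: Phim_def euler_op_eq)
next
  case (Suc m)
  have e: "euler_op (1 - fps_X ^ Suc m) = - (fps_const (of_nat (Suc m)) * fps_X ^ Suc m :: rat fps)"
    by (rule fps_ext) (auto simp del: power_Suc)
  have "euler_op (Phim (Suc m)) = - Phim m * (\<Sum>n\<in>{1..m}. lambert_term n) * (1 - fps_X ^ Suc m) - Phim m * (lambert_term (Suc m) * (1 - fps_X ^ Suc m))"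
    unfolding Phim_Suc euler_op_mult Suc e by (simp only: lambert_term_mult zero_less_Suc) (simp del: power_Suc)
  also have "\<dots> = - Phim (Suc m) * (\<Sum>n\<in>{1..Suc m}. lambert_term n)"
    unfolding Phim_Suc by (simp add: algebra_simps del: power_Suc)
  finally show ?case .
qed

lemma euler_Phi: "euler_op Phi = - Phi * Sf 1"
proof (rule fps_ext)
  fix k
  have "fps_nth (euler_op Phi) k = fps_nth (euler_op (Phim k)) k" by (simp add: Phi_eq_Phim[of k k])
  also have "\<dots> = - (\<Sum>i=0..k. fps_nth (Phim k) i * fps_nth (\<Sum>n\<in>{1..k}. lambert_term n) (k - i))"
    by (simp add: euler_Phim fps_mult_nth)
  also have "\<dots> = - (\<Sum>i=0..k. fps_nth Phi i * fps_nth (Sf 1) (k - i))"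
  proof (intro arg_cong[of _ _ uminus] sum.cong refl)
    fix i assume i: "i \<in> {0..k}"
    have "fps_nth (\<Sum>n\<in>{1..k}. lambert_term n) j = fps_nth (Sf 1) j" if "j \<le> k" for j
    proof (cases "j = 0")
      case False
      have "fps_nth (\<Sum>n\<in>{1..k}. lambert_term n) j = (\<Sum>n\<in>{1..k}. if n dvd j then of_nat n else 0)"
        using False by (simp add: fps_sum_nth lambert_term_def)
      also have "\<dots> = (\<Sum>n\<in>{n\<in>{1..k}. n dvd j}. of_nat n)"
        by (rule sum.inter_filter[symmetric]) auto
      also have "{n\<in>{1..k}. n dvd j} = {n. n dvd j}"
        using False that by (auto dest: dvd_imp_le intro: le_trans gr0I simp: Suc_le_eq)
      finally show ?thesis by (simp add: Sf_def sig_def)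
    qed (simp add: fps_sum_nth lambert_term_def Sf_def)
    thus "fps_nth (Phim k) i * fps_nth (\<Sum>n\<in>{1..k}. lambert_term n) (k - i) = fps_nth Phi i * fps_nth (Sf 1) (k - i)"
      using i by (simp add: Phi_eq_Phim[of i k])
  qed
  finally show "fps_nth (euler_op Phi) k = fps_nth (- Phi * Sf 1) k"
    by (simp add: fps_mult_nth)
qed

section \<open>Partitions with bounded parts and Euler's product\<close>

definition partitions_le :: "nat \<Rightarrow> nat \<Rightarrow> nat multiset set" where
  "partitions_le m n = {M \<in> partitions n. \<forall>x\<in>#M. x \<le> m}"

lemma finite_partitions_le [simp]: "finite (partitions_le m n)" by (simp add: partitions_le_def)

definition Pm :: "nat \<Rightarrow> rat fps" where "Pm m = Abs_fps (\<lambda>n. of_nat (card (partitions_le m n)))"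

lemma card_partitions_le_Suc:
  "card (partitions_le (Suc m) n) = card (partitions_le m n) + (if n \<ge> Suc m then card (partitions_le (Suc m) (n - Suc m)) else 0)"
proof -
  let ?A = "{M \<in> partitions_le (Suc m) n. Suc m \<in># M}"
  have 1: "partitions_le (Suc m) n = partitions_le m n \<union> ?A"
    by (auto simp: partitions_le_def) (metis le_SucE)+
  \<comment> \<open>Removing one part of the maximal admissible size.\<close>
  have 2: "card ?A = (if n \<ge> Suc m then card (partitions_le (Suc m) (n - Suc m)) else 0)"
  proof (cases "n \<ge> Suc m")
    case True
    have "bij_betw (add_mset (Suc m)) (partitions_le (Suc m) (n - Suc m)) ?A"
    proof (rule bij_betw_byWitness[where f' = "\<lambda>M. M - {#Suc m#}"], goal_cases)
      case 4
      show ?case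
      proof safe
        fix M assume M: "M \<in> partitions_le (Suc m) n" "Suc m \<in># M"
        then obtain N where "M = add_mset (Suc m) N" by (auto dest: multi_member_split)
        thus "M - {#Suc m#} \<in> partitions_le (Suc m) (n - Suc m)"
          using M by (auto simp: partitions_le_def partitions_def)
      qed
    qed (use True in \<open>auto simp: partitions_le_def partitions_def\<close>)
    from bij_betw_same_card[OF this] True show ?thesis by simp
  next
    case False
    have "?A = {}" using False by (auto simp: partitions_le_def dest: partitions_elem_le)
    thus ?thesis using False by (metis card.empty)
  qed
  have "card (partitions_le (Suc m) n) = card (partitions_le m n) + card ?A"
    by (subst 1, rule card_Un_disjoint) (auto simp: partitions_le_def)
  thus ?thesis using 2 by simp
qed

lemma Pm_Suc: "Pm (Suc m) * (1 - fps_X ^ Suc m) = Pm m"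
proof (rule fps_ext)
  fix n
  have "fps_nth (Pm (Suc m) * (1 - fps_X ^ Suc m)) n = fps_nth (Pm (Suc m)) n - fps_nth (Pm (Suc m) * fps_X ^ Suc m) n"
    by (simp only: right_diff_distrib mult_1_right fps_sub_nth)
  also have "\<dots> = fps_nth (Pm m) n"
    by (subst fps_X_power_mult_right_nth) (simp add: Pm_def card_partitions_le_Suc[of m n])
  finally show "fps_nth (Pm (Suc m) * (1 - fps_X ^ Suc m)) n = fps_nth (Pm m) n" .
qed

lemma Phim_Pm: "Phim m * Pm m = 1"
proof (induction m)
  case 0
  have "partitions_le 0 n = (if n = 0 then {{#}} else {})" for n
    by (auto simp: partitions_le_def partitions_def) (metis multiset_cases not_gr_zero union_single_eq_member sum_mset.empty less_irrefl)+
  hence "Pm 0 = 1" by (intro fps_ext) (simp add: Pm_def)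
  thus ?case by (simp add: Phim_def)
next
  case (Suc m)
  have "Phim (Suc m) * Pm (Suc m) = Phim m * (Pm (Suc m) * (1 - fps_X ^ Suc m))"
    unfolding Phim_Suc by (simp only: mult_ac)
  thus ?case using Suc by (simp only: Pm_Suc)
qed

lemma Phi_Pf: "Phi * Pf = 1"
proof (rule fps_ext)
  fix n
  have P: "fps_nth Pf k = fps_nth (Pm n) k" if "k \<le> n" for k
  proof -
    have "partitions_le n k = partitions k"
      using that partitions_elem_le by (fastforce simp: partitions_le_def)
    thus ?thesis by (simp add: Pf_def Pm_def pn_def)
  qed
  have "fps_nth (Phi * Pf) n = fps_nth (Phim n * Pm n) n"
    unfolding fps_mult_nth by (intro sum.cong refl) (auto simp: P Phi_eq_Phim[of _ n])
  thus "fps_nth (Phi * Pf) n = fps_nth 1 n" by (simp only: Phim_Pm)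
qed

lemma euler_Pf: "euler_op Pf = Pf * Sf 1"
proof -
  have "0 = euler_op (Phi * Pf)" by (simp add: Phi_Pf euler_op_eq)
  also have "\<dots> = Phi * (euler_op Pf - Pf * Sf 1)" by (simp add: euler_op_mult euler_Phi algebra_simps)
  finally have "Phi * (euler_op Pf - Pf * Sf 1) = 0" by simp
  moreover have "Phi \<noteq> 0" using Phi_Pf by auto
  ultimately show ?thesis by simp
qed

section \<open>Generating functions of the rank tails\<close>

definition Gr :: "nat \<Rightarrow> rat fps" where "Gr \<rho> = Abs_fps (\<lambda>n. of_nat (rank_ge (int \<rho>) n))"

lemma Gr_rec: "\<rho> \<ge> 1 \<Longrightarrow> Gr \<rho> = fps_X ^ (\<rho> + 1) * (Pf - Gr (\<rho> + 3))"
proof (rule fps_ext)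
  fix n assume r: "\<rho> \<ge> 1"
  show "fps_nth (Gr \<rho>) n = fps_nth (fps_X ^ (\<rho> + 1) * (Pf - Gr (\<rho> + 3))) n"
  proof (cases "n < \<rho> + 1")
    case True
    thus ?thesis using r rank_ge_eq_0[of "int \<rho>" n] by (subst fps_X_power_mult_nth) (simp add: Gr_def)
  next
    case False
    thus ?thesis using rank_ge_rec[OF r, of n] rank_ge_le_pn[of "int \<rho> + 3" "n - \<rho> - 1"]
      by (subst fps_X_power_mult_nth) (simp add: Gr_def Pf_def of_nat_diff add_ac)
  qed
qed

text \<open>Every application of the hypothesis multiplies by a positive power of q, so the order of
  vanishing exceeds any bound.\<close>

lemma fps_eq_0_if_shift:
  fixes d :: "nat \<Rightarrow> 'a :: comm_ring_1 fps"
  assumes "\<And>\<rho>. \<rho> \<ge> 1 \<Longrightarrow> d \<rho> = - (fps_X ^ (\<rho> + 1) * d (\<rho> + 3))"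
  shows "\<rho> \<ge> 1 \<Longrightarrow> d \<rho> = 0"
proof -
  have "\<forall>\<rho>\<ge>1. fps_nth (d \<rho>) n = 0" for n
  proof (induction n rule: less_induct)
    case (less n)
    show ?case
    proof (intro allI impI)
      fix \<rho> :: nat assume r: "\<rho> \<ge> 1"
      have "fps_nth (d \<rho>) n = - fps_nth (fps_X ^ (\<rho> + 1) * d (\<rho> + 3)) n" using assms[OF r] by simp
      also have "\<dots> = 0" using less[of "n - (\<rho> + 1)"] by (subst fps_X_power_mult_nth) auto
      finally show "fps_nth (d \<rho>) n = 0" .
    qed
  qed
  thus "\<rho> \<ge> 1 \<Longrightarrow> d \<rho> = 0" by (intro fps_ext) auto
qed

lemma euler_X_power: "euler_op (fps_X ^ k * f) = fps_X ^ k * (euler_op f + fps_const (of_nat k) * f)"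
proof (rule fps_ext)
  fix n show "fps_nth (euler_op (fps_X ^ k * f)) n = fps_nth (fps_X ^ k * (euler_op f + fps_const (of_nat k) * f)) n"
    by (cases "n < k") (simp_all add: fps_X_power_mult_nth of_nat_diff ring_distribs)
qed

text \<open>The rank-crank partial differential equation, one power of the elliptic variable at a time: both
  sides satisfy the same first-order recursion in \<rho>.\<close>

theorem rank_crank:
  assumes r: "\<rho> \<ge> 1"
  shows "24 * euler_op (Gr \<rho>) + fps_const ((2 * of_nat \<rho> - 1)\<^sup>2 - 1) * Gr \<rho> = Pf * Bf \<rho>"
proof -
  define Z where "Z \<rho> = 24 * euler_op (Gr \<rho>) + fps_const ((2 * of_nat \<rho> - 1)\<^sup>2 - 1) * Gr \<rho>" for \<rho>
  have Zr: "Z \<rho> = fps_X ^ (\<rho> + 1) * (Pf * (fps_const ((2 * of_nat \<rho> + 5)\<^sup>2 - 1) + 24 * Sf 1) - Z (\<rho> + 3))" if r: "\<rho> \<ge> 1" for \<rho>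
  proof -
    let ?H = "Pf - Gr (\<rho> + 3)"
    \<comment> \<open>The factor q^(\<rho>+1) adds 24 (\<rho> + 1) when q d/dq passes it, and
      (2\<rho> - 1)^2 + 24 (\<rho> + 1) = (2\<rho> + 5)^2 = (2(\<rho> + 3) - 1)^2. This is what
      makes the operator compatible with the step 3.\<close>
    have c: "fps_const ((2 * of_nat \<rho> + 5)\<^sup>2 - 1) = (24 * fps_const (of_nat (\<rho> + 1)) + fps_const ((2 * of_nat \<rho> - 1)\<^sup>2 - 1) :: rat fps)"
      by (simp add: fps_numeral_fps_const power2_eq_square algebra_simps)
    have c2: "fps_const ((2 * of_nat (\<rho> + 3) - 1)\<^sup>2 - 1) = (fps_const ((2 * of_nat \<rho> + 5)\<^sup>2 - 1) :: rat fps)"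
      by (simp add: power2_eq_square algebra_simps)
    have "Z \<rho> = 24 * (fps_X ^ (\<rho> + 1) * (euler_op ?H + fps_const (of_nat (\<rho> + 1)) * ?H)) + fps_const ((2 * of_nat \<rho> - 1)\<^sup>2 - 1) * (fps_X ^ (\<rho> + 1) * ?H)"
      unfolding Z_def by (subst (1 2) Gr_rec[OF r]) (simp only: euler_X_power)
    also have "\<dots> = fps_X ^ (\<rho> + 1) * (24 * euler_op ?H + fps_const ((2 * of_nat \<rho> + 5)\<^sup>2 - 1) * ?H)"
      unfolding c by (simp only: distrib_left distrib_right mult_ac add_ac)
    also have "24 * euler_op ?H + fps_const ((2 * of_nat \<rho> + 5)\<^sup>2 - 1) * ?H = Pf * (fps_const ((2 * of_nat \<rho> + 5)\<^sup>2 - 1) + 24 * Sf 1) - Z (\<rho> + 3)"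
      unfolding Z_def c2 euler_op_diff euler_Pf by (simp add: algebra_simps)
    finally show ?thesis .
  qed
  have "Z \<rho> - Pf * Bf \<rho> = 0"
  proof (rule fps_eq_0_if_shift[where d = "\<lambda>\<rho>. Z \<rho> - Pf * Bf \<rho>", OF _ r])
    fix \<rho> :: nat assume "\<rho> \<ge> 1"
    thus "Z \<rho> - Pf * Bf \<rho> = - (fps_X ^ (\<rho> + 1) * (Z (\<rho> + 3) - Pf * Bf (\<rho> + 3)))"
      by (subst Zr, assumption, subst Bf_rec) (simp add: algebra_simps)
  qed
  thus ?thesis by (simp add: Z_def)
qed

section \<open>The transformation law of the Eisenstein series of weight two\<close>

lemma has_sum_int:
  fixes f :: "int \<Rightarrow> 'a :: {topological_comm_monoid_add,t2_space}"
  assumes "((\<lambda>n. f (int n)) has_sum a) UNIV" "((\<lambda>n. f (- int (Suc n))) has_sum b) UNIV"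
  shows "(f has_sum (a + b)) UNIV"
proof -
  have 1: "(f has_sum a) {0..}"
    using assms(1) by (subst has_sum_reindex_bij_witness[where i = int and j = nat and T = UNIV and h = "\<lambda>n. f (int n)" and s' = a]) auto
  have 2: "(f has_sum b) {..<0}"
    using assms(2) by (subst has_sum_reindex_bij_witness[where i = "\<lambda>n. - int (Suc n)" and j = "\<lambda>k. nat (- k - 1)" and T = UNIV and h = "\<lambda>n. f (- int (Suc n))" and s' = b]) auto
  have "(f has_sum (a + b)) ({0..} \<union> {..<0})"
    by (rule has_sum_Un_disjoint[OF 1 2]) auto
  moreover have "{0..} \<union> {..<0} = (UNIV :: int set)" by auto
  ultimately show ?thesis by simp
qed

lemma has_sum_int_nonzero:
  fixes f :: "int \<Rightarrow> 'a :: {topological_comm_monoid_add,t2_space}"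
  assumes "((\<lambda>n. f (int (Suc n))) has_sum a) UNIV" "((\<lambda>n. f (- int (Suc n))) has_sum b) UNIV"
  shows "(f has_sum (a + b)) (- {0})"
proof -
  have 1: "(f has_sum a) {0<..}"
    using assms(1) by (subst has_sum_reindex_bij_witness[where i = "\<lambda>n. int (Suc n)" and j = "\<lambda>k. nat (k - 1)" and T = UNIV and h = "\<lambda>n. f (int (Suc n))" and s' = a]) auto
  have 2: "(f has_sum b) {..<0}"
    using assms(2) by (subst has_sum_reindex_bij_witness[where i = "\<lambda>n. - int (Suc n)" and j = "\<lambda>k. nat (- k - 1)" and T = UNIV and h = "\<lambda>n. f (- int (Suc n))" and s' = b]) auto
  have "(f has_sum (a + b)) ({0<..} \<union> {..<0})"
    by (rule has_sum_Un_disjoint[OF 1 2]) auto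
  moreover have "{0<..} \<union> {..<0} = - {0 :: int}" by auto
  ultimately show ?thesis by simp
qed

text \<open>The logarithmic derivative of Gamma(z) Gamma(1 - z) = \<pi> / sin(\<pi> z).\<close>

lemma Digamma_reflection:
  fixes z :: complex
  assumes "z \<notin> \<int>"
  shows "Digamma (1 - z) - Digamma z = of_real pi * cot (of_real pi * z)"
proof -
  let ?p = "complex_of_real pi"
  have nz: "z \<notin> \<int>\<^sub>\<le>\<^sub>0" "1 - z \<notin> \<int>\<^sub>\<le>\<^sub>0"
    using assms by (auto elim!: nonpos_Ints_cases' dest: nonpos_Ints_Int)
       (metis Ints_1 Ints_diff diff_diff_eq2 diff_add_cancel add.commute nonpos_Ints_Int Ints_minus Ints_of_nat)
  have s0: "sin (?p * z) \<noteq> 0"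
  proof
    assume "sin (?p * z) = 0"
    then obtain n :: int where "?p * z = of_real (n * pi)" by (auto simp: sin_eq_0)
    hence "z = of_int n" by (simp add: field_simps)
    thus False using assms by simp
  qed
  have d1: "((\<lambda>w. Gamma w * Gamma (1 - w)) has_field_derivative
     Gamma z * Gamma (1 - z) * (Digamma z - Digamma (1 - z))) (at z)"
    using nz by (auto intro!: derivative_eq_intros simp: algebra_simps)
  have d2: "((\<lambda>w. ?p / sin (?p * w)) has_field_derivative
     - (?p / sin (?p * z)) * (?p * cot (?p * z))) (at z)"
    using s0 by (auto intro!: derivative_eq_intros simp: cot_def field_simps power2_eq_square)
  have "Gamma z * Gamma (1 - z) * (Digamma z - Digamma (1 - z)) = - (?p / sin (?p * z)) * (?p * cot (?p * z))"
    using d1 d2 unfolding Gamma_reflection_complex by (rule DERIV_unique)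
  hence "(?p / sin (?p * z)) * (Digamma z - Digamma (1 - z)) = (?p / sin (?p * z)) * - (?p * cot (?p * z))"
    unfolding Gamma_reflection_complex by simp
  hence "Digamma z - Digamma (1 - z) = - (?p * cot (?p * z))"
    by (rule mult_left_cancel[THEN iffD1, rotated]) (use s0 in simp)
  thus ?thesis by (metis minus_diff_eq minus_equation_iff)
qed

lemma sin_pi_nonzero: "sin (of_real pi * z) \<noteq> 0" if "z \<notin> \<int>" for z :: complex
proof
  assume "sin (of_real pi * z) = 0"
  then obtain n :: int where "of_real pi * z = of_real (n * pi)" by (auto simp: sin_eq_0)
  hence "z = of_int n" by (simp add: field_simps)
  thus False using that by simp
qed

text \<open>In the difference of the limit formulas for the digamma function at 1 - z and z the
  logarithms cancel.\<close>

lemma cot_partial_fractions: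
  fixes z :: complex
  assumes "z \<notin> \<int>"
  shows "(\<lambda>n. inverse (z + of_nat n) - inverse (of_nat (Suc n) - z)) sums (of_real pi * cot (of_real pi * z))"
proof -
  have nz: "z \<noteq> 0" "1 - z \<noteq> 0" using assms by auto
  have "(\<lambda>m. (of_real (ln (real m)) - (\<Sum>n<m. inverse (1 - z + of_nat n))) -
     (of_real (ln (real m)) - (\<Sum>n<m. inverse (z + of_nat n)))) \<longlonglongrightarrow> Digamma (1 - z) - Digamma z"
    by (intro tendsto_diff Digamma_LIMSEQ nz)
  thus ?thesis unfolding sums_def Digamma_reflection[OF assms]
    by (simp add: sum_subtractf algebra_simps)
qed

text \<open>Differentiating the reflection formula gives two trigamma values; the one at z sums over
  n \<ge> 0 and the one at 1 - z over n < 0.\<close>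

lemma inverse_sin_squared_sums:
  fixes z :: complex
  assumes "z \<notin> \<int>"
  shows "((\<lambda>n::int. 1 / (z + of_int n) ^ 2) has_sum ((of_real pi / sin (of_real pi * z)) ^ 2)) UNIV"
proof -
  let ?p = "complex_of_real pi"
  have nz: "z \<notin> \<int>\<^sub>\<le>\<^sub>0" "1 - z \<notin> \<int>\<^sub>\<le>\<^sub>0" "z \<noteq> 0" "1 - z \<noteq> 0"
    using assms by (auto elim!: nonpos_Ints_cases' dest: nonpos_Ints_Int)
       (metis Ints_1 Ints_diff diff_diff_eq2 diff_add_cancel add.commute nonpos_Ints_Int Ints_minus Ints_of_nat)
  have "open (- \<int> :: complex set)" by (simp add: closed_Ints open_Compl)
  have d1: "((\<lambda>w. Digamma (1 - w) - Digamma w) has_field_derivative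
     - Polygamma 1 (1 - z) - Polygamma 1 z) (at z)"
    using nz by (auto intro!: derivative_eq_intros DERIV_chain2[OF has_field_derivative_Polygamma])
  have d2: "((\<lambda>w. ?p * cot (?p * w)) has_field_derivative (- ((?p / sin (?p * z)) ^ 2))) (at z)"
  proof -
    have gen: "p * ((- s * p * s - c * (c * p)) / (s * s)) = - (p ^ 2 * (s ^ 2 + c ^ 2) / s ^ 2)" if "s \<noteq> 0" for p s c :: complex
      using that by (simp add: field_simps power2_eq_square)
    have "((\<lambda>w. ?p * (cos (?p * w) / sin (?p * w))) has_field_derivative 
      ?p * ((- sin (?p * z) * ?p * sin (?p * z) - cos (?p * z) * (cos (?p * z) * ?p)) / (sin (?p * z) * sin (?p * z)))) (at z)"
      using sin_pi_nonzero[OF assms] by (auto intro!: derivative_eq_intros simp: algebra_simps)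
    also have "?p * ((- sin (?p * z) * ?p * sin (?p * z) - cos (?p * z) * (cos (?p * z) * ?p)) / (sin (?p * z) * sin (?p * z)))
       = - (?p ^ 2 * ((sin (?p * z))^2 + (cos (?p * z))^2) / (sin (?p * z))^2)"
      by (rule gen) (rule sin_pi_nonzero[OF assms])
    finally show ?thesis by (simp add: cot_def power_divide)
  qed
  have "- Polygamma 1 (1 - z) - Polygamma 1 z = - ((?p / sin (?p * z)) ^ 2)"
  proof (rule DERIV_unique[OF _ d2])
    show "((\<lambda>w. ?p * cot (?p * w)) has_field_derivative - Polygamma 1 (1 - z) - Polygamma 1 z) (at z)"
      by (rule has_field_derivative_transform_within_open[OF d1 \<open>open (- \<int>)\<close>])
         (use assms Digamma_reflection in auto)
  qed
  hence eq: "Polygamma 1 z + Polygamma 1 (1 - z) = (?p / sin (?p * z)) ^ 2" by (simp add: algebra_simps)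
  have abs: "((\<lambda>k. 1 / (w + of_nat k) ^ 2) has_sum Polygamma 1 w) UNIV" if "w \<noteq> 0" for w :: complex
  proof (rule norm_summable_imp_has_sum)
    show "(\<lambda>k. 1 / (w + of_nat k) ^ 2) sums Polygamma 1 w"
      using Polygamma_LIMSEQ[of w 1] that by (simp add: inverse_eq_divide numeral_2_eq_2)
    show "summable (\<lambda>k. norm (1 / (w + of_nat k) ^ 2))"
    proof (rule summable_comparison_test_ev)
      show "summable (\<lambda>k. 4 * inverse (real k ^ 2))"
        by (intro summable_mult inverse_power_summable) simp
      \<comment> \<open>Once k \<ge> 2 |w| the distance |w + k| is at least k/2, hence the constant
        4.\<close>
      have "norm (norm (1 / (w + of_nat k) ^ 2)) \<le> 4 * inverse (real k ^ 2)" if "k \<ge> nat \<lceil>2 * norm w\<rceil> + 1" for k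
      proof -
        have k: "real k \<ge> 2 * norm w" "k > 0" using that by linarith+
        have "real k = norm (w + of_nat k - w)" by simp
        also have "\<dots> \<le> norm (w + of_nat k) + norm w" by (rule norm_triangle_ineq4)
        finally have "real k / 2 \<le> norm (w + of_nat k)" using k by linarith
        hence "(real k / 2)^2 \<le> norm (w + of_nat k)^2" by (intro power_mono) auto
        hence "1 / (norm (w + of_nat k)^2) \<le> 1 / (real k / 2)^2"
          using k by (intro divide_left_mono) (auto intro!: mult_pos_pos)
        thus ?thesis by (simp add: norm_divide norm_power power_divide inverse_eq_divide)
      qed
      thus "\<forall>\<^sub>F k in sequentially. norm (norm (1 / (w + of_nat k) ^ 2)) \<le> 4 * inverse (real k ^ 2)"
        by (intro eventually_sequentiallyI) auto
    qed
  qed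
  show ?thesis
  proof (subst eq[symmetric], rule has_sum_int)
    show "((\<lambda>n. 1 / (z + of_int (int n)) ^ 2) has_sum Polygamma 1 z) UNIV" using abs[of z] nz by simp
    have "((\<lambda>n. 1 / (1 - z + of_nat n) ^ 2) has_sum Polygamma 1 (1 - z)) UNIV" using abs[of "1 - z"] nz by simp
    also have "(\<lambda>n. 1 / (1 - z + of_nat n) ^ 2) = (\<lambda>n. 1 / (z + of_int (- int (Suc n))) ^ 2)"
      by (auto simp: power2_eq_square algebra_simps)
    finally show "((\<lambda>n. 1 / (z + of_int (- int (Suc n))) ^ 2) has_sum Polygamma 1 (1 - z)) UNIV" .
  qed
qed

definition qq :: "complex \<Rightarrow> complex" where "qq z = exp (2 * of_real pi * \<i> * z)"

lemma norm_qq: "norm (qq z) = exp (- 2 * pi * Im z)"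
  by (simp add: qq_def norm_exp_eq_Re)

lemma norm_qq_less_1: "Im z > 0 \<Longrightarrow> norm (qq z) < 1"
  by (simp add: norm_qq)

lemma qq_nonzero [simp]: "qq z \<noteq> 0" by (simp add: qq_def)

lemma qq_of_nat_mult: "qq (of_nat n * z) = qq z ^ n"
  by (simp add: qq_def exp_of_nat_mult[symmetric] mult_ac)

lemma inverse_sin_squared_qq:
  assumes "qq z \<noteq> 1"
  shows "(of_real pi / sin (of_real pi * z)) ^ 2 = - 4 * of_real pi ^ 2 * (qq z / (1 - qq z) ^ 2)"
proof -
  define e where "e = exp (\<i> * (of_real pi * z))"
  have e: "e \<noteq> 0" "qq z = e ^ 2" "exp (- (\<i> * (of_real pi * z))) = inverse e"
    by (auto simp: e_def qq_def exp_minus exp_double[symmetric] mult_ac power2_eq_square exp_add[symmetric])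
  have "sin (of_real pi * z) = (e - inverse e) / (2 * \<i>)"
    by (simp add: sin_exp_eq e e_def)
  moreover have "((e - inverse e) / (2 * \<i>)) ^ 2 = - ((1 - e^2) ^ 2 / (4 * e^2))"
    using e(1) by (simp add: power_divide power2_eq_square field_simps)
  ultimately have "(sin (of_real pi * z)) ^ 2 = - ((1 - e^2) ^ 2 / (4 * e^2))" by simp
  thus ?thesis using assms e by (simp add: power_divide)
qed

lemma has_sum_geometric_deriv:
  fixes x :: "'a :: {real_normed_field,banach}"
  assumes "norm x < 1"
  shows "((\<lambda>r. of_nat (Suc r) * x ^ (Suc r)) has_sum (x / (1 - x) ^ 2)) UNIV"
proof (rule norm_summable_imp_has_sum)
  have "summable (\<lambda>n. of_nat (Suc n) * norm x ^ n)"
    using geometric_deriv_sums[of "norm x"] assms by (simp add: sums_iff)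
  hence "summable (\<lambda>n. norm x * (of_nat (Suc n) * norm x ^ n))" by (rule summable_mult)
  thus "summable (\<lambda>n. norm (of_nat (Suc n) * x ^ (Suc n)))"
    by (simp add: norm_mult norm_power mult_ac del: of_nat_Suc)
  show "(\<lambda>r. of_nat (Suc r) * x ^ (Suc r)) sums (x / (1 - x) ^ 2)"
    using sums_mult[OF geometric_deriv_sums[OF assms], of x] by (simp add: mult_ac)
qed

text \<open>One absolutely summable double series of terms r q^(mr), summed along rows and along the
  fibres of the product m r.\<close>

lemma has_sum_lambert_1:
  fixes q :: complex
  assumes "norm q < 1"
  obtains X where "((\<lambda>m. q ^ Suc m / (1 - q ^ Suc m) ^ 2) has_sum X) UNIV" "((\<lambda>n. of_nat (sig 1 n) * q ^ n) has_sum X) UNIV"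
proof -
  note inner = has_sum_geometric_deriv
  define g where "g = (\<lambda>(m, r). of_nat (Suc r) * (q ^ Suc m) ^ Suc r)"
  have q1: "norm (q ^ Suc m) < 1" for m
    using assms by (simp add: norm_power power_less_one_iff del: power_Suc)
  have "(\<lambda>p. norm (g p)) summable_on (UNIV \<times> UNIV)"
  proof (rule summable_on_SigmaI)
    show "((\<lambda>r. norm (g (m, r))) has_sum (norm q ^ Suc m / (1 - norm q ^ Suc m) ^ 2)) UNIV" for m
      using inner[of "norm q ^ Suc m"] q1[of m] by (simp add: g_def norm_mult norm_power del: of_nat_Suc power_Suc)
    show "(\<lambda>m. norm q ^ Suc m / (1 - norm q ^ Suc m) ^ 2) summable_on UNIV"
    proof (rule summable_nonneg_imp_summable_on)
      show "summable (\<lambda>m. norm q ^ Suc m / (1 - norm q ^ Suc m) ^ 2)"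
      proof (rule summable_comparison_test_ev)
        show "summable (\<lambda>m. norm q ^ Suc m / (1 - norm q) ^ 2)"
          using assms by (intro summable_divide) (simp add: summable_Suc_iff summable_geometric)
        have "norm (norm q ^ Suc m / (1 - norm q ^ Suc m) ^ 2) \<le> norm q ^ Suc m / (1 - norm q) ^ 2" for m
        proof -
          have "norm q ^ Suc m \<le> norm q" using assms by (simp add: mult_left_le power_le_one)
          hence "(1 - norm q) ^ 2 \<le> (1 - norm q ^ Suc m) ^ 2" using assms by (intro power_mono) auto
          moreover have "(1 - norm q) ^ 2 > 0" using assms by simp
          ultimately have "norm q ^ Suc m / (1 - norm q ^ Suc m) ^ 2 \<le> norm q ^ Suc m / (1 - norm q) ^ 2"
            by (intro divide_left_mono mult_pos_pos) auto
          thus ?thesis by (simp add: norm_power)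
        qed
        thus "\<forall>\<^sub>F m in sequentially. norm (norm q ^ Suc m / (1 - norm q ^ Suc m) ^ 2) \<le> norm q ^ Suc m / (1 - norm q) ^ 2"
          by simp
      qed
    qed auto
  qed auto
  hence "g summable_on (UNIV \<times> UNIV)" by (rule abs_summable_summable)
  then obtain X where X: "(g has_sum X) (UNIV \<times> UNIV)" by (auto simp: summable_on_def)
  have 1: "((\<lambda>m. q ^ Suc m / (1 - q ^ Suc m) ^ 2) has_sum X) UNIV"
    by (rule has_sum_SigmaD[OF X]) (use inner[OF q1] in \<open>simp add: g_def del: of_nat_Suc power_Suc\<close>)
  have "((\<lambda>(n, d). of_nat d * q ^ n) has_sum X) (Sigma {1..} (\<lambda>n. {d. d dvd n}))"
  proof -
    have *: "\<exists>d' k'. a = (Suc d' * Suc k', Suc d')" if h: "a \<in> (SIGMA n:{1..}. {d. d dvd n})" for a :: "nat \<times> nat"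
    proof -
      obtain n d where a: "a = (n, d)" "d dvd n" "n \<ge> 1" using h by (cases a) auto
      then obtain k where "n = d * k" "d > 0" "k > 0" by (auto elim!: dvdE)
      thus ?thesis using a by (auto simp: gr0_conv_Suc)
    qed
    have "((\<lambda>(n, d). of_nat d * q ^ n) has_sum X) (Sigma {1..} (\<lambda>n. {d. d dvd n})) \<longleftrightarrow> (g has_sum X) (UNIV \<times> UNIV)"
    proof (rule has_sum_reindex_bij_witness[where i = "\<lambda>(m, r). (Suc r * Suc m, Suc r)" and j = "\<lambda>(n, d). (n div d - 1, d - 1)"], goal_cases)
      case (1 a)
      from *[OF 1] show ?case by (auto simp del: mult_Suc mult_Suc_right)
    next
      case (5 a)
      from *[OF 5] show ?case by (auto simp: g_def power_mult[symmetric] mult.commute simp del: mult_Suc mult_Suc_right power_Suc of_nat_Suc)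
    qed (auto simp del: mult_Suc mult_Suc_right)
    thus ?thesis using X by simp
  qed
  hence "((\<lambda>n. \<Sum>d | d dvd n. of_nat d * q ^ n) has_sum X) {1..}"
    by (rule has_sum_SigmaD) (auto intro!: has_sum_finite)
  hence "((\<lambda>n. of_nat (sig 1 n) * q ^ n) has_sum X) {1..}"
    by (simp add: sig_def sum_distrib_right)
  hence "((\<lambda>n. of_nat (sig 1 n) * q ^ n) has_sum X) UNIV"
    by (rule has_sum_cong_neutral[THEN iffD1, rotated -1]) (auto simp: not_le)
  with 1 show ?thesis using that by blast
qed

text \<open>The q-expansion of the sum over m \<noteq> 0 of the sum over all n of 1/(m z + n)^2,
  taken in this order.\<close>

definition GK :: "complex \<Rightarrow> complex" where
  "GK z = - 8 * of_real pi ^ 2 * suminf (\<lambda>n. of_nat (sig 1 n) * qq z ^ n)"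

lemma of_int_mult_notin_Ints: "Im z > 0 \<Longrightarrow> m \<noteq> 0 \<Longrightarrow> of_int m * z \<notin> \<int>"
  by (auto elim!: Ints_cases simp: complex_eq_iff)

lemma has_sum_GK:
  assumes "Im z > 0"
  shows "((\<lambda>m. (of_real pi / sin (of_real pi * (of_int m * z))) ^ 2) has_sum GK z) (- {0})"
proof -
  obtain X where X: "((\<lambda>m. qq z ^ Suc m / (1 - qq z ^ Suc m) ^ 2) has_sum X) UNIV" "((\<lambda>n. of_nat (sig 1 n) * qq z ^ n) has_sum X) UNIV"
    using has_sum_lambert_1[OF norm_qq_less_1[OF assms]] by blast
  have GK: "GK z = - 4 * of_real pi ^ 2 * X + - 4 * of_real pi ^ 2 * X"
    using has_sum_imp_sums[OF X(2)] by (simp add: GK_def sums_iff)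
  have pos: "(of_real pi / sin (of_real pi * (of_int (int (Suc m)) * z))) ^ 2 = - 4 * of_real pi ^ 2 * (qq z ^ Suc m / (1 - qq z ^ Suc m) ^ 2)" for m
  proof -
    have "norm (qq (of_nat (Suc m) * z)) < 1" by (rule norm_qq_less_1) (use assms in auto)
    hence "qq (of_nat (Suc m) * z) \<noteq> 1" by auto
    from inverse_sin_squared_qq[OF this] show ?thesis 
      by (simp only: of_int_of_nat_eq qq_of_nat_mult)
  qed
  have 1: "((\<lambda>m. (of_real pi / sin (of_real pi * (of_int (int (Suc m)) * z))) ^ 2) has_sum - 4 * of_real pi ^ 2 * X) UNIV"
    unfolding pos by (rule has_sum_cmult_right[OF X(1)])
  have "(\<lambda>m. (of_real pi / sin (of_real pi * (of_int (- int (Suc m)) * z))) ^ 2) = (\<lambda>m. (of_real pi / sin (of_real pi * (of_int (int (Suc m)) * z))) ^ 2)"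
  proof
    fix m
    have "of_real pi * (of_int (- int (Suc m)) * z) = - (of_real pi * (of_int (int (Suc m)) * z))"
      by (simp only: of_int_minus mult_minus_left mult_minus_right)
    thus "(of_real pi / sin (of_real pi * (of_int (- int (Suc m)) * z))) ^ 2 = (of_real pi / sin (of_real pi * (of_int (int (Suc m)) * z))) ^ 2"
      by (simp only: sin_minus power_divide power2_minus)
  qed
  with 1 have 2: "((\<lambda>m. (of_real pi / sin (of_real pi * (of_int (- int (Suc m)) * z))) ^ 2) has_sum - 4 * of_real pi ^ 2 * X) UNIV"
    by simp
  show ?thesis unfolding GK by (rule has_sum_int_nonzero[OF 1 2])
qed

section \<open>Exchanging the order of summation in the lattice sum\<close>

lemma has_sum_subtract:
  fixes f g :: "'a \<Rightarrow> complex"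
  assumes "(f has_sum a) A" "(g has_sum b) A"
  shows "((\<lambda>x. f x - g x) has_sum (a - b)) A"
  using has_sum_add[OF assms(1) has_sum_cmult_right[OF assms(2), of "-1"]] by simp

lemma has_sum_finite_sum:
  fixes f :: "'b \<Rightarrow> 'a \<Rightarrow> complex"
  assumes "\<And>i. i \<in> I \<Longrightarrow> (f i has_sum s i) A" "finite I"
  shows "((\<lambda>x. \<Sum>i\<in>I. f i x) has_sum (\<Sum>i\<in>I. s i)) A"
  using assms(2,1) by (induction I rule: finite_induct) (auto intro!: has_sum_add)

lemma has_sum_tendsto:
  assumes "(f has_sum s) A" "filterlim F (finite_subsets_at_top A) sequentially"
  shows "(\<lambda>N. sum f (F N)) \<longlonglongrightarrow> s"
  using assms unfolding has_sum_def by (rule filterlim_compose)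

lemma filterlim_int_intervals:
  "filterlim (\<lambda>N. {- int N..<int N}) (finite_subsets_at_top UNIV) sequentially"
  "filterlim (\<lambda>N. {- int N..<int N} - {0}) (finite_subsets_at_top (- {0})) sequentially"
  "filterlim (\<lambda>N. {- int N..int N} - {0}) (finite_subsets_at_top (- {0})) sequentially"
proof -
  have "\<exists>N0. \<forall>N\<ge>N0. X \<subseteq> {- int N..<int N}" if "finite X" for X :: "int set"
  proof -
    have "\<forall>x\<in>X. \<bar>x\<bar> \<le> Max (insert 0 (abs ` X))" using that by (auto intro!: Max_ge)
    then obtain B where B: "\<forall>x\<in>X. \<bar>x\<bar> < B" by (meson zle_add1_eq_le)
    show ?thesis by (rule exI[of _ "nat B"]) (use B in force)
  qed
  note * = this
  show "filterlim (\<lambda>N. {- int N..<int N}) (finite_subsets_at_top UNIV) sequentially"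
    unfolding filterlim_finite_subsets_at_top eventually_sequentially using * by auto
  show "filterlim (\<lambda>N. {- int N..<int N} - {0}) (finite_subsets_at_top (- {0})) sequentially"
    unfolding filterlim_finite_subsets_at_top eventually_sequentially
  proof safe
    fix X :: "int set" assume X: "finite X" "X \<subseteq> - {0}"
    then obtain N0 where N0: "\<forall>N\<ge>N0. X \<subseteq> {- int N..<int N}" using * by blast
    show "\<exists>N0. \<forall>N\<ge>N0. finite ({- int N..<int N} - {0}) \<and> X \<subseteq> {- int N..<int N} - {0} \<and> {- int N..<int N} - {0} \<subseteq> - {0}"
      by (rule exI[of _ N0]) (use N0 X in force)
  qed
  show "filterlim (\<lambda>N. {- int N..int N} - {0}) (finite_subsets_at_top (- {0})) sequentially"
    unfolding filterlim_finite_subsets_at_top eventually_sequentially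
  proof safe
    fix X :: "int set" assume X: "finite X" "X \<subseteq> - {0}"
    then obtain N0 where N0: "\<forall>N\<ge>N0. X \<subseteq> {- int N..<int N}" using * by blast
    show "\<exists>N0. \<forall>N\<ge>N0. finite ({- int N..int N} - {0}) \<and> X \<subseteq> {- int N..int N} - {0} \<and> {- int N..int N} - {0} \<subseteq> - {0}"
      by (rule exI[of _ N0]) (use N0 X in force)
  qed
qed

lemma summable_on_product_nonneg:
  fixes f :: "'a \<Rightarrow> real" and g :: "'b \<Rightarrow> real"
  assumes "f summable_on A" "g summable_on B" "\<And>x. x \<in> A \<Longrightarrow> f x \<ge> 0" "\<And>x. x \<in> B \<Longrightarrow> g x \<ge> 0"
  shows "(\<lambda>(x, y). f x * g y) summable_on (A \<times> B)"
proof -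
  obtain b where b: "(g has_sum b) B" using assms by (auto simp: summable_on_def)
  show ?thesis
    by (rule summable_on_SigmaI[where g = "\<lambda>x. f x * b"])
       (use assms in \<open>auto intro!: has_sum_cmult_right b summable_on_cmult_left\<close>)
qed

lemma summable_on_int_powr:
  "(\<lambda>n::int. (1 + real_of_int \<bar>n\<bar>) powr (-3/2)) summable_on UNIV"
  "(\<lambda>n::int. (real_of_int \<bar>n\<bar>) powr (-3/2)) summable_on (- {0})"
proof -
  have s: "summable (\<lambda>n. real (Suc n) powr (-3/2))"
    by (subst summable_Suc_iff) (simp add: summable_real_powr_iff)
  have 1: "(\<lambda>n. real (Suc n) powr (-3/2)) summable_on UNIV"
    by (rule summable_nonneg_imp_summable_on[OF s]) auto
  have s2: "summable (\<lambda>n. real (Suc (Suc n)) powr (-3/2))"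
    using s by (subst summable_Suc_iff)
  have 2: "(\<lambda>n. real (Suc (Suc n)) powr (-3/2)) summable_on UNIV"
    by (rule summable_nonneg_imp_summable_on[OF s2]) auto
  obtain a b where ab: "((\<lambda>n. real (Suc n) powr (-3/2)) has_sum a) UNIV" "((\<lambda>n. real (Suc (Suc n)) powr (-3/2)) has_sum b) UNIV"
    using 1 2 by (auto simp: summable_on_def)
  have "((\<lambda>n::int. (1 + real_of_int \<bar>n\<bar>) powr (-3/2)) has_sum (a + b)) UNIV"
    by (rule has_sum_int) (use ab in \<open>simp_all add: add_ac\<close>)
  thus "(\<lambda>n::int. (1 + real_of_int \<bar>n\<bar>) powr (-3/2)) summable_on UNIV" by (auto simp: summable_on_def)
  have "((\<lambda>n::int. (real_of_int \<bar>n\<bar>) powr (-3/2)) has_sum (a + a)) (- {0})"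
    by (rule has_sum_int_nonzero) (use ab in \<open>simp_all add: add_ac\<close>)
  thus "(\<lambda>n::int. (real_of_int \<bar>n\<bar>) powr (-3/2)) summable_on (- {0})" by (auto simp: summable_on_def)
qed

text \<open>One factor |d|^(1/2) and the factor |d + 1| are bounded below by powers of |m|, the
  remaining |d|^(3/2) by a power of 1 + |n|. This majorises the terms by a product of two convergent
  series with exponent 3/2.\<close>

lemma lattice_summable:
  assumes z: "Im z > 0"
  shows "(\<lambda>(m, n). 1 / ((of_int m * z + of_int n) ^ 2 * (of_int m * z + of_int n + 1))) summable_on (- {0::int}) \<times> (UNIV :: int set)"
proof -
  define y where "y = Im z"
  have y: "y > 0" using z by (simp add: y_def)
  \<comment> \<open>Chosen so that 1 + |n| \<le> k |d|.\<close>
  define k where "k = 1 / y + 1 + norm z / y"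
  have k: "k > 0" using y by (simp add: k_def add_pos_nonneg)
  define C where "C = k powr (3/2) * y powr (-1/2) / y"
  have "(\<lambda>p. norm (case p of (m, n) \<Rightarrow> 1 / ((of_int m * z + of_int n) ^ 2 * (of_int m * z + of_int n + 1)))) summable_on (- {0::int}) \<times> (UNIV :: int set)"
  proof (rule summable_on_comparison_test)
    show "(\<lambda>(m::int, n::int). (C * real_of_int \<bar>m\<bar> powr (-3/2)) * (1 + real_of_int \<bar>n\<bar>) powr (-3/2)) summable_on (- {0}) \<times> UNIV"
      using y k by (intro summable_on_product_nonneg summable_on_cmult_right summable_on_int_powr) (auto simp: C_def)
    fix p :: "int \<times> int" assume "p \<in> (- {0}) \<times> UNIV"
    then obtain m n where p: "p = (m, n)" "m \<noteq> 0" by auto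
    define d where "d = of_int m * z + of_int n"
    have m1: "real_of_int \<bar>m\<bar> \<ge> 1" using p by linarith
    have d1: "norm d \<ge> y * real_of_int \<bar>m\<bar>"
      using abs_Im_le_cmod[of d] y by (simp add: d_def y_def abs_mult mult_ac)
    have d2: "norm (d + 1) \<ge> y * real_of_int \<bar>m\<bar>"
      using abs_Im_le_cmod[of "d + 1"] y by (simp add: d_def y_def abs_mult mult_ac)
    have "real_of_int \<bar>n\<bar> = norm (d - of_int m * z)" by (simp add: d_def)
    also have "\<dots> \<le> norm d + norm (of_int m * z)" by (rule norm_triangle_ineq4)
    also have "norm (of_int m * z) = real_of_int \<bar>m\<bar> * norm z" by (simp add: norm_mult)
    also have "\<dots> \<le> (norm d / y) * norm z"
      using d1 y by (intro mult_right_mono) (auto simp: pos_le_divide_eq mult_ac)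
    finally have n1: "real_of_int \<bar>n\<bar> \<le> norm d + norm d / y * norm z" by simp
    have yM: "y * 1 \<le> y * real_of_int \<bar>m\<bar>" using m1 y by (intro mult_left_mono) auto
    have "y \<le> norm d" using yM d1 by linarith
    hence "1 \<le> norm d / y" using y by simp
    hence n2: "1 + real_of_int \<bar>n\<bar> \<le> norm d * k" using n1 by (simp add: k_def algebra_simps)
    have dpos: "norm d > 0" "norm (d + 1) > 0" using d1 d2 yM y by linarith+
    have "norm d ^ 2 = norm d powr (1/2) * norm d powr (3/2)"
      using dpos powr_add[of "norm d" "1/2" "3/2"] by simp
    also have "\<dots> \<ge> (y * real_of_int \<bar>m\<bar>) powr (1/2) * ((1 + real_of_int \<bar>n\<bar>) / k) powr (3/2)"
      using d1 n2 k y m1 by (intro mult_mono powr_mono2) (auto simp: pos_divide_le_eq)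
    finally have "norm d ^ 2 * norm (d + 1) \<ge> (y * real_of_int \<bar>m\<bar>) powr (1/2) * ((1 + real_of_int \<bar>n\<bar>) / k) powr (3/2) * (y * real_of_int \<bar>m\<bar>)"
      using d2 y by (intro mult_mono) auto
    moreover have "(y * real_of_int \<bar>m\<bar>) powr (1/2) * ((1 + real_of_int \<bar>n\<bar>) / k) powr (3/2) * (y * real_of_int \<bar>m\<bar>) > 0"
      using y m1 k by (intro mult_pos_pos) auto
    ultimately have "1 / (norm d ^ 2 * norm (d + 1)) \<le> 1 / ((y * real_of_int \<bar>m\<bar>) powr (1/2) * ((1 + real_of_int \<bar>n\<bar>) / k) powr (3/2) * (y * real_of_int \<bar>m\<bar>))"
      by (intro divide_left_mono) (auto intro!: mult_pos_pos simp: dpos)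
    also have "\<dots> = (C * real_of_int \<bar>m\<bar> powr (-3/2)) * (1 + real_of_int \<bar>n\<bar>) powr (-3/2)"
    proof -
      have "1 / ((y * M) powr (1/2) * (N / k) powr (3/2) * (y * M)) = (C * M powr (-3/2)) * N powr (-3/2)"
        if "M > 0" "N > 0" for M N
      proof -
        have "M powr (3/2) = M powr (1/2) * M" using that powr_add[of M "1/2" 1] by simp
        thus ?thesis using y k that by (simp add: C_def powr_mult powr_divide powr_minus divide_simps)
      qed
      thus ?thesis using m1 by simp
    qed
    finally show "norm (case p of (m, n) \<Rightarrow> 1 / ((of_int m * z + of_int n) ^ 2 * (of_int m * z + of_int n + 1))) \<le> (case p of (m, n) \<Rightarrow> (C * real_of_int \<bar>m\<bar> powr (-3/2)) * (1 + real_of_int \<bar>n\<bar>) powr (-3/2))"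
      by (simp add: p d_def norm_divide norm_mult norm_power)
  qed auto
  thus ?thesis by (rule abs_summable_summable)
qed

lemma cot_at_of_nat_over_tendsto:
  assumes z: "Im z > 0"
  shows "(\<lambda>N. cot (of_real pi * (of_nat N / z))) \<longlonglongrightarrow> \<i>"
proof -
  define p where "p = qq (- 1 / z)"
  have im: "Im (- 1 / z) > 0" using z by (auto simp: Im_divide power2_eq_square sum_squares_gt_zero_iff intro!: divide_pos_pos)
  have p1: "norm p < 1" unfolding p_def by (rule norm_qq_less_1[OF im])
  have "(\<lambda>N. \<i> * ((1 + p ^ N) / (1 - p ^ N))) \<longlonglongrightarrow> \<i> * ((1 + 0) / (1 - 0))"
    using p1 by (intro tendsto_intros LIMSEQ_power_zero) auto
  hence lim: "(\<lambda>N. \<i> * ((1 + p ^ N) / (1 - p ^ N))) \<longlonglongrightarrow> \<i>" by simp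
  have "cot (of_real pi * (of_nat N / z)) = \<i> * ((1 + p ^ N) / (1 - p ^ N))" if "N > 0" for N
  proof -
    define e where "e = exp (\<i> * (of_real pi * (of_nat N / z)))"
    have e: "e \<noteq> 0" "exp (- (\<i> * (of_real pi * (of_nat N / z)))) = inverse e"
      by (auto simp: e_def exp_minus)
    have pN: "p ^ N = inverse e ^ 2"
    proof -
      have "p ^ N = qq (of_nat N * (- 1 / z))" by (simp only: p_def qq_of_nat_mult)
      also have "\<dots> = exp (- (\<i> * (of_real pi * (of_nat N / z)))) * exp (- (\<i> * (of_real pi * (of_nat N / z))))"
        unfolding qq_def exp_add[symmetric] by (rule arg_cong[where f = exp]) (simp add: field_simps)
      finally show ?thesis by (simp only: e power2_eq_square)
    qed
    have "norm (p ^ N) < 1" using p1 that by (simp add: norm_power power_less_one_iff)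
    hence "p ^ N \<noteq> 1" by auto
    hence e2: "e ^ 2 \<noteq> 1" using pN e by (auto simp: power_inverse)
    have "cot (of_real pi * (of_nat N / z)) = \<i> * ((e + inverse e) / (e - inverse e))"
    proof -
      have "cos (of_real pi * (of_nat N / z)) = (e + inverse e) / 2"
        by (simp only: cos_exp_eq e(2)) (simp only: e_def)
      moreover have "sin (of_real pi * (of_nat N / z)) = (e - inverse e) / (2 * \<i>)"
        by (simp only: sin_exp_eq e(2)) (simp only: e_def)
      moreover have "a / 2 / (b / (2 * \<i>)) = \<i> * (a / b)" for a b :: complex
        by (cases "b = 0") (auto simp: field_simps)
      ultimately show ?thesis by (simp only: cot_def)
    qed
    also have "(e + inverse e) / (e - inverse e) = (1 + p ^ N) / (1 - p ^ N)"
      using e e2 by (simp add: pN field_simps power2_eq_square)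
    finally show ?thesis .
  qed
  thus ?thesis
    by (intro Lim_transform_eventually[OF lim] eventually_sequentiallyI[of 1]) auto
qed

lemma cot_symmetric_limit:
  fixes x :: complex
  assumes x: "x \<notin> \<int>"
  shows "(\<lambda>M. \<Sum>m=1..M. 1 / (of_nat m - x) - 1 / (of_nat m + x)) \<longlonglongrightarrow> 1 / x - of_real pi * cot (of_real pi * x)"
proof -
  have "(\<Sum>m=1..M. 1 / (of_nat m - x) - 1 / (of_nat m + x)) =
     - (\<Sum>n<M. inverse (x + of_nat n) - inverse (of_nat (Suc n) - x)) + (1 / x - inverse (of_nat M + x))" for M
    by (induction M) (auto simp: inverse_eq_divide add_ac)
  moreover have "(\<lambda>M. - (\<Sum>n<M. inverse (x + of_nat n) - inverse (of_nat (Suc n) - x)) + (1 / x - inverse (of_nat M + x)))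
     \<longlonglongrightarrow> - (of_real pi * cot (of_real pi * x)) + (1 / x - 0)"
  proof (intro tendsto_intros)
    show "(\<lambda>M. \<Sum>n<M. inverse (x + of_nat n) - inverse (of_nat (Suc n) - x)) \<longlonglongrightarrow> of_real pi * cot (of_real pi * x)"
      using cot_partial_fractions[OF x] by (simp add: sums_def)
    have "filterlim (\<lambda>M. x + of_nat M) at_infinity sequentially"
      by (rule tendsto_add_filterlim_at_infinity[OF tendsto_const tendsto_of_nat])
    thus "(\<lambda>M. inverse (of_nat M + x)) \<longlonglongrightarrow> 0"
      by (subst add.commute) (rule filterlim_compose[OF tendsto_inverse_0])
  qed
  ultimately show ?thesis by simp
qed

lemma sum_int_telescope:
  fixes f :: "int \<Rightarrow> 'a :: ab_group_add"
  shows "(\<Sum>n\<in>{- int N..<int N}. f n - f (n + 1)) = f (- int N) - f (int N)"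
proof (induction N)
  case (Suc N)
  have "{- int (Suc N)..<int (Suc N)} = insert (- int (Suc N)) (insert (int N) {- int N..<int N})" by auto
  thus ?case using Suc by (simp add: algebra_simps)
qed auto

lemma sum_int_symmetric:
  fixes f :: "int \<Rightarrow> 'a :: comm_monoid_add"
  shows "(\<Sum>m\<in>{- int N..int N} - {0}. f m) = (\<Sum>m=1..N. f (int m) + f (- int m))"
proof (induction N)
  case (Suc N)
  have "{- int (Suc N)..int (Suc N)} - {0} = insert (- int (Suc N)) (insert (int (Suc N)) ({- int N..int N} - {0}))" by auto
  thus ?case using Suc by (simp add: add_ac)
qed auto

lemma Im_minus_inverse_pos: "Im z > 0 \<Longrightarrow> Im (- 1 / z) > 0"
  by (auto simp: Im_divide power2_eq_square sum_squares_gt_zero_iff intro!: divide_pos_pos)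

lemma has_sum_inverse_squares_int: "((\<lambda>n::int. 1 / (of_int n :: complex) ^ 2) has_sum (of_real pi ^ 2 / 3)) (- {0})"
proof -
  have "((\<lambda>n. 1 / real (n + 1) ^ 2) has_sum (pi\<^sup>2 / 6)) UNIV"
    using sums_nonneg_imp_has_sum[OF inverse_squares_sums] by (simp add: add_ac)
  hence 1: "((\<lambda>n. complex_of_real (1 / real (n + 1) ^ 2)) has_sum of_real (pi\<^sup>2 / 6)) UNIV"
    by (rule has_sum_of_real)
  have "((\<lambda>n::int. 1 / (of_int n :: complex) ^ 2) has_sum (of_real (pi\<^sup>2 / 6) + of_real (pi\<^sup>2 / 6))) (- {0})"
    by (rule has_sum_int_nonzero) (use 1 in \<open>simp_all add: power2_eq_square algebra_simps\<close>)
  thus ?thesis by (simp add: field_simps)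
qed

text \<open>The substitution z -> -1/z exchanges the roles of m and n, but the sum of 1/d^2 over the
  lattice depends on the order. With the telescoping 1/d - 1/(d + 1) subtracted, it becomes the
  absolutely convergent sum of 1/(d^2 (d + 1)), so the whole discrepancy between the two orders is
  carried by the telescoping part.\<close>

theorem GK_S:
  assumes z: "Im z > 0"
  shows "GK z - 2 * of_real pi * \<i> / z = of_real pi ^ 2 / (3 * z ^ 2) + GK (- 1 / z) / z ^ 2 - of_real pi ^ 2 / 3"
proof -
  define d where "d = (\<lambda>(m::int) (n::int). of_int m * z + of_int n)"
  have z0: "z \<noteq> 0" using z by auto
  have dnz: "d m n \<noteq> 0" if "m \<noteq> 0" for m n
    using that z by (auto simp: d_def complex_eq_iff)
  have nz': "of_int n / z \<notin> \<int>" if "n \<noteq> 0" for n :: int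
  proof
    assume "of_int n / z \<in> \<int>"
    then obtain k where "of_int n / z = of_int k" by (auto elim: Ints_cases)
    hence "of_int n = of_int k * z" using z0 by (simp add: field_simps)
    hence "of_int n = Re (of_int k * z)" "Im (of_int k * z) = 0" by (simp_all add: complex_eq_iff)
    thus False using z that by auto
  qed
  define A B C where "A = (\<lambda>m n. 1 / d m n ^ 2)" and "B = (\<lambda>m n. 1 / d m n - 1 / d m (n + 1))"
    and "C = (\<lambda>m n. 1 / (d m n ^ 2 * (d m n + 1)))"
  have d1: "d m (n + 1) = d m n + 1" for m n by (simp add: d_def)
  have ABC: "C m n = A m n - B m n" if "m \<noteq> 0" for m n
  proof -
    have "1 / (x ^ 2 * (x + 1)) = 1 / x ^ 2 - (1 / x - 1 / (x + 1))" if "x \<noteq> 0" "x + 1 \<noteq> 0" for x :: complex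
      using that by (simp add: divide_simps power2_eq_square)
    thus ?thesis using dnz[OF that, of n] dnz[OF that, of "n + 1"] by (simp add: A_def B_def C_def d1)
  qed
  have Csum: "(\<lambda>(m, n). C m n) summable_on (- {0}) \<times> UNIV"
    using lattice_summable[OF z] by (simp add: C_def d_def)
  then obtain T where T: "((\<lambda>(m, n). C m n) has_sum T) ((- {0}) \<times> UNIV)" by (auto simp: summable_on_def)
  have CsumR: "C m summable_on UNIV" if "m \<noteq> 0" for m
    using summable_on_SigmaD1[OF Csum] that by auto
  have Csum': "(\<lambda>(n, m). C m n) summable_on UNIV \<times> (- {0})"
    using Csum summable_on_swap[of "\<lambda>(m, n). C m n"] by simp
  have CsumL: "(\<lambda>m. C m n) summable_on (- {0})" for n
    using summable_on_SigmaD1[OF Csum', of n] by auto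
  \<comment> \<open>Summed over \<open>n\<close> first, the telescoping part contributes nothing; summed over \<open>m\<close> first, it yields the correction term.\<close>
  have rowA: "(A m has_sum ((of_real pi / sin (of_real pi * (of_int m * z))) ^ 2)) UNIV" if "m \<noteq> 0" for m
    using inverse_sin_squared_sums[OF of_int_mult_notin_Ints[OF z that]] by (simp add: A_def d_def)
  have rowB: "(B m has_sum 0) UNIV" if m: "m \<noteq> 0" for m
  proof -
    have "B m = (\<lambda>n. A m n - C m n)" using ABC[OF m] by auto
    hence "B m summable_on UNIV"
      using has_sum_subtract[OF rowA[OF m] has_sum_infsum[OF CsumR[OF m]]] by (auto simp: summable_on_def)
    then obtain b where b: "(B m has_sum b) UNIV" by (auto simp: summable_on_def)
    have "(\<lambda>N. \<Sum>n\<in>{- int N..<int N}. B m n) \<longlonglongrightarrow> b"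
      by (rule has_sum_tendsto[OF b filterlim_int_intervals(1)])
    hence "(\<lambda>N. 1 / d m (- int N) - 1 / d m (int N)) \<longlonglongrightarrow> b"
      unfolding B_def by (subst (asm) sum_int_telescope)
    moreover have "(\<lambda>N. 1 / d m (- int N) - 1 / d m (int N)) \<longlonglongrightarrow> 0 - 0"
    proof (intro tendsto_diff)
      have 1: "filterlim (\<lambda>N. of_int m * z + of_nat N) at_infinity sequentially"
        by (rule tendsto_add_filterlim_at_infinity[OF tendsto_const tendsto_of_nat])
      show "(\<lambda>N. 1 / d m (int N)) \<longlonglongrightarrow> 0"
        using filterlim_compose[OF tendsto_inverse_0 1] by (simp add: d_def inverse_eq_divide)
      have 2: "filterlim (\<lambda>N. - (of_int m * z) + of_nat N) at_infinity sequentially"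
        by (rule tendsto_add_filterlim_at_infinity[OF tendsto_const tendsto_of_nat])
      have "(\<lambda>N. - inverse (- (of_int m * z) + of_nat N)) \<longlonglongrightarrow> - 0"
        by (intro tendsto_minus filterlim_compose[OF tendsto_inverse_0 2])
      moreover have "- inverse (- (of_int m * z) + of_nat N) = 1 / d m (- int N)" for N
        by (simp add: d_def inverse_eq_divide) (metis minus_diff_eq minus_divide_right uminus_add_conv_diff)
      ultimately show "(\<lambda>N. 1 / d m (- int N)) \<longlonglongrightarrow> 0" by simp
    qed
    ultimately have "b = 0" using LIMSEQ_unique by fastforce
    with b show ?thesis by simp
  qed
  have TGK: "T = GK z"
  proof -
    have "((\<lambda>m. (of_real pi / sin (of_real pi * (of_int m * z))) ^ 2) has_sum T) (- {0})"
    proof (rule has_sum_SigmaD[OF T])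
      fix m :: int assume "m \<in> - {0}"
      hence m: "m \<noteq> 0" by simp
      have "((\<lambda>n. A m n - B m n) has_sum ((of_real pi / sin (of_real pi * (of_int m * z))) ^ 2 - 0)) UNIV"
        by (intro has_sum_subtract rowA rowB m)
      thus "((\<lambda>y. case (m, y) of (m, n) \<Rightarrow> C m n) has_sum (of_real pi / sin (of_real pi * (of_int m * z))) ^ 2) UNIV"
        using ABC[OF m] by simp
    qed
    thus ?thesis using has_sum_GK[OF z] has_sum_unique by blast
  qed
  \<comment> \<open>Column sums over m \<noteq> 0: for n = 0 the value of zeta at 2 enters, for
    other n the term m = 0 has to be removed from the sum over all integers.\<close>
  define D where "D = (\<lambda>n. if n = 0 then of_real pi ^ 2 / (3 * z ^ 2) else (of_real pi / sin (of_real pi * (of_int n * (- 1 / z)))) ^ 2 / z ^ 2 - 1 / of_int n ^ 2)"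
  have colA: "((\<lambda>m. A m n) has_sum D n) (- {0})" for n
  proof (cases "n = 0")
    case True
    have "((\<lambda>m::int. 1 / z ^ 2 * (1 / (of_int m :: complex) ^ 2)) has_sum (1 / z ^ 2 * (of_real pi ^ 2 / 3))) (- {0})"
      by (rule has_sum_cmult_right[OF has_sum_inverse_squares_int])
    thus ?thesis using True by (simp add: A_def d_def D_def power_mult_distrib mult_ac)
  next
    case False
    have "((\<lambda>m::int. 1 / (of_int n / z + of_int m) ^ 2) has_sum ((of_real pi / sin (of_real pi * (of_int n / z))) ^ 2)) UNIV"
      by (rule inverse_sin_squared_sums[OF nz'[OF False]])
    hence "((\<lambda>m::int. 1 / z ^ 2 * (1 / (of_int n / z + of_int m) ^ 2)) has_sum (1 / z ^ 2 * (of_real pi / sin (of_real pi * (of_int n / z))) ^ 2)) UNIV"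
      by (rule has_sum_cmult_right)
    also have "(\<lambda>m::int. 1 / z ^ 2 * (1 / (of_int n / z + of_int m) ^ 2)) = (\<lambda>m. A m n)"
    proof
      fix m :: int
      have "z * (of_int n / z + of_int m) = d m n" using z0 by (simp add: d_def field_simps)
      thus "1 / z ^ 2 * (1 / (of_int n / z + of_int m) ^ 2) = A m n"
        by (simp add: A_def flip: power_mult_distrib)
    qed
    also have "(of_real pi / sin (of_real pi * (of_int n / z))) ^ 2 = (of_real pi / sin (of_real pi * (of_int n * (- 1 / z)))) ^ 2"
      by (simp add: power_divide)
    finally have "((\<lambda>m. A m n) has_sum (1 / z ^ 2 * (of_real pi / sin (of_real pi * (of_int n * (- 1 / z)))) ^ 2 - A 0 n)) (UNIV - {0})"
      by (rule has_sum_Diff) (use has_sum_finite[of "{0}" "\<lambda>m. A m n"] in auto)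
    thus ?thesis using False by (simp add: D_def A_def d_def Compl_eq_Diff_UNIV)
  qed
  have "((\<lambda>m. \<Sum>n\<in>{- int N..<int N}. A m n - C m n) has_sum (\<Sum>n\<in>{- int N..<int N}. D n - infsum (\<lambda>m. C m n) (- {0}))) (- {0})" for N
    by (intro has_sum_finite_sum has_sum_subtract colA has_sum_infsum CsumL) auto
  moreover have "(\<Sum>n\<in>{- int N..<int N}. A m n - C m n) = 1 / (of_int m * z - of_nat N) - 1 / (of_int m * z + of_nat N)" if "m \<in> - {0}" for m N
  proof -
    have "(\<Sum>n\<in>{- int N..<int N}. A m n - C m n) = (\<Sum>n\<in>{- int N..<int N}. B m n)"
      using ABC that by (intro sum.cong) auto
    also have "\<dots> = 1 / d m (- int N) - 1 / d m (int N)" unfolding B_def by (rule sum_int_telescope)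
    finally show ?thesis by (simp add: d_def)
  qed
  ultimately have strip: "((\<lambda>m. 1 / (of_int m * z - of_nat N) - 1 / (of_int m * z + of_nat N)) has_sum (\<Sum>n\<in>{- int N..<int N}. D n - infsum (\<lambda>m. C m n) (- {0}))) (- {0})" for N
    using has_sum_cong by (metis (no_types, lifting))
  have strip_val: "(\<Sum>n\<in>{- int N..<int N}. D n - infsum (\<lambda>m. C m n) (- {0})) = 2 / of_nat N - 2 * of_real pi * cot (of_real pi * (of_nat N / z)) / z" if N: "N > 0" for N
  proof -
    let ?x = "of_nat N / z"
    have x: "?x \<notin> \<int>" using nz'[of "int N"] N by simp
    have l1: "(\<lambda>M. \<Sum>m\<in>{- int M..int M} - {0}. 1 / (of_int m * z - of_nat N) - 1 / (of_int m * z + of_nat N)) \<longlonglongrightarrow> (\<Sum>n\<in>{- int N..<int N}. D n - infsum (\<lambda>m. C m n) (- {0}))"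
      by (rule has_sum_tendsto[OF strip filterlim_int_intervals(3)])
    have l2: "(\<lambda>M. \<Sum>m\<in>{- int M..int M} - {0}. 1 / (of_int m * z - of_nat N) - 1 / (of_int m * z + of_nat N)) =
       (\<lambda>M. 2 / z * (\<Sum>m=1..M. 1 / (of_nat m - ?x) - 1 / (of_nat m + ?x)))"
    proof
      fix M
      have "1 / (of_int (int m) * z - of_nat N) - 1 / (of_int (int m) * z + of_nat N) + (1 / (of_int (- int m) * z - of_nat N) - 1 / (of_int (- int m) * z + of_nat N))
         = 2 / z * (1 / (of_nat m - ?x) - 1 / (of_nat m + ?x))" if "m \<in> {1..M}" for m
      proof -
        have e: "of_nat m * z - of_nat N = z * (of_nat m - ?x)" "of_nat m * z + of_nat N = z * (of_nat m + ?x)"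
          using z0 by (simp_all add: field_simps)
        have n: "of_int (- int m) * z - of_nat N = - (z * (of_nat m + ?x))" "of_int (- int m) * z + of_nat N = - (z * (of_nat m - ?x))"
          using e by (simp_all flip: e)
        have "1 / (z * a) - 1 / (z * b) + (1 / (- (z * b)) - 1 / (- (z * a))) = 2 / z * (1 / a - 1 / b)" for a b
          by (simp add: right_diff_distrib mult.commute)
        thus ?thesis unfolding n by (simp only: of_int_of_nat_eq e)
      qed
      thus "(\<Sum>m\<in>{- int M..int M} - {0}. 1 / (of_int m * z - of_nat N) - 1 / (of_int m * z + of_nat N)) = 2 / z * (\<Sum>m=1..M. 1 / (of_nat m - ?x) - 1 / (of_nat m + ?x))"
        unfolding sum_int_symmetric sum_distrib_left by (intro sum.cong) auto
    qed
    have l3: "(\<lambda>M. 2 / z * (\<Sum>m=1..M. 1 / (of_nat m - ?x) - 1 / (of_nat m + ?x))) \<longlonglongrightarrow> 2 / z * (1 / ?x - of_real pi * cot (of_real pi * ?x))"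
      by (intro tendsto_mult tendsto_const cot_symmetric_limit x)
    have "(\<Sum>n\<in>{- int N..<int N}. D n - infsum (\<lambda>m. C m n) (- {0})) = 2 / z * (1 / ?x - of_real pi * cot (of_real pi * ?x))"
      by (rule LIMSEQ_unique[OF l1[unfolded l2] l3])
    thus ?thesis using z0 N by (simp add: algebra_simps)
  qed
  \<comment> \<open>The cotangent tends to i since N/z moves down into the lower half-plane; this
    limit is the anomalous term of the transformation law.\<close>
  have "(\<lambda>N. 2 / of_nat N - 2 * of_real pi * cot (of_real pi * (of_nat N / z)) / z) \<longlonglongrightarrow> 0 - 2 * of_real pi * \<i> / z"
    using z0 by (intro tendsto_intros cot_at_of_nat_over_tendsto[OF z] tendsto_divide_0[OF tendsto_const] tendsto_of_nat) auto
  hence L: "(\<lambda>N. 2 / of_nat N - 2 * of_real pi * cot (of_real pi * (of_nat N / z)) / z) \<longlonglongrightarrow> - 2 * of_real pi * \<i> / z" by simp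
  have lim1: "(\<lambda>N. \<Sum>n\<in>{- int N..<int N}. D n - infsum (\<lambda>m. C m n) (- {0})) \<longlonglongrightarrow> - 2 * of_real pi * \<i> / z"
    by (rule Lim_transform_eventually[OF L eventually_sequentiallyI[of 1]]) (use strip_val in auto)
  have "((\<lambda>n. infsum (\<lambda>m. C m n) (- {0})) has_sum T) UNIV"
  proof (rule has_sum_SigmaD[where f = "\<lambda>(n, m). C m n" and B = "\<lambda>_. - {0}"])
    show "((\<lambda>(n, m). C m n) has_sum T) (UNIV \<times> - {0})"
      using T has_sum_swap[of "\<lambda>(m, n). C m n"] by simp
  qed (use CsumL in auto)
  hence lim2: "(\<lambda>N. \<Sum>n\<in>{- int N..<int N}. infsum (\<lambda>m. C m n) (- {0})) \<longlonglongrightarrow> T"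
    by (rule has_sum_tendsto[OF _ filterlim_int_intervals(1)])
  have lim3: "(\<lambda>N. \<Sum>n\<in>{- int N..<int N}. D n) \<longlonglongrightarrow> - 2 * of_real pi * \<i> / z + T"
    using tendsto_add[OF lim1 lim2] by (simp add: sum_subtractf)
  have "(\<lambda>N. \<Sum>n\<in>{- int N..<int N} - {0}. (of_real pi / sin (of_real pi * (of_int n * (- 1 / z)))) ^ 2) \<longlonglongrightarrow> GK (- 1 / z)"
    by (rule has_sum_tendsto[OF has_sum_GK[OF Im_minus_inverse_pos[OF z]] filterlim_int_intervals(2)])
  moreover have "(\<lambda>N. \<Sum>n\<in>{- int N..<int N} - {0}. 1 / (of_int n :: complex) ^ 2) \<longlonglongrightarrow> of_real pi ^ 2 / 3"
    by (rule has_sum_tendsto[OF has_sum_inverse_squares_int filterlim_int_intervals(2)])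
  ultimately have "(\<lambda>N. of_real pi ^ 2 / (3 * z ^ 2) + (\<Sum>n\<in>{- int N..<int N} - {0}. (of_real pi / sin (of_real pi * (of_int n * (- 1 / z)))) ^ 2) / z ^ 2 - (\<Sum>n\<in>{- int N..<int N} - {0}. 1 / (of_int n :: complex) ^ 2)) 
    \<longlonglongrightarrow> of_real pi ^ 2 / (3 * z ^ 2) + GK (- 1 / z) / z ^ 2 - of_real pi ^ 2 / 3"
    using z0 by (intro tendsto_intros) auto
  hence "(\<lambda>N. \<Sum>n\<in>{- int N..<int N}. D n) \<longlonglongrightarrow> of_real pi ^ 2 / (3 * z ^ 2) + GK (- 1 / z) / z ^ 2 - of_real pi ^ 2 / 3"
  proof (rule Lim_transform_eventually[OF _ eventually_sequentiallyI[of 1]])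
    fix N :: nat assume N: "N \<ge> 1"
    have "(\<Sum>n\<in>{- int N..<int N}. D n) = D 0 + (\<Sum>n\<in>{- int N..<int N} - {0}. D n)"
      using N by (intro sum.remove) auto
    also have "(\<Sum>n\<in>{- int N..<int N} - {0}. D n) = (\<Sum>n\<in>{- int N..<int N} - {0}. (of_real pi / sin (of_real pi * (of_int n * (- 1 / z)))) ^ 2 / z ^ 2 - 1 / of_int n ^ 2)"
      by (intro sum.cong) (auto simp: D_def)
    finally show "of_real pi ^ 2 / (3 * z ^ 2) + (\<Sum>n\<in>{- int N..<int N} - {0}. (of_real pi / sin (of_real pi * (of_int n * (- 1 / z)))) ^ 2) / z ^ 2 - (\<Sum>n\<in>{- int N..<int N} - {0}. 1 / (of_int n :: complex) ^ 2) = (\<Sum>n\<in>{- int N..<int N}. D n)"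
      by (simp add: sum_subtractf sum_divide_distrib D_def)
  qed
  from LIMSEQ_unique[OF lim3 this] show ?thesis by (simp add: TGK algebra_simps)
qed

section \<open>Odd moments\<close>

text \<open>With \<rho> = M + 1 the number (2\<rho> - 1)^2 in \<open>rank_crank\<close> is (2M +
  1)^2; weighting by powers of 2M + 1 therefore turns that relation into a recursion with step 2 in
  the exponent.\<close>

definition Ym :: "nat \<Rightarrow> nat \<Rightarrow> int" where
  "Ym a n = 2 * (\<Sum>M<n. (2 * int M + 1) ^ a * int (rank_ge (int M + 1) n))"

text \<open>The total weight with which \<open>cf i n\<close> occurs when the series
  \<open>Bf (M + 1)\<close> are summed with weights (2M + 1)^a.\<close>

definition phi_sum :: "nat \<Rightarrow> nat \<Rightarrow> rat" where
  "phi_sum a i = (\<Sum>M<i. (2 * of_nat M + 1) ^ a * (4 * (of_nat i - of_nat (M + 1)) * (of_nat i - of_nat (M + 1) + 1)))"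

definition Wf :: "nat \<Rightarrow> rat fps" where
  "Wf a = Abs_fps (\<lambda>n. \<Sum>i=1..n. phi_sum a i * cf (int i) n)"

lemma odd_binomial_diff:
  fixes x :: "'a :: comm_ring_1"
  shows "(x + 1) ^ n - (x - 1) ^ n = 2 * (\<Sum>a\<le>n. if odd (n - a) then of_nat (n choose a) * x ^ a else 0)"
proof -
  have "(x - 1) ^ n = (\<Sum>a\<le>n. of_nat (n choose a) * x ^ a * (- 1) ^ (n - a))"
    using binomial_ring[of x "-1" n] by simp
  moreover have "(x + 1) ^ n = (\<Sum>a\<le>n. of_nat (n choose a) * x ^ a)"
    using binomial_ring[of x 1 n] by simp
  ultimately show ?thesis
    by (auto simp: sum_distrib_left sum_subtractf[symmetric] intro!: sum.cong)
qed

text \<open>Expanding (M + 1)^(2k) - M^(2k) about the midpoint M + 1/2 leaves only odd powers; the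
  factor 4^k clears the halves.\<close>

lemma rank_moment_Ym:
  assumes "k \<ge> 1"
  shows "4 ^ k * rank_moment (2 * k) n = 2 * (\<Sum>a\<le>2*k. if odd a then int ((2 * k) choose a) * Ym a n else 0)"
proof -
  have e: "4 ^ k * (int (M + 1) ^ (2 * k) - int M ^ (2 * k)) = 2 * (\<Sum>a\<le>2*k. if odd a then int ((2 * k) choose a) * (2 * int M + 1) ^ a else 0)" for M
  proof -
    have "4 ^ k * int (M + 1) ^ (2 * k) = ((2 * int M + 1) + 1) ^ (2 * k)"
    proof -
      have "(4::int) ^ k = 2 ^ (2 * k)" by (simp add: power_mult)
      thus ?thesis by (simp add: power_mult_distrib[symmetric] algebra_simps)
    qed
    moreover have "4 ^ k * int M ^ (2 * k) = ((2 * int M + 1) - 1) ^ (2 * k)"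
      by (simp add: power_mult_distrib power_mult)
    moreover have "(\<Sum>a\<le>2*k. if odd (2 * k - a) then of_nat ((2 * k) choose a) * (2 * int M + 1) ^ a else 0) = (\<Sum>a\<le>2*k. if odd a then int ((2 * k) choose a) * (2 * int M + 1) ^ a else 0)"
      by (intro sum.cong) auto
    ultimately show ?thesis using odd_binomial_diff[of "2 * int M + 1" "2 * k"]
      by (simp only: right_diff_distrib)
  qed
  have "4 ^ k * rank_moment (2 * k) n = 2 * (\<Sum>M<n. (4 ^ k * (int (M + 1) ^ (2 * k) - int M ^ (2 * k))) * int (rank_ge (int M + 1) n))"
    unfolding rank_moment_even[OF assms] by (simp add: sum_distrib_left mult_ac)
  also have "\<dots> = 2 * (\<Sum>M<n. \<Sum>a\<le>2*k. if odd a then int ((2 * k) choose a) * (2 * ((2 * int M + 1) ^ a * int (rank_ge (int M + 1) n))) else 0)"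
    unfolding e by (auto simp: sum_distrib_left sum_distrib_right mult_ac intro!: sum.cong)
  also have "\<dots> = 2 * (\<Sum>a\<le>2*k. \<Sum>M<n. if odd a then int ((2 * k) choose a) * (2 * ((2 * int M + 1) ^ a * int (rank_ge (int M + 1) n))) else 0)"
    by (subst sum.swap) simp
  also have "\<dots> = 2 * (\<Sum>a\<le>2*k. if odd a then int ((2 * k) choose a) * Ym a n else 0)"
    by (auto simp: Ym_def sum_distrib_left intro!: sum.cong)
  finally show ?thesis .
qed

lemma Ym_1: "rank_moment 2 n = Ym 1 n"
  using rank_moment_Ym[of 1 n] by (simp add: numeral_2_eq_2 atMost_Suc)

theorem Ym_rec: "(24 * of_nat n - 1) * of_int (Ym a n) + of_int (Ym (a + 2) n) = 2 * fps_nth (Pf * Wf a) n"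
proof -
  let ?x = "\<lambda>M. 2 * of_nat M + 1 :: rat"
  have rc: "(24 * of_nat n - 1 + ?x M ^ 2) * of_nat (rank_ge (int M + 1) n) = fps_nth (Pf * Bf (M + 1)) n" for M
    using arg_cong[OF rank_crank[of "M + 1"], of "\<lambda>f. fps_nth f n"]
    by (simp add: Gr_def fps_numeral_fps_const algebra_simps)
  have "(24 * of_nat n - 1) * of_int (Ym a n) + of_int (Ym (a + 2) n) = 2 * (\<Sum>M<n. ?x M ^ a * ((24 * of_nat n - 1 + ?x M ^ 2) * of_nat (rank_ge (int M + 1) n)))"
    by (simp add: Ym_def sum_distrib_left algebra_simps power_add power2_eq_square flip: sum.distrib)
  also have "\<dots> = 2 * fps_nth (Pf * (\<Sum>M<n. fps_const (?x M ^ a) * Bf (M + 1))) n"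
  proof -
    have "c * fps_nth (Pf * B) n = fps_nth (Pf * (fps_const c * B)) n" for c B
      by (simp only: mult.left_commute[of Pf] fps_mult_left_const_nth)
    thus ?thesis by (simp only: rc sum_distrib_left[of Pf] fps_sum_nth)
  qed
  also have "fps_nth (Pf * (\<Sum>M<n. fps_const (?x M ^ a) * Bf (M + 1))) n = fps_nth (Pf * Wf a) n"
    unfolding fps_mult_nth
  proof (intro sum.cong refl arg_cong2[of _ _ _ _ times])
    fix j assume "j \<in> {0..n}"
    define k where "k = n - j"
    have k: "k \<le> n" by (simp add: k_def)
    have "fps_nth (\<Sum>M<n. fps_const (?x M ^ a) * Bf (M + 1)) k = (\<Sum>M<n. \<Sum>i\<in>{M+2..k}. ?x M ^ a * (4 * (of_nat i - of_nat (M + 1)) * (of_nat i - of_nat (M + 1) + 1) * cf (int i) k))"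
      by (simp add: fps_sum_nth Bf_def sum_distrib_left)
    also have "\<dots> = (\<Sum>(M, i)\<in>Sigma {..<n} (\<lambda>M. {M+2..k}). ?x M ^ a * (4 * (of_nat i - of_nat (M + 1)) * (of_nat i - of_nat (M + 1) + 1) * cf (int i) k))"
      by (rule sum.Sigma) auto
    also have "\<dots> = (\<Sum>(i, M)\<in>Sigma {1..k} (\<lambda>i. {..<i}). ?x M ^ a * (4 * (of_nat i - of_nat (M + 1)) * (of_nat i - of_nat (M + 1) + 1) * cf (int i) k))"
    proof -
      have "(\<Sum>(M, i)\<in>Sigma {..<n} (\<lambda>M. {M+2..k}). ?x M ^ a * (4 * (of_nat i - of_nat (M + 1)) * (of_nat i - of_nat (M + 1) + 1) * cf (int i) k))
        = (\<Sum>(i, M)\<in>prod.swap ` Sigma {..<n} (\<lambda>M. {M+2..k}). ?x M ^ a * (4 * (of_nat i - of_nat (M + 1)) * (of_nat i - of_nat (M + 1) + 1) * cf (int i) k))"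
        by (subst sum.reindex) (auto simp: inj_on_def intro!: sum.cong)
      also have "\<dots> = (\<Sum>(i, M)\<in>Sigma {1..k} (\<lambda>i. {..<i}). ?x M ^ a * (4 * (of_nat i - of_nat (M + 1)) * (of_nat i - of_nat (M + 1) + 1) * cf (int i) k))"
      proof (rule sum.mono_neutral_left)
        show "\<forall>p\<in>Sigma {1..k} (\<lambda>i. {..<i}) - prod.swap ` Sigma {..<n} (\<lambda>M. {M+2..k}). (case p of (i, M) \<Rightarrow> ?x M ^ a * (4 * (of_nat i - of_nat (M + 1)) * (of_nat i - of_nat (M + 1) + 1) * cf (int i) k)) = 0"
        proof
          fix p assume p: "p \<in> Sigma {1..k} (\<lambda>i. {..<i}) - prod.swap ` Sigma {..<n} (\<lambda>M. {M+2..k})"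
          obtain i M where pe: "p = (i, M)" by force
          have "i = M + 1"
          proof (rule ccontr)
            assume "i \<noteq> M + 1"
            hence "(M, i) \<in> Sigma {..<n} (\<lambda>M. {M+2..k})" using p pe k by auto
            hence "p \<in> prod.swap ` Sigma {..<n} (\<lambda>M. {M+2..k})" using pe by (force intro: image_eqI[of _ _ "(M, i)"])
            thus False using p by simp
          qed
          thus "(case p of (i, M) \<Rightarrow> ?x M ^ a * (4 * (of_nat i - of_nat (M + 1)) * (of_nat i - of_nat (M + 1) + 1) * cf (int i) k)) = 0"
            by (simp add: pe)
        qed
      qed auto
      finally show ?thesis .
    qed
    also have "\<dots> = (\<Sum>i=1..k. \<Sum>M<i. ?x M ^ a * (4 * (of_nat i - of_nat (M + 1)) * (of_nat i - of_nat (M + 1) + 1) * cf (int i) k))"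
      by (rule sum.Sigma[symmetric]) auto
    also have "\<dots> = fps_nth (Wf a) k"
      by (simp add: Wf_def phi_sum_def sum_distrib_right mult.assoc)
    finally show "fps_nth (\<Sum>M<n. fps_const (?x M ^ a) * Bf (M + 1)) (n - j) = fps_nth (Wf a) (n - j)" by (simp add: k_def)
  qed
  finally show ?thesis .
qed

section \<open>Sums of odd powers as polynomials in the upper limit\<close>

function fp :: "nat \<Rightarrow> rat poly" where
  "fp b = smult (1 / of_nat (2 * (b + 1))) (monom (2 ^ (b + 1)) (b + 1) - (\<Sum>j\<in>{1..b div 2}. smult (2 * of_nat ((b + 1) choose (2 * j + 1))) (fp (b - 2 * j))))"
  by auto
termination by (relation "Wellfounded.measure id") auto

declare fp.simps [simp del]

definition F_sum :: "nat \<Rightarrow> nat \<Rightarrow> rat" where "F_sum b i = (\<Sum>M<i. (2 * of_nat M + 1) ^ b)"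

text \<open>Summing (x + 1)^(b+1) - (x - 1)^(b+1) over odd x < 2i telescopes. Solved for its leading
  term this is the recursion that defines \<open>fp\<close>; its only division is by 2(b + 1), which
  matters later for denominators.\<close>

lemma F_sum_telescope:
  "(2 * of_nat i) ^ (b + 1) = 2 * of_nat (b + 1) * F_sum b i + (\<Sum>j\<in>{1..b div 2}. 2 * of_nat ((b + 1) choose (2 * j + 1)) * F_sum (b - 2 * j) i)"
proof -
  have odd: "(x + 1) ^ (b + 1) - (x - 1) ^ (b + 1) = 2 * of_nat (b + 1) * x ^ b + (\<Sum>j\<in>{1..b div 2}. 2 * of_nat ((b + 1) choose (2 * j + 1)) * x ^ (b - 2 * j))" for x :: rat
  proof -
    have "(\<Sum>a\<le>b+1. if odd (b + 1 - a) then of_nat ((b + 1) choose a) * x ^ a else 0) = (\<Sum>a\<in>{a\<in>{..b+1}. odd (b + 1 - a)}. of_nat ((b + 1) choose a) * x ^ a)"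
      by (rule sum.inter_filter[symmetric]) auto
    also have "\<dots> = (\<Sum>j\<in>{0..b div 2}. of_nat ((b + 1) choose (2 * j + 1)) * x ^ (b - 2 * j))"
    proof (rule sum.reindex_bij_witness[where i = "\<lambda>j. b - 2 * j" and j = "\<lambda>a. (b - a) div 2"], goal_cases)
      case (1 a)
      hence "a \<le> b" "even (b - a)" by (auto simp: le_Suc_eq Suc_diff_le)
      thus ?case by simp
    next
      case (5 a)
      hence a: "a \<le> b" "even (b - a)" by (auto simp: le_Suc_eq Suc_diff_le)
      have "(b + 1) choose (2 * ((b - a) div 2) + 1) = (b + 1) choose a"
        using a by (subst binomial_symmetric) auto
      thus ?case using a by simp
    qed (auto simp: Suc_diff_le)
    also have "\<dots> = of_nat (b + 1) * x ^ b + (\<Sum>j\<in>{1..b div 2}. of_nat ((b + 1) choose (2 * j + 1)) * x ^ (b - 2 * j))"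
      by (simp add: sum.atLeast_Suc_atMost)
    finally show ?thesis unfolding odd_binomial_diff by (simp add: sum_distrib_left algebra_simps)
  qed
  have "(2 * of_nat i) ^ (b + 1) = (\<Sum>M<i. ((2 * of_nat M + 1) + 1) ^ (b + 1) - ((2 * of_nat M + 1) - 1) ^ (b + 1) :: rat)"
  proof -
    have "(\<Sum>M<i. ((2 * of_nat M + 1) + 1) ^ (b + 1) - ((2 * of_nat M + 1) - 1) ^ (b + 1) :: rat) = (\<Sum>M<i. (2 * of_nat (Suc M)) ^ (b + 1) - (2 * of_nat M) ^ (b + 1))"
      by (intro sum.cong refl) (simp add: algebra_simps)
    also have "\<dots> = (2 * of_nat i) ^ (b + 1) - (2 * of_nat 0) ^ (b + 1)"
      by (rule sum_lessThan_telescope)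
    finally show ?thesis by simp
  qed
  also have "\<dots> = 2 * of_nat (b + 1) * F_sum b i + (\<Sum>j\<in>{1..b div 2}. 2 * of_nat ((b + 1) choose (2 * j + 1)) * F_sum (b - 2 * j) i)"
    unfolding odd F_sum_def sum.distrib sum_distrib_left
    by (subst (2) sum.swap) simp
  finally show ?thesis .
qed

lemma poly_fp: "poly (fp b) (of_nat i) = F_sum b i"
proof (induction b rule: less_induct)
  case (less b)
  have "poly (fp b) (of_nat i) = 1 / of_nat (2 * (b + 1)) * ((2 * of_nat i) ^ (b + 1) - (\<Sum>j\<in>{1..b div 2}. 2 * of_nat ((b + 1) choose (2 * j + 1)) * F_sum (b - 2 * j) i))"
  proof -
    have "(\<Sum>j\<in>{1..b div 2}. 2 * of_nat ((b + 1) choose (2 * j + 1)) * F_sum (b - 2 * j) i) = (\<Sum>j\<in>{1..b div 2}. 2 * of_nat ((b + 1) choose (2 * j + 1)) * poly (fp (b - 2 * j)) (of_nat i))"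
      by (intro sum.cong refl) (use less in auto)
    thus ?thesis by (subst fp.simps) (simp only: poly_smult poly_diff poly_sum poly_monom power_mult_distrib)
  qed
  also have "\<dots> = F_sum b i"
    unfolding F_sum_telescope by (simp add: field_simps)
  finally show ?case .
qed

lemma coeff_fp:
  "coeff (fp b) k = 1 / of_nat (2 * (b + 1)) * ((if k = b + 1 then 2 ^ (b + 1) else 0) - (\<Sum>j\<in>{1..b div 2}. 2 * of_nat ((b + 1) choose (2 * j + 1)) * coeff (fp (b - 2 * j)) k))"
  by (subst fp.simps) (simp add: coeff_sum)

lemma coeff_fp_eq_0: "k > b + 1 \<or> even (k + b) \<Longrightarrow> coeff (fp b) k = 0"
proof (induction b rule: less_induct)
  case (less b)
  have "coeff (fp (b - 2 * j)) k = 0" if "j \<in> {1..b div 2}" for j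
    using that less.prems by (intro less.IH) auto
  thus ?case using less.prems by (subst coeff_fp) auto
qed

lemma coeff_fp_0: "coeff (fp b) 0 = 0"
  using poly_fp[of b 0] by (simp add: F_sum_def poly_0_coeff_0)

lemma coeff_fp_top: "coeff (fp b) (b + 1) = 2 ^ b / of_nat (b + 1)"
proof -
  have "coeff (fp (b - 2 * j)) (b + 1) = 0" if "j \<in> {1..b div 2}" for j
    using that by (intro coeff_fp_eq_0) auto
  hence "coeff (fp b) (b + 1) = 1 / of_nat (2 * (b + 1)) * 2 ^ (b + 1)" by (subst coeff_fp) simp
  thus ?thesis by (simp only: of_nat_mult of_nat_numeral power_add power_one_right) (simp del: of_nat_add of_nat_Suc)
qed

text \<open>In degree b - 1 only the summand j = 1 of the recursion contributes, with the known
  leading coefficient of \<open>fp (b - 2)\<close>.\<close>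

lemma coeff_fp_next:
  assumes "b \<ge> 2"
  shows "coeff (fp b) (b - 1) = - (of_nat b * 2 ^ b / 24)"
proof -
  have z: "coeff (fp (b - 2 * j)) (b - 1) = 0" if "j \<in> {2..b div 2}" for j
    using that by (intro coeff_fp_eq_0) auto
  have "(\<Sum>j\<in>{1..b div 2}. 2 * of_nat ((b + 1) choose (2 * j + 1)) * coeff (fp (b - 2 * j)) (b - 1)) = 2 * of_nat ((b + 1) choose 3) * coeff (fp (b - 2)) (b - 1)"
    using assms z by (subst sum.atLeast_Suc_atMost) (auto simp: numeral_3_eq_3)
  also have "coeff (fp (b - 2)) (b - 1) = 2 ^ (b - 2) / of_nat (b - 1)"
    using coeff_fp_top[of "b - 2"] assms by (simp add: Suc_diff_Suc numeral_2_eq_2)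
  finally have 1: "(\<Sum>j\<in>{1..b div 2}. 2 * of_nat ((b + 1) choose (2 * j + 1)) * coeff (fp (b - 2 * j)) (b - 1)) = 2 * of_nat ((b + 1) choose 3) * (2 ^ (b - 2) / of_nat (b - 1))" .
  obtain c where c: "b = c + 2" using assms by (metis le_add_diff_inverse2)
  have ch: "of_nat ((c + 3) choose 3) = ((of_nat c + 3) * (of_nat c + 2) * (of_nat c + 1) / 6 :: rat)" for c
  proof (induction c)
    case (Suc c)
    have "Suc c + 3 = Suc (c + 3)" by simp
    hence "(Suc c + 3) choose 3 = ((Suc c + 2) choose 2) + ((c + 3) choose 3)"
      by (simp only: numeral_3_eq_3 binomial_Suc_Suc) (simp add: numeral_2_eq_2)
    thus ?case using Suc choose_rat[of "Suc c"] by (simp add: field_simps del: binomial_Suc_Suc)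
  qed simp
  have "coeff (fp b) (b - 1) = 1 / of_nat (2 * (b + 1)) * (0 - 2 * of_nat ((b + 1) choose 3) * (2 ^ (b - 2) / of_nat (b - 1)))"
  proof -
    have ne: "(b - 1 = b + 1) = False" by simp
    show ?thesis by (subst coeff_fp) (simp only: 1 ne if_False)
  qed
  also have "\<dots> = - (of_nat b * 2 ^ b / 24)"
  proof -
    have gen: "1 / (2 * (C + 3)) * (0 - 2 * ((C + 3) * (C + 2) * (C + 1) / 6) * (t / (C + 1))) = - ((C + 2) * (t * 4) / 24)"
      if "C + 1 \<noteq> 0" "C + 3 \<noteq> 0" for C t :: rat
      using that by (simp add: divide_simps) (simp add: algebra_simps)
    have b: "b + 1 = c + 3" "b - 2 = c" "b - 1 = c + 1" using c by auto
    have "(of_nat c + 1 :: rat) \<noteq> 0" "(of_nat c + 3 :: rat) \<noteq> 0"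
      using of_nat_0_le_iff[of c, where 'a = rat] by linarith+
    from gen[OF this, of "2 ^ c"] show ?thesis unfolding b ch
      by (simp add: c power_add add_ac)
  qed
  finally show ?thesis .
qed

text \<open>With y = 2M + 1 the quadratic weight is (2i - y)^2 - 1 = (4 i^2 - 1) - 4 i y + y^2,
  summed power by power in y.\<close>

definition phi_poly :: "nat \<Rightarrow> rat poly" where
  "phi_poly a = (monom 4 2 - 1) * fp a - monom 4 1 * fp (a + 1) + fp (a + 2)"

lemma poly_phi_poly: "poly (phi_poly a) (of_nat i) = phi_sum a i"
proof -
  have "phi_sum a i = (\<Sum>M<i. (4 * of_nat i ^ 2 - 1) * (2 * of_nat M + 1) ^ a - 4 * of_nat i * (2 * of_nat M + 1) ^ (a + 1) + (2 * of_nat M + 1) ^ (a + 2))"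
    unfolding phi_sum_def by (intro sum.cong refl) (simp add: power_add power2_eq_square algebra_simps)
  also have "\<dots> = poly (phi_poly a) (of_nat i)"
    by (simp add: phi_poly_def poly_fp poly_monom F_sum_def sum.distrib sum_subtractf sum_distrib_left)
  finally show ?thesis by simp
qed

lemma coeff_phi_poly:
  "coeff (phi_poly a) k = 4 * (if k \<ge> 2 then coeff (fp a) (k - 2) else 0) - coeff (fp a) k - 4 * (if k \<ge> 1 then coeff (fp (a + 1)) (k - 1) else 0) + coeff (fp (a + 2)) k"
  by (auto simp: phi_poly_def left_diff_distrib coeff_monom_mult)

lemma coeff_phi_poly_eq_0:
  assumes "odd a" "k > a + 3 \<or> odd k \<or> k = 0"
  shows "coeff (phi_poly a) k = 0"
proof (cases "k = 0")
  case True thus ?thesis by (simp add: coeff_phi_poly coeff_fp_0)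
next
  case False
  have "coeff (fp a) k = 0" "coeff (fp (a + 2)) k = 0" using assms False by (auto intro!: coeff_fp_eq_0)
  moreover have "coeff (fp (a + 1)) (k - 1) = 0" using assms False by (intro coeff_fp_eq_0) auto
  moreover have "coeff (fp a) (k - 2) = 0" if "k \<ge> 2" using assms False that by (intro coeff_fp_eq_0) auto
  ultimately show ?thesis by (simp add: coeff_phi_poly)
qed

lemma degree_phi_poly: "odd a \<Longrightarrow> degree (phi_poly a) \<le> a + 3"
  by (intro degree_le) (auto intro: coeff_phi_poly_eq_0)

text \<open>The three leading terms combine into one fraction. For a = l - 2 its denominator is (l -
  1) l (l + 1), the source of the single \<open>1/l\<close> in the second moment.\<close>

lemma coeff_phi_top: "coeff (phi_poly a) (a + 3) = 2 ^ (a + 3) / (of_nat (a + 1) * of_nat (a + 2) * of_nat (a + 3))"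
proof -
  have "coeff (fp a) (a + 3) = 0" by (rule coeff_fp_eq_0) auto
  hence "coeff (phi_poly a) (a + 3) = 4 * (2 ^ a / of_nat (a + 1)) - 4 * (2 ^ (a + 1) / of_nat (a + 2)) + 2 ^ (a + 2) / of_nat (a + 3)"
    using coeff_fp_top[of a] coeff_fp_top[of "a + 1"] coeff_fp_top[of "a + 2"] by (simp add: coeff_phi_poly numeral_3_eq_3)
  also have "\<dots> = 2 ^ (a + 3) / (of_nat (a + 1) * of_nat (a + 2) * of_nat (a + 3))"
  proof -
    have gen: "4 * (t / A) - 4 * (t * 2 / (A + 1)) + t * 4 / (A + 2) = t * 8 / (A * (A + 1) * (A + 2))"
      if "A \<noteq> 0" "A + 1 \<noteq> 0" "A + 2 \<noteq> 0" for A t :: rat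
      using that by (simp add: divide_simps) (simp add: algebra_simps)
    have "of_nat (a + 1) \<noteq> (0::rat)" "of_nat (a + 1) + 1 \<noteq> (0::rat)" "of_nat (a + 1) + 2 \<noteq> (0::rat)"
      using of_nat_0_le_iff[of a, where 'a = rat] unfolding of_nat_add of_nat_1 by linarith+
    from gen[OF this, of "2 ^ a"] show ?thesis by (simp add: power_add add_ac mult_ac)
  qed
  finally show ?thesis .
qed

text \<open>The three contributions from \<open>coeff_fp_next\<close> cancel, leaving minus the
  leading coefficient of \<open>fp a\<close>.\<close>

lemma coeff_phi_next:
  assumes "a \<ge> 2"
  shows "coeff (phi_poly a) (a + 1) = - (2 ^ a / of_nat (a + 1))"
proof -
  have "coeff (phi_poly a) (a + 1) = 4 * coeff (fp a) (a - 1) - coeff (fp a) (a + 1) - 4 * coeff (fp (a + 1)) (a + 1 - 1) + coeff (fp (a + 2)) (a + 2 - 1)"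
    using assms by (simp add: coeff_phi_poly)
  also have "\<dots> = - (2 ^ a / of_nat (a + 1))"
  proof -
    have gen: "4 * - (A * t / 24) - D - 4 * - ((A + 1) * (t * 2) / 24) + - ((A + 2) * (t * 4) / 24) = - D" for A t D :: rat
      by (simp add: field_simps)
    have n: "coeff (fp a) (a - 1) = - (of_nat a * 2 ^ a / 24)" "coeff (fp (a + 1)) (a + 1 - 1) = - ((of_nat a + 1) * (2 ^ a * 2) / 24)"
      "coeff (fp (a + 2)) (a + 2 - 1) = - ((of_nat a + 2) * (2 ^ a * 4) / 24)"
      using coeff_fp_next[of a] coeff_fp_next[of "a + 1"] coeff_fp_next[of "a + 2"] assms by (simp_all add: power_add add_ac)
    show ?thesis unfolding n coeff_fp_top by (rule gen)
  qed
  finally show ?thesis .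
qed

text \<open>The polynomial is even and vanishes at 0, and \<open>cf\<close> is even in i, so the sum
  over positive i is half of the sum over all i, a combination of even moments.\<close>

lemma Wf_eq_mu:
  assumes "odd a"
  shows "Wf a = fps_const (1/2) * (\<Sum>k=1..(a + 3) div 2. fps_const (coeff (phi_poly a) (2 * k)) * mu (2 * k))"
proof (rule fps_ext)
  fix n
  let ?p = "poly (phi_poly a)"
  have pe: "?p x = (\<Sum>k=1..(a + 3) div 2. coeff (phi_poly a) (2 * k) * x ^ (2 * k))" for x
  proof -
    have "?p x = (\<Sum>i\<le>a + 3. coeff (phi_poly a) i * x ^ i)"
      unfolding poly_altdef by (rule sum.mono_neutral_left) (use degree_phi_poly[OF assms] in \<open>auto intro: coeff_eq_0\<close>)
    also have "\<dots> = (\<Sum>i\<in>(\<lambda>k. 2 * k) ` {1..(a + 3) div 2}. coeff (phi_poly a) i * x ^ i)"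
    proof (rule sum.mono_neutral_right)
      show "\<forall>i\<in>{..a + 3} - (\<lambda>k. 2 * k) ` {1..(a + 3) div 2}. coeff (phi_poly a) i * x ^ i = 0"
      proof
        fix i assume i: "i \<in> {..a + 3} - (\<lambda>k. 2 * k) ` {1..(a + 3) div 2}"
        have "odd i \<or> i = 0"
        proof (rule ccontr)
          assume "\<not> (odd i \<or> i = 0)"
          then obtain k where "i = 2 * k" "k \<ge> 1" by (auto elim!: evenE)
          thus False using i by auto
        qed
        thus "coeff (phi_poly a) i * x ^ i = 0" using coeff_phi_poly_eq_0[OF assms] by auto
      qed
    qed auto
    also have "\<dots> = (\<Sum>k=1..(a + 3) div 2. coeff (phi_poly a) (2 * k) * x ^ (2 * k))"
      by (subst sum.reindex) (auto simp: inj_on_def)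
    finally show ?thesis .
  qed
  have pm: "?p (- x) = ?p x" for x by (simp add: pe)
  have p0: "?p 0 = 0" by (simp add: pe power_0_left)
  have "(\<Sum>i=-int K..int K. ?p (of_int i) * cf i n) = 2 * (\<Sum>i=1..K. ?p (of_nat i) * cf (int i) n)" for K
  proof (induction K)
    case 0 thus ?case by (simp add: p0)
  next
    case (Suc K)
    have "{- int (Suc K)..int (Suc K)} = insert (- int (Suc K)) (insert (int (Suc K)) {- int K..int K})" by auto
    moreover have "?p (of_int (- int (Suc K))) * cf (- int (Suc K)) n = ?p (of_nat (Suc K)) * cf (int (Suc K)) n"
      using pm[of "of_nat (Suc K)"] by (simp only: cf_minus of_int_minus of_int_of_nat_eq)
    ultimately show ?case using Suc by (simp del: of_int_minus of_nat_Suc)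
  qed
  hence "fps_nth (Wf a) n = 1/2 * (\<Sum>i=-int n..int n. ?p (of_int i) * cf i n)"
    by (simp add: Wf_def poly_phi_poly)
  also have "\<dots> = 1/2 * (\<Sum>k=1..(a + 3) div 2. coeff (phi_poly a) (2 * k) * (\<Sum>i=-int n..int n. of_int i ^ (2 * k) * cf i n))"
    unfolding pe sum_distrib_right by (subst sum.swap) (simp add: sum_distrib_left mult.assoc)
  finally show "fps_nth (Wf a) n = fps_nth (fps_const (1/2) * (\<Sum>k=1..(a + 3) div 2. fps_const (coeff (phi_poly a) (2 * k)) * mu (2 * k))) n"
    by (simp add: fps_sum_nth mu_def)
qed

section \<open>Eisenstein series by Liouville summation\<close>

definition quads :: "nat \<Rightarrow> (nat \<times> nat \<times> nat \<times> nat) set" where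
  "quads N = {(a, x, b, y). a \<ge> 1 \<and> x \<ge> 1 \<and> b \<ge> 1 \<and> y \<ge> 1 \<and> a * x + b * y = N}"

lemma finite_quads [simp]: "finite (quads N)"
proof -
  have "quads N \<subseteq> {..N} \<times> {..N} \<times> {..N} \<times> {..N}"
  proof
    fix p assume "p \<in> quads N"
    then obtain a x b y where p: "p = (a, x, b, y)" "a \<ge> 1" "x \<ge> 1" "b \<ge> 1" "y \<ge> 1" "a * x + b * y = N" by (auto simp: quads_def)
    have "a \<le> a * x" "x \<le> a * x" "b \<le> b * y" "y \<le> b * y" using p by simp_all
    hence "a \<le> N" "x \<le> N" "b \<le> N" "y \<le> N" using p by linarith+
    thus "p \<in> {..N} \<times> {..N} \<times> {..N} \<times> {..N}" using p(1) by auto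
  qed
  thus ?thesis by (rule finite_subset) auto
qed

lemma sum_quads_swap: "(\<Sum>(a, x, b, y)\<in>quads N. h a x b y) = (\<Sum>(a, x, b, y)\<in>quads N. h b y a x)"
  by (rule sum.reindex_bij_witness[where i = "\<lambda>(a, x, b, y). (b, y, a, x)" and j = "\<lambda>(a, x, b, y). (b, y, a, x)"]) (auto simp: quads_def)

text \<open>The subtraction step of the Euclidean algorithm, applied to the pair of weights.\<close>

lemma sum_quads_euclid:
  fixes h :: "nat \<Rightarrow> nat \<Rightarrow> 'a :: comm_ring_1"
  shows "(\<Sum>(a, x, b, y)\<in>quads N. if x > y then h a b else 0) = (\<Sum>(c, y, a, z)\<in>quads N. if c > a then h a (c - a) else 0)"
proof -
  have "(\<Sum>(a, x, b, y)\<in>quads N. if x > y then h a b else 0) = (\<Sum>(a, x, b, y)\<in>{(a, x, b, y)\<in>quads N. x > y}. h a b)"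
    by (rule sum.mono_neutral_cong_right) (auto split: if_splits)
  also have "\<dots> = (\<Sum>(c, y, a, z)\<in>{(c, y, a, z)\<in>quads N. c > a}. h a (c - a))"
  proof (rule sum.reindex_bij_witness[where i = "\<lambda>(c, y, a, z). (a, y + z, c - a, y)" and j = "\<lambda>(a, x, b, y). (a + b, y, a, x - y)"], goal_cases)
    case (2 p)
    then obtain a x b y where p: "p = (a, x, b, y)" "a \<ge> 1" "b \<ge> 1" "y \<ge> 1" "x > y" "a * x + b * y = N" by (auto simp: quads_def)
    obtain z where z: "x = y + z" using p by (metis less_imp_add_positive)
    show ?case using p by (auto simp: quads_def z algebra_simps)
  next
    case (4 p)
    then obtain c y a z where p: "p = (c, y, a, z)" "c > a" "y \<ge> 1" "a \<ge> 1" "z \<ge> 1" "c * y + a * z = N" by (auto simp: quads_def)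
    obtain b where b: "c = a + b" using p by (metis less_imp_add_positive)
    show ?case using p by (auto simp: quads_def b algebra_simps)
  qed auto
  also have "\<dots> = (\<Sum>(c, y, a, z)\<in>quads N. if c > a then h a (c - a) else 0)"
    by (rule sum.mono_neutral_cong_left) (auto split: if_splits)
  finally show ?thesis .
qed

lemma sum_trichotomy:
  fixes h :: "nat \<Rightarrow> nat \<Rightarrow> nat \<Rightarrow> nat \<Rightarrow> 'a :: comm_ring_1" and u v :: "nat \<Rightarrow> nat \<Rightarrow> nat \<Rightarrow> nat \<Rightarrow> nat"
  shows "(\<Sum>(a, x, b, y)\<in>A. h a x b y) = (\<Sum>(a, x, b, y)\<in>A. if v a x b y < u a x b y then h a x b y else 0)
     + (\<Sum>(a, x, b, y)\<in>A. if u a x b y < v a x b y then h a x b y else 0) + (\<Sum>(a, x, b, y)\<in>A. if u a x b y = v a x b y then h a x b y else 0)"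
  by (subst sum.distrib[symmetric])+ (auto intro!: sum.cong)

lemma sum_quads_eq_sides:
  fixes h :: "nat \<Rightarrow> nat \<Rightarrow> 'a :: comm_ring_1"
  assumes "N > 0"
  shows "(\<Sum>(a, x, b, y)\<in>quads N. if x = y then h a b else 0) = (\<Sum>d | d dvd N. \<Sum>c=1..<d. h c (d - c))"
proof -
  have "(\<Sum>(a, x, b, y)\<in>quads N. if x = y then h a b else 0) = (\<Sum>(a, x, b, y)\<in>{(a, x, b, y)\<in>quads N. x = y}. h a b)"
    by (rule sum.mono_neutral_cong_right) (auto split: if_splits)
  also have "\<dots> = (\<Sum>(d, c)\<in>Sigma {d. d dvd N} (\<lambda>d. {1..<d}). h c (d - c))"
  proof (rule sum.reindex_bij_witness[where i = "\<lambda>(d, c). (c, N div d, d - c, N div d)" and j = "\<lambda>(a, x, b, y). (a + b, a)"], goal_cases)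
    case (1 p)
    then obtain a x b where p: "p = (a, x, b, x)" "a \<ge> 1" "b \<ge> 1" "x \<ge> 1" "(a + b) * x = N" by (auto simp: quads_def algebra_simps)
    have "N div (a + b) = x" using p by (metis add_is_0 nonzero_mult_div_cancel_left not_one_le_zero)
    thus ?case using p by simp
  next
    case (2 p)
    then obtain a x b where p: "p = (a, x, b, x)" "a \<ge> 1" "b \<ge> 1" "x \<ge> 1" "(a + b) * x = N" by (auto simp: quads_def algebra_simps)
    thus ?case by auto
  next
    case (4 p)
    then obtain d c where p: "p = (d, c)" "d dvd N" "1 \<le> c" "c < d" by auto
    obtain k where k: "N = d * k" using p by auto
    have "k \<ge> 1" using assms k by (cases k) auto
    moreover have "c * k + (d - c) * k = N" using p k by (simp flip: distrib_right)
    ultimately show ?case using p k by (auto simp: quads_def)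
  qed auto
  also have "\<dots> = (\<Sum>d | d dvd N. \<Sum>c=1..<d. h c (d - c))"
    by (rule sum.Sigma[symmetric]) (use assms in auto)
  finally show ?thesis .
qed

lemma sum_quads_eq_weights:
  fixes h :: "nat \<Rightarrow> 'a :: comm_ring_1"
  assumes "N > 0"
  shows "(\<Sum>(a, x, b, y)\<in>quads N. if a = b then h a else 0) = (\<Sum>d | d dvd N. of_nat (N div d - 1) * h d)"
proof -
  have "(\<Sum>(a, x, b, y)\<in>quads N. if a = b then h a else 0) = (\<Sum>(x, a, y, b)\<in>quads N. if a = b then h a else 0)"
    by (rule sum.reindex_bij_witness[where i = "\<lambda>(x, a, y, b). (a, x, b, y)" and j = "\<lambda>(x, a, y, b). (a, x, b, y)"]) (auto simp: quads_def mult.commute)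
  also have "\<dots> = (\<Sum>(x, a, y, b)\<in>{(x, a, y, b)\<in>quads N. a = b}. h a)"
    by (rule sum.mono_neutral_cong_right) (auto split: if_splits)
  also have "\<dots> = (\<Sum>(d, c)\<in>Sigma {d. d dvd N} (\<lambda>d. {1..<N div d}). h d)"
  proof (rule sum.reindex_bij_witness[where i = "\<lambda>(d, c). (c, d, N div d - c, d)" and j = "\<lambda>(x, a, y, b). (a, x)"], goal_cases)
    case (1 p)
    then obtain a x b where p: "p = (a, x, b, x)" "a \<ge> 1" "b \<ge> 1" "x \<ge> 1" "(a + b) * x = N" by (auto simp: quads_def algebra_simps)
    have "N div x = a + b" using p by auto
    thus ?case using p by simp
  next
    case (2 p)
    then obtain a x b where p: "p = (a, x, b, x)" "a \<ge> 1" "b \<ge> 1" "x \<ge> 1" "(a + b) * x = N" by (auto simp: quads_def algebra_simps)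
    have "N div x = a + b" using p by auto
    thus ?case using p by auto
  next
    case (4 p)
    then obtain d c where p: "p = (d, c)" "d dvd N" "1 \<le> c" "c < N div d" by auto
    obtain k where k: "N = d * k" using p by auto
    have d: "d \<ge> 1" using assms k by (cases d) auto
    hence kk: "N div d = k" using k by simp
    have "c * d + (k - c) * d = N" using p k kk by (simp flip: distrib_right)
    thus ?case using p kk d by (auto simp: quads_def)
  qed auto
  also have "\<dots> = (\<Sum>d | d dvd N. \<Sum>c=1..<N div d. h d)"
    by (rule sum.Sigma[symmetric]) (use assms in auto)
  finally show ?thesis by simp
qed

text \<open>Comparing x with y and applying the Euclidean step expresses the sum of f(a + b) through
  one sum \<open>X\<close>; comparing a with b does the same for f(|a - b|) with a sum
  \<open>Y\<close>. Evaluating the sum of f over the first weight by both case distinctions relates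
  \<open>X\<close> and \<open>Y\<close>, and only diagonal terms, which are divisor sums,
  remain.\<close>

theorem liouville:
  fixes f :: "nat \<Rightarrow> 'a :: comm_ring_1"
  assumes "N > 0"
  shows "(\<Sum>(a, x, b, y)\<in>quads N. f (a + b) - f (max a b - min a b)) = 
    (\<Sum>d | d dvd N. of_nat (d - 1) * f d - of_nat (N div d - 1) * (2 * f d + f 0) + 2 * (\<Sum>c=1..<d. f c))"
proof -
  define X where "X = (\<Sum>(c, y, a, z)\<in>quads N. if c > a then f c else 0)"
  have plus: "(\<Sum>(a, x, b, y)\<in>quads N. f (a + b)) = 2 * X + (\<Sum>d | d dvd N. of_nat (d - 1) * f d)"
  proof -
    have A: "(\<Sum>(a, x, b, y)\<in>quads N. if x > y then f (a + b) else 0) = X"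
      unfolding X_def using sum_quads_euclid[of "\<lambda>a b. f (a + b)" N] by (auto intro!: sum.cong split: if_splits) 
    have B: "(\<Sum>(a, x, b, y)\<in>quads N. if x < y then f (a + b) else 0) = X"
      unfolding A[symmetric] by (subst sum_quads_swap) (auto intro!: sum.cong simp: add.commute)
    have C: "(\<Sum>(a, x, b, y)\<in>quads N. if x = y then f (a + b) else 0) = (\<Sum>d | d dvd N. of_nat (d - 1) * f d)"
      unfolding sum_quads_eq_sides[OF assms, of "\<lambda>a b. f (a + b)"] 
    proof (intro sum.cong refl)
      fix d
      have "(\<Sum>c=1..<d. f (c + (d - c))) = (\<Sum>c=1..<d. f d)" by (intro sum.cong) auto
      thus "(\<Sum>c=1..<d. f (c + (d - c))) = of_nat (d - 1) * f d" by simp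
    qed
    show ?thesis
      using sum_trichotomy[where h = "\<lambda>a x b y. f (a + b)" and A = "quads N" and u = "\<lambda>a x b y. x" and v = "\<lambda>a x b y. y"] A B C
      by simp
  qed
  define Y where "Y = (\<Sum>(c, y, a, z)\<in>quads N. if y < z then f c else 0)"
  have minus: "(\<Sum>(a, x, b, y)\<in>quads N. f (max a b - min a b)) = 2 * Y + (\<Sum>d | d dvd N. of_nat (N div d - 1) * f 0)"
  proof -
    have A: "(\<Sum>(a, x, b, y)\<in>quads N. if a > b then f (max a b - min a b) else 0) = Y"
    proof -
      have "(\<Sum>(c, y, a, z)\<in>quads N. if c > a then f (c - a) else 0) = (\<Sum>(a, x, b, y)\<in>quads N. if x > y then f b else 0)"
        using sum_quads_euclid[of "\<lambda>a b. f b" N] by simp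
      also have "\<dots> = Y" unfolding Y_def by (subst sum_quads_swap) simp
      finally show ?thesis by (auto intro!: sum.cong simp: case_prod_unfold if_distrib cong: if_cong) 
    qed
    have B: "(\<Sum>(a, x, b, y)\<in>quads N. if a < b then f (max a b - min a b) else 0) = Y"
      unfolding A[symmetric] by (subst sum_quads_swap) (auto intro!: sum.cong simp: max.commute min.commute)
    have C: "(\<Sum>(a, x, b, y)\<in>quads N. if a = b then f (max a b - min a b) else 0) = (\<Sum>d | d dvd N. of_nat (N div d - 1) * f 0)"
      using sum_quads_eq_weights[OF assms, of "\<lambda>a. f 0"] by (auto intro!: sum.cong simp: case_prod_unfold if_distrib cong: if_cong) 
    show ?thesis
      using sum_trichotomy[where h = "\<lambda>a x b y. f (max a b - min a b)" and A = "quads N" and u = "\<lambda>a x b y. a" and v = "\<lambda>a x b y. b"] A B C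
      by simp
  qed
  \<comment> \<open>Trichotomy of y and z against trichotomy of c and a; the Euclidean step
    identifies the two parts that are not yet known.\<close>
  have "Y = X + (\<Sum>d | d dvd N. of_nat (N div d - 1) * f d) - (\<Sum>d | d dvd N. \<Sum>c=1..<d. f c)"
  proof -
    have 1: "(\<Sum>(c, y, a, z)\<in>quads N. f c) = Y + (\<Sum>(c, y, a, z)\<in>quads N. if y > z then f c else 0) + (\<Sum>(c, y, a, z)\<in>quads N. if y = z then f c else 0)"
      using sum_trichotomy[where h = "\<lambda>c y a z. f c" and A = "quads N" and u = "\<lambda>c y a z. y" and v = "\<lambda>c y a z. z"] by (simp add: Y_def)
    have 2: "(\<Sum>(c, y, a, z)\<in>quads N. f c) = X + (\<Sum>(c, y, a, z)\<in>quads N. if c < a then f c else 0) + (\<Sum>(c, y, a, z)\<in>quads N. if c = a then f c else 0)"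
      using sum_trichotomy[where h = "\<lambda>c y a z. f c" and A = "quads N" and u = "\<lambda>c y a z. c" and v = "\<lambda>c y a z. a"] by (simp add: X_def)
    have 3: "(\<Sum>(c, y, a, z)\<in>quads N. if y > z then f c else 0) = (\<Sum>(c, y, a, z)\<in>quads N. if c < a then f c else 0)"
      unfolding sum_quads_euclid[of "\<lambda>a b. f a" N] by (subst sum_quads_swap) simp
    have 4: "(\<Sum>(c, y, a, z)\<in>quads N. if y = z then f c else 0) = (\<Sum>d | d dvd N. \<Sum>c=1..<d. f c)"
      by (rule sum_quads_eq_sides[OF assms, of "\<lambda>a b. f a"])
    have 5: "(\<Sum>(c, y, a, z)\<in>quads N. if c = a then f c else 0) = (\<Sum>d | d dvd N. of_nat (N div d - 1) * f d)"
      by (rule sum_quads_eq_weights[OF assms])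
    show ?thesis using 1 2 unfolding 3 4 5 by (simp add: algebra_simps)
  qed
  moreover have "(\<Sum>(a, x, b, y)\<in>quads N. f (a + b) - f (max a b - min a b)) = (\<Sum>(a, x, b, y)\<in>quads N. f (a + b)) - (\<Sum>(a, x, b, y)\<in>quads N. f (max a b - min a b))"
    by (simp add: case_prod_unfold sum_subtractf)
  moreover have "(\<Sum>d | d dvd N. of_nat (d - 1) * f d - of_nat (N div d - 1) * (2 * f d + f 0) + 2 * (\<Sum>c=1..<d. f c)) =
    (\<Sum>d | d dvd N. of_nat (d - 1) * f d) - (2 * (\<Sum>d | d dvd N. of_nat (N div d - 1) * f d) + (\<Sum>d | d dvd N. of_nat (N div d - 1) * f 0)) + 2 * (\<Sum>d | d dvd N. \<Sum>c=1..<d. f c)"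
    by (simp only: sum.distrib sum_subtractf sum_distrib_left[of 2] distrib_left mult.left_commute[of _ 2])
  ultimately show ?thesis unfolding plus minus by (simp only:) (simp add: algebra_simps)
qed

section \<open>Bernoulli numbers from the hyperbolic cotangent\<close>

definition eu :: "rat fps" where "eu = fps_exp 1"

text \<open>The series (x/2) coth(x/2), with the pole of 1/(e^x - 1) removed by the shift.\<close>

definition ct :: "rat fps" where "ct = fps_const (1/2) * (eu + 1) * inverse (fps_shift 1 (eu - 1))"

text \<open>This is -B_{2k}/(2k)!.\<close>

definition gh :: "nat \<Rightarrow> rat" where "gh k = - fps_nth ct (2 * k)"

lemma eu_minus_1: "eu - 1 = fps_X * fps_shift 1 (eu - 1)"
proof (rule fps_ext)
  fix n show "fps_nth (eu - 1) n = fps_nth (fps_X * fps_shift 1 (eu - 1)) n"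
    by (cases n) (simp_all add: eu_def)
qed

lemma eu_ct: "2 * ((eu - 1) * ct) = fps_X * (eu + 1)"
proof -
  have "fps_nth (fps_shift 1 (eu - 1)) 0 \<noteq> 0" by (simp add: eu_def)
  hence i: "fps_shift 1 (eu - 1) * inverse (fps_shift 1 (eu - 1)) = 1" by (metis inverse_mult_eq_1 mult.commute)
  have "2 * ((eu - 1) * ct) = 2 * (fps_X * fps_shift 1 (eu - 1) * (fps_const (1/2) * (eu + 1) * inverse (fps_shift 1 (eu - 1))))"
    by (subst eu_minus_1) (simp only: ct_def)
  also have "\<dots> = (2 * fps_const (1/2)) * (fps_X * (eu + 1)) * (fps_shift 1 (eu - 1) * inverse (fps_shift 1 (eu - 1)))"
    by (simp only: mult_ac)
  also have "2 * fps_const (1/2 :: rat) = 1" by (simp add: fps_numeral_fps_const)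
  finally show ?thesis unfolding i by simp
qed

lemma eu_minus_1_nonzero: "eu - 1 \<noteq> 0"
proof
  assume "eu - 1 = 0"
  hence "fps_nth (eu - 1) 1 = 0" by simp
  thus False by (simp add: eu_def)
qed

text \<open>The differential equation coth' = 1 - coth^2. It makes the recursion for the Bernoulli
  numbers quadratic with the explicit divisor 2k + 3, from which denominators at l can be read
  off.\<close>

lemma ct_riccati: "4 * (euler_op ct - ct + ct ^ 2) = fps_X ^ 2"
proof -
  define c' where "c' = fps_deriv ct"
  have "fps_deriv (2 * ((eu - 1) * ct)) = fps_deriv (fps_X * (eu + 1))" by (simp only: eu_ct)
  hence d: "2 * (eu * ct + (eu - 1) * c') = (eu + 1) + fps_X * eu"
    by (simp add: c'_def eu_def algebra_simps)
  have h: "2 * ((eu - 1) * ct) = fps_X * (eu + 1)" by (rule eu_ct)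
  have "(eu - 1) ^ 2 * (4 * (fps_X * c' - ct + ct ^ 2)) = (eu - 1) ^ 2 * fps_X ^ 2"
  proof -
    have gen: "(e - 1) ^ 2 * (4 * (X * y - c + c ^ 2)) = (e - 1) ^ 2 * X ^ 2"
      if d: "2 * (e * c + (e - 1) * y) = (e + 1) + X * e" and h: "2 * ((e - 1) * c) = X * (e + 1)" for e c X y :: "rat fps"
    proof -
      have d': "2 * ((e - 1) * y) = e + 1 + X * e - 2 * e * c" using d by (simp add: algebra_simps)
      have "(e - 1) ^ 2 * (4 * (X * y - c + c ^ 2)) = 2 * X * (e - 1) * (2 * ((e - 1) * y)) - 2 * (e - 1) * (2 * ((e - 1) * c)) + (2 * ((e - 1) * c)) ^ 2"
        by (simp add: algebra_simps power2_eq_square)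
      also have "\<dots> = 2 * X * (e - 1) * (e + 1 + X * e) - 2 * X * e * (2 * ((e - 1) * c)) - 2 * (e - 1) * (2 * ((e - 1) * c)) + (2 * ((e - 1) * c)) ^ 2"
        unfolding d' by (simp add: algebra_simps)
      also have "\<dots> = (e - 1) ^ 2 * X ^ 2"
        unfolding h by (simp add: algebra_simps power2_eq_square)
      finally show ?thesis .
    qed
    show ?thesis by (rule gen[OF d h])
  qed
  thus ?thesis using eu_minus_1_nonzero by (simp add: euler_op_eq c'_def)
qed

lemma ct_0: "fps_nth ct 0 = 1"
  by (simp add: ct_def eu_def)

lemma ct_rec: "(of_nat n + 1) * fps_nth ct n = (if n = 2 then 1/4 else 0) - (\<Sum>i=1..<n. fps_nth ct i * fps_nth ct (n - i))" if "n \<ge> 1"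
proof -
  have "4 * (of_nat n * fps_nth ct n - fps_nth ct n + (\<Sum>i=0..n. fps_nth ct i * fps_nth ct (n - i))) = (if n = 2 then 1 else 0)"
  proof -
    have "fps_nth (4 * (euler_op ct - ct + ct ^ 2)) n = fps_nth (fps_X ^ 2) n" by (simp only: ct_riccati)
    hence "4 * fps_nth (euler_op ct - ct + ct ^ 2) n = fps_nth (fps_X ^ 2) n" by (simp only: fps_mult_numeral_left)
    thus ?thesis by (simp only: fps_add_nth fps_sub_nth euler_op_nth power2_eq_square[of ct] fps_mult_nth fps_X_power_nth)
  qed
  moreover have "(\<Sum>i=0..n. fps_nth ct i * fps_nth ct (n - i)) = 2 * fps_nth ct n + (\<Sum>i=1..<n. fps_nth ct i * fps_nth ct (n - i))"
  proof -
    have "{0..n} = insert 0 (insert n {1..<n})" using that by auto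
    thus ?thesis using that by (simp add: ct_0)
  qed
  ultimately show ?thesis by (simp add: algebra_simps split: if_splits)
qed

lemma ct_odd: "odd n \<Longrightarrow> fps_nth ct n = 0"
proof (induction n rule: less_induct)
  case (less n)
  have n: "n \<ge> 1" using less by (cases n) auto
  have "(\<Sum>i=1..<n. fps_nth ct i * fps_nth ct (n - i)) = 0"
  proof (rule sum.neutral, rule ballI)
    fix i assume i: "i \<in> {1..<n}"
    have "odd i \<or> odd (n - i)" using less.prems i by (auto simp: )
    thus "fps_nth ct i * fps_nth ct (n - i) = 0" using less.IH[of i] less.IH[of "n - i"] i by auto
  qed
  moreover have "n \<noteq> 2" using less.prems by auto
  ultimately have "(of_nat n + 1) * fps_nth ct n = 0" using ct_rec[OF n] by simp
  moreover have "of_nat n + 1 \<noteq> (0 :: rat)" using of_nat_0_le_iff[of n, where 'a = rat] by linarith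
  ultimately show ?case by simp
qed

lemma gh_1: "gh 1 = - 1/12"
proof -
  have "{1..<2::nat} = {1}" by auto
  hence "3 * fps_nth ct 2 = 1/4" using ct_rec[of 2] ct_odd[of 1] by simp
  thus ?thesis by (simp add: gh_def)
qed

lemma sum_even_terms:
  fixes f :: "nat \<Rightarrow> 'a :: comm_monoid_add"
  assumes "\<And>i. odd i \<Longrightarrow> f i = 0"
  shows "(\<Sum>i=1..<2*m. f i) = (\<Sum>j=1..<m. f (2 * j))"
proof -
  have "(\<Sum>i=1..<2*m. f i) = (\<Sum>i\<in>(\<lambda>j. 2 * j) ` {1..<m}. f i)"
  proof (rule sum.mono_neutral_right)
    show "\<forall>i\<in>{1..<2 * m} - (\<lambda>j. 2 * j) ` {1..<m}. f i = 0"
    proof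
      fix i assume i: "i \<in> {1..<2 * m} - (\<lambda>j. 2 * j) ` {1..<m}"
      have "odd i"
      proof (rule ccontr)
        assume "\<not> odd i" then obtain j where "i = 2 * j" by (auto elim: evenE)
        thus False using i by auto
      qed
      thus "f i = 0" by (rule assms)
    qed
  qed auto
  thus ?thesis by (subst (asm) sum.reindex) (auto simp: inj_on_def)
qed

lemma gh_rec: "k \<ge> 1 \<Longrightarrow> (2 * of_nat k + 3) * gh (k + 1) = (\<Sum>i=1..k. gh i * gh (k + 1 - i))"
proof -
  assume k: "k \<ge> 1"
  have "(\<Sum>i=1..<2 * (k + 1). fps_nth ct i * fps_nth ct (2 * (k + 1) - i)) = (\<Sum>j=1..<k + 1. fps_nth ct (2 * j) * fps_nth ct (2 * (k + 1) - 2 * j))"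
    by (rule sum_even_terms) (simp add: ct_odd)
  also have "\<dots> = (\<Sum>j=1..k. gh j * gh (k + 1 - j))"
    by (rule sum.cong) (auto simp: gh_def right_diff_distrib')
  finally show ?thesis using ct_rec[of "2 * (k + 1)"] k by (simp add: gh_def algebra_simps)
qed

text \<open>A coefficient comparison in (e^x - 1) T = (e^x + 1)(e^(dx) - e^(-dx)), where T sums
  e^(cx) over |c| \<le> d, the end terms counted once and all others twice. The symmetric sum avoids
  odd Bernoulli numbers.\<close>

lemma faulhaber_gh:
  assumes k: "k \<ge> 1" and d: "d \<ge> 1"
  shows "2 * (\<Sum>c=1..<d. of_nat c ^ (2 * k)) + of_nat d ^ (2 * k) =
    2 * fact (2 * k) * (of_nat d ^ (2 * k + 1) / fact (2 * k + 1) - (\<Sum>i=1..k. gh i * of_nat d ^ (2 * (k - i) + 1) / fact (2 * (k - i) + 1)))"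
proof -
  define e where "e = (\<lambda>c::int. fps_exp (of_int c) :: rat fps)"
  have ee: "e i * e j = e (i + j)" for i j by (simp add: e_def fps_exp_add_mult)
  have e1: "e 1 = eu" "e 0 = 1" by (simp_all add: e_def eu_def)
  define T where "T d = 2 * (\<Sum>c=1..<d. e (int c) + e (- int c)) + e (int d) + e (- int d) + 2" for d
  have "(e 1 - 1) * T d = (e 1 + 1) * (e (int d) - e (- int d))" if "d \<ge> 1" for d
    using that
  proof (induction d rule: dec_induct)
    case base
    have "e 1 * e (- 1) = 1" using ee[of 1 "- 1"] e1(2) by simp
    thus ?case by (simp add: T_def algebra_simps)
  next
    case (step d)
    have T: "T (Suc d) = T d + (e (int d) + e (- int d)) + (e (int d + 1) + e (- 1 - int d))"
      using step by (simp add: T_def algebra_simps)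
    have p: "e (int d + 1) = e 1 * e (int d)" and m: "e (- int d) = e 1 * e (- 1 - int d)"
      by (simp_all add: ee add.commute)
    have gen: "(E - 1) * (A + (p + E * m) + (E * p + m)) = (E + 1) * (E * p - m)"
      if "(E - 1) * A = (E + 1) * (p - E * m)" for A p m E :: "rat fps"
      using that by (simp add: algebra_simps)
    have "(e 1 - 1) * T (Suc d) = (e 1 + 1) * (e (int d + 1) - e (- 1 - int d))"
      unfolding T p m by (rule gen) (use step m in simp)
    moreover have "int (Suc d) = int d + 1" "- int (Suc d) = - 1 - int d" by simp_all
    ultimately show ?case by (simp only:)
  qed
  hence "(eu - 1) * T d = (eu + 1) * (e (int d) - e (- int d))" using d e1 by simp
  moreover have "(eu - 1) * (fps_X * T d) = fps_X * ((eu - 1) * T d)" by (simp only: mult_ac)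
  ultimately have "(eu - 1) * (fps_X * T d) = 2 * ((eu - 1) * ct) * (e (int d) - e (- int d))" by (simp add: eu_ct mult.assoc)
  hence "(eu - 1) * (fps_X * T d) = (eu - 1) * (2 * ct * (e (int d) - e (- int d)))" by (simp only: mult_ac)
  hence main: "fps_X * T d = 2 * (ct * (e (int d) - e (- int d)))" using eu_minus_1_nonzero by (simp add: mult.assoc)
  have en: "fps_nth (e (int c)) (2 * k) = of_nat c ^ (2 * k) / fact (2 * k)" "fps_nth (e (- int c)) (2 * k) = of_nat c ^ (2 * k) / fact (2 * k)" for c
    by (simp_all add: e_def)
  have "fps_nth (fps_X * T d) (2 * k + 1) = fps_nth (T d) (2 * k)" by simp
  also have "\<dots> = 4 * (\<Sum>c=1..<d. of_nat c ^ (2 * k) / fact (2 * k)) + 2 * (of_nat d ^ (2 * k) / fact (2 * k))"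
    using k by (simp add: T_def fps_sum_nth en fps_numeral_fps_const sum.distrib sum_distrib_left)
  finally have L: "fps_nth (fps_X * T d) (2 * k + 1) = 2 / fact (2 * k) * (2 * (\<Sum>c=1..<d. of_nat c ^ (2 * k)) + of_nat d ^ (2 * k))"
    by (simp add: sum_divide_distrib[symmetric] add_divide_distrib[symmetric] algebra_simps)
  have "fps_nth (ct * (e (int d) - e (- int d))) (2 * k + 1) = (\<Sum>i=0..2*k+1. fps_nth ct i * (fps_nth (e (int d)) (2 * k + 1 - i) - fps_nth (e (- int d)) (2 * k + 1 - i)))"
    by (simp add: fps_mult_nth)
  also have "\<dots> = (\<Sum>i\<in>(\<lambda>j. 2 * j) ` {0..k}. fps_nth ct i * (fps_nth (e (int d)) (2 * k + 1 - i) - fps_nth (e (- int d)) (2 * k + 1 - i)))"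
  proof (rule sum.mono_neutral_right)
    show "\<forall>i\<in>{0..2 * k + 1} - (\<lambda>j. 2 * j) ` {0..k}. fps_nth ct i * (fps_nth (e (int d)) (2 * k + 1 - i) - fps_nth (e (- int d)) (2 * k + 1 - i)) = 0"
    proof
      fix i assume i: "i \<in> {0..2 * k + 1} - (\<lambda>j. 2 * j) ` {0..k}"
      have "odd i"
      proof (rule ccontr)
        assume "\<not> odd i" then obtain j where "i = 2 * j" by (auto elim: evenE)
        thus False using i by auto
      qed
      thus "fps_nth ct i * (fps_nth (e (int d)) (2 * k + 1 - i) - fps_nth (e (- int d)) (2 * k + 1 - i)) = 0" by (simp add: ct_odd)
    qed
  qed auto
  also have "\<dots> = (\<Sum>j=0..k. fps_nth ct (2 * j) * (2 * of_nat d ^ (2 * (k - j) + 1) / fact (2 * (k - j) + 1)))"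
  proof (subst sum.reindex)
    show "sum ((\<lambda>i. fps_nth ct i * (fps_nth (e (int d)) (2 * k + 1 - i) - fps_nth (e (- int d)) (2 * k + 1 - i))) \<circ> (\<lambda>j. 2 * j)) {0..k} = (\<Sum>j=0..k. fps_nth ct (2 * j) * (2 * of_nat d ^ (2 * (k - j) + 1) / fact (2 * (k - j) + 1)))"
    proof (rule sum.cong[OF refl])
      fix j assume j: "j \<in> {0..k}"
      have "2 * k + 1 - 2 * j = 2 * (k - j) + 1" using j by auto
      thus "((\<lambda>i. fps_nth ct i * (fps_nth (e (int d)) (2 * k + 1 - i) - fps_nth (e (- int d)) (2 * k + 1 - i))) \<circ> (\<lambda>j. 2 * j)) j = fps_nth ct (2 * j) * (2 * of_nat d ^ (2 * (k - j) + 1) / fact (2 * (k - j) + 1))"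
        by (simp add: e_def)
    qed
  qed (auto simp: inj_on_def)
  also have "\<dots> = 2 * of_nat d ^ (2 * k + 1) / fact (2 * k + 1) - 2 * (\<Sum>i=1..k. gh i * of_nat d ^ (2 * (k - i) + 1) / fact (2 * (k - i) + 1))"
  proof -
    define D where "D j = of_nat d ^ (2 * (k - j) + 1) / (fact (2 * (k - j) + 1) :: rat)" for j
    have "(\<Sum>j=0..k. fps_nth ct (2 * j) * (2 * D j)) = 2 * D 0 - 2 * (\<Sum>i=1..k. gh i * D i)"
      by (simp add: sum.atLeast_Suc_atMost ct_0 gh_def sum_distrib_left sum_negf mult_ac)
    thus ?thesis unfolding D_def by (simp only: times_divide_eq_right diff_zero)
  qed
  finally have R: "fps_nth (2 * (ct * (e (int d) - e (- int d)))) (2 * k + 1) = 4 * (of_nat d ^ (2 * k + 1) / fact (2 * k + 1) - (\<Sum>i=1..k. gh i * of_nat d ^ (2 * (k - i) + 1) / fact (2 * (k - i) + 1)))"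
    by (simp add: fps_numeral_fps_const)
  have "2 / fact (2 * k) * (2 * (\<Sum>c=1..<d. of_nat c ^ (2 * k)) + of_nat d ^ (2 * k)) = 4 * (of_nat d ^ (2 * k + 1) / fact (2 * k + 1) - (\<Sum>i=1..k. gh i * of_nat d ^ (2 * (k - i) + 1) / fact (2 * (k - i) + 1)))"
    using L R main by simp
  note eq = this
  have "A = 2 * F * B" if "2 / F * A = 4 * B" "F \<noteq> 0" for A F B :: rat using that by (simp add: field_simps)
  from this[OF eq] show ?thesis by simp
qed

lemma Sf_mult_nth:
  "fps_nth (Sf i * Sf j) n = (\<Sum>(a, x, b, y)\<in>quads n. of_nat a ^ i * of_nat b ^ j)"
proof -
  have "fps_nth (Sf i * Sf j) n = (\<Sum>m=0..n. of_nat (sig i m) * of_nat (sig j (n - m)))"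
    by (simp add: fps_mult_nth Sf_def)
  also have "\<dots> = (\<Sum>m\<in>{0<..<n}. of_nat (sig i m) * of_nat (sig j (n - m)))"
  proof (rule sum.mono_neutral_right)
    show "\<forall>m\<in>{0..n} - {0<..<n}. of_nat (sig i m) * of_nat (sig j (n - m)) = 0"
    proof
      fix m assume "m \<in> {0..n} - {0<..<n}"
      hence "m = 0 \<or> m = n" by auto
      thus "of_nat (sig i m) * of_nat (sig j (n - m)) = 0" by auto
    qed
  qed auto
  also have "\<dots> = (\<Sum>m\<in>{0<..<n}. \<Sum>(a, b)\<in>{a. a dvd m} \<times> {b. b dvd n - m}. of_nat a ^ i * of_nat b ^ j)"
    by (simp add: sig_def sum_product sum.cartesian_product)
  also have "\<dots> = (\<Sum>(m, a, b)\<in>Sigma {0<..<n} (\<lambda>m. {a. a dvd m} \<times> {b. b dvd n - m}). of_nat a ^ i * of_nat b ^ j)"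
    by (subst sum.Sigma) (auto simp: case_prod_unfold)
  also have "\<dots> = (\<Sum>(a, x, b, y)\<in>quads n. of_nat a ^ i * of_nat b ^ j)"
  proof (rule sum.reindex_bij_witness[where i = "\<lambda>(a, x, b, y). (a * x, a, b)" and j = "\<lambda>(m, a, b). (a, m div a, b, (n - m) div b)"], goal_cases)
    case (1 p) thus ?case by auto
  next
    case (2 p)
    then obtain m a b where p: "p = (m, a, b)" "0 < m" "m < n" "a dvd m" "b dvd n - m" by auto
    obtain x y where xy: "m = a * x" "n - m = b * y" using p by (auto elim!: dvdE)
    have "a > 0" "x > 0" "b > 0" "y > 0" using p xy by (auto intro!: gr0I)
    thus ?case using p xy by (auto simp: quads_def)
  next
    case (3 p)
    then obtain a x b y where p: "p = (a, x, b, y)" "a \<ge> 1" "x \<ge> 1" "b \<ge> 1" "y \<ge> 1" "a * x + b * y = n" by (auto simp: quads_def)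
    have "n - a * x = b * y" using p by linarith
    thus ?case using p by auto
  next
    case (4 p)
    then obtain a x b y where p: "p = (a, x, b, y)" "a \<ge> 1" "x \<ge> 1" "b \<ge> 1" "y \<ge> 1" "a * x + b * y = n" by (auto simp: quads_def)
    have "n - a * x = b * y" "a * x < n" using p by (auto simp flip: p(6))
    thus ?case using p by auto
  qed auto
  finally show ?thesis .
qed

text \<open>The normalised Eisenstein series of weight 2k times -B_{2k}/(2k)!, the scaling in which
  its convolution recursion has no further coefficients.\<close>

definition eis :: "nat \<Rightarrow> rat fps" where
  "eis k = fps_const (gh k) + fps_const (2 / fact (2 * k - 1)) * Sf (2 * k - 1)"

lemma even_power_diff:
  fixes a b :: nat
  assumes "k \<ge> 1"
  shows "of_nat (a + b) ^ (2 * k) - of_nat (max a b - min a b) ^ (2 * k) = 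
     (\<Sum>i=1..k. 2 * fact (2 * k) / (fact (2 * i - 1) * fact (2 * (k + 1 - i) - 1)) * (of_nat a ^ (2 * i - 1) * of_nat b ^ (2 * (k + 1 - i) - 1)) :: rat)"
proof -
  let ?a = "of_nat a :: rat" and ?b = "of_nat b :: rat"
  have m: "of_nat (max a b - min a b) ^ (2 * k) = (?a - ?b) ^ (2 * k)"
  proof (cases "a \<ge> b")
    case True thus ?thesis by (simp add: of_nat_diff max_def min_def)
  next
    case False
    hence "of_nat (max a b - min a b) ^ (2 * k) = (?b - ?a) ^ (2 * k)" by (simp add: of_nat_diff max_def min_def)
    also have "\<dots> = (- (?a - ?b)) ^ (2 * k)" by simp
    also have "\<dots> = (?a - ?b) ^ (2 * k)" by (rule power_minus_even) simp
    finally show ?thesis .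
  qed
  have "(?a + ?b) ^ (2 * k) - (?a - ?b) ^ (2 * k) = (\<Sum>j\<le>2*k. of_nat ((2 * k) choose j) * ?a ^ j * ?b ^ (2 * k - j) * (1 - (- 1) ^ (2 * k - j)))"
  proof -
    have "(?a - ?b) ^ (2 * k) = (\<Sum>j\<le>2*k. of_nat ((2 * k) choose j) * ?a ^ j * (- ?b) ^ (2 * k - j))"
      using binomial_ring[of ?a "- ?b" "2 * k"] by simp
    moreover have "(- ?b) ^ n = (- 1) ^ n * ?b ^ n" for n by (rule power_minus)
    ultimately have "(?a + ?b) ^ (2 * k) - (?a - ?b) ^ (2 * k) = (\<Sum>j\<le>2*k. of_nat ((2 * k) choose j) * ?a ^ j * ?b ^ (2 * k - j) - of_nat ((2 * k) choose j) * ?a ^ j * ((- 1) ^ (2 * k - j) * ?b ^ (2 * k - j)))"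
      by (simp only: binomial_ring[of ?a ?b] sum_subtractf)
    thus ?thesis by (simp only: right_diff_distrib mult_1_right mult_1_left mult_ac)
  qed
  also have "\<dots> = (\<Sum>j\<in>(\<lambda>i. 2 * i - 1) ` {1..k}. of_nat ((2 * k) choose j) * ?a ^ j * ?b ^ (2 * k - j) * (1 - (- 1) ^ (2 * k - j)))"
  proof (rule sum.mono_neutral_right)
    show "\<forall>j\<in>{..2 * k} - (\<lambda>i. 2 * i - 1) ` {1..k}. of_nat ((2 * k) choose j) * ?a ^ j * ?b ^ (2 * k - j) * (1 - (- 1) ^ (2 * k - j)) = 0"
    proof
      fix j assume j: "j \<in> {..2 * k} - (\<lambda>i. 2 * i - 1) ` {1..k}"
      have "even j"
      proof (rule ccontr)
        assume "odd j" then obtain i where i: "j = 2 * i + 1" by (auto elim: oddE)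
        hence "j = 2 * (i + 1) - 1" "i + 1 \<in> {1..k}" using j by auto
        thus False using j by blast
      qed
      thus "of_nat ((2 * k) choose j) * ?a ^ j * ?b ^ (2 * k - j) * (1 - (- 1) ^ (2 * k - j)) = 0" using j by simp
    qed
  qed auto
  also have "\<dots> = (\<Sum>i=1..k. 2 * fact (2 * k) / (fact (2 * i - 1) * fact (2 * (k + 1 - i) - 1)) * (?a ^ (2 * i - 1) * ?b ^ (2 * (k + 1 - i) - 1)))"
  proof (subst sum.reindex)
    show "inj_on (\<lambda>i. 2 * i - 1) {1..k}" by (auto simp: inj_on_def)
    show "sum ((\<lambda>j. of_nat ((2 * k) choose j) * ?a ^ j * ?b ^ (2 * k - j) * (1 - (- 1) ^ (2 * k - j))) \<circ> (\<lambda>i. 2 * i - 1)) {1..k} = (\<Sum>i=1..k. 2 * fact (2 * k) / (fact (2 * i - 1) * fact (2 * (k + 1 - i) - 1)) * (?a ^ (2 * i - 1) * ?b ^ (2 * (k + 1 - i) - 1)))"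
    proof (rule sum.cong[OF refl])
      fix i assume i: "i \<in> {1..k}"
      have e: "2 * k - (2 * i - 1) = 2 * (k + 1 - i) - 1" "odd (2 * (k + 1 - i) - 1)" "2 * i - 1 \<le> 2 * k" using i by auto
      have "of_nat ((2 * k) choose (2 * i - 1)) = (fact (2 * k) / (fact (2 * i - 1) * fact (2 * (k + 1 - i) - 1)) :: rat)"
        using binomial_fact[OF e(3), where 'a = rat] by (simp only: e(1))
      thus "((\<lambda>j. of_nat ((2 * k) choose j) * ?a ^ j * ?b ^ (2 * k - j) * (1 - (- 1) ^ (2 * k - j))) \<circ> (\<lambda>i. 2 * i - 1)) i = 2 * fact (2 * k) / (fact (2 * i - 1) * fact (2 * (k + 1 - i) - 1)) * (?a ^ (2 * i - 1) * ?b ^ (2 * (k + 1 - i) - 1))"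
        using e(2) by (simp only: o_def e(1)) simp
    qed
  qed
  finally show ?thesis unfolding m by simp
qed

text \<open>Liouville's identity for f(m) = m^(2k): the left side expands into products of divisor
  sums of odd exponents, and on the right \<open>faulhaber_gh\<close> turns the inner power sum into
  the mixed terms with \<open>gh\<close>. The term n/d times d^(2k) yields q d/dq. The constant term
  is \<open>gh_rec\<close>.\<close>

theorem eis_rec:
  assumes k: "k \<ge> 1"
  shows "fps_const (of_nat k * (2 * of_nat k + 3)) * eis (k + 1) = euler_op (eis k) + fps_const (of_nat k) * (\<Sum>i=1..k. eis i * eis (k + 1 - i))"
proof (rule fps_ext)
  fix n
  show "fps_nth (fps_const (of_nat k * (2 * of_nat k + 3)) * eis (k + 1)) n = fps_nth (euler_op (eis k) + fps_const (of_nat k) * (\<Sum>i=1..k. eis i * eis (k + 1 - i))) n"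
  proof (cases "n = 0")
    case True
    have "fps_nth (\<Sum>i=1..k. eis i * eis (k + 1 - i)) 0 = (\<Sum>i=1..k. gh i * gh (k + 1 - i))"
      by (simp add: fps_sum_nth eis_def Sf_def)
    thus ?thesis using True gh_rec[OF k] by (simp add: eis_def Sf_def mult.assoc)
  next
    case False
    let ?s = "\<lambda>j. of_nat (sig j n) :: rat"
    define Q where "Q = (\<Sum>i=1..k. fps_nth (Sf (2 * i - 1) * Sf (2 * (k + 1 - i) - 1)) n / (fact (2 * i - 1) * fact (2 * (k + 1 - i) - 1)))"
    define R where "R = (\<Sum>i=1..k. gh i * ?s (2 * (k - i) + 1) / fact (2 * (k - i) + 1))"
    have "2 * fact (2 * k) * Q = (\<Sum>(a, x, b, y)\<in>quads n. of_nat (a + b) ^ (2 * k) - of_nat (max a b - min a b) ^ (2 * k))"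
      unfolding even_power_diff[OF k] Q_def Sf_mult_nth
      by (simp add: case_prod_unfold sum_distrib_left sum_divide_distrib) (subst sum.swap, simp)
    also have "\<dots> = (\<Sum>d | d dvd n. of_nat (d - 1) * of_nat d ^ (2 * k) - of_nat (n div d - 1) * (2 * of_nat d ^ (2 * k) + of_nat 0 ^ (2 * k)) + 2 * (\<Sum>c=1..<d. of_nat c ^ (2 * k)))"
      using liouville[of n "\<lambda>m. of_nat m ^ (2 * k) :: rat"] False by simp
    also have "\<dots> = (\<Sum>d | d dvd n. of_nat d ^ (2 * k + 1) - 2 * of_nat n * of_nat d ^ (2 * k - 1) + 2 * fact (2 * k) * (of_nat d ^ (2 * k + 1) / fact (2 * k + 1) - (\<Sum>i=1..k. gh i * of_nat d ^ (2 * (k - i) + 1) / fact (2 * (k - i) + 1))))"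
    proof (rule sum.cong[OF refl])
      fix d assume "d \<in> {d. d dvd n}"
      then obtain m where m: "n = d * m" by auto
      hence dm: "d \<ge> 1" "m \<ge> 1" using False by (auto simp: Suc_le_eq intro!: gr0I)
      have p: "of_nat d ^ (2 * k) = (of_nat d * of_nat d ^ (2 * k - 1) :: rat)" using k by (simp flip: power_Suc)
      have "of_nat (d - 1) * of_nat d ^ (2 * k) - of_nat (n div d - 1) * (2 * of_nat d ^ (2 * k) + of_nat 0 ^ (2 * k)) + 2 * (\<Sum>c=1..<d. of_nat c ^ (2 * k))
         = (of_nat d - 1) * of_nat d ^ (2 * k) - (of_nat m - 1) * (2 * of_nat d ^ (2 * k)) + 2 * (\<Sum>c=1..<d. of_nat c ^ (2 * k) :: rat)"
        using dm m k by (simp add: of_nat_diff)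
      also have "\<dots> = of_nat d ^ (2 * k + 1) - 2 * of_nat m * of_nat d ^ (2 * k) + (2 * (\<Sum>c=1..<d. of_nat c ^ (2 * k)) + of_nat d ^ (2 * k))"
        by (simp add: algebra_simps)
      also have "2 * of_nat m * of_nat d ^ (2 * k) = (2 * of_nat n * of_nat d ^ (2 * k - 1) :: rat)"
        unfolding p by (simp add: m)
      finally show "of_nat (d - 1) * of_nat d ^ (2 * k) - of_nat (n div d - 1) * (2 * of_nat d ^ (2 * k) + of_nat 0 ^ (2 * k)) + 2 * (\<Sum>c=1..<d. of_nat c ^ (2 * k))
         = of_nat d ^ (2 * k + 1) - 2 * of_nat n * of_nat d ^ (2 * k - 1) + 2 * fact (2 * k) * (of_nat d ^ (2 * k + 1) / fact (2 * k + 1) - (\<Sum>i=1..k. gh i * of_nat d ^ (2 * (k - i) + 1) / fact (2 * (k - i) + 1)))"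
        unfolding faulhaber_gh[OF k dm(1)] .
    qed
    also have "\<dots> = ?s (2 * k + 1) - 2 * of_nat n * ?s (2 * k - 1) + 2 * fact (2 * k) * (?s (2 * k + 1) / fact (2 * k + 1) - R)"
    proof -
      have "(\<Sum>d | d dvd n. \<Sum>i=1..k. gh i * of_nat d ^ (2 * (k - i) + 1) / fact (2 * (k - i) + 1)) = R"
        unfolding R_def by (subst sum.swap) (simp add: sig_def sum_distrib_left sum_divide_distrib)
      thus ?thesis
        by (simp only: sum.distrib sum_subtractf sum_distrib_left[symmetric] sum_divide_distrib[symmetric]) (simp add: sig_def)
    qed
    finally have Q: "2 * fact (2 * k) * Q = ?s (2 * k + 1) - 2 * of_nat n * ?s (2 * k - 1) + 2 * fact (2 * k) * (?s (2 * k + 1) / fact (2 * k + 1) - R)" .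
    have ei: "eis i * eis (k + 1 - i) = fps_const (gh i * gh (k + 1 - i)) + fps_const (gh i * (2 / fact (2 * (k + 1 - i) - 1))) * Sf (2 * (k + 1 - i) - 1)
        + fps_const (gh (k + 1 - i) * (2 / fact (2 * i - 1))) * Sf (2 * i - 1)
        + fps_const (2 / fact (2 * i - 1) * (2 / fact (2 * (k + 1 - i) - 1))) * (Sf (2 * i - 1) * Sf (2 * (k + 1 - i) - 1))" for i
      unfolding eis_def by (simp only: fps_const_mult[symmetric]) (simp only: algebra_simps)
    have R1: "(\<Sum>i=1..k. gh i * (2 / fact (2 * (k + 1 - i) - 1)) * ?s (2 * (k + 1 - i) - 1)) = 2 * R"
    proof -
      have "2 * (k + 1 - i) - 1 = 2 * (k - i) + 1" if "i \<in> {1..k}" for i using that by auto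
      thus ?thesis unfolding R_def sum_distrib_left by (intro sum.cong refl) simp
    qed
    have R2: "(\<Sum>i=1..k. gh (k + 1 - i) * (2 / fact (2 * i - 1)) * ?s (2 * i - 1)) = 2 * R"
      unfolding R1[symmetric]
      by (rule sum.reindex_bij_witness[where i = "\<lambda>i. k + 1 - i" and j = "\<lambda>i. k + 1 - i"]) auto
    have "fps_nth (\<Sum>i=1..k. eis i * eis (k + 1 - i)) n = 2 * R + 2 * R + 4 * Q"
    proof -
      have "fps_nth (\<Sum>i=1..k. eis i * eis (k + 1 - i)) n = (\<Sum>i=1..k. gh i * (2 / fact (2 * (k + 1 - i) - 1)) * ?s (2 * (k + 1 - i) - 1)) + (\<Sum>i=1..k. gh (k + 1 - i) * (2 / fact (2 * i - 1)) * ?s (2 * i - 1))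
         + (\<Sum>i=1..k. 2 / fact (2 * i - 1) * (2 / fact (2 * (k + 1 - i) - 1)) * fps_nth (Sf (2 * i - 1) * Sf (2 * (k + 1 - i) - 1)) n)"
        unfolding ei fps_sum_nth sum.distrib[symmetric]
        by (intro sum.cong refl) (simp only: fps_add_nth fps_mult_left_const_nth, use False in \<open>simp add: Sf_def\<close>)
      also have "(\<Sum>i=1..k. 2 / fact (2 * i - 1) * (2 / fact (2 * (k + 1 - i) - 1)) * fps_nth (Sf (2 * i - 1) * Sf (2 * (k + 1 - i) - 1)) n) = 4 * Q"
        unfolding Q_def sum_distrib_left by (intro sum.cong refl) simp
      finally show ?thesis unfolding R1 R2 .
    qed
    moreover have "fps_nth (eis (k + 1)) n = 2 / fact (2 * k + 1) * ?s (2 * k + 1)" "fps_nth (eis k) n = 2 / fact (2 * k - 1) * ?s (2 * k - 1)"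
      using False by (simp_all add: eis_def Sf_def)
    moreover have "of_nat k * (2 * of_nat k + 3) * (2 / fact (2 * k + 1) * ?s (2 * k + 1)) = of_nat n * (2 / fact (2 * k - 1) * ?s (2 * k - 1)) + of_nat k * (2 * R + 2 * R + 4 * Q)"
    proof -
      obtain k' where k': "k = Suc k'" using k by (metis Suc_le_D One_nat_def)
      have f1: "fact (2 * k) = (2 * of_nat k * fact (2 * k - 1) :: rat)" unfolding k' by simp
      have f2: "fact (2 * k + 1) = ((2 * of_nat k + 1) * (2 * of_nat k * fact (2 * k - 1)) :: rat)" unfolding f1[symmetric] by simp
      define u where "u = (fact (2 * k - 1) :: rat)"
      define K where "K = (of_nat k :: rat)"
      have nz: "u \<noteq> 0" "K \<noteq> 0" "2 * K + 1 \<noteq> 0"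
        using k of_nat_0_le_iff[of k, where 'a = rat] by (auto simp: u_def K_def) 
      have QQ: "2 * (2 * K * u) * Q = ?s (2 * k + 1) - 2 * of_nat n * ?s (2 * k - 1) + 2 * (2 * K * u) * (?s (2 * k + 1) / ((2 * K + 1) * (2 * K * u)) - R)"
        using Q unfolding f1 f2 u_def K_def .
      have h1: "4 * K * (Q + R) = ?s (2 * k + 1) / u - 2 * of_nat n * ?s (2 * k - 1) / u + 4 * K * (?s (2 * k + 1) / ((2 * K + 1) * (2 * K * u)))"
      proof -
        have gen: "4 * K * (Q + R) = s / u - 2 * N * t / u + 4 * K * w" if "2 * (2 * K * u) * Q = s - 2 * N * t + 2 * (2 * K * u) * (w - R)" for s t N w
          using that nz(1) by (simp add: field_simps)
        show ?thesis by (rule gen[OF QQ])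
      qed
      have h2: "K * (2 * K + 3) * (2 / ((2 * K + 1) * (2 * K * u)) * s) = s / u + 4 * K * (s / ((2 * K + 1) * (2 * K * u)))" for s
        using nz by (simp add: divide_simps) (simp add: algebra_simps)
      have h3: "K * (2 * R + 2 * R + 4 * Q) = 4 * K * (Q + R)" by (simp add: algebra_simps)
      have "K * (2 * K + 3) * (2 / ((2 * K + 1) * (2 * K * u)) * ?s (2 * k + 1)) = of_nat n * (2 / u * ?s (2 * k - 1)) + K * (2 * R + 2 * R + 4 * Q)"
        unfolding h2 h3 h1 by simp
      thus ?thesis unfolding f2 u_def K_def .
    qed
    ultimately show ?thesis by simp
  qed
qed

section \<open>Modular forms as power series\<close>

definition cx :: "rat fps \<Rightarrow> complex fps" where "cx f = Abs_fps (\<lambda>n. of_rat (fps_nth f n))"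

lemma cx_nth [simp]: "fps_nth (cx f) n = of_rat (fps_nth f n)" by (simp add: cx_def)

lemma of_rat_sum: "of_rat (sum f A) = (\<Sum>x\<in>A. (of_rat (f x) :: 'a :: field_char_0))"
  by (induction A rule: infinite_finite_induct) (auto simp: of_rat_add)

lemma cx_add [simp]: "cx (f + g) = cx f + cx g" by (rule fps_ext) (simp add: of_rat_add)
lemma cx_diff [simp]: "cx (f - g) = cx f - cx g" by (rule fps_ext) (simp add: of_rat_diff)
lemma cx_mult [simp]: "cx (f * g) = cx f * cx g" by (rule fps_ext) (simp add: fps_mult_nth of_rat_mult of_rat_sum)
lemma cx_const [simp]: "cx (fps_const c) = fps_const (of_rat c)" by (rule fps_ext) simp
lemma cx_1 [simp]: "cx 1 = 1" by (rule fps_ext) simp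
lemma cx_0 [simp]: "cx 0 = 0" by (rule fps_ext) simp
lemma cx_numeral [simp]: "cx (numeral n) = numeral n" by (rule fps_ext) (simp add: fps_numeral_nth)
lemma cx_power [simp]: "cx (f ^ n) = cx f ^ n" by (induction n) auto
lemma cx_X [simp]: "cx fps_X = fps_X" by (rule fps_ext) (simp add: fps_X_def)
lemma cx_euler: "cx (euler_op f) = euler_op (cx f)" by (rule fps_ext) (simp add: of_rat_mult)
text \<open>Convergence on the open unit disc, that is, for all z in the upper half-plane.\<close>

definition conv :: "complex fps \<Rightarrow> bool" where "conv f \<longleftrightarrow> fps_conv_radius f \<ge> 1"

lemma convD: "conv f \<Longrightarrow> norm q < 1 \<Longrightarrow> ereal (norm q) < fps_conv_radius f"
  unfolding conv_def by (meson ereal_less(3) less_le_trans)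

lemma conv_add [intro]: "conv f \<Longrightarrow> conv g \<Longrightarrow> conv (f + g)"
  unfolding conv_def using fps_conv_radius_add[of f g] by (meson min.boundedI order_trans)
lemma conv_diff [intro]: "conv f \<Longrightarrow> conv g \<Longrightarrow> conv (f - g)"
  unfolding conv_def using fps_conv_radius_diff[of f g] by (meson min.boundedI order_trans)
lemma conv_mult [intro]: "conv f \<Longrightarrow> conv g \<Longrightarrow> conv (f * g)"
  unfolding conv_def using fps_conv_radius_mult[of f g] by (meson min.boundedI order_trans)
lemma conv_const [simp, intro]: "conv (fps_const c)" by (simp add: conv_def)
lemma conv_1 [simp, intro]: "conv 1" by (simp add: conv_def)
lemma conv_0 [simp, intro]: "conv 0" by (simp add: conv_def)
lemma conv_numeral [simp, intro]: "conv (numeral n)" by (simp add: conv_def)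
lemma conv_X [simp, intro]: "conv fps_X" by (simp add: conv_def)
lemma conv_power [intro]: "conv f \<Longrightarrow> conv (f ^ n)" by (induction n) auto
lemma conv_deriv [intro]: "conv f \<Longrightarrow> conv (fps_deriv f)"
  unfolding conv_def using fps_conv_radius_deriv[of f] by simp
lemma conv_euler [intro]: "conv f \<Longrightarrow> conv (euler_op f)"
  by (simp add: euler_op_eq conv_mult conv_deriv)

lemma conv_comparison:
  assumes "conv g" "\<And>n. norm (fps_nth f n) \<le> norm (fps_nth g n)"
  shows "conv f"
  unfolding conv_def fps_conv_radius_def
proof (rule conv_radius_geI_ex')
  fix r :: real assume r: "0 < r" "ereal r < 1"
  have "summable (\<lambda>n. norm (fps_nth g n * (of_real r) ^ n))"
    by (rule norm_summable_fps) (use convD[OF assms(1), of "complex_of_real r"] r in simp)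
  thus "summable (\<lambda>n. fps_nth f n * complex_of_real r ^ n)"
    by (rule summable_norm_cancel[OF summable_comparison_test'[where N = 0]])
       (use assms(2) in \<open>auto simp: norm_mult norm_power intro!: mult_right_mono\<close>)
qed

lemma conv_powers: "conv (Abs_fps (\<lambda>n. of_nat n ^ k))"
proof (induction k)
  case 0
  have "conv_radius (\<lambda>n. 1 :: complex) \<ge> 1"
  proof (rule conv_radius_geI_ex')
    fix r :: real assume "0 < r" "ereal r < 1"
    thus "summable (\<lambda>n. 1 * complex_of_real r ^ n)" by (simp add: summable_geometric)
  qed
  thus ?case by (simp add: conv_def fps_conv_radius_def)
next
  case (Suc k)
  have "Abs_fps (\<lambda>n. of_nat n ^ Suc k) = euler_op (Abs_fps (\<lambda>n. of_nat n ^ k) :: complex fps)"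
    by (rule fps_ext) simp
  thus ?case using Suc by auto
qed

lemma sig_le: "sig k n \<le> n ^ (k + 1)"
proof (cases "n = 0")
  case False
  have "sig k n \<le> (\<Sum>d\<in>{d. d dvd n}. n ^ k)" unfolding sig_def
    using False by (intro sum_mono power_mono) (auto dest: dvd_imp_le)
  also have "\<dots> = card {d. d dvd n} * n ^ k" by simp
  also have "card {d. d dvd n} \<le> card {1..n}"
    using False by (intro card_mono) (auto dest: dvd_imp_le intro!: Suc_leI gr0I)
  hence "card {d. d dvd n} * n ^ k \<le> n * n ^ k" by (intro mult_right_mono) auto
  finally show ?thesis by simp
qed simp

lemma conv_Sf [intro, simp]: "conv (cx (Sf k))"
proof (rule conv_comparison[OF conv_powers[of "k + 1"]])
  fix n
  have "real (sig k n) \<le> real (n ^ (k + 1))" using sig_le by (simp only: of_nat_le_iff)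
  thus "norm (fps_nth (cx (Sf k)) n) \<le> norm (fps_nth (Abs_fps (\<lambda>n. complex_of_nat n ^ (k + 1))) n)"
    by (simp add: Sf_def norm_power norm_mult)
qed

lemma conv_lS: "conv (Abs_fps (\<lambda>n. of_nat (sig 1 n) / of_nat n))"
proof (rule conv_comparison[OF conv_powers[of 2]])
  fix n
  have "real (sig 1 n) \<le> real (n ^ 2)" using sig_le[of 1 n] by (simp only: of_nat_le_iff) (simp add: numeral_2_eq_2)
  moreover have "real (sig 1 n) / real n \<le> real (sig 1 n)" by (cases "n = 0") (auto simp: divide_le_eq mult_le_cancel_left1)
  ultimately have "real (sig 1 n) / real n \<le> real n ^ 2" unfolding of_nat_power by linarith
  thus "norm (fps_nth (Abs_fps (\<lambda>n. of_nat (sig 1 n) / of_nat n :: complex)) n) \<le> norm (fps_nth (Abs_fps (\<lambda>n. complex_of_nat n ^ 2)) n)"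
    by (simp add: norm_divide norm_power)
qed

lemma euler_linear_uniq:
  fixes s y y' :: "complex fps"
  assumes "euler_op y = s * y" "euler_op y' = s * y'" "fps_nth y 0 = fps_nth y' 0" "fps_nth s 0 = 0"
  shows "y = y'"
proof (rule fps_ext)
  fix n show "fps_nth y n = fps_nth y' n"
  proof (induction n rule: less_induct)
    case (less n)
    show ?case
    proof (cases "n = 0")
      case False
      have e: "of_nat n * fps_nth Y n = (\<Sum>k=1..n. fps_nth s k * fps_nth Y (n - k))" if "euler_op Y = s * Y" for Y
        using arg_cong[OF that, of "\<lambda>f. fps_nth f n"] assms(4) by (simp add: fps_mult_nth sum.atLeast_Suc_atMost)
      have "of_nat n * fps_nth y n = of_nat n * fps_nth y' n"
        unfolding e[OF assms(1)] e[OF assms(2)] by (intro sum.cong refl) (use less in auto)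
      thus ?thesis using False by simp
    qed (use assms in simp)
  qed
qed

text \<open>The solution is exp(c L) with L = \<Sum> \<sigma>_1(n)/n q^n, holomorphic on the disc;
  its Taylor series converges there and satisfies the same equation with the same constant
  term.\<close>

lemma conv_euler_solution:
  fixes y :: "rat fps"
  assumes y: "euler_op y = fps_const c * Sf 1 * y" and y0: "fps_nth y 0 = 1"
  shows "conv (cx y)"
proof -
  define L where "L = (Abs_fps (\<lambda>n. of_nat (sig 1 n) / of_nat n) :: complex fps)"
  have L: "conv L" unfolding L_def by (rule conv_lS)
  have eL: "euler_op L = cx (Sf 1)" by (rule fps_ext) (simp add: L_def Sf_def)
  define h where "h q = exp (of_rat c * eval_fps L q)" for q
  have ball: "eball 0 1 = (ball 0 1 :: complex set)" by (simp add: one_ereal_def)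
  have "eval_fps L holomorphic_on ball 0 1"
    by (rule holomorphic_on_eval_fps) (use convD[OF L] in auto)
  hence "(\<lambda>q. of_rat c * eval_fps L q) holomorphic_on ball 0 1"
    by (intro holomorphic_on_mult holomorphic_on_const)
  hence hol: "h holomorphic_on eball 0 1" unfolding h_def ball by (rule holomorphic_on_exp')
  define H where "H = fps_expansion h 0"
  have rad: "fps_conv_radius H \<ge> 1" unfolding H_def by (rule conv_radius_fps_expansion[OF hol])
  have ev: "eval_fps H q = h q" if "norm q < 1" for q
    using eval_fps_expansion'[OF hol, of q] that by (simp add: H_def one_ereal_def)
  have cH: "conv H" using rad by (simp add: conv_def)
  have d: "eval_fps (fps_deriv H) q = of_rat c * eval_fps (fps_deriv L) q * h q" if q: "norm q < 1" for q
  proof (rule DERIV_unique)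
    have "(eval_fps H has_field_derivative eval_fps (fps_deriv H) q) (at q)"
      by (rule has_field_derivative_eval_fps[OF convD[OF cH q]])
    thus "(h has_field_derivative eval_fps (fps_deriv H) q) (at q)"
      by (rule has_field_derivative_transform_within_open[where S = "ball 0 1"]) (use q ev in auto)
    show "(h has_field_derivative of_rat c * eval_fps (fps_deriv L) q * h q) (at q)"
      unfolding h_def by (auto intro!: derivative_eq_intros DERIV_chain2[OF has_field_derivative_eval_fps] convD[OF L q])
  qed
  have "euler_op H = (fps_const (of_rat c) * cx (Sf 1)) * H"
  proof (rule eval_fps_eqD)
    show "fps_conv_radius (euler_op H) > 0" using conv_euler[OF cH] by (auto simp: conv_def intro: less_le_trans[of _ 1])
    have "conv ((fps_const (of_rat c) * cx (Sf 1)) * H)" using cH by blast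
    thus "fps_conv_radius ((fps_const (of_rat c) * cx (Sf 1)) * H) > 0" by (auto simp: conv_def intro: less_le_trans[of _ 1])
    show "\<forall>\<^sub>F q in nhds 0. eval_fps (euler_op H) q = eval_fps ((fps_const (of_rat c) * cx (Sf 1)) * H) q"
    proof (rule eventually_nhds_in_open[THEN eventually_mono])
      show "open (ball (0::complex) 1)" "0 \<in> ball (0::complex) 1" by auto
      fix q :: complex assume "q \<in> ball 0 1"
      hence q: "norm q < 1" by simp
      have "eval_fps (euler_op H) q = q * (of_rat c * eval_fps (fps_deriv L) q * h q)"
        unfolding euler_op_eq using q cH by (subst eval_fps_mult) (auto intro!: convD simp: d)
      also have "\<dots> = of_rat c * eval_fps (euler_op L) q * eval_fps H q"
        unfolding euler_op_eq using q L by (subst eval_fps_mult) (auto intro!: convD simp: ev)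
      also have "\<dots> = eval_fps ((fps_const (of_rat c) * cx (Sf 1)) * H) q"
      proof -
        have "eval_fps ((fps_const (of_rat c) * cx (Sf 1)) * H) q = eval_fps (fps_const (of_rat c) * cx (Sf 1)) q * eval_fps H q"
          by (rule eval_fps_mult) (auto intro!: convD cH q conv_mult)
        moreover have "eval_fps (fps_const (of_rat c) * cx (Sf 1)) q = of_rat c * eval_fps (cx (Sf 1)) q"
          by (subst eval_fps_mult) (auto intro!: convD q)
        ultimately show ?thesis unfolding eL by (simp only:)
      qed
      finally show "eval_fps (euler_op H) q = eval_fps ((fps_const (of_rat c) * cx (Sf 1)) * H) q" .
    qed
  qed
  moreover have "euler_op (cx y) = (fps_const (of_rat c) * cx (Sf 1)) * cx y"
    using arg_cong[OF y, of cx] by (simp add: cx_euler)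
  moreover have "fps_nth H 0 = fps_nth (cx y) 0"
  proof -
    have "fps_nth H 0 = h 0" using ev[of 0] by (simp add: eval_fps_at_0)
    thus ?thesis using y0 by (simp add: h_def eval_fps_at_0 L_def)
  qed
  ultimately have "H = cx y" by (rule euler_linear_uniq) (simp add: Sf_def)
  thus ?thesis using cH by simp
qed

lemma Phi_0: "fps_nth Phi 0 = 1" by (simp add: Phi_def)

lemma Pf_0: "fps_nth Pf 0 = 1"
  using arg_cong[OF Phi_Pf, of "\<lambda>f. fps_nth f 0"] Phi_0 by simp

lemma conv_Phi [simp, intro]: "conv (cx Phi)"
  by (rule conv_euler_solution[of _ "-1"]) (simp_all add: euler_Phi Phi_0 mult_ac flip: fps_const_neg)

lemma conv_Pf [simp, intro]: "conv (cx Pf)"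
  by (rule conv_euler_solution[of _ 1]) (simp_all add: euler_Pf Pf_0 mult_ac)

definition ev :: "complex fps \<Rightarrow> complex \<Rightarrow> complex" where "ev f z = eval_fps f (qq z)"

lemma ev_add: "conv f \<Longrightarrow> conv g \<Longrightarrow> Im z > 0 \<Longrightarrow> ev (f + g) z = ev f z + ev g z"
  unfolding ev_def by (intro eval_fps_add convD norm_qq_less_1)
lemma ev_diff: "conv f \<Longrightarrow> conv g \<Longrightarrow> Im z > 0 \<Longrightarrow> ev (f - g) z = ev f z - ev g z"
  unfolding ev_def by (intro eval_fps_diff convD norm_qq_less_1)
lemma ev_mult: "conv f \<Longrightarrow> conv g \<Longrightarrow> Im z > 0 \<Longrightarrow> ev (f * g) z = ev f z * ev g z"
  unfolding ev_def by (intro eval_fps_mult convD norm_qq_less_1)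
lemma ev_const [simp]: "ev (fps_const c) z = c" by (simp add: ev_def)
lemma ev_1 [simp]: "ev 1 z = 1" by (simp add: ev_def)
lemma ev_0 [simp]: "ev 0 z = 0" by (simp add: ev_def)
lemma ev_numeral [simp]: "ev (numeral n) z = numeral n" by (simp add: ev_def)
lemma ev_X [simp]: "ev fps_X z = qq z" by (simp add: ev_def)
lemma ev_power: "conv f \<Longrightarrow> Im z > 0 \<Longrightarrow> ev (f ^ n) z = ev f z ^ n"
  by (induction n) (auto simp: ev_mult conv_power)

lemma ev_sums: "conv f \<Longrightarrow> Im z > 0 \<Longrightarrow> (\<lambda>n. fps_nth f n * qq z ^ n) sums ev f z"
  unfolding ev_def by (intro sums_eval_fps convD norm_qq_less_1)

lemma qq_plus_1 [simp]: "qq (z + 1) = qq z"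
  by (simp add: qq_def distrib_left exp_add mult.commute[of _ \<i>]) (simp add: mult_ac)

lemma ev_plus_1 [simp]: "ev f (z + 1) = ev f z" by (simp add: ev_def)

lemma ev_deriv:
  assumes "conv f" "Im z > 0"
  shows "(ev f has_field_derivative 2 * of_real pi * \<i> * ev (euler_op f) z) (at z)"
proof -
  have q: "norm (qq z) < 1" by (rule norm_qq_less_1[OF assms(2)])
  have dq: "(qq has_field_derivative 2 * of_real pi * \<i> * qq z) (at z)"
    unfolding qq_def [abs_def] by (auto intro!: derivative_eq_intros)
  have "((\<lambda>z. eval_fps f (qq z)) has_field_derivative eval_fps (fps_deriv f) (qq z) * (2 * of_real pi * \<i> * qq z)) (at z)"
    by (rule DERIV_chain2[OF has_field_derivative_eval_fps[OF convD[OF assms(1) q]] dq])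
  moreover have "ev (euler_op f) z = qq z * eval_fps (fps_deriv f) (qq z)"
    unfolding ev_def euler_op_eq using q assms by (subst eval_fps_mult) (auto intro!: convD)
  ultimately show ?thesis by (simp add: ev_def[abs_def] mult_ac)
qed

definition E2f :: "rat fps" where "E2f = 1 - 24 * Sf 1"

lemma conv_E2f [simp, intro]: "conv (cx E2f)" unfolding E2f_def by auto

lemma E2_S:
  assumes z: "Im z > 0"
  shows "ev (cx E2f) (- 1 / z) = z ^ 2 * ev (cx E2f) z - 6 * \<i> * z / of_real pi"
proof -
  have S: "ev (cx (Sf 1)) z = - GK z / (8 * of_real pi ^ 2)" if "Im z > 0" for z
  proof -
    have "ev (cx (Sf 1)) z = suminf (\<lambda>n. of_nat (sig 1 n) * qq z ^ n)"
      using ev_sums[OF conv_Sf[of 1] that] by (simp add: sums_iff Sf_def)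
    thus ?thesis by (simp add: GK_def)
  qed
  have E: "ev (cx E2f) z = 1 + 3 * GK z / of_real pi ^ 2" if "Im z > 0" for z
    unfolding E2f_def using that by (simp add: ev_diff ev_mult S conv_mult field_simps del: One_nat_def)
  have z0: "z \<noteq> 0" using z by auto
  have p: "complex_of_real pi \<noteq> 0" by simp
  have "GK (- 1 / z) = z ^ 2 * (GK z - 2 * of_real pi * \<i> / z - of_real pi ^ 2 / (3 * z ^ 2) + of_real pi ^ 2 / 3)"
  proof -
    have "GK (- 1 / z) / z ^ 2 = GK z - 2 * of_real pi * \<i> / z - of_real pi ^ 2 / (3 * z ^ 2) + of_real pi ^ 2 / 3"
      using GK_S[OF z] by (simp only: algebra_simps)
    moreover have "GK (- 1 / z) = z ^ 2 * (GK (- 1 / z) / z ^ 2)" using z0 by simp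
    ultimately show ?thesis by (simp only:)
  qed
  note eq = this
  have gen: "1 + 3 * (z ^ 2 * (g - 2 * p * \<i> / z - p ^ 2 / (3 * z ^ 2) + p ^ 2 / 3)) / p ^ 2 = z ^ 2 * (1 + 3 * g / p ^ 2) - 6 * \<i> * z / p"
    if "p \<noteq> 0" for g p
    using that z0 by (simp add: field_simps power2_eq_square)
  show ?thesis unfolding E[OF z] E[OF Im_minus_inverse_pos[OF z]] eq by (rule gen[OF p])
qed

text \<open>The square of Dedekind's eta function. Its law under z -> -1/z needs no square root, and
  the powers of eta to which the Hecke operator is applied, as well as those it produces, are
  even.\<close>

definition eta2 :: "complex \<Rightarrow> complex" where
  "eta2 z = exp (2 * of_real pi * \<i> * z / 12) * ev (cx Phi) z ^ 2"

lemma ev_Phi_Pf: "Im z > 0 \<Longrightarrow> ev (cx Phi) z * ev (cx Pf) z = 1"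
proof -
  assume z: "Im z > 0"
  have "ev (cx Phi) z * ev (cx Pf) z = ev (cx (Phi * Pf)) z" using z by (simp add: ev_mult)
  thus ?thesis by (simp only: Phi_Pf cx_1 ev_1)
qed

lemma eta2_nonzero: "Im z > 0 \<Longrightarrow> eta2 z \<noteq> 0"
  using ev_Phi_Pf[of z] by (auto simp: eta2_def)

lemma eta2_deriv:
  assumes "Im z > 0"
  shows "(eta2 has_field_derivative (2 * of_real pi * \<i> / 12) * ev (cx E2f) z * eta2 z) (at z)"
proof -
  have e: "euler_op (cx Phi) = - cx Phi * cx (Sf 1)"
    using arg_cong[OF euler_Phi, of cx] by (simp add: cx_euler flip: fps_const_neg) (metis cx_0 cx_diff cx_mult diff_0 minus_mult_left)
  have ee: "ev (euler_op (cx Phi)) z = - (ev (cx Phi) z * ev (cx (Sf 1)) z)"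
  proof -
    have "ev (0 - cx Phi * cx (Sf 1)) z = ev 0 z - ev (cx Phi * cx (Sf 1)) z" using assms by (intro ev_diff) auto
    thus ?thesis using assms by (simp add: e ev_mult)
  qed
  have E: "ev (cx E2f) z = 1 - 24 * ev (cx (Sf 1)) z"
    unfolding E2f_def using assms by (simp add: ev_diff ev_mult conv_mult)
  have de: "((\<lambda>z. exp (2 * of_real pi * \<i> * z / 12)) has_field_derivative exp (2 * of_real pi * \<i> * z / 12) * (2 * of_real pi * \<i> / 12)) (at z)"
  proof (rule DERIV_chain2[OF DERIV_exp])
    show "((\<lambda>z. 2 * of_real pi * \<i> * z / 12) has_field_derivative 2 * of_real pi * \<i> / 12) (at z)"
      by (auto intro!: derivative_eq_intros)
  qed
  have dp: "((\<lambda>z. ev (cx Phi) z ^ 2) has_field_derivative 2 * ev (cx Phi) z * (2 * of_real pi * \<i> * ev (euler_op (cx Phi)) z)) (at z)"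
    using DERIV_mult[OF ev_deriv[OF conv_Phi assms] ev_deriv[OF conv_Phi assms]] by (simp add: power2_eq_square algebra_simps)
  show ?thesis using DERIV_mult[OF de dp] unfolding ee E eta2_def[abs_def] by (simp add: algebra_simps power2_eq_square)
qed

text \<open>The logarithmic derivative of \<open>eta2\<close> is a multiple of E_2, so by
  \<open>E2_S\<close> the quotient of the two sides has derivative zero; the constant is found at
  the fixed point i.\<close>

theorem eta2_S:
  assumes z: "Im z > 0"
  shows "eta2 (- 1 / z) = - \<i> * z * eta2 z"
proof -
  define R where "R z = eta2 (- 1 / z) / (z * eta2 z)" for z
  let ?H = "{z. Im z > 0}"
  have "\<exists>c. \<forall>z\<in>?H. R z = c"
  proof (rule has_field_derivative_zero_constant)
    show "convex ?H" by (rule convex_halfspace_Im_gt)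
    fix z assume "z \<in> ?H"
    hence z: "Im z > 0" by simp
    have z0: "z \<noteq> 0" using z by auto
    let ?p = "2 * of_real pi * \<i> / 12"
    have d1: "((\<lambda>z. eta2 (- 1 / z)) has_field_derivative (?p * ev (cx E2f) (- 1 / z) * eta2 (- 1 / z)) * (1 / z ^ 2)) (at z)"
      by (rule DERIV_chain2[where g = "\<lambda>z. - 1 / z" and x = z, OF eta2_deriv[OF Im_minus_inverse_pos[OF z]]])
         (use z0 in \<open>auto intro!: derivative_eq_intros simp: power2_eq_square\<close>)
    have d2: "((\<lambda>z. z * eta2 z) has_field_derivative eta2 z + z * (?p * ev (cx E2f) z * eta2 z)) (at z)"
      by (auto intro!: derivative_eq_intros eta2_deriv z)
    have d3: "(R has_field_derivative ((?p * ev (cx E2f) (- 1 / z) * eta2 (- 1 / z)) * (1 / z ^ 2) * (z * eta2 z) - eta2 (- 1 / z) * (eta2 z + z * (?p * ev (cx E2f) z * eta2 z))) / ((z * eta2 z) * (z * eta2 z))) (at z)"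
      unfolding R_def [abs_def] by (rule DERIV_divide[OF d1 d2]) (use z0 eta2_nonzero[OF z] in simp)
    have p6: "?p * (6 * \<i> * z / of_real pi) = - z" by (simp add: field_simps)
    have e1: "(a * y) * (1 / z ^ 2) * (z * x) - y * (x + z * (?p * e * x)) = y * x * (a / z - 1 - z * ?p * e)" for a x y e
      using z0 by (simp add: field_simps power2_eq_square)
    have "?p * ev (cx E2f) (- 1 / z) = ?p * z ^ 2 * ev (cx E2f) z - ?p * (6 * \<i> * z / of_real pi)"
      unfolding E2_S[OF z] by (simp only: right_diff_distrib mult.assoc)
    hence "?p * ev (cx E2f) (- 1 / z) = ?p * z ^ 2 * ev (cx E2f) z + z" unfolding p6 by simp
    hence "?p * ev (cx E2f) (- 1 / z) / z - 1 - z * ?p * ev (cx E2f) z = 0"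
      using z0 by (simp only:) (simp add: add_divide_distrib power2_eq_square)
    hence "(?p * ev (cx E2f) (- 1 / z) * eta2 (- 1 / z)) * (1 / z ^ 2) * (z * eta2 z) - eta2 (- 1 / z) * (eta2 z + z * (?p * ev (cx E2f) z * eta2 z)) = 0"
      unfolding e1 by simp
    thus "(R has_field_derivative 0) (at z within ?H)" using d3 has_field_derivative_at_within by fastforce
  qed
  then obtain c where c: "\<And>z. Im z > 0 \<Longrightarrow> R z = c" by auto
  have "- 1 / \<i> = \<i>" by (simp add: field_simps)
  hence "R \<i> = 1 / \<i>" using eta2_nonzero[of \<i>] by (simp add: R_def)
  hence "c = - \<i>" using c[of \<i>] by simp
  hence "R z = - \<i>" using c[OF z] by simp
  moreover have "z * eta2 z \<noteq> 0" using eta2_nonzero[OF z] z by auto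
  hence "eta2 (- 1 / z) = R z * (z * eta2 z)" by (simp add: R_def)
  ultimately show ?thesis by simp
qed

lemma eta2_plus_1: "eta2 (z + 1) = exp (2 * of_real pi * \<i> / 12) * eta2 z"
  by (simp add: eta2_def distrib_left add_divide_distrib exp_add mult_ac)

text \<open>Only z -> -1/z is imposed, since a series in integral powers of q is invariant under z
  -> z + 1.\<close>

definition mform :: "int \<Rightarrow> rat fps \<Rightarrow> bool" where
  "mform k f \<longleftrightarrow> conv (cx f) \<and> (\<forall>z. Im z > 0 \<longrightarrow> ev (cx f) (- 1 / z) = z powi k * ev (cx f) z)"

lemma mformI: "conv (cx f) \<Longrightarrow> (\<And>z. Im z > 0 \<Longrightarrow> ev (cx f) (- 1 / z) = z powi k * ev (cx f) z) \<Longrightarrow> mform k f"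
  by (auto simp: mform_def)

lemma mform_conv: "mform k f \<Longrightarrow> conv (cx f)" by (simp add: mform_def)

lemma mform_S: "mform k f \<Longrightarrow> Im z > 0 \<Longrightarrow> ev (cx f) (- 1 / z) = z powi k * ev (cx f) z" by (simp add: mform_def)

lemma mform_add:
  assumes "mform k f" "mform k g"
  shows "mform k (f + g)"
proof (rule mformI)
  show "conv (cx (f + g))" using assms by (auto simp: mform_conv)
  fix z assume z: "Im z > 0"
  show "ev (cx (f + g)) (- 1 / z) = z powi k * ev (cx (f + g)) z"
    using assms z Im_minus_inverse_pos[OF z] by (simp only: ev_add mform_conv mform_S cx_add distrib_left right_diff_distrib)
qed

lemma mform_mult:
  assumes "mform k f" "mform m g"
  shows "mform (k + m) (f * g)"
proof (rule mformI)
  show "conv (cx (f * g))" using assms by (auto simp: mform_conv)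
  fix z assume z: "Im z > 0"
  hence "z \<noteq> 0" by auto
  hence "z powi (k + m) = z powi k * z powi m" by (simp add: power_int_add)
  thus "ev (cx (f * g)) (- 1 / z) = z powi (k + m) * ev (cx (f * g)) z"
    using assms z Im_minus_inverse_pos[OF z] by (simp only: ev_mult mform_conv mform_S cx_mult mult_ac)
qed

lemma mform_const: "mform 0 (fps_const c)" by (rule mformI) auto

lemma mform_smult: "mform k f \<Longrightarrow> mform k (fps_const c * f)"
  using mform_mult[OF mform_const] by fastforce

lemma mform_0: "mform k 0" by (rule mformI) auto

lemma mform_sum: "(\<And>i. i \<in> A \<Longrightarrow> mform k (f i)) \<Longrightarrow> mform k (sum f A)"
  by (induction A rule: infinite_finite_induct) (auto intro: mform_0 mform_add)

lemma mform_deriv_S: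
  assumes f: "mform k f" and z: "Im z > 0"
  shows "ev (cx (euler_op f)) (- 1 / z) = z powi (k + 2) * ev (cx (euler_op f)) z - of_int k * (\<i> / (2 * of_real pi)) * z powi (k + 1) * ev (cx f) z"
proof -
  let ?t = "2 * of_real pi * \<i>"
  have z0: "z \<noteq> 0" using z by auto
  have d1: "((\<lambda>z. ev (cx f) (- 1 / z)) has_field_derivative ?t * ev (euler_op (cx f)) (- 1 / z) * (1 / z ^ 2)) (at z)"
    by (rule DERIV_chain2[where g = "\<lambda>z. - 1 / z" and x = z, OF ev_deriv[OF mform_conv[OF f] Im_minus_inverse_pos[OF z]]])
       (use z0 in \<open>auto intro!: derivative_eq_intros simp: power2_eq_square\<close>)
  have dz: "((\<lambda>z. z powi k) has_field_derivative of_int k * z powi (k - 1)) (at z)"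
    using z0 by (auto intro!: derivative_eq_intros)
  have d2: "((\<lambda>z. z powi k * ev (cx f) z) has_field_derivative of_int k * z powi (k - 1) * ev (cx f) z + ?t * ev (euler_op (cx f)) z * z powi k) (at z)"
    by (rule DERIV_mult[OF dz ev_deriv[OF mform_conv[OF f] z]])
  have "?t * ev (euler_op (cx f)) (- 1 / z) * (1 / z ^ 2) = of_int k * z powi (k - 1) * ev (cx f) z + ?t * ev (euler_op (cx f)) z * z powi k"
  proof (rule DERIV_unique[OF _ d2])
    show "((\<lambda>z. z powi k * ev (cx f) z) has_field_derivative ?t * ev (euler_op (cx f)) (- 1 / z) * (1 / z ^ 2)) (at z)"
      by (rule has_field_derivative_transform_within_open[OF d1, where S = "{z. Im z > 0}"])
         (use z mform_S[OF f] open_halfspace_Im_gt in auto)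
  qed
  hence "?t * ev (euler_op (cx f)) (- 1 / z) = z ^ 2 * (of_int k * z powi (k - 1) * ev (cx f) z + ?t * ev (euler_op (cx f)) z * z powi k)"
    using z0 by (simp add: field_simps)
  moreover have "z ^ 2 * z powi (k - 1) = z powi (k + 1)" "z ^ 2 * z powi k = z powi (k + 2)"
  proof -
    have "z ^ 2 = z powi 2" by simp
    thus "z ^ 2 * z powi (k - 1) = z powi (k + 1)" "z ^ 2 * z powi k = z powi (k + 2)"
      using z0 by (simp_all add: power_int_add[symmetric] add_ac del: power_int_numeral)
  qed
  ultimately have eq: "?t * ev (euler_op (cx f)) (- 1 / z) = of_int k * z powi (k + 1) * ev (cx f) z + ?t * ev (euler_op (cx f)) z * z powi (k + 2)"
    by (simp add: distrib_left mult_ac)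
  have gen: "A = B * C - k' * x * D * E" if "y * A = k' * D * E + y * C * B" "y * x = - 1" for A B C D E x y k' :: complex
  proof -
    have "A = - x * (y * A)" using that(2) by (simp add: mult.assoc[symmetric] mult.commute[of x])
    also have "\<dots> = - (k' * x * D * E) - (y * x) * (C * B)" unfolding that(1) by (simp add: algebra_simps)
    finally show ?thesis using that(2) by simp
  qed
  show ?thesis unfolding cx_euler by (rule gen[OF eq]) simp
qed

text \<open>The Serre derivative: differentiation produces an anomalous term proportional to k, and
  so does multiplication by E_2; with the factor 12 they cancel.\<close>

lemma mform_serre:
  assumes "mform k f"
  shows "mform (k + 2) (12 * euler_op f - fps_const (of_int k) * E2f * f)"
proof (rule mformI)
  have c: "conv (cx f)" "conv (cx (euler_op f))" using mform_conv[OF assms] by (auto simp: cx_euler)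
  show "conv (cx (12 * euler_op f - fps_const (of_int k) * E2f * f))" using c by auto
  fix z assume z: "Im z > 0"
  have z0: "z \<noteq> 0" using z by auto
  have e: "ev (cx (12 * euler_op f - fps_const (of_int k) * E2f * f)) z = 12 * ev (cx (euler_op f)) z - of_int k * ev (cx E2f) z * ev (cx f) z" if "Im z > 0" for z
    using c that by (simp add: ev_diff ev_mult conv_mult)
  have p: "z powi (k + 1) = z * z powi k" "z powi (k + 2) = z ^ 2 * z powi k"
    using z0 by (simp_all add: power_int_add power2_eq_square)
  show "ev (cx (12 * euler_op f - fps_const (of_int k) * E2f * f)) (- 1 / z) = z powi (k + 2) * ev (cx (12 * euler_op f - fps_const (of_int k) * E2f * f)) z"
    unfolding e[OF z] e[OF Im_minus_inverse_pos[OF z]] mform_deriv_S[OF assms z] E2_S[OF z] mform_S[OF assms z] p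
    by (simp add: field_simps power2_eq_square)
qed

lemma eis_1: "eis 1 = fps_const (- 1/12) * E2f"
proof (rule fps_ext)
  fix n
  have "gh (Suc 0) = - (1/12)" using gh_1 by simp
  thus "eis 1 $ n = (fps_const (- 1/12) * E2f) $ n"
    by (simp add: eis_def E2f_def fps_numeral_fps_const right_diff_distrib flip: fps_const_mult)
qed

lemma conv_eis [simp, intro]: "conv (cx (eis k))" unfolding eis_def by auto

text \<open>For k = 1 the recursion gives 5 G_4 = q d/dq G_2 + G_2^2 in this scaling, and the
  anomalous terms of the two summands cancel.\<close>

lemma mform_eis_2: "mform 4 (eis 2)"
proof -
  have r: "fps_const 5 * eis 2 = euler_op (eis 1) + eis 1 * eis 1"
    using eis_rec[of 1] by (simp add: numeral_2_eq_2)
  have e5: "eis 2 = fps_const (1/5) * (euler_op (eis 1) + eis 1 * eis 1)"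
    unfolding r[symmetric] by (simp add: mult.assoc[symmetric])
  have e1: "ev (cx (eis 1)) z = - (1/12) * ev (cx E2f) z" if "Im z > 0" for z
    unfolding eis_1 using that by (simp add: ev_mult of_rat_divide of_rat_minus)
  have z0: "z \<noteq> 0" if "Im z > 0" for z using that by auto
  have S1: "ev (cx (eis 1)) (- 1 / z) = z ^ 2 * ev (cx (eis 1)) z + \<i> / (2 * of_real pi) * z" if "Im z > 0" for z
    unfolding e1[OF that] e1[OF Im_minus_inverse_pos[OF that]] E2_S[OF that] by (simp add: algebra_simps)
  have S2: "ev (cx (euler_op (eis 1))) (- 1 / z) = z ^ 4 * ev (cx (euler_op (eis 1))) z - \<i> / of_real pi * z ^ 3 * ev (cx (eis 1)) z + z ^ 2 / (4 * of_real pi ^ 2)" if z: "Im z > 0" for z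
  proof -
    let ?t = "2 * of_real pi * \<i>"
    have d1: "((\<lambda>z. ev (cx (eis 1)) (- 1 / z)) has_field_derivative ?t * ev (euler_op (cx (eis 1))) (- 1 / z) * (1 / z ^ 2)) (at z)"
      by (rule DERIV_chain2[where g = "\<lambda>z. - 1 / z" and x = z, OF ev_deriv[OF conv_eis Im_minus_inverse_pos[OF z]]])
         (use z0[OF z] in \<open>auto intro!: derivative_eq_intros simp: power2_eq_square\<close>)
    have d2: "((\<lambda>z. z ^ 2 * ev (cx (eis 1)) z + \<i> / (2 * of_real pi) * z) has_field_derivative 2 * z * ev (cx (eis 1)) z + z ^ 2 * (?t * ev (euler_op (cx (eis 1))) z) + \<i> / (2 * of_real pi)) (at z)"
      by (auto intro!: derivative_eq_intros ev_deriv z simp del: One_nat_def)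
    have "?t * ev (euler_op (cx (eis 1))) (- 1 / z) * (1 / z ^ 2) = 2 * z * ev (cx (eis 1)) z + z ^ 2 * (?t * ev (euler_op (cx (eis 1))) z) + \<i> / (2 * of_real pi)"
    proof (rule DERIV_unique[OF _ d2])
      show "((\<lambda>z. z ^ 2 * ev (cx (eis 1)) z + \<i> / (2 * of_real pi) * z) has_field_derivative ?t * ev (euler_op (cx (eis 1))) (- 1 / z) * (1 / z ^ 2)) (at z)"
        by (rule has_field_derivative_transform_within_open[OF d1, where S = "{z. Im z > 0}"])
           (use z S1 open_halfspace_Im_gt in \<open>auto simp del: One_nat_def\<close>)
    qed
    note eq = this
    have gen: "A = z ^ 4 * C - \<i> / p * z ^ 3 * B + z ^ 2 / (4 * p ^ 2)" if "2 * p * \<i> * A * (1 / z ^ 2) = 2 * z * B + z ^ 2 * (2 * p * \<i> * C) + \<i> / (2 * p)" "p \<noteq> 0" for A B C p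
    proof -
      have "A = (2 * p * \<i> * A * (1 / z ^ 2)) * z ^ 2 / (2 * p * \<i>)" using that(2) z0[OF z] by simp
      also have "\<dots> = z ^ 4 * C - \<i> / p * z ^ 3 * B + z ^ 2 / (4 * p ^ 2)"
        unfolding that(1) using that(2) z0[OF z] by (simp add: field_simps power2_eq_square power3_eq_cube power4_eq_xxxx)
      finally show ?thesis .
    qed
    show ?thesis unfolding cx_euler by (rule gen[OF eq]) simp
  qed
  have c: "conv (cx (euler_op (eis 1)))" by (simp add: cx_euler conv_euler del: One_nat_def)
  have m: "mform 4 (euler_op (eis 1) + eis 1 * eis 1)"
  proof (rule mformI)
    show "conv (cx (euler_op (eis 1) + eis 1 * eis 1))" using c by (auto simp del: One_nat_def)
    fix z assume z: "Im z > 0"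
    have e: "ev (cx (euler_op (eis 1) + eis 1 * eis 1)) z = ev (cx (euler_op (eis 1))) z + ev (cx (eis 1)) z * ev (cx (eis 1)) z" if "Im z > 0" for z
      using c that by (simp add: ev_add ev_mult conv_mult del: One_nat_def)
    have gen: "(z ^ 4 * C - \<i> / p * z ^ 3 * B + z ^ 2 / (4 * p ^ 2)) + (z ^ 2 * B + \<i> / (2 * p) * z) * (z ^ 2 * B + \<i> / (2 * p) * z) = z ^ 4 * (C + B * B)" if "p \<noteq> 0" for B C p
      using that by (simp add: field_simps power2_eq_square power3_eq_cube power4_eq_xxxx)
    show "ev (cx (euler_op (eis 1) + eis 1 * eis 1)) (- 1 / z) = z powi 4 * ev (cx (euler_op (eis 1) + eis 1 * eis 1)) z"
      unfolding e[OF z] e[OF Im_minus_inverse_pos[OF z]] S1[OF z] S2[OF z] power_int_numeral by (rule gen) simp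
  qed
  show ?thesis unfolding e5 by (rule mform_smult[OF m])
qed

text \<open>In the recursion the two products containing the quasimodular \<open>eis 1\<close> join
  the derivative to a Serre derivative; all other products are forms of the right weight by
  induction.\<close>

theorem mform_eis: "k \<ge> 2 \<Longrightarrow> mform (2 * int k) (eis k)"
proof (induction k rule: less_induct)
  case (less k)
  show ?case
  proof (cases "k = 2")
    case True thus ?thesis using mform_eis_2 by simp
  next
    case False
    define m where "m = k - 1"
    have m: "m \<ge> 2" "k = m + 1" using less.prems False by (auto simp: m_def)
    have IH: "mform (2 * int i) (eis i)" if "i \<ge> 2" "i \<le> m" for i using less.IH[of i] that m by simp
    have "(\<Sum>i=1..m. eis i * eis (m + 1 - i)) = 2 * (eis 1 * eis m) + (\<Sum>i=2..m-1. eis i * eis (m + 1 - i))"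
    proof -
      have "{1..m} = insert 1 (insert m {2..m-1})" using m by auto
      thus ?thesis using m by (simp add: mult.commute)
    qed
    from this have r: "fps_const (of_nat m * (2 * of_nat m + 3)) * eis k = (euler_op (eis m) + fps_const (2 * of_nat m) * (eis 1 * eis m)) + fps_const (of_nat m) * (\<Sum>i=2..m-1. eis i * eis (m + 1 - i))"
    proof -
      have c2: "fps_const (2 * of_nat m) = 2 * (fps_const (of_nat m) :: rat fps)" by (simp add: fps_numeral_fps_const)
      show ?thesis using eis_rec[of m] m unfolding \<open>(\<Sum>i=1..m. eis i * eis (m + 1 - i)) = _\<close> c2
        by (simp only: distrib_left mult_ac add_ac)
    qed
    have s: "euler_op (eis m) + fps_const (2 * of_nat m) * (eis 1 * eis m) = fps_const (1/12) * (12 * euler_op (eis m) - fps_const (of_int (2 * int m)) * E2f * eis m)"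
    proof -
      have "fps_const (2 * of_nat m) * (fps_const (- 1/12) * E2f * eis m) = - (fps_const (1/12) * (fps_const (of_int (2 * int m)) * E2f * eis m))"
        by (simp add: mult.assoc[symmetric] mult.commute[of "fps_const (1/12)"] flip: fps_const_neg)
      moreover have "euler_op (eis m) = fps_const (1/12) * (12 * euler_op (eis m))"
        by (simp add: fps_numeral_fps_const mult.assoc[symmetric])
      ultimately show ?thesis unfolding eis_1 right_diff_distrib by simp
    qed
    have "mform (2 * int m + 2) (fps_const (1/12) * (12 * euler_op (eis m) - fps_const (of_int (2 * int m)) * E2f * eis m))"
      by (intro mform_smult mform_serre IH) (use m in auto)
    moreover have "mform (2 * int m + 2) (fps_const (of_nat m) * (\<Sum>i=2..m-1. eis i * eis (m + 1 - i)))"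
    proof (intro mform_smult mform_sum)
      fix i assume i: "i \<in> {2..m-1}"
      have "mform (2 * int i + 2 * int (m + 1 - i)) (eis i * eis (m + 1 - i))"
        by (intro mform_mult IH) (use i m in auto)
      moreover have "2 * int i + 2 * int (m + 1 - i) = 2 * int m + 2" using i by auto
      ultimately show "mform (2 * int m + 2) (eis i * eis (m + 1 - i))" by (simp only:)
    qed
    ultimately have mf: "mform (2 * int m + 2) (fps_const (of_nat m * (2 * of_nat m + 3)) * eis k)"
      unfolding r s by (rule mform_add)
    have "of_nat (m * (2 * m + 3)) \<noteq> (0 :: rat)" using m by (subst of_nat_eq_0_iff) simp
    hence "of_nat m * (2 * of_nat m + 3) \<noteq> (0 :: rat)" by simp
    hence E: "fps_const (1 / (of_nat m * (2 * of_nat m + 3))) * (fps_const (of_nat m * (2 * of_nat m + 3)) * eis k) = eis k"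
      by (simp add: mult.assoc[symmetric])
    have "mform (2 * int m + 2) (eis k)"
      using mform_smult[OF mf, of "1 / (of_nat m * (2 * of_nat m + 3))"] unfolding E .
    moreover have "2 * int k = 2 * int m + 2" using m by simp
    ultimately show ?thesis by (simp only:)
  qed
qed

section \<open>Transformation laws from the generators of the modular group\<close>

lemma SL2_induct [consumes 1, case_names id T T_inv S]:
  fixes p q c d :: int
  assumes det: "p * d - q * c = 1"
    and id: "P 1 0 0 1"
    and T: "\<And>a b c d. a * d - b * c = 1 \<Longrightarrow> P a b c d \<Longrightarrow> P (a + c) (b + d) c d"
    and T': "\<And>a b c d. a * d - b * c = 1 \<Longrightarrow> P a b c d \<Longrightarrow> P (a - c) (b - d) c d"
    and S: "\<And>a b c d. a * d - b * c = 1 \<Longrightarrow> P a b c d \<Longrightarrow> P (- c) (- d) a b"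
  shows "P p q c d"
proof -
  have Tk: "P (a + k * c) (b + k * d) c d" if "a * d - b * c = 1" "P a b c d" for a b c d k
  proof (induction k rule: int_induct[where k = 0])
    case base thus ?case using that by simp
  next
    case (step1 i)
    have "(a + i * c) * d - (b + i * d) * c = 1" using that by (simp add: algebra_simps)
    from T[OF this step1(2)] show ?case by (simp add: algebra_simps)
  next
    case (step2 i)
    have "(a + i * c) * d - (b + i * d) * c = 1" using that by (simp add: algebra_simps)
    from T'[OF this step2(2)] show ?case by (simp add: algebra_simps)
  qed
  show ?thesis using det
  proof (induction "nat \<bar>c\<bar>" arbitrary: p q c d rule: less_induct)
    case less
    show ?case
    proof (cases "c = 0")
      case True
      hence "p * d = 1" using less.prems by simp
      hence "p = 1 \<and> d = 1 \<or> p = -1 \<and> d = -1" by (auto simp: zmult_eq_1_iff)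
      thus ?thesis
      proof
        assume "p = 1 \<and> d = 1" thus ?thesis using Tk[of 1 1 0 0 q] id True by simp
      next
        assume a: "p = -1 \<and> d = -1"
        have "P 0 (-1) 1 0" using S[of 1 1 0 0] id by simp
        hence "P (-1) 0 0 (-1)" using S[of 0 0 "-1" 1] by simp
        thus ?thesis using Tk[of "-1" "-1" 0 0 "-q"] a True by simp
      qed
    next
      case False
      \<comment> \<open>Division with remainder in the first column; applying S then strictly
        reduces the lower left entry.\<close>
      define k p' q' where "k = p div c" and "p' = p - k * c" and "q' = q - k * d"
      have "p' = p mod c" by (simp add: p'_def k_def minus_div_mult_eq_mod)
      hence "\<bar>p'\<bar> < \<bar>c\<bar>" using False by (simp add: abs_mod_less)
      moreover have "c * (- q') - d * (- p') = 1" using less.prems by (simp add: p'_def q'_def algebra_simps)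
      ultimately have "P c d (- p') (- q')" using less.hyps[of "- p'" c "- q'" d] by simp
      from S[OF _ this] have "P p' q' c d" using \<open>c * (- q') - d * (- p') = 1\<close> by simp
      moreover have "p' * d - q' * c = 1" using less.prems by (simp add: p'_def q'_def algebra_simps)
      ultimately have "P (p' + k * c) (q' + k * d) c d" using Tk by blast
      thus ?thesis by (simp add: p'_def q'_def)
    qed
  qed
qed

lemma SL2_action:
  assumes det: "a * d - b * c = (1 :: int)" and z: "Im z > 0"
  shows "of_int c * z + of_int d \<noteq> (0 :: complex)"
    and "Im ((of_int a * z + of_int b) / (of_int c * z + of_int d)) > 0"
proof -
  show nz: "of_int c * z + of_int d \<noteq> (0 :: complex)"
  proof
    assume h: "of_int c * z + of_int d = (0 :: complex)"
    from arg_cong[OF h, of Im] have "of_int c * Im z = 0" by simp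
    hence "c = 0" using z by simp
    moreover from this have "d = 0" using h by simp
    ultimately show False using det by simp
  qed
  have "Im ((of_int a * z + of_int b) / (of_int c * z + of_int d)) = of_int (a * d - b * c) * Im z / cmod (of_int c * z + of_int d) ^ 2"
    by (simp add: Im_divide cmod_power2 algebra_simps)
  also have "\<dots> > 0" using nz z det by simp
  finally show "Im ((of_int a * z + of_int b) / (of_int c * z + of_int d)) > 0" .
qed

lemma S_action:
  assumes "a * d - b * c = (1 :: int)" "Im z > 0"
  shows "(of_int (- c) * z + of_int (- d)) / (of_int a * z + of_int b) = - 1 / ((of_int a * z + of_int b) / (of_int c * z + of_int d) :: complex)"
  using SL2_action(1)[OF assms] by (simp add: field_simps)

lemma modular_from_generators:
  assumes T: "\<And>z. Im z > 0 \<Longrightarrow> f (z + 1) = f z"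
    and S: "\<And>z. Im z > 0 \<Longrightarrow> f (- 1 / z) = z powi k * f z"
    and det: "a * d - b * c = (1 :: int)" and z: "Im z > 0"
  shows "f ((of_int a * z + of_int b) / (of_int c * z + of_int d)) = (of_int c * z + of_int d) powi k * (f z :: complex)"
  using det
proof (induction rule: SL2_induct)
  case id thus ?case by simp
next
  case (T a b c d)
  note h = SL2_action[OF T(1) z]
  have "(of_int (a + c) * z + of_int (b + d)) / (of_int c * z + of_int d) = (of_int a * z + of_int b) / (of_int c * z + of_int d) + 1"
    using h(1) by (simp add: field_simps)
  thus ?case using assms(1)[OF h(2)] T(2) by simp
next
  case (T_inv a b c d)
  have "(a - c) * d - (b - d) * c = 1" using T_inv(1) by (simp add: algebra_simps)
  note h = SL2_action[OF this z]
  have e: "(of_int a * z + of_int b) / (of_int c * z + of_int d) = (of_int (a - c) * z + of_int (b - d)) / (of_int c * z + of_int d) + 1"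
    using h(1) by (simp add: field_simps)
  show ?case using assms(1)[OF h(2)] T_inv(2) unfolding e by simp
next
  case (S a b c d)
  note h = SL2_action[OF S(1) z]
  have "((of_int a * z + of_int b) / (of_int c * z + of_int d)) * (of_int c * z + of_int d) = of_int a * z + of_int b"
    using h(1) by simp
  hence p: "((of_int a * z + of_int b) / (of_int c * z + of_int d)) powi k * (of_int c * z + of_int d) powi k = (of_int a * z + of_int b) powi k"
    by (metis power_int_mult_distrib)
  show ?case unfolding S_action[OF S(1) z] assms(2)[OF h(2)] S(2) mult.assoc[symmetric] p by simp
qed

lemma mform_is_modular_form:
  assumes "mform k f"
  shows "is_modular_form k (\<lambda>n. of_rat (fps_nth f n))"
proof -
  have e: "exp (2 * of_real pi * \<i> * of_nat n * z) = qq z ^ n" for n z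
    by (simp add: qq_def exp_of_nat_mult[symmetric] mult_ac)
  have s: "(\<lambda>n. of_rat (fps_nth f n) * exp (2 * of_real pi * \<i> * of_nat n * z)) sums ev (cx f) z" if "Im z > 0" for z
    using ev_sums[OF mform_conv[OF assms] that] unfolding e by simp
  have q: "qexp (\<lambda>n. of_rat (fps_nth f n)) z = ev (cx f) z" if "Im z > 0" for z
    using s[OF that] by (simp add: qexp_def sums_iff)
  show ?thesis unfolding is_modular_form_def
  proof (intro conjI allI impI)
    fix z :: complex assume "Im z > 0"
    thus "summable (\<lambda>n. of_rat (fps_nth f n) * exp (2 * of_real pi * \<i> * of_nat n * z))" using s sums_summable by blast
  next
    fix a b c d :: int and z :: complex assume h: "a * d - b * c = 1" "Im z > 0"
    show "qexp (\<lambda>n. of_rat (fps_nth f n)) ((of_int a * z + of_int b) / (of_int c * z + of_int d)) = (of_int c * z + of_int d) powi k * qexp (\<lambda>n. of_rat (fps_nth f n)) z"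
      unfolding q[OF h(2)] q[OF SL2_action(2)[OF h]]
      by (rule modular_from_generators[OF _ _ h]) (use mform_S[OF assms] in auto)
  qed
qed

text \<open>The exponent of the multiplier of \<open>\<eta>\<^sup>2\<close> as a twelfth root of unity; that it is a cocycle is checked on residues modulo 3 and 4.\<close>

definition eta_exp :: "int \<Rightarrow> int \<Rightarrow> int \<Rightarrow> int \<Rightarrow> int" where
  "eta_exp a b c d = (1 - c ^ 2) * (b * d + 3 * (c - 1) * d + c + 3) + c * (a + d - 3)"

lemma eta_exp_cong:
  assumes "[a = a'] (mod m)" "[b = b'] (mod m)" "[c = c'] (mod m)" "[d = d'] (mod m)"
  shows "[eta_exp a b c d = eta_exp a' b' c' d'] (mod m)"
  unfolding eta_exp_def by (intro cong_add cong_mult cong_diff cong_pow cong_refl assms)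

lemma eta_exp_cases:
  "m = 3 \<or> m = 4 \<Longrightarrow> \<forall>a\<in>set [0..m-1]. \<forall>b\<in>set [0..m-1]. \<forall>c\<in>set [0..m-1]. \<forall>d\<in>set [0..m-1].
     (a * d - b * c - 1) mod m = (0::int) \<longrightarrow>
       (eta_exp (a + c) (b + d) c d - eta_exp a b c d - 1) mod m = 0 \<and>
       (eta_exp (- c) (- d) a b - eta_exp a b c d + 3) mod m = 0"
  by (erule disjE; hypsubst; code_simp)

lemma eta_exp_step:
  assumes "a * d - b * c = 1"
  shows "[eta_exp (a + c) (b + d) c d = eta_exp a b c d + 1] (mod 12)"
    and "[eta_exp (- c) (- d) a b = eta_exp a b c d - 3] (mod 12)"
proof -
  have *: "[eta_exp (a + c) (b + d) c d = eta_exp a b c d + 1] (mod m) \<and> [eta_exp (- c) (- d) a b = eta_exp a b c d - 3] (mod m)"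
    if m: "m = 3 \<or> m = 4" for m
  proof -
    define a' b' c' d' where defs: "a' = a mod m" "b' = b mod m" "c' = c mod m" "d' = d mod m"
    have in': "x mod m \<in> set [0..m-1]" for x using m by auto
    have cg: "[a' = a] (mod m)" "[b' = b] (mod m)" "[c' = c] (mod m)" "[d' = d] (mod m)" unfolding defs by simp_all
    have "[a' * d' - b' * c' - 1 = a * d - b * c - 1] (mod m)" by (intro cong_diff cong_mult cong_refl cg)
    hence "[a' * d' - b' * c' - 1 = 0] (mod m)" using assms by simp
    hence "(a' * d' - b' * c' - 1) mod m = 0" by (simp only: cong_iff_dvd_diff mod_eq_0_iff_dvd diff_0_right)
    hence r: "(eta_exp (a' + c') (b' + d') c' d' - eta_exp a' b' c' d' - 1) mod m = 0"
      "(eta_exp (- c') (- d') a' b' - eta_exp a' b' c' d' + 3) mod m = 0"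
      using eta_exp_cases[OF m] in' unfolding defs by metis+
    have "[eta_exp (a' + c') (b' + d') c' d' - eta_exp a' b' c' d' - 1 = eta_exp (a + c) (b + d) c d - eta_exp a b c d - 1] (mod m)"
      by (intro cong_diff eta_exp_cong cong_add cong_refl cg)
    hence 1: "m dvd eta_exp (a + c) (b + d) c d - eta_exp a b c d - 1" using r by (simp add: cong_dvd_iff mod_eq_0_iff_dvd)
    have "[eta_exp (- c') (- d') a' b' - eta_exp a' b' c' d' + 3 = eta_exp (- c) (- d) a b - eta_exp a b c d + 3] (mod m)"
      by (intro cong_diff eta_exp_cong cong_add cong_refl cg cong_minus_minus_iff[THEN iffD2])
    hence 2: "m dvd eta_exp (- c) (- d) a b - eta_exp a b c d + 3" using r by (simp add: cong_dvd_iff mod_eq_0_iff_dvd)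
    from 1 2 show ?thesis by (simp add: cong_iff_dvd_diff algebra_simps)
  qed
  have "coprime 3 (4 :: int)"
  proof (rule coprimeI)
    fix c :: int assume "c dvd 3" "c dvd 4"
    hence "c dvd 4 - 3" using dvd_diff by blast
    thus "is_unit c" by simp
  qed
  from *[of 3] *[of 4] coprime_cong_mult[OF _ _ this]
  show "[eta_exp (a + c) (b + d) c d = eta_exp a b c d + 1] (mod 12)"
    and "[eta_exp (- c) (- d) a b = eta_exp a b c d - 3] (mod 12)" by fastforce+
qed

definition z12 :: complex where "z12 = exp (2 * of_real pi * \<i> / 12)"

lemma z12_nonzero [simp]: "z12 \<noteq> 0" by (simp add: z12_def)

lemma z12_pow_3: "z12 ^ 3 = \<i>"
proof -
  have "z12 ^ 3 = exp (of_real (pi / 2) * \<i>)"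
    by (simp add: z12_def exp_of_nat_mult[symmetric] mult_ac)
  thus ?thesis by (simp only: exp_Euler[of "of_real _", unfolded mult.commute[of \<i>]] flip: cos_of_real sin_of_real) simp
qed

lemma z12_pow_12: "z12 powi 12 = 1"
proof -
  have "z12 ^ 12 = (z12 ^ 3) ^ 4" by simp
  thus ?thesis by (simp add: z12_pow_3)
qed

lemma z12_powi_cong: "[e = e'] (mod 12) \<Longrightarrow> z12 powi e = z12 powi e'"
proof -
  assume "[e = e'] (mod 12)"
  then obtain k where "e = e' + 12 * k" by (metis cong_iff_lin cong_sym)
  thus ?thesis by (simp add: power_int_add power_int_mult z12_pow_12 del: power_int_numeral)
qed

lemma eta2_SL2:
  assumes det: "a * d - b * c = (1 :: int)" and z: "Im z > 0"
  shows "eta2 ((of_int a * z + of_int b) / (of_int c * z + of_int d)) = z12 powi (eta_exp a b c d) * (of_int c * z + of_int d) * eta2 z"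
  using det
proof (induction rule: SL2_induct)
  case id thus ?case by (simp add: eta_exp_def)
next
  case (T a b c d)
  note h = SL2_action[OF T(1) z]
  have "(of_int (a + c) * z + of_int (b + d)) / (of_int c * z + of_int d) = (of_int a * z + of_int b) / (of_int c * z + of_int d) + 1"
    using h(1) by (simp add: field_simps)
  thus ?case using eta2_plus_1[folded z12_def] T(2) z12_powi_cong[OF eta_exp_step(1)[OF T(1)]]
    by (simp add: power_int_add mult_ac)
next
  case (T_inv a b c d)
  have d: "(a - c) * d - (b - d) * c = 1" using T_inv(1) by (simp add: algebra_simps)
  note h = SL2_action[OF d z]
  have e: "(of_int a * z + of_int b) / (of_int c * z + of_int d) = (of_int (a - c) * z + of_int (b - d)) / (of_int c * z + of_int d) + 1"
    using h(1) by (simp add: field_simps)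
  have "z12 * eta2 ((of_int (a - c) * z + of_int (b - d)) / (of_int c * z + of_int d)) = eta2 ((of_int a * z + of_int b) / (of_int c * z + of_int d))"
    unfolding e eta2_plus_1 z12_def ..
  also have "\<dots> = z12 * (z12 powi (eta_exp (a - c) (b - d) c d) * (of_int c * z + of_int d) * eta2 z)"
    using T_inv(2) z12_powi_cong[OF eta_exp_step(1)[OF d]] by (simp add: power_int_add mult_ac)
  finally show ?case by simp
next
  case (S a b c d)
  note h = SL2_action[OF S(1) z]
  have p: "((of_int a * z + of_int b) / (of_int c * z + of_int d)) * (of_int c * z + of_int d) = of_int a * z + of_int b"
    using h(1) by simp
  have i3: "z12 powi (- 3) = - \<i>" using z12_pow_3 by (simp add: power_int_minus)
  have "z12 powi (eta_exp (- c) (- d) a b) = - \<i> * z12 powi (eta_exp a b c d)"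
    unfolding z12_powi_cong[OF eta_exp_step(2)[OF S(1)]] i3[symmetric] by (simp add: power_int_add[symmetric])
  thus ?case unfolding S_action[OF S(1) z] eta2_S[OF h(2)] S(2) using h(1) by (simp add: mult_ac)
qed

section \<open>Dilations and arithmetic progressions of coefficients\<close>

lemma conv_dilate:
  assumes "conv f" "l > 0"
  shows "conv (Abs_fps (\<lambda>n. if l dvd n then fps_nth f (n div l) else 0))"
    and "Im z > 0 \<Longrightarrow> ev (Abs_fps (\<lambda>n. if l dvd n then fps_nth f (n div l) else 0)) z = ev f (of_nat l * z)"
proof -
  let ?g = "Abs_fps (\<lambda>n. if l dvd n then fps_nth f (n div l) else 0)"
  have m: "strict_mono (\<lambda>n. l * n)" using assms by (auto simp: strict_mono_def)
  have *: "(\<lambda>n. fps_nth ?g n * q ^ n) sums eval_fps f (q ^ l)" if "norm q < 1" for q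
  proof -
    have "norm (q ^ l) < 1" using that assms by (simp add: norm_power power_less_one_iff)
    hence "(\<lambda>n. fps_nth f n * (q ^ l) ^ n) sums eval_fps f (q ^ l)"
      using assms convD sums_eval_fps by blast
    hence "(\<lambda>n. fps_nth ?g (l * n) * q ^ (l * n)) sums eval_fps f (q ^ l)" using assms by (simp add: power_mult)
    moreover have "fps_nth ?g n * q ^ n = 0" if "n \<notin> range (\<lambda>n. l * n)" for n using that by (auto elim!: dvdE)
    ultimately show ?thesis using sums_mono_reindex[OF m, of "\<lambda>n. fps_nth ?g n * q ^ n"] by simp
  qed
  show "conv ?g" unfolding conv_def fps_conv_radius_def
  proof (rule conv_radius_geI_ex)
    fix r :: real assume r: "0 < r" "ereal r < 1"
    show "\<exists>z. norm z = r \<and> summable (\<lambda>n. fps_nth ?g n * z ^ n)"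
      using *[of "of_real r"] r by (intro exI[of _ "of_real r"]) (auto simp: sums_iff)
  qed
  assume "Im z > 0"
  thus "ev ?g z = ev f (of_nat l * z)"
    using *[OF norm_qq_less_1[of z]] by (simp add: ev_def eval_fps_def sums_iff qq_of_nat_mult)
qed

text \<open>Absolute convergence at the l-th root of the radius, restricted to a subsequence of the
  exponents.\<close>

lemma conv_section:
  assumes "conv f" "l > 0"
  shows "conv (Abs_fps (\<lambda>n. fps_nth f (l * n + b)))"
  unfolding conv_def fps_conv_radius_def
proof (rule conv_radius_geI_ex)
  fix r :: real assume r: "0 < r" "ereal r < 1"
  define s where "s = root l r"
  have s: "s > 0" "s ^ l = r" using r assms by (auto simp: s_def real_root_gt_zero)
  have "s < 1" using r assms by (auto simp: s_def)
  hence c: "summable (\<lambda>n. norm (fps_nth f n * of_real s ^ n))"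
    using convD[OF assms(1), of "complex_of_real s"] s abs_summable_in_conv_radius[of "of_real s" "fps_nth f"]
    by (auto simp: fps_conv_radius_def)
  have "strict_mono (\<lambda>n. l * n + b)" using assms by (auto simp: strict_mono_def)
  hence "summable (\<lambda>n. norm (fps_nth f (l * n + b) * of_real s ^ (l * n + b)))"
    using summable_mono_reindex c summable_reindex[OF c, of "\<lambda>n. l * n + b"] by (auto simp: comp_def strict_mono_imp_increasing strict_mono_on_imp_inj_on)
  hence "summable (\<lambda>n. fps_nth f (l * n + b) * of_real s ^ (l * n + b))" by (rule summable_norm_cancel)
  hence "summable (\<lambda>n. (fps_nth f (l * n + b) * of_real s ^ (l * n + b)) / of_real s ^ b)" by (rule summable_divide)
  moreover have "(fps_nth f (l * n + b) * of_real s ^ (l * n + b)) / of_real s ^ b = fps_nth (Abs_fps (\<lambda>n. fps_nth f (l * n + b))) n * of_real r ^ n" for n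
    using s by (simp add: power_add power_mult flip: s(2))
  ultimately show "\<exists>z. norm z = r \<and> summable (\<lambda>n. fps_nth (Abs_fps (\<lambda>n. fps_nth f (l * n + b))) n * z ^ n)"
    using r by (intro exI[of _ "of_real r"]) auto
qed

text \<open>The average over the l points (z + 24 j)/l filters the exponents (h + 12 n)/12 with l
  dividing h + 12 n. Shifts by multiples of 24 are used because they do not disturb the multiplier
  of eta.\<close>

lemma ev_section:
  assumes f: "conv f" and l: "l > 0" and b: "b < l" and z: "Im z > 0"
    and cp: "\<And>n. l dvd (h + 12 * n) \<longleftrightarrow> n mod l = b" and h': "l * h' = h + 12 * b"
  shows "exp (2 * of_real pi * \<i> * z * of_nat h' / 12) * ev (Abs_fps (\<lambda>n. fps_nth f (l * n + b))) z
     = (1 / of_nat l) * (\<Sum>j<l. exp (2 * of_real pi * \<i> * ((z + 24 * of_nat j) / of_nat l) * of_nat h / 12) * ev f ((z + 24 * of_nat j) / of_nat l))"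
proof -
  let ?w = "\<lambda>j. (z + 24 * of_nat j) / of_nat l :: complex"
  let ?e = "\<lambda>n z. exp (2 * of_real pi * \<i> * z * of_nat (h + 12 * n) / 12)"
  have w: "Im (?w j) > 0" for j using z l by (simp add: Im_divide_of_nat)
  have e: "exp (2 * of_real pi * \<i> * z * of_nat h / 12) * qq z ^ n = ?e n z" for n z
    unfolding qq_def exp_of_nat_mult[symmetric] exp_add[symmetric] by (rule arg_cong[of _ _ exp]) (simp add: field_simps)
  have s1: "(\<lambda>n. fps_nth f n * ?e n (?w j)) sums (exp (2 * of_real pi * \<i> * ?w j * of_nat h / 12) * ev f (?w j))" for j
    using sums_mult[OF ev_sums[OF f w[of j]], of "exp (2 * of_real pi * \<i> * ?w j * of_nat h / 12)"]
    unfolding e[symmetric] by (simp add: mult_ac)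
  have s2: "(\<lambda>n. \<Sum>j<l. fps_nth f n * ?e n (?w j)) sums (\<Sum>j<l. exp (2 * of_real pi * \<i> * ?w j * of_nat h / 12) * ev f (?w j))"
    by (rule sums_sum) (rule s1)
  have root: "(\<Sum>j<l. ?e n (?w j)) = (if n mod l = b then of_nat l * exp (2 * of_real pi * \<i> * z * of_nat ((h + 12 * n) div l) / 12) else 0)" for n
  proof -
    let ?r = "exp (2 * of_real pi * \<i> * of_nat (2 * (h + 12 * n)) / of_nat l)"
    have "?e n (?w j) = ?e n (z / of_nat l) * ?r ^ j" for j
      unfolding exp_of_nat_mult[symmetric] exp_add[symmetric] using l
      by (intro arg_cong[of _ _ exp]) (simp add: divide_simps algebra_simps)
    hence S: "(\<Sum>j<l. ?e n (?w j)) = ?e n (z / of_nat l) * (\<Sum>j<l. ?r ^ j)" by (simp add: sum_distrib_left)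
    show ?thesis
    proof (cases "n mod l = b")
      case True
      hence "l dvd h + 12 * n" using cp[of n] by blast
      then obtain k where k: "h + 12 * n = l * k" by (rule dvdE)
      have "?r = exp (of_nat (2 * k) * (2 * of_real pi * \<i>))" unfolding k using l by (simp add: mult_ac)
      also have "\<dots> = 1" unfolding exp_of_nat_mult by simp
      finally have r: "?r = 1" .
      have "?e n (z / of_nat l) = exp (2 * of_real pi * \<i> * z * of_nat k / 12)" unfolding k using l by (simp add: mult_ac)
      thus ?thesis using True S r l by (simp add: k)
    next
      case False
      have "?r ^ l = exp (of_nat (2 * (h + 12 * n)) * (2 * of_real pi * \<i>))"
        using l unfolding exp_of_nat_mult[symmetric] by (simp add: mult_ac)
      also have "\<dots> = 1" unfolding exp_of_nat_mult by simp
      finally have rl: "?r ^ l = 1" .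
      have "?r \<noteq> 1"
      proof
        assume "?r = 1"
        then obtain i :: int where i: "Im (2 * of_real pi * \<i> * of_nat (2 * (h + 12 * n)) / of_nat l) = of_int (2 * i) * pi"
          unfolding exp_eq_1 by blast
        have "Im (2 * of_real pi * \<i> * of_nat (2 * (h + 12 * n)) / of_nat l) = 2 * pi * real (2 * (h + 12 * n)) / real l"
          by (simp add: Im_divide_of_nat)
        hence "pi * (2 * real (2 * (h + 12 * n))) = pi * (2 * (of_int i * real l))" using l i by (simp add: field_simps)
        hence "2 * real (2 * (h + 12 * n)) = 2 * (of_int i * real l)" using pi_neq_zero mult_left_cancel by blast
        hence "real (2 * (h + 12 * n)) = of_int i * real l" by simp
        hence "int (2 * (h + 12 * n)) = i * int l" by (metis of_int_eq_iff of_int_mult of_int_of_nat_eq)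
        hence "int l dvd int (2 * (h + 12 * n))" by simp
        hence "l dvd 2 * (h + 12 * n)" by presburger
        \<comment> \<open>The root of unity has exponent 2(h + 12 n)/l. If l were even, b + l/2
          would satisfy the divisibility in \<open>cp\<close> as well, against the uniqueness of the
          residue b.\<close>
        moreover have "coprime l 2"
        proof -
          have "odd l"
          proof
            assume "even l"
            then obtain m where m: "l = 2 * m" by auto
            have "l dvd h + 12 * b" using h' by (metis dvd_triv_left)
            hence "l dvd h + 12 * (b + m)" using m by (simp add: distrib_left) (metis add.assoc dvd_add dvd_triv_left mult.assoc mult_2_right numeral_Bit0 mult.commute dvd_mult)
            hence "(b + m) mod l = b mod l" using cp[of "b + m"] b by simp
            hence "l dvd m" using m mod_eq_dvd_iff_nat[of b "b+m" l] by (metis add_diff_cancel_left' le_add1)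
            thus False using m l by (auto dest: dvd_imp_le)
          qed
          thus ?thesis by simp
        qed
        ultimately have "l dvd h + 12 * n" using coprime_dvd_mult_right_iff by blast
        thus False using False cp by simp
      qed
      hence "(\<Sum>j<l. ?r ^ j) = 0" using rl by (simp add: geometric_sum)
      thus ?thesis using False S by simp
    qed
  qed
  have s3: "(\<lambda>n. if n mod l = b then of_nat l * (fps_nth f n * exp (2 * of_real pi * \<i> * z * of_nat ((h + 12 * n) div l) / 12)) else 0) sums (\<Sum>j<l. exp (2 * of_real pi * \<i> * ?w j * of_nat h / 12) * ev f (?w j))"
    using s2 unfolding sum_distrib_left[symmetric] root by (rule sums_cong[THEN iffD1, rotated]) (simp add: mult_ac)
  have m: "strict_mono (\<lambda>n. l * n + b)" using l by (auto simp: strict_mono_def)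
  have "(\<lambda>n. of_nat l * (fps_nth f (l * n + b) * exp (2 * of_real pi * \<i> * z * of_nat ((h + 12 * (l * n + b)) div l) / 12))) sums (\<Sum>j<l. exp (2 * of_real pi * \<i> * ?w j * of_nat h / 12) * ev f (?w j))"
  proof -
    have "n \<in> range (\<lambda>n. l * n + b)" if "n mod l = b" for n
      using that by (metis mult_div_mod_eq rangeI)
    hence z0: "(if n mod l = b then of_nat l * (fps_nth f n * exp (2 * of_real pi * \<i> * z * of_nat ((h + 12 * n) div l) / 12)) else 0) = 0"
      if "n \<notin> range (\<lambda>n. l * n + b)" for n using that by auto
    have "(\<lambda>n. (\<lambda>n. if n mod l = b then of_nat l * (fps_nth f n * exp (2 * of_real pi * \<i> * z * of_nat ((h + 12 * n) div l) / 12)) else 0) (l * n + b)) sums (\<Sum>j<l. exp (2 * of_real pi * \<i> * ?w j * of_nat h / 12) * ev f (?w j))"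
      by (subst sums_mono_reindex[OF m]) (use z0 s3 in auto)
    thus ?thesis using b by simp
  qed
  moreover have "exp (2 * of_real pi * \<i> * z * of_nat ((h + 12 * (l * n + b)) div l) / 12) = exp (2 * of_real pi * \<i> * z * of_nat h' / 12) * qq z ^ n" for n
  proof -
    have "h + 12 * (l * n + b) = l * (h' + 12 * n)" using h' by (simp add: distrib_left)
    hence "(h + 12 * (l * n + b)) div l = h' + 12 * n" using l by simp
    thus ?thesis unfolding qq_def exp_of_nat_mult[symmetric] exp_add[symmetric]
      by (intro arg_cong[of _ _ exp]) (simp add: field_simps)
  qed
  ultimately have "(\<lambda>n. of_nat l * exp (2 * of_real pi * \<i> * z * of_nat h' / 12) * (fps_nth (Abs_fps (\<lambda>n. fps_nth f (l * n + b))) n * qq z ^ n)) sums (\<Sum>j<l. exp (2 * of_real pi * \<i> * ?w j * of_nat h / 12) * ev f (?w j))"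
    by (simp add: mult_ac)
  from sums_unique2[OF this sums_mult[OF ev_sums[OF conv_section[OF f l] z]]]
  show ?thesis using l by (simp add: mult.assoc)
qed

section \<open>The Hecke operator\<close>

definition dilate :: "nat \<Rightarrow> 'a :: zero fps \<Rightarrow> 'a fps" where
  "dilate l f = Abs_fps (\<lambda>n. if l dvd n then fps_nth f (n div l) else 0)"

definition slice :: "nat \<Rightarrow> nat \<Rightarrow> 'a fps \<Rightarrow> 'a fps" where
  "slice l b f = Abs_fps (\<lambda>n. fps_nth f (l * n + b))"

lemma cx_dilate: "cx (dilate l f) = dilate l (cx f)" by (rule fps_ext) (simp add: dilate_def)
lemma cx_slice: "cx (slice l b f) = slice l b (cx f)" by (rule fps_ext) (simp add: slice_def)

lemma not_dvd_2_3:
  fixes l :: nat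
  assumes "prime l" "l > 3"
  shows "\<not> l dvd 2 ^ a * 3 ^ b"
proof
  assume "l dvd 2 ^ a * 3 ^ b"
  hence "l dvd 2 \<or> l dvd 3" using assms(1) prime_dvd_mult_iff prime_dvd_power by blast
  thus False using assms(2) by (auto dest!: dvd_imp_le)
qed

lemma prime_square_mod_24:
  fixes l :: nat
  assumes "prime l" "l > 3"
  shows "\<exists>y. l ^ 2 = 1 + 24 * y"
proof -
  have "odd l" using assms prime_odd_nat by auto
  hence "\<not> 2 dvd l" "\<not> 3 dvd l" using assms primes_dvd_imp_eq[of 3 l] by auto
  hence "l mod 24 \<in> {1,5,7,11,13,17,19,23}" by (simp add: dvd_eq_mod_eq_0) presburger
  hence "(l mod 24) ^ 2 mod 24 = 1" by auto
  hence "l ^ 2 mod 24 = 1" by (simp add: power_mod)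
  thus ?thesis by (metis add.commute mod_mult_div_eq)
qed

text \<open>The Hecke operator of index l applied to eta^(2h) F, a function of weight w + h. The
  image has the multiplier of eta^(2h'); its lowest exponents are kept in the series, and
  multiplying by \<open>Pf ^ (2 * h')\<close> divides out eta^(2h'). The two equations for h' and v
  say that both the progression part and the dilated part start with q^(h'/12) times integral powers
  of q.\<close>

theorem hecke_mform:
  fixes l h h' b v w :: nat
  assumes l: "prime l" "l > 3" and F: "mform (int w) F" and b: "b < l"
    and h': "l * h' = h + 12 * b" and v: "l * h = h' + 12 * v" and wh: "w + h \<ge> 1"
  shows "mform (int w + int h - int h') (Pf ^ (2 * h') * (slice l b (Phi ^ (2 * h) * F)
    + fps_const ((-1) ^ ((l - 1) div 2 * h) * of_nat l ^ (w + h - 1)) * fps_X ^ v * dilate l (Phi ^ (2 * h) * F)))"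
    (is "mform _ (_ * ?B)")
proof (rule mformI)
  define A where "A = Phi ^ (2 * h) * F"
  define \<kappa> :: complex where "\<kappa> = (-1) ^ ((l - 1) div 2 * h)"
  define f where "f z = eta2 z ^ h * ev (cx F) z" for z
  define g where "g z = exp (2 * of_real pi * \<i> * z * of_nat h' / 12) * ev (cx ?B) z" for z
  have l0: "l > 0" using l by simp
  have lodd: "odd l" using l prime_odd_nat by auto
  have cA: "conv (cx A)" using mform_conv[OF F] by (auto simp: A_def)
  have cs: "conv (slice l b (cx A))" "conv (dilate l (cx A))"
    unfolding slice_def dilate_def by (rule conv_section[OF cA l0] conv_dilate(1)[OF cA l0])+
  have cB: "conv (cx ?B)" unfolding A_def[symmetric]
    by (simp add: cx_slice cx_dilate cs conv_add conv_mult conv_power)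
  thus "conv (cx (Pf ^ (2 * h') * ?B))" by (simp add: conv_mult conv_power del: cx_add)
  have fexp: "f z = exp (2 * of_real pi * \<i> * z * of_nat h / 12) * ev (cx A) z" if "Im z > 0" for z
    using that mform_conv[OF F] unfolding f_def A_def eta2_def
    by (simp add: ev_mult ev_power conv_power power_mult_distrib exp_of_nat_mult[symmetric] power_mult[symmetric] mult_ac)
  have fSL2: "f ((of_int a * z + of_int b) / (of_int c * z + of_int d)) = (z12 powi (eta_exp a b c d)) ^ h * (of_int c * z + of_int d) ^ (w + h) * f z"
    if "a * d - b * c = 1" "Im z > 0" for a b c d z
  proof -
    have "ev (cx F) ((of_int a * z + of_int b) / (of_int c * z + of_int d)) = (of_int c * z + of_int d) powi int w * ev (cx F) z"
      by (rule modular_from_generators[OF _ _ that]) (use mform_S[OF F] in auto)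
    thus ?thesis unfolding f_def eta2_SL2[OF that] by (simp add: power_mult_distrib power_add mult_ac)
  qed
  have fS: "f (- 1 / z) = (- \<i>) ^ h * z ^ (w + h) * f z" if "Im z > 0" for z
    unfolding f_def eta2_S[OF that] mform_S[OF F that] power_mult_distrib power_add power_int_of_nat by (simp only: mult_ac)
  \<comment> \<open>Under z -> -1/z the summand at j = 0 and the dilated term pick up (-i)^h, the
    other summands (-i)^(h'). The sign \<open>\<kappa>\<close> reconciles them, since l h and h'
    agree modulo 12.\<close>
  have k1: "(- \<i>) ^ (l * h) = \<kappa> * (- \<i>) ^ h"
  proof -
    obtain u where u: "l = 2 * u + 1" using lodd by (auto elim: oddE)
    have "l * h = 2 * (u * h) + h" by (simp add: u distrib_right)
    thus ?thesis by (simp add: \<kappa>_def u power_add power_mult)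
  qed
  have k2: "(- \<i>) ^ (l * h) = (- \<i>) ^ h'"
  proof -
    have "(- \<i>) ^ 12 = ((- \<i>) ^ 4) ^ 3" by simp
    also have "\<dots> = 1" by simp
    finally show ?thesis unfolding v power_add power_mult by simp
  qed
  have kk: "\<kappa> * \<kappa> = 1" unfolding \<kappa>_def by (simp flip: power_mult_distrib)
  have cp: "l dvd (h + 12 * n) \<longleftrightarrow> n mod l = b" for n
  proof -
    have "coprime l 12"
    proof -
      have "\<not> l dvd 12" using not_dvd_2_3[OF l, of 2 1] by simp
      thus ?thesis using l(1) by (simp add: prime_imp_coprime)
    qed
    hence "[12 * n = 12 * b] (mod l) \<longleftrightarrow> [n = b] (mod l)" by (simp add: cong_mult_lcancel_nat coprime_commute)
    moreover have "[h + 12 * b = 0] (mod l)" unfolding h'[symmetric] by (simp add: cong_0_iff)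
    hence "l dvd (h + 12 * n) \<longleftrightarrow> [h + 12 * n = h + 12 * b] (mod l)" by (metis cong_0_iff cong_sym cong_trans)
    ultimately show ?thesis using b by (simp add: cong_add_lcancel_nat) (simp add: Cong.cong_def)
  qed
  define m where "m = w + h - 1"
  have m: "w + h = Suc m" using wh by (simp add: m_def)
  have geq: "g z = (1 / of_nat l) * (\<Sum>j<l. f ((z + 24 * of_nat j) / of_nat l)) + \<kappa> * of_nat l ^ m * f (of_nat l * z)" if z: "Im z > 0" for z
  proof -
    have i1: "Im ((z + 24 * of_nat j) / of_nat l) > 0" for j using z l0 by (simp add: Im_divide_of_nat)
    have i2: "Im (of_nat l * z) > 0" using z l0 by simp
    have evB: "ev (cx ?B) z = ev (slice l b (cx A)) z + \<kappa> * of_nat l ^ m * qq z ^ v * ev (cx A) (of_nat l * z)"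
      using z conv_dilate(2)[OF cA l0 z, folded dilate_def] cs
      unfolding A_def[symmetric] m_def[symmetric]
      by (simp add: cx_slice cx_dilate ev_add ev_mult ev_power conv_mult conv_power \<kappa>_def of_rat_mult of_rat_power of_rat_minus)
    have x: "exp (2 * of_real pi * \<i> * z * of_nat h' / 12) * qq z ^ v = exp (2 * of_real pi * \<i> * (of_nat l * z) * of_nat h / 12)"
    proof -
      have "of_nat l * of_nat h = (of_nat h' + 12 * of_nat v :: complex)" using arg_cong[OF v, of "of_nat :: nat \<Rightarrow> complex"] by simp
      moreover have "2 * of_real pi * \<i> * (of_nat l * z) * of_nat h / 12 = 2 * of_real pi * \<i> * z * (of_nat l * of_nat h) / (12 :: complex)"
        by (simp add: mult_ac)
      ultimately have "2 * of_real pi * \<i> * (of_nat l * z) * of_nat h / 12 = 2 * of_real pi * \<i> * z * (of_nat h' + 12 * of_nat v) / (12 :: complex)"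
        by (simp only:)
      moreover have "\<dots> = 2 * of_real pi * \<i> * z * of_nat h' / 12 + of_nat v * (2 * of_real pi * \<i> * z)"
        by (simp add: add_divide_distrib distrib_left mult_ac)
      ultimately show ?thesis unfolding qq_def exp_of_nat_mult[symmetric] exp_add[symmetric] by (simp only:)
    qed
    show ?thesis
      unfolding g_def evB
      unfolding distrib_left slice_def ev_section[OF cA l0 b z cp h'] fexp[OF i1] fexp[OF i2] x[symmetric]
      by (simp add: mult_ac)
  qed
  have gS: "g (- 1 / z) = (- \<i>) ^ h' * z ^ (w + h) * g z" if z: "Im z > 0" for z
  proof -
    have z0: "z \<noteq> 0" using z by auto
    have ln: "of_nat l \<noteq> (0 :: complex)" using l0 by simp
    have t1: "f (of_nat l * (- 1 / z)) = (- \<i>) ^ h * (z / of_nat l) ^ (w + h) * f (z / of_nat l)"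
    proof -
      have "Im (z / of_nat l) > 0" using z l0 by (simp add: Im_divide_of_nat)
      from fS[OF this] show ?thesis by simp
    qed
    have t2: "f ((- 1 / z + 24 * of_nat 0) / of_nat l) = (- \<i>) ^ h * (of_nat l * z) ^ (w + h) * f (of_nat l * z)"
    proof -
      have "Im (of_nat l * z) > 0" using z l0 by simp
      from fS[OF this] show ?thesis by (simp add: mult.commute)
    qed
    \<comment> \<open>For j \<noteq> 0 the inversion sends the point with shift j to a point with
      shift j', where 576 j j' is -1 modulo l; this permutes the nonzero shifts, while j = 0 is
      exchanged with the dilation.\<close>
    have "\<exists>j'. j' \<in> {1..<l} \<and> int l dvd 576 * int j * int j' + 1" if j: "j \<in> {1..<l}" for j
    proof -
      have "\<not> l dvd j" using j by (auto dest: dvd_imp_le)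
      moreover have "\<not> l dvd 576" using not_dvd_2_3[OF l, of 6 2] by simp
      ultimately have "\<not> l dvd 576 * j" using l(1) by (auto simp: prime_dvd_mult_iff)
      hence "coprime (576 * j) l" using l(1) by (metis coprime_commute prime_imp_coprime)
      then obtain x where x: "[576 * j * x = 1] (mod l)" using cong_solve_coprime_nat by (metis One_nat_def)
      define j' where "j' = nat ((- int x) mod int l)"
      have ij: "int j' = (- int x) mod int l" using l0 by (simp add: j'_def)
      have "[int (576 * j * x) = 1] (mod int l)" using x by (metis cong_int_iff of_nat_1)
      hence "[576 * int j * int j' + 1 = 576 * int j * (- int x) + int (576 * j * x)] (mod int l)"
        unfolding ij by (intro cong_add cong_mult cong_refl) (auto intro: cong_sym)
      hence d: "int l dvd 576 * int j * int j' + 1" by (simp add: cong_0_iff)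
      have "j' \<noteq> 0" using d l by (intro notI) auto
      moreover have "j' < l" using ij l0 by (metis of_nat_0_less_iff of_nat_less_iff pos_mod_bound)
      ultimately show ?thesis using d by (intro exI[of _ j']) auto
    qed
    then obtain \<sigma> where \<sigma>: "\<And>j. j \<in> {1..<l} \<Longrightarrow> \<sigma> j \<in> {1..<l} \<and> int l dvd 576 * int j * int (\<sigma> j) + 1" by metis
    have inj: "inj_on \<sigma> {1..<l}"
    proof (rule inj_onI)
      fix i j assume ij: "i \<in> {1..<l}" "j \<in> {1..<l}" "\<sigma> i = \<sigma> j"
      have "int l dvd (576 * int i * int (\<sigma> i) + 1) * int j - (576 * int j * int (\<sigma> j) + 1) * int i"
        using \<sigma>[OF ij(1)] \<sigma>[OF ij(2)] by (intro dvd_diff dvd_mult2) auto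
      also have "\<dots> = int j - int i" using ij(3) by (simp add: algebra_simps)
      finally have "[int j = int i] (mod int l)" by (simp add: cong_iff_dvd_diff)
      hence "[j = i] (mod l)" by (simp add: cong_int_iff)
      thus "i = j" using ij by (simp add: Cong.cong_def)
    qed
    hence bij: "bij_betw \<sigma> {1..<l} {1..<l}"
      using \<sigma> by (intro bij_betw_imageI endo_inj_surj) auto
    have t3: "f ((- 1 / z + 24 * of_nat j) / of_nat l) = (- \<i>) ^ h' * z ^ (w + h) * f ((z + 24 * of_nat (\<sigma> j)) / of_nat l)" if j: "j \<in> {1..<l}" for j
    proof -
      obtain b' where b': "576 * int j * int (\<sigma> j) + 1 = - (int l * b')" using \<sigma>[OF j] by (metis dvdE minus_mult_right minus_minus)
      let ?u = "(z + 24 * of_nat (\<sigma> j)) / of_nat l"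
      have u: "Im ?u > 0" using z l0 by (simp add: Im_divide_of_nat)
      have det: "(24 * int j) * (- (24 * int (\<sigma> j))) - b' * int l = 1" using b' by (simp add: algebra_simps)
      have "of_int (576 * int j * int (\<sigma> j) + 1) = (of_int (- (int l * b')) :: complex)" using b' by simp
      hence bc: "576 * of_nat j * of_nat (\<sigma> j) + of_nat l * of_int b' = (- 1 :: complex)" by (simp add: algebra_simps eq_neg_iff_add_eq_0)
      have den: "of_int (int l) * ?u + of_int (- (24 * int (\<sigma> j))) = z" using ln by simp
      have num: "of_int (24 * int j) * ?u + of_int b' = (24 * of_nat j * z - 1) / of_nat l"
      proof -
        have "of_int b' = (- 1 - 576 * of_nat j * of_nat (\<sigma> j)) / (of_nat l :: complex)" using bc ln by (simp add: field_simps)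
        thus ?thesis using ln by (simp add: field_simps)
      qed
      have act: "(of_int (24 * int j) * ?u + of_int b') / (of_int (int l) * ?u + of_int (- (24 * int (\<sigma> j)))) = (- 1 / z + 24 * of_nat j) / of_nat l"
        unfolding den num using z0 ln by (simp add: field_simps)
      \<comment> \<open>The diagonal entries are divisible by 24 and l^2 is 1 modulo 24, so only the
        term -3 c with c = l survives.\<close>
      have ee: "[eta_exp (24 * int j) b' (int l) (- (24 * int (\<sigma> j))) = - 3 * int l] (mod 12)"
      proof -
        obtain y' where "l ^ 2 = 1 + 24 * y'" using prime_square_mod_24[OF l] by blast
        hence "int (l ^ 2) = int (1 + 24 * y')" by (simp only:)
        then obtain y where y: "int l ^ 2 = 1 + 24 * y" by simp
        have "eta_exp (24 * int j) b' (int l) (- (24 * int (\<sigma> j))) - (- 3 * int l) = 12 * (- 2 * y * (b' * (- (24 * int (\<sigma> j))) + 3 * (int l - 1) * (- (24 * int (\<sigma> j))) + int l + 3) + int l * (2 * int j - 2 * int (\<sigma> j)))"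
          unfolding eta_exp_def y by (simp add: algebra_simps)
        thus ?thesis unfolding cong_iff_dvd_diff by simp
      qed
      have "(z12 powi (eta_exp (24 * int j) b' (int l) (- (24 * int (\<sigma> j))))) ^ h = (- \<i>) ^ (l * h)"
      proof -
        have "z12 powi (- 3 * int l) = (z12 powi (- 3)) powi int l" by (rule power_int_mult)
        also have "z12 powi (- 3) = - \<i>" using z12_pow_3 by (simp add: power_int_minus)
        finally have "z12 powi (- 3 * int l) = (- \<i>) ^ l" by simp
        thus ?thesis unfolding z12_powi_cong[OF ee] power_mult by simp
      qed
      thus ?thesis using fSL2[OF det u] unfolding act by (simp only: den k2)
    qed
    have split: "(\<Sum>j<l. y j) = y 0 + (\<Sum>j\<in>{1..<l}. y j)" for y :: "nat \<Rightarrow> complex"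
    proof -
      have "{..<l} = insert 0 {1..<l}" using l0 by auto
      thus ?thesis by simp
    qed
    have s: "(\<Sum>j<l. f ((- 1 / z + 24 * of_nat j) / of_nat l)) = (- \<i>) ^ h * (of_nat l * z) ^ (w + h) * f (of_nat l * z) + (- \<i>) ^ h' * z ^ (w + h) * (\<Sum>j\<in>{1..<l}. f ((z + 24 * of_nat j) / of_nat l))"
      unfolding split t2 sum.reindex_bij_betw[OF bij, of "\<lambda>j. f ((z + 24 * of_nat j) / of_nat l)", symmetric] sum_distrib_left
      using t3 by (simp only: cong: sum.cong)
    have gen: "(1 / L) * (I * (L * z) ^ Suc m * X + I' * z ^ Suc m * Y) + K * L ^ m * (I * (z / L) ^ Suc m * Z) = I' * z ^ Suc m * ((1 / L) * (Z + Y) + K * L ^ m * X)"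
      if "I' = K * I" "K * K = 1" "L \<noteq> 0" for L I I' K X Y Z :: complex
    proof -
      have "I = K * I'" using that by (simp add: mult.assoc[symmetric])
      have a: "(1 / L) * (I * (L * z) ^ Suc m * X) = I' * z ^ Suc m * (K * L ^ m * X)"
        unfolding \<open>I = _\<close> using that(3) by (simp add: power_mult_distrib)
      have b: "K * L ^ m * (I * (z / L) ^ Suc m * Z) = I' * z ^ Suc m * ((1 / L) * Z)"
        unfolding \<open>I' = _\<close> using that(3) by (simp add: power_divide field_simps)
      show ?thesis unfolding distrib_left a b by (simp add: algebra_simps)
    qed
    show ?thesis unfolding geq[OF z] geq[OF Im_minus_inverse_pos[OF z]] s t1 m
      unfolding split[of "\<lambda>j. f ((z + 24 * of_nat j) / of_nat l)"] of_nat_0 mult_zero_right add_0_right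
      by (rule gen) (use k1 k2 kk ln in auto)
  qed
  have gev: "g z = eta2 z ^ h' * ev (cx (Pf ^ (2 * h') * ?B)) z" if z: "Im z > 0" for z
  proof -
    have "ev (cx (Pf ^ (2 * h') * ?B)) z = ev (cx Pf) z ^ (2 * h') * ev (cx ?B) z"
      using cB z unfolding cx_mult[of "Pf ^ (2 * h')"] by (simp only: ev_mult ev_power conv_power conv_Pf cx_power)
    moreover have "eta2 z ^ h' = exp (2 * of_real pi * \<i> * z * of_nat h' / 12) * ev (cx Phi) z ^ (2 * h')"
      unfolding eta2_def by (simp add: power_mult_distrib exp_of_nat_mult[symmetric] power_mult[symmetric] mult_ac)
    moreover have "ev (cx Phi) z ^ (2 * h') * ev (cx Pf) z ^ (2 * h') = 1"
      unfolding power_mult_distrib[symmetric] ev_Phi_Pf[OF z] by simp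
    ultimately show ?thesis unfolding g_def by (simp add: mult.assoc[symmetric])
  qed
  fix z assume z: "Im z > 0"
  have z0: "z \<noteq> 0" using z by auto
  have "((- \<i>) * z * eta2 z) ^ h' * ev (cx (Pf ^ (2 * h') * ?B)) (- 1 / z) = (- \<i>) ^ h' * z ^ (w + h) * (eta2 z ^ h' * ev (cx (Pf ^ (2 * h') * ?B)) z)"
    using gS[OF z] unfolding gev[OF z] gev[OF Im_minus_inverse_pos[OF z]] eta2_S[OF z] .
  hence "((- \<i>) ^ h' * eta2 z ^ h') * (z ^ h' * ev (cx (Pf ^ (2 * h') * ?B)) (- 1 / z)) = ((- \<i>) ^ h' * eta2 z ^ h') * (z ^ (w + h) * ev (cx (Pf ^ (2 * h') * ?B)) z)"
    unfolding power_mult_distrib by (simp only: mult_ac)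
  hence "z ^ h' * ev (cx (Pf ^ (2 * h') * ?B)) (- 1 / z) = z ^ (w + h) * ev (cx (Pf ^ (2 * h') * ?B)) z"
    using eta2_nonzero[OF z] by (subst (asm) mult_left_cancel) auto
  moreover have p: "z powi (int w + int h - int h') = z ^ (w + h) / z ^ h'"
    using z0 by (simp add: power_int_diff power_int_add power_add)
  moreover have gen: "X = P / Q * Y" if "Q * X = P * Y" "Q \<noteq> 0" for X P Q Y :: complex using that by (simp add: field_simps)
  ultimately show "ev (cx (Pf ^ (2 * h') * ?B)) (- 1 / z) = z powi (int w + int h - int h') * ev (cx (Pf ^ (2 * h') * ?B)) z"
    unfolding p using z0 by (intro gen) auto
qed

section \<open>Integrality at a prime\<close>

lemma l_integral_iff:
  assumes "prime l"
  shows "l_integral l x \<longleftrightarrow> (\<exists>a b. \<not> int l dvd b \<and> x * of_int b = of_int a)"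
proof
  obtain p q where pq: "quotient_of x = (p, q)" by fastforce
  have q: "q > 0" "coprime p q" and x: "x = of_int p / of_int q"
    using quotient_of_denom_pos[OF pq] quotient_of_coprime[OF pq] quotient_of_div[OF pq] by auto
  assume "l_integral l x"
  thus "\<exists>a b. \<not> int l dvd b \<and> x * of_int b = of_int a" using pq q x by (intro exI[of _ p] exI[of _ q]) (auto simp: l_integral_def)
next
  obtain p q where pq: "quotient_of x = (p, q)" by fastforce
  have q: "q > 0" "coprime p q" and x: "x = of_int p / of_int q"
    using quotient_of_denom_pos[OF pq] quotient_of_coprime[OF pq] quotient_of_div[OF pq] by auto
  assume "\<exists>a b. \<not> int l dvd b \<and> x * of_int b = of_int a"
  then obtain a b where ab: "\<not> int l dvd b" "x * of_int b = of_int a" by blast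
  have "of_int (p * b) = (of_int (a * q) :: rat)" using ab(2) q unfolding x by (simp add: field_simps)
  hence "p * b = a * q" by (simp only: of_int_eq_iff)
  hence "q dvd p * b" by simp
  hence "q dvd b" using q(2) by (simp add: coprime_commute coprime_dvd_mult_right_iff)
  hence "\<not> int l dvd q" using ab(1) dvd_trans by blast
  thus "l_integral l x" using pq by (simp add: l_integral_def)
qed

section \<open>Rational numbers and power series integral at l\<close>

locale large_prime =
  fixes l :: nat
  assumes prime_l: "prime l" and l_gt_3: "l > 3"
begin

abbreviation "li \<equiv> l_integral l"

lemma l_pos: "l > 0" using l_gt_3 by simp

lemma ndvd_mult: "\<not> int l dvd a \<Longrightarrow> \<not> int l dvd b \<Longrightarrow> \<not> int l dvd a * b"
  using prime_l by (simp add: prime_dvd_mult_iff)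

lemma li_iff: "li x \<longleftrightarrow> (\<exists>a b. \<not> int l dvd b \<and> x * of_int b = of_int a)"
  by (rule l_integral_iff[OF prime_l])

lemma li_of_int [simp]: "li (of_int n)"
  unfolding li_iff using l_gt_3 by (intro exI[of _ n] exI[of _ 1]) auto

lemma li_of_nat [simp]: "li (of_nat n)" using li_of_int[of "int n"] by simp
lemma li_numeral [simp]: "li (numeral n)" using li_of_int[of "numeral n"] by simp
lemma li_0 [simp]: "li 0" and li_1 [simp]: "li 1" using li_of_int[of 0] li_of_int[of 1] by simp_all

lemma li_Ints: "x \<in> \<int> \<Longrightarrow> li x" by (auto elim: Ints_cases)

lemma li_add: "li x \<Longrightarrow> li y \<Longrightarrow> li (x + y)"
proof -
  assume "li x" "li y"
  then obtain a b a' b' where h: "\<not> int l dvd b" "x * of_int b = of_int a" "\<not> int l dvd b'" "y * of_int b' = of_int a'"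
    unfolding li_iff by blast
  have "(x + y) * of_int (b * b') = of_int (a * b' + a' * b)"
    by (simp add: distrib_right flip: h(2,4))
  thus ?thesis unfolding li_iff using ndvd_mult h by blast
qed

lemma li_mult: "li x \<Longrightarrow> li y \<Longrightarrow> li (x * y)"
proof -
  assume "li x" "li y"
  then obtain a b a' b' where h: "\<not> int l dvd b" "x * of_int b = of_int a" "\<not> int l dvd b'" "y * of_int b' = of_int a'"
    unfolding li_iff by blast
  have "(x * y) * of_int (b * b') = of_int (a * a')" by (simp add: mult_ac flip: h(2,4))
  thus ?thesis unfolding li_iff using ndvd_mult h by blast
qed

lemma li_minus: "li x \<Longrightarrow> li (- x)" using li_mult[of "-1" x] li_of_int[of "-1"] by simp
lemma li_diff: "li x \<Longrightarrow> li y \<Longrightarrow> li (x - y)" using li_add[of x "- y"] li_minus by simp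
lemma li_power: "li x \<Longrightarrow> li (x ^ n)" by (induction n) (auto intro: li_mult)
lemma li_sum: "(\<And>i. i \<in> A \<Longrightarrow> li (f i)) \<Longrightarrow> li (sum f A)"
  by (induction A rule: infinite_finite_induct) (auto intro: li_add)

lemma li_divide_int: "li x \<Longrightarrow> \<not> int l dvd n \<Longrightarrow> li (x / of_int n)"
proof -
  assume "li x" and n: "\<not> int l dvd n"
  then obtain a b where h: "\<not> int l dvd b" "x * of_int b = of_int a" unfolding li_iff by blast
  have "n \<noteq> 0" using n by auto
  hence "x / of_int n * of_int (b * n) = of_int a" using h(2) by (simp add: field_simps)
  thus ?thesis unfolding li_iff using ndvd_mult h n by blast
qed

lemma li_divide_nat: "li x \<Longrightarrow> \<not> l dvd n \<Longrightarrow> li (x / of_nat n)"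
  using li_divide_int[of x "int n"] by simp

lemma ndvd_less: "0 < n \<Longrightarrow> n < l \<Longrightarrow> \<not> l dvd n" by (auto dest: dvd_imp_le)
lemma ndvd_fact: "n < l \<Longrightarrow> \<not> l dvd fact n" using prime_dvd_fact_iff[OF prime_l] by auto
lemmas ndvd_2_3 = not_dvd_2_3[OF prime_l l_gt_3]
lemma li_div_fact: "li x \<Longrightarrow> n < l \<Longrightarrow> li (x / fact n)"
  using li_divide_nat[OF _ ndvd_fact] by simp

definition cgc :: "rat \<Rightarrow> rat \<Rightarrow> bool" where "cgc x y \<longleftrightarrow> (\<exists>k. li k \<and> x = y + of_nat l * k)"

lemma cgcI: "li k \<Longrightarrow> x = y + of_nat l * k \<Longrightarrow> cgc x y" by (auto simp: cgc_def)
lemma cgc_refl [simp]: "cgc x x" by (rule cgcI[of 0]) auto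
lemma cgc_trans [trans]: "cgc x y \<Longrightarrow> cgc y z \<Longrightarrow> cgc x z"
  unfolding cgc_def by (elim exE conjE, rule_tac x = "k + ka" in exI) (auto intro: li_add simp: distrib_left)
lemma cgc_sym: "cgc x y \<Longrightarrow> cgc y x"
  unfolding cgc_def by (elim exE conjE, rule_tac x = "- k" in exI) (auto intro: li_minus)
lemma cgc_mult_left: "li c \<Longrightarrow> cgc x y \<Longrightarrow> cgc (c * x) (c * y)"
  unfolding cgc_def by (elim exE conjE, rule_tac x = "c * k" in exI) (auto intro: li_mult simp: algebra_simps)
lemma cgc_cancel:
  assumes "cgc (of_int n * x) (of_int n * y)" "\<not> int l dvd n"
  shows "cgc x y"
proof -
  have n: "n \<noteq> 0" using assms(2) by auto
  have "cgc ((1 / of_int n) * (of_int n * x)) ((1 / of_int n) * (of_int n * y))"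
    by (intro cgc_mult_left assms li_divide_int) auto
  thus ?thesis using n by simp
qed
lemma cgc_int:
  assumes "li x" obtains c :: int where "cgc x (of_int c)"
proof -
  obtain a b where h: "\<not> int l dvd b" "x * of_int b = of_int a" using assms unfolding li_iff by blast
  have "coprime b (int l)" using prime_imp_coprime[of "int l" b] prime_l h(1) by (simp add: coprime_commute)
  then obtain i where i: "[b * i = 1] (mod int l)" using cong_solve_coprime_int by blast
  then obtain k where k: "b * i = 1 + int l * k" by (metis cong_iff_lin cong_sym)
  have "of_int b * of_int i = (1 + of_nat l * of_int k :: rat)" using arg_cong[OF k, of "of_int :: int \<Rightarrow> rat"] by simp
  hence "of_int (a * i) = x * (1 + of_nat l * of_int k)" by (simp add: h(2)[symmetric] mult.assoc)
  hence "x = of_int (a * i) + of_nat l * (- (x * of_int k))" by (simp add: algebra_simps)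
  hence "cgc x (of_int (a * i))" by (rule cgcI[rotated]) (intro li_minus li_mult assms li_of_int)
  thus ?thesis by (rule that)
qed

text \<open>A common denominator, rather than mere \<open>l\<close>-integrality, is needed to pass to integer coefficients in part (3).\<close>
definition BI :: "rat fps \<Rightarrow> bool" where
  "BI f \<longleftrightarrow> (\<exists>D. \<not> int l dvd D \<and> (\<forall>n. of_int D * fps_nth f n \<in> \<int>))"

lemma BI_li: "BI f \<Longrightarrow> li (fps_nth f n)"
proof -
  assume "BI f"
  then obtain D where D: "\<not> int l dvd D" "of_int D * fps_nth f n \<in> \<int>" unfolding BI_def by blast
  from D(2) obtain a where "of_int D * fps_nth f n = of_int a" by (auto elim: Ints_cases)
  thus ?thesis unfolding li_iff using D(1) by (intro exI[of _ a] exI[of _ D]) (simp add: mult.commute)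
qed

lemma BI_int: "(\<And>n. fps_nth f n \<in> \<int>) \<Longrightarrow> BI f"
  unfolding BI_def using l_gt_3 by (intro exI[of _ 1]) auto

lemma BI_const: "li c \<Longrightarrow> BI (fps_const c)"
proof -
  assume "li c"
  then obtain a b where h: "\<not> int l dvd b" "c * of_int b = of_int a" unfolding li_iff by blast
  hence "of_int b * fps_nth (fps_const c) n \<in> \<int>" for n by (simp add: mult.commute[of "of_int b"])
  thus ?thesis using h(1) unfolding BI_def by blast
qed

lemma BI_0 [simp]: "BI 0" and BI_1 [simp]: "BI 1" using BI_const[of 0] BI_const[of 1] by simp_all
lemma BI_numeral [simp]: "BI (numeral n)" using BI_const[of "numeral n"] by (simp add: fps_numeral_fps_const)
lemma BI_X [simp]: "BI fps_X" by (rule BI_int) (simp add: fps_X_def)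

lemma BI_add: "BI f \<Longrightarrow> BI g \<Longrightarrow> BI (f + g)"
proof -
  assume "BI f" "BI g"
  then obtain D E where h: "\<not> int l dvd D" "\<not> int l dvd E" "\<And>n. of_int D * fps_nth f n \<in> \<int>" "\<And>n. of_int E * fps_nth g n \<in> \<int>"
    unfolding BI_def by blast
  have "of_int (D * E) * fps_nth (f + g) n \<in> \<int>" for n
  proof -
    have "of_int (D * E) * fps_nth (f + g) n = of_int E * (of_int D * fps_nth f n) + of_int D * (of_int E * fps_nth g n)"
      by (simp add: algebra_simps)
    thus ?thesis using h by auto
  qed
  thus ?thesis unfolding BI_def using ndvd_mult h by blast
qed

lemma BI_mult: "BI f \<Longrightarrow> BI g \<Longrightarrow> BI (f * g)"
proof -
  assume "BI f" "BI g"
  then obtain D E where h: "\<not> int l dvd D" "\<not> int l dvd E" "\<And>n. of_int D * fps_nth f n \<in> \<int>" "\<And>n. of_int E * fps_nth g n \<in> \<int>"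
    unfolding BI_def by blast
  have "of_int (D * E) * fps_nth (f * g) n \<in> \<int>" for n
  proof -
    have "of_int (D * E) * fps_nth (f * g) n = (\<Sum>i=0..n. (of_int D * fps_nth f i) * (of_int E * fps_nth g (n - i)))"
      by (simp add: fps_mult_nth sum_distrib_left mult_ac)
    thus ?thesis using h by auto
  qed
  thus ?thesis unfolding BI_def using ndvd_mult h by blast
qed

lemma BI_smult: "li c \<Longrightarrow> BI f \<Longrightarrow> BI (fps_const c * f)" by (intro BI_mult BI_const)
lemma BI_minus: "BI f \<Longrightarrow> BI (- f)" using BI_smult[of "-1" f] li_minus[of 1] by (simp flip: fps_const_neg)
lemma BI_diff: "BI f \<Longrightarrow> BI g \<Longrightarrow> BI (f - g)" using BI_add[of f "- g"] BI_minus by simp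
lemma BI_power: "BI f \<Longrightarrow> BI (f ^ n)" by (induction n) (auto intro: BI_mult)
lemma BI_euler: "BI f \<Longrightarrow> BI (euler_op f)"
proof -
  assume "BI f"
  then obtain D where D: "\<not> int l dvd D" "\<And>n. of_int D * fps_nth f n \<in> \<int>" unfolding BI_def by blast
  have "of_int D * fps_nth (euler_op f) n \<in> \<int>" for n
    using Ints_mult[OF Ints_of_nat[of n] D(2)[of n]] by (simp add: euler_op_nth mult_ac)
  thus ?thesis unfolding BI_def using D(1) by blast
qed

text \<open>Congruence modulo l^e whose quotient again has a common denominator prime to l, so that
  it can be multiplied and sliced without leaving \<open>BI\<close>.\<close>

definition cg :: "nat \<Rightarrow> rat fps \<Rightarrow> rat fps \<Rightarrow> bool" where
  "cg e f g \<longleftrightarrow> (\<exists>k. BI k \<and> f = g + fps_const (of_nat l ^ e) * k)"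

lemma cgI: "BI k \<Longrightarrow> f = g + fps_const (of_nat l ^ e) * k \<Longrightarrow> cg e f g" by (auto simp: cg_def)
lemma cg_refl [simp]: "cg e f f" by (rule cgI[of 0]) auto
lemma cg_sym: "cg e f g \<Longrightarrow> cg e g f"
  unfolding cg_def by (elim exE conjE, rule_tac x = "- k" in exI) (auto intro: BI_minus)
lemma cg_trans [trans]: "cg e f g \<Longrightarrow> cg e g h \<Longrightarrow> cg e f h"
  unfolding cg_def by (elim exE conjE, rule_tac x = "k + ka" in exI) (auto intro: BI_add simp: distrib_left)
lemma cg_add: "cg e f g \<Longrightarrow> cg e f' g' \<Longrightarrow> cg e (f + f') (g + g')"
  unfolding cg_def by (elim exE conjE, rule_tac x = "k + ka" in exI) (auto intro: BI_add simp: distrib_left)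
lemma cg_diff: "cg e f g \<Longrightarrow> cg e f' g' \<Longrightarrow> cg e (f - f') (g - g')"
  unfolding cg_def by (elim exE conjE, rule_tac x = "k - ka" in exI) (auto intro: BI_diff simp: right_diff_distrib)
lemma cg_mult_left: "BI h \<Longrightarrow> cg e f g \<Longrightarrow> cg e (h * f) (h * g)"
  unfolding cg_def by (elim exE conjE, rule_tac x = "h * k" in exI) (auto intro: BI_mult simp: algebra_simps)
lemma cg_mult: "cg e f g \<Longrightarrow> cg e f' g' \<Longrightarrow> BI g \<Longrightarrow> BI f' \<Longrightarrow> cg e (f * f') (g * g')"
  by (rule cg_trans[of e _ "g * f'"], subst (1 2) mult.commute[of _ f']) (auto intro: cg_mult_left)
lemma cg_smult: "li c \<Longrightarrow> cg e f g \<Longrightarrow> cg e (fps_const c * f) (fps_const c * g)"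
  by (intro cg_mult_left BI_const)
lemma cg_sum: "(\<And>i. i \<in> A \<Longrightarrow> cg e (f i) (g i)) \<Longrightarrow> cg e (sum f A) (sum g A)"
  by (induction A rule: infinite_finite_induct) (auto intro: cg_add)
lemma cg_BI: "cg e f g \<Longrightarrow> BI g \<Longrightarrow> BI f"
  unfolding cg_def by (auto intro!: BI_add BI_smult li_power)
lemma cg_const: "cgc x y \<Longrightarrow> cg 1 (fps_const x) (fps_const y)"
  unfolding cgc_def cg_def by (elim exE conjE, rule_tac x = "fps_const k" in exI) (auto intro: BI_const)
lemma cg_smult_cgc: "cgc x y \<Longrightarrow> BI f \<Longrightarrow> cg 1 (fps_const x * f) (fps_const y * f)"
  unfolding mult.commute[of _ f] by (intro cg_mult_left cg_const)
lemma cg_nth_intI: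
  assumes "\<And>n. \<exists>k::int. fps_nth f n = fps_nth g n + of_nat l ^ e * of_int k"
  shows "cg e f g"
proof -
  obtain k :: "nat \<Rightarrow> int" where k: "\<And>n. fps_nth f n = fps_nth g n + of_nat l ^ e * of_int (k n)" using assms by metis
  show ?thesis by (rule cgI[of "Abs_fps (\<lambda>n. of_int (k n))"]) (auto intro!: BI_int fps_ext simp: k)
qed

text \<open>In the binomial expansion the linear term gains a factor l from the binomial
  coefficient, and all higher terms carry l^(2e), where 2e \<ge> e + 1.\<close>

lemma cg_power_lift:
  assumes "cg e f g" "BI g" "e \<ge> 1"
  shows "cg (e + 1) (f ^ l) (g ^ l)"
proof -
  obtain k where k: "BI k" "f = g + fps_const (of_nat l ^ e) * k" using assms(1) by (auto simp: cg_def)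
  let ?c = "fps_const (of_nat l ^ e) :: rat fps"
  have t: "cg (e + 1) (of_nat (l choose i) * (?c * k) ^ i * g ^ (l - i)) 0" if i: "i \<in> {1..l}" for i
  proof (cases "i = 1")
    case True
    have "of_nat (l choose i) * (?c * k) ^ i * g ^ (l - i) = fps_const (of_nat l ^ (e + 1)) * (k * g ^ (l - 1))"
      using True by (simp add: mult_ac flip: fps_of_nat)
    thus ?thesis by (intro cgI[of "k * g ^ (l - 1)"]) (auto intro!: BI_mult BI_power k assms)
  next
    case False
    have "e * 2 \<le> e * i" using i False by (intro mult_le_mono2) auto
    hence e: "e * i = (e + 1) + (e * i - (e + 1))" using assms(3) by linarith
    have p: "?c ^ i = fps_const (of_nat l ^ (e + 1)) * fps_const (of_nat l ^ (e * i - (e + 1)))"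
      unfolding fps_const_power fps_const_mult power_mult[symmetric] power_add[symmetric] e[symmetric] ..
    have eqn: "of_nat (l choose i) * (?c * k) ^ i * g ^ (l - i) = fps_const (of_nat l ^ (e + 1)) * (fps_const (of_nat l ^ (e * i - (e + 1))) * of_nat (l choose i) * k ^ i * g ^ (l - i))"
      unfolding power_mult_distrib p by (simp only: mult_ac)
    have bi: "BI (fps_const (of_nat l ^ (e * i - (e + 1))) * of_nat (l choose i) * k ^ i * g ^ (l - i))"
      unfolding fps_of_nat[symmetric] by (intro BI_mult BI_power BI_const li_power li_of_nat k assms)
    show ?thesis by (rule cgI[OF bi]) (simp only: eqn add_0)
  qed
  have "f ^ l = (\<Sum>i\<le>l. of_nat (l choose i) * (?c * k) ^ i * g ^ (l - i))" unfolding k(2) add.commute[of g] by (rule binomial_ring)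
  also have "{..l} = insert 0 {1..l}" by auto
  finally have "f ^ l = g ^ l + (\<Sum>i=1..l. of_nat (l choose i) * (?c * k) ^ i * g ^ (l - i))" by simp
  moreover have "cg (e + 1) (\<Sum>i=1..l. of_nat (l choose i) * (?c * k) ^ i * g ^ (l - i)) (\<Sum>i\<in>{1..l}. 0)"
    by (rule cg_sum) (rule t)
  ultimately show ?thesis using cg_add[OF cg_refl[of "e + 1" "g ^ l"], of _ 0] by simp
qed

end

lemma slice_nth [simp]: "fps_nth (slice l b f) n = fps_nth f (l * n + b)" by (simp add: slice_def)
lemma dilate_nth: "fps_nth (dilate m f) n = (if m dvd n then fps_nth f (n div m) else 0)" by (simp add: dilate_def)

lemma slice_add: "slice l b (f + g) = slice l b f + slice l b g" by (rule fps_ext) simp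
lemma slice_diff: "slice l b (f - g) = slice l b f - slice l b (g :: 'a :: ab_group_add fps)" by (rule fps_ext) simp
lemma slice_smult: "slice l b (fps_const c * f) = fps_const c * slice l b (f :: 'a :: comm_ring_1 fps)" by (rule fps_ext) simp
lemma sum_multiples:
  fixes f :: "nat \<Rightarrow> 'a :: comm_monoid_add"
  assumes "m > 0" "b < m"
  shows "(\<Sum>i=0..m*n+b. if m dvd i then f i else 0) = (\<Sum>j=0..n. f (m * j))"
proof -
  have "(\<Sum>j=0..n. f (m * j)) = (\<Sum>i\<in>(\<lambda>i. m * i) ` {0..n}. f i)"
    using assms by (subst sum.reindex) (auto simp: inj_on_def)
  also have "\<dots> = (\<Sum>i\<in>{i\<in>{0..m*n+b}. m dvd i}. f i)"
  proof (rule sum.cong)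
    show "(\<lambda>i. m * i) ` {0..n} = {i \<in> {0..m * n + b}. m dvd i}"
    proof (intro equalityI subsetI)
      fix i assume "i \<in> {i \<in> {0..m * n + b}. m dvd i}"
      then obtain j where j: "i = m * j" "m * j \<le> m * n + b" by auto
      have "m * j < m * (n + 1)" using j assms by simp
      hence "j < n + 1" by (rule mult_less_cancel1[THEN iffD1, THEN conjunct2])
      thus "i \<in> (\<lambda>i. m * i) ` {0..n}" using j by auto
    qed (use assms in \<open>auto intro: trans_le_add1\<close>)
  qed simp
  finally show ?thesis by (simp add: sum.inter_filter[symmetric])
qed

lemma slice_dilate_mult:
  fixes f g :: "'a :: comm_ring_1 fps"
  assumes "l > 0" "b < l"
  shows "slice l b (dilate l f * g) = f * slice l b g"
proof (rule fps_ext)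
  fix n
  have "fps_nth (slice l b (dilate l f * g)) n = (\<Sum>i=0..l*n+b. if l dvd i then fps_nth f (i div l) * fps_nth g (l * n + b - i) else 0)"
    unfolding slice_nth fps_mult_nth by (intro sum.cong) (auto simp: dilate_nth)
  also have "\<dots> = (\<Sum>j=0..n. fps_nth f (l * j div l) * fps_nth g (l * n + b - l * j))" by (rule sum_multiples[OF assms])
  also have "\<dots> = fps_nth (f * slice l b g) n" unfolding fps_mult_nth
  proof (intro sum.cong refl)
    fix j assume "j \<in> {0..n}"
    hence "l * n + b - l * j = l * (n - j) + b" by (simp add: right_diff_distrib')
    thus "fps_nth f (l * j div l) * fps_nth g (l * n + b - l * j) = fps_nth f j * fps_nth (slice l b g) (n - j)" using assms by simp
  qed
  finally show "fps_nth (slice l b (dilate l f * g)) n = fps_nth (f * slice l b g) n" .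
qed

lemma dilate_add: "dilate m (f + g) = dilate m f + dilate m (g :: 'a :: comm_ring_1 fps)" by (rule fps_ext) (simp add: dilate_nth)
lemma dilate_diff: "dilate m (f - g) = dilate m f - dilate m (g :: 'a :: comm_ring_1 fps)" by (rule fps_ext) (simp add: dilate_nth)
lemma dilate_const: "m > 0 \<Longrightarrow> dilate m (fps_const c) = fps_const (c :: 'a :: comm_ring_1)"
  by (rule fps_ext) (auto simp: dilate_nth dvd_div_eq_0_iff)
lemma dilate_1: "m > 0 \<Longrightarrow> dilate m (1 :: 'a :: comm_ring_1 fps) = 1" using dilate_const[of m 1] by simp

lemma dilate_mult:
  fixes f g :: "'a :: comm_ring_1 fps"
  assumes m: "m > 0"
  shows "dilate m (f * g) = dilate m f * dilate m g"
proof (rule fps_ext)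
  fix n
  have *: "fps_nth (dilate m f * dilate m g) n = (\<Sum>i=0..n. if m dvd i then (if m dvd n then fps_nth f (i div m) * fps_nth g ((n - i) div m) else 0) else 0)"
    unfolding fps_mult_nth by (intro sum.cong) (auto simp: dilate_nth dvd_diff_nat dest: dvd_diffD)
  show "fps_nth (dilate m (f * g)) n = fps_nth (dilate m f * dilate m g) n"
  proof (cases "m dvd n")
    case True
    then obtain k where k: "n = m * k" by auto
    have "fps_nth (dilate m f * dilate m g) n = (\<Sum>j=0..k. fps_nth f (m * j div m) * fps_nth g ((n - m * j) div m))"
      unfolding * using sum_multiples[OF m m, where n = k and f = "\<lambda>i. fps_nth f (i div m) * fps_nth g ((n - i) div m)"] True m k by (simp cong: if_cong)
    also have "\<dots> = fps_nth (f * g) k" unfolding fps_mult_nth k using m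
      by (intro sum.cong) (auto simp: right_diff_distrib'[symmetric])
    finally show ?thesis using True k m by (simp add: dilate_nth)
  next
    case False thus ?thesis unfolding * by (simp add: dilate_nth cong: if_cong)
  qed
qed

lemma dilate_power: "m > 0 \<Longrightarrow> dilate m (f ^ n) = dilate m (f :: 'a :: comm_ring_1 fps) ^ n"
  by (induction n) (auto simp: dilate_1 dilate_mult)

lemma Phi_Pf_power: "Phi ^ n * Pf ^ n = 1" by (simp flip: power_mult_distrib add: Phi_Pf)

context large_prime
begin

lemma BI_slice: "BI f \<Longrightarrow> BI (slice m b f)" unfolding BI_def by auto
lemma BI_dilate: "BI f \<Longrightarrow> BI (dilate m f)" unfolding BI_def dilate_nth by auto
lemma BI_Pf: "BI Pf" by (rule BI_int) (simp add: Pf_def)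
lemma Phi_int: "fps_nth Phi n \<in> \<int>"
proof -
  have "fps_nth (\<Prod>k\<in>A. 1 - fps_X ^ k :: rat fps) n \<in> \<int>" if "finite A" for A n using that
  proof (induction A arbitrary: n rule: finite_induct)
    case empty thus ?case by (simp add: fps_one_nth)
  next
    case (insert k A)
    have x: "fps_nth (1 - fps_X ^ k :: rat fps) i \<in> \<int>" for i by (simp add: fps_X_power_nth fps_one_nth)
    show ?case using insert by (auto simp: fps_mult_nth intro!: Ints_mult x)
  qed
  thus ?thesis by (simp add: Phi_def)
qed
lemma BI_Phi: "BI Phi" by (rule BI_int) (rule Phi_int)

lemma cg_slice: "cg e f g \<Longrightarrow> cg e (slice m b f) (slice m b g)"
  unfolding cg_def by (elim exE conjE, rule_tac x = "slice m b k" in exI) (auto intro: BI_slice simp: slice_add slice_smult)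

lemma cg_nth: "cg 1 f g \<Longrightarrow> cgc (fps_nth f n) (fps_nth g n)"
  unfolding cg_def cgc_def using BI_li by fastforce

lemma cgc_Ints:
  assumes "cgc x y" "x \<in> \<int>" "y \<in> \<int>"
  shows "\<exists>k::int. x = y + of_nat l * of_int k"
proof -
  obtain k where k: "li k" "x = y + of_nat l * k" using assms(1) by (auto simp: cgc_def)
  obtain a b where h: "\<not> int l dvd b" "k * of_int b = of_int a" using k(1) unfolding li_iff by blast
  obtain m where m: "x - y = of_int m" using assms(2,3) by (meson Ints_cases Ints_diff)
  have "of_int (m * b) = (x - y) * of_int b" by (simp add: m)
  also have "\<dots> = of_int (int l * a)" unfolding k(2) by (simp add: h(2)[symmetric])
  finally have "m * b = int l * a" by (simp only: of_int_eq_iff)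
  hence "int l dvd m" using h(1) prime_l by (metis dvd_triv_left prime_dvd_mult_iff prime_nat_int_transfer)
  then obtain i where "m = int l * i" by auto
  thus ?thesis using m by (intro exI[of _ i]) (simp add: algebra_simps)
qed

section \<open>Frobenius congruences\<close>

lemma freshman:
  assumes "BI x" "BI y"
  shows "cg 1 ((x + y) ^ l) (x ^ l + y ^ l)"
proof -
  have t: "cg 1 (of_nat (l choose i) * x ^ i * y ^ (l - i)) 0" if "i \<in> {1..<l}" for i
  proof -
    have "l dvd (l choose i)" using that prime_l by (intro dvd_choose_prime) auto
    then obtain k where k: "l choose i = l * k" by auto
    have "of_nat (l choose i) * x ^ i * y ^ (l - i) = 0 + fps_const (of_nat l ^ 1) * (fps_const (of_nat k) * x ^ i * y ^ (l - i))"
      unfolding k by (simp add: mult_ac flip: fps_of_nat)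
    thus ?thesis by (rule cgI[rotated]) (intro BI_mult BI_power BI_const li_of_nat assms)
  qed
  have "(x + y) ^ l = (\<Sum>i\<le>l. of_nat (l choose i) * x ^ i * y ^ (l - i))" by (rule binomial_ring)
  also have "{..l} = insert 0 (insert l {1..<l})" using l_pos by auto
  finally have "(x + y) ^ l = (x ^ l + y ^ l) + (\<Sum>i=1..<l. of_nat (l choose i) * x ^ i * y ^ (l - i))"
    using l_pos by (simp add: add_ac)
  moreover have "cg 1 (\<Sum>i=1..<l. of_nat (l choose i) * x ^ i * y ^ (l - i)) (\<Sum>i\<in>{1..<l}. 0)"
    by (rule cg_sum) (rule t)
  ultimately show ?thesis using cg_add[OF cg_refl[of 1 "x ^ l + y ^ l"], of _ 0] by simp
qed

lemma fermat_int: "\<exists>k::int. a ^ l = a + int l * k"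
proof -
  have "[a ^ l = a] (mod int l)"
  proof (cases "int l dvd a")
    case True
    moreover from this have "int l dvd a ^ l" using l_pos by (simp add: dvd_power dvd_trans)
    ultimately show ?thesis by (simp add: cong_iff_dvd_diff dvd_diff)
  next
    case False
    define b where "b = nat (a mod int l)"
    have b: "int b = a mod int l" using l_pos by (simp add: b_def)
    have ab: "[a = int b] (mod int l)" unfolding b by simp
    have "\<not> int l dvd int b" using False cong_dvd_iff[OF ab] by simp
    hence "\<not> l dvd b" by simp
    hence "[b ^ (l - 1) = 1] (mod l)" using fermat_theorem[OF prime_l] by blast
    hence "[int b ^ (l - 1) = 1] (mod int l)" by (metis cong_int_iff of_nat_1 of_nat_power)
    hence "[a ^ (l - 1) = 1] (mod int l)" using cong_pow[OF ab] cong_trans by blast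
    hence "[a * a ^ (l - 1) = a * 1] (mod int l)" by (intro cong_mult cong_refl)
    thus ?thesis using l_pos by (simp add: power_eq_if)
  qed
  thus ?thesis by (metis cong_iff_lin cong_sym)
qed

lemma Ints_fps_power:
  fixes f :: "rat fps"
  assumes "\<And>n. fps_nth f n \<in> \<int>" shows "fps_nth (f ^ m) n \<in> \<int>"
proof (induction m arbitrary: n)
  case 0 thus ?case by (simp add: fps_one_nth)
next
  case (Suc m) thus ?case using assms by (auto simp: fps_mult_nth)
qed

text \<open>Peeling off the constant term reduces coefficient n of f^l to coefficient n - l of the
  l-th power of the shifted series; the constant itself is Fermat's theorem.\<close>

lemma frobenius:
  assumes "\<And>n. fps_nth f n \<in> \<int>"
  shows "cg 1 (f ^ l) (dilate l f)"
proof -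
  have "cgc (fps_nth (f ^ l) n) (fps_nth (dilate l f) n)" for n using assms
  proof (induction n arbitrary: f rule: less_induct)
    case (less n)
    define g where "g = fps_shift 1 f"
    define a where "a = fps_nth f 0"
    have f: "f = fps_const a + fps_X * g"
      by (rule fps_ext) (simp add: g_def a_def)
    have g: "fps_nth g i \<in> \<int>" for i using less.prems by (simp add: g_def)
    have a: "a \<in> \<int>" using less.prems by (simp add: a_def)
    have "cg 1 (f ^ l) (fps_const a ^ l + (fps_X * g) ^ l)"
      unfolding f using a g by (intro freshman BI_const BI_mult BI_X BI_int li_Ints) auto
    hence c: "cgc (fps_nth (f ^ l) n) (fps_nth (fps_const (a ^ l) + fps_X ^ l * g ^ l) n)"
      using cg_nth by (simp only: power_mult_distrib fps_const_power)
    also have "cgc (fps_nth (fps_const (a ^ l) + fps_X ^ l * g ^ l) n) (fps_nth (dilate l f) n)"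
    proof (cases "n = 0")
      case True
      obtain b where b: "a = of_int b" using a by (auto elim: Ints_cases)
      obtain k where "b ^ l = b + int l * k" using fermat_int by blast
      hence "of_int (b ^ l) = (of_int (b + int l * k) :: rat)" by simp
      hence "a ^ l = a + of_nat l * of_int k" by (simp add: b)
      thus ?thesis using True l_pos by (intro cgcI[of "of_int k"]) (auto simp: dilate_nth a_def fps_X_power_mult_nth)
    next
      case n: False
      show ?thesis
      proof (cases "n < l")
        case True
        hence "\<not> l dvd n" using n by (auto dest: dvd_imp_le)
        thus ?thesis using True n by (simp add: dilate_nth fps_X_power_mult_nth)
      next
        case False
        have "cgc (fps_nth (g ^ l) (n - l)) (fps_nth (dilate l g) (n - l))" using less.IH[of "n - l" g] g n l_pos by simp
        moreover have "fps_nth (dilate l g) (n - l) = fps_nth (dilate l f) n"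
        proof -
          have "l dvd n - l \<longleftrightarrow> l dvd n" using False by (metis dvd_diff_nat dvd_diffD dvd_refl not_less)
          moreover have "(n - l) div l + 1 = n div l" using False l_pos by (simp add: le_div_geq)
          ultimately show ?thesis by (auto simp: dilate_nth g_def)
        qed
        ultimately show ?thesis using False n by (simp add: fps_X_power_mult_nth)
      qed
    qed
    finally show ?case .
  qed
  hence "\<exists>k::int. fps_nth (f ^ l) n = fps_nth (dilate l f) n + of_nat l ^ 1 * of_int k" for n
    using cgc_Ints[of "fps_nth (f ^ l) n" "fps_nth (dilate l f) n"] Ints_fps_power[OF assms] assms by (auto simp: dilate_nth)
  thus ?thesis by (rule cg_nth_intI)
qed

text \<open>The l-th power of the previous congruence; \<open>cg_power_lift\<close> gains one power
  of l at each stage.\<close>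

lemma Pf_frobenius:
  assumes "e \<ge> 1"
  shows "cg e (Pf ^ (l ^ e)) (dilate l (Pf ^ (l ^ (e - 1))))"
  using assms
proof (induction e rule: dec_induct)
  case base thus ?case using frobenius[of Pf] by (simp add: Pf_def)
next
  case (step e)
  have "cg (e + 1) ((Pf ^ (l ^ e)) ^ l) (dilate l (Pf ^ (l ^ (e - 1))) ^ l)"
    using step by (intro cg_power_lift) (auto intro!: BI_dilate BI_power BI_Pf)
  moreover have "(Pf ^ (l ^ e)) ^ l = Pf ^ (l ^ Suc e)" by (simp add: power_mult[symmetric] mult.commute)
  moreover have "dilate l (Pf ^ (l ^ (e - 1))) ^ l = dilate l (Pf ^ (l ^ (Suc e - 1)))"
  proof -
    have "l ^ (e - 1) * l = l ^ e" using step by (metis One_nat_def Suc_pred less_eq_Suc_le power_Suc2)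
    thus ?thesis using l_pos by (simp add: dilate_power power_mult[symmetric])
  qed
  ultimately show ?case by simp
qed

end

context large_prime
begin

section \<open>Sums of level one forms modulo l\<close>

inductive MF :: "nat \<Rightarrow> rat fps \<Rightarrow> bool" for W :: nat where
  MF_form: "mform (int k) f \<Longrightarrow> BI f \<Longrightarrow> k \<le> W \<Longrightarrow> MF W f"
| MF_add: "MF W f \<Longrightarrow> MF W g \<Longrightarrow> MF W (f + g)"

text \<open>Integer weights are needed after the Hecke step, which changes the weight by an amount
  that can be negative for small l.\<close>

inductive MZ :: "int \<Rightarrow> rat fps \<Rightarrow> bool" for W :: int where
  MZ_form: "mform k f \<Longrightarrow> BI f \<Longrightarrow> k \<le> W \<Longrightarrow> MZ W f"
| MZ_add: "MZ W f \<Longrightarrow> MZ W g \<Longrightarrow> MZ W (f + g)"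

lemma MF_BI: "MF W f \<Longrightarrow> BI f" by (induction rule: MF.induct) (auto intro: BI_add)
lemma MZ_BI: "MZ W f \<Longrightarrow> BI f" by (induction rule: MZ.induct) (auto intro: BI_add)
lemma MF_mono: "MF W f \<Longrightarrow> W \<le> V \<Longrightarrow> MF V f" by (induction rule: MF.induct) (auto intro: MF.intros)
lemma MZ_mono: "MZ W f \<Longrightarrow> W \<le> V \<Longrightarrow> MZ V f" by (induction rule: MZ.induct) (auto intro: MZ.intros)
lemma MF_const: "li c \<Longrightarrow> MF W (fps_const c)" using mform_const by (intro MF_form[of 0] BI_const) auto
lemma MF_0: "MF W 0" using MF_const[of 0] by simp
lemma MZ_0: "MZ W 0" using mform_0[of W] by (intro MZ_form[of W]) auto
lemma MF_mult:
  assumes "MF W f" "MF V g"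
  shows "MF (W + V) (f * g)"
  using assms(1)
proof (induction rule: MF.induct)
  case (MF_form k f)
  show ?case using assms(2)
  proof (induction rule: MF.induct)
    case (MF_form k' g)
    have "mform (int (k + k')) (f * g)" using mform_mult[OF \<open>mform (int k) f\<close> MF_form(1)] by simp
    thus ?case using MF_form \<open>BI f\<close> \<open>k \<le> W\<close> by (intro MF.MF_form[of "k + k'"]) (auto intro: BI_mult)
  qed (auto simp: distrib_left intro: MF.intros)
qed (auto simp: distrib_right intro: MF.intros)
lemma MZ_smult: "MZ W f \<Longrightarrow> li c \<Longrightarrow> MZ W (fps_const c * f)"
  by (induction rule: MZ.induct) (auto simp: distrib_left intro: MZ.intros BI_smult mform_smult)

text \<open>Congruent modulo l to a sum of forms: the property that survives the replacement of S_2
  by S_{l+1}.\<close>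

definition MFc :: "nat \<Rightarrow> rat fps \<Rightarrow> bool" where "MFc W f \<longleftrightarrow> (\<exists>g. MF W g \<and> cg 1 f g)"

lemma MFc_MF: "MF W f \<Longrightarrow> MFc W f" unfolding MFc_def using cg_refl by blast
lemma MFc_cong: "MFc W g \<Longrightarrow> cg 1 f g \<Longrightarrow> MFc W f" unfolding MFc_def using cg_trans by blast
lemma MFc_BI: "MFc W f \<Longrightarrow> BI f" unfolding MFc_def using cg_BI MF_BI by blast
lemma MFc_mono: "MFc W f \<Longrightarrow> W \<le> V \<Longrightarrow> MFc V f" unfolding MFc_def using MF_mono by blast
lemma MFc_add: "MFc W f \<Longrightarrow> MFc W g \<Longrightarrow> MFc W (f + g)" unfolding MFc_def using MF_add cg_add by blast
lemma MFc_0: "MFc W 0" using MFc_MF MF_0 by blast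
lemma MFc_sum: "(\<And>i. i \<in> A \<Longrightarrow> MFc W (f i)) \<Longrightarrow> MFc W (sum f A)"
  by (induction A rule: infinite_finite_induct) (auto intro: MFc_add MFc_0)
lemma MFc_mult: "MFc W f \<Longrightarrow> MFc V g \<Longrightarrow> MFc (W + V) (f * g)"
  unfolding MFc_def using MF_mult cg_mult MF_BI cg_BI by blast
lemma MFc_const: "li c \<Longrightarrow> MFc W (fps_const c)" using MFc_MF MF_const by blast
lemma MFc_smult: "li c \<Longrightarrow> MFc W f \<Longrightarrow> MFc W (fps_const c * f)" using MFc_mult[OF MFc_const[of c 0]] by simp

end

locale rank_prime = large_prime +
  fixes \<beta> r :: nat
  assumes \<beta>: "1 \<le> \<beta>" "\<beta> < l" and \<beta>_r: "24 * \<beta> = 1 + l * r"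
begin

section \<open>Restriction of P F to the progression\<close>

definition res :: "rat fps \<Rightarrow> rat fps" where "res F = slice l \<beta> (Pf * F)"

lemma res_add: "res (f + g) = res f + res g" by (simp add: res_def distrib_left slice_add)
lemma res_diff: "res (f - g) = res f - res g" by (simp add: res_def right_diff_distrib slice_diff)
lemma res_smult: "res (fps_const c * f) = fps_const c * res f"
  by (simp add: res_def slice_smult mult.left_commute[of Pf])
lemma res_BI: "BI f \<Longrightarrow> BI (res f)" unfolding res_def by (intro BI_slice BI_mult BI_Pf)
lemma res_cong: "cg e f g \<Longrightarrow> cg e (res f) (res g)" unfolding res_def by (intro cg_slice cg_mult_left BI_Pf)

lemma odd_l: "odd l" using prime_l l_gt_3 prime_odd_nat by auto
lemma odd_r: "odd r"
proof
  assume "even r" hence "even (l * r)" by simp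
  thus False using \<beta>_r by presburger
qed
lemma r_less: "r < 24"
proof -
  have "l * r < l * 24" using \<beta>_r \<beta>(2) by linarith
  thus ?thesis by simp
qed
lemma l_ge_5: "l \<ge> 5" using l_gt_3 odd_l by (cases "l = 4") auto

text \<open>Here 2h = l^e - 1 and 2h' = l^(e-1) + r are the exponents of eta before and after the
  Hecke operator. The bound on h makes the coefficient l^(w+h-1) of the dilated part divisible by
  l^e.\<close>

lemma hecke_index:
  assumes e: "e = 1 \<or> e = 2"
  obtains h h' v where "2 * h + 1 = l ^ e" "2 * h' = l ^ (e - 1) + r" "l * h' = h + 12 * \<beta>" "l * h = h' + 12 * v" "h \<ge> e + 1"
proof -
  obtain y where y: "l ^ 2 = 1 + 24 * y" using prime_square_mod_24[OF prime_l l_gt_3] by blast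
  have le: "l ^ e = l * l ^ (e - 1)" using e by (auto simp: power2_eq_square)
  have "odd (l ^ e)" using odd_l by simp
  then obtain h where h: "l ^ e = 2 * h + 1" by (rule oddE)
  have "even (l ^ (e - 1) + r)" using odd_l odd_r by simp
  then obtain h' where h': "l ^ (e - 1) + r = 2 * h'" by (rule evenE)
  have "2 * (l * h') = l * (2 * h')" by simp
  also have "\<dots> = l ^ e + l * r" unfolding h'[symmetric] le by (simp add: distrib_left)
  also have "\<dots> = 2 * (h + 12 * \<beta>)" using h \<beta>_r by simp
  finally have 1: "l * h' = h + 12 * \<beta>" by simp
  have he: "h \<ge> e + 1"
  proof -
    have "5 ^ e \<le> l ^ e" using l_ge_5 by (intro power_mono) auto
    thus ?thesis using h e by auto
  qed
  define t where "t = int \<beta> * int l - int y * int r"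
  \<comment> \<open>From l r = 24 \<beta> - 1 and l^2 = 1 + 24 y: multiplying the first equation by
    l shows that 24 divides l + r, and this makes v an integer.\<close>
  have lr: "int l + int r = 24 * t"
  proof -
    have "24 * int \<beta> * int l = (1 + int l * int r) * int l" using arg_cong[OF \<beta>_r, of int] by simp
    also have "\<dots> = int l + (int l ^ 2) * int r" by (simp add: algebra_simps power2_eq_square)
    also have "int l ^ 2 = 1 + 24 * int y" using arg_cong[OF y, of int] by simp
    finally show ?thesis by (simp add: t_def algebra_simps)
  qed
  have y': "int l * int l = 1 + 24 * int y" using arg_cong[OF y, of int] by (simp add: power2_eq_square)
  have d: "\<exists>v. 2 * (int l * int h) - 2 * int h' = 24 * v"
  proof -
    have "2 * (int l * int h) = int l * (int l ^ e - 1)" using arg_cong[OF h, of int] by (simp add: algebra_simps)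
    moreover have "2 * int h' = int l ^ (e - 1) + int r" using arg_cong[OF h', of int] by simp
    moreover have "int l * (int l ^ e - 1) - (int l ^ (e - 1) + int r) = 24 * (if e = 1 then int y - t else int l * int y - t)"
    proof (cases "e = 1")
      case True thus ?thesis using lr y' by (simp add: right_diff_distrib)
    next
      case False
      hence "e = 2" using e by simp
      have "int l * (int l * int l) = int l + 24 * (int l * int y)" unfolding y' by (simp add: algebra_simps)
      thus ?thesis using \<open>e = 2\<close> lr by (simp add: right_diff_distrib power2_eq_square)
    qed
    ultimately show ?thesis by (simp only:) blast
  qed
  then obtain v where "2 * (int l * int h) - 2 * int h' = 24 * v" by blast
  hence v: "int l * int h - int h' = 12 * v" by linarith
  have "v \<ge> 0"
  proof -
    have "2 * h' \<le> l ^ (e - 1) + 23" using h' r_less by simp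
    have "l * h \<ge> 5 * h" using l_ge_5 by simp
    have "l ^ (e - 1) * 5 \<le> l ^ e" unfolding le using l_ge_5 by simp
    hence "5 * (2 * h') \<le> 2 * h + 1 + 115" using \<open>2 * h' \<le> _\<close> h by linarith
    hence "h' < l * h + 12" using \<open>l * h \<ge> 5 * h\<close> he e by linarith
    hence "int h' < int l * int h + 12" by (metis of_nat_add of_nat_less_iff of_nat_mult of_nat_numeral)
    thus ?thesis using v by linarith
  qed
  then obtain v' where "v = int v'" using nonneg_int_cases by blast
  hence "int (l * h) = int (h' + 12 * v')" using v by simp
  hence "l * h = h' + 12 * v'" by (simp only: of_nat_eq_iff)
  thus ?thesis using that[of h h' v'] h h' 1 he by simp
qed

text \<open>P F equals P^(l^e) times A = \<Phi>^(l^e - 1) F. Modulo l^e the first factor is a series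
  in q^l and leaves the slice as P^(l^(e-1)); the slice of A is \<Phi>^(2h') G by the Hecke
  operator, whose other term is zero modulo l^e. Since 2h' = l^(e-1) + r, what remains is \<Phi>^r
  G.\<close>

lemma res_form:
  assumes F: "mform (int w) F" "BI F" and e: "e = 1 \<or> e = 2"
  obtains G where "mform (int w + (int l ^ e - 1 - int l ^ (e - 1) - int r) div 2) G" "BI G" "cg e (res F) (Phi ^ r * G)"
proof -
  obtain h h' v where hv: "2 * h + 1 = l ^ e" "2 * h' = l ^ (e - 1) + r" "l * h' = h + 12 * \<beta>" "l * h = h' + 12 * v" "h \<ge> e + 1"
    using hecke_index[OF e] by metis
  define A where "A = Phi ^ (2 * h) * F"
  define c :: rat where "c = (-1) ^ ((l - 1) div 2 * h) * of_nat l ^ (w + h - 1)"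
  define G where "G = Pf ^ (2 * h') * (slice l \<beta> A + fps_const c * fps_X ^ v * dilate l A)"
  have G: "mform (int w + int h - int h') G"
    unfolding G_def A_def c_def by (rule hecke_mform[OF prime_l l_gt_3 F(1) \<beta>(2) hv(3,4)]) (use hv(5) in simp)
  have wt: "int w + int h - int h' = int w + (int l ^ e - 1 - int l ^ (e - 1) - int r) div 2"
  proof -
    have "int l ^ e = 2 * int h + 1" "int l ^ (e - 1) + int r = 2 * int h'"
      using arg_cong[OF hv(1), of int] arg_cong[OF hv(2), of int] by simp_all
    hence "int l ^ e - 1 - int l ^ (e - 1) - int r = 2 * (int h - int h')" by simp
    thus ?thesis by simp
  qed
  have lic: "li c" unfolding c_def by (intro li_mult li_power li_of_nat li_minus li_1)
  have BA: "BI A" unfolding A_def by (intro BI_mult BI_power BI_Phi F)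
  have BD: "BI (fps_X ^ v * dilate l A)" by (intro BI_mult BI_power BI_X BI_dilate BA)
  have BG: "BI G" unfolding G_def by (intro BI_mult BI_power BI_Pf BI_add BI_slice BA BI_const lic BI_X BI_dilate)
  have sl: "slice l \<beta> A = Phi ^ (2 * h') * G - fps_const c * (fps_X ^ v * dilate l A)"
    unfolding G_def by (simp add: mult.assoc[symmetric] Phi_Pf_power)
  have cgs: "cg e (slice l \<beta> A) (Phi ^ (2 * h') * G)"
  proof -
    have "w + h - 1 = e + (w + h - 1 - e)" using hv(5) by simp
    hence "of_nat l ^ (w + h - 1) = (of_nat l ^ e * of_nat l ^ (w + h - 1 - e) :: rat)" by (metis power_add)
    hence "c = of_nat l ^ e * ((-1) ^ ((l - 1) div 2 * h) * of_nat l ^ (w + h - 1 - e))" unfolding c_def by (simp only: mult_ac)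
    hence c': "fps_const c = fps_const (of_nat l ^ e) * fps_const ((-1) ^ ((l - 1) div 2 * h) * of_nat l ^ (w + h - 1 - e))" by simp
    show ?thesis unfolding sl c'
      by (rule cgI[of "- (fps_const ((-1) ^ ((l - 1) div 2 * h) * of_nat l ^ (w + h - 1 - e)) * (fps_X ^ v * dilate l A))"])
         (intro BI_minus BI_smult li_mult li_power li_of_nat li_minus li_1 BD, simp only: mult.assoc mult_minus_right add_uminus_conv_diff)
  qed
  have PF: "Pf * F = Pf ^ (l ^ e) * A"
  proof -
    have "Pf ^ (l ^ e) * A = (Phi ^ (2 * h) * Pf ^ (2 * h)) * (Pf * F)"
      unfolding A_def hv(1)[symmetric] power_add power_one_right by (simp only: mult_ac)
    thus ?thesis by (simp add: Phi_Pf_power)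
  qed
  have "cg e (res F) (slice l \<beta> (dilate l (Pf ^ (l ^ (e - 1))) * A))"
    unfolding res_def PF mult.commute[of _ A] by (intro cg_slice cg_mult_left BA Pf_frobenius) (use e in auto)
  also have "slice l \<beta> (dilate l (Pf ^ (l ^ (e - 1))) * A) = Pf ^ (l ^ (e - 1)) * slice l \<beta> A"
    by (rule slice_dilate_mult[OF l_pos \<beta>(2)])
  also have "cg e (Pf ^ (l ^ (e - 1)) * slice l \<beta> A) (Pf ^ (l ^ (e - 1)) * (Phi ^ (2 * h') * G))"
    by (intro cg_mult_left BI_power BI_Pf cgs)
  also have "Pf ^ (l ^ (e - 1)) * (Phi ^ (2 * h') * G) = Phi ^ r * G"
  proof -
    have "Pf ^ (l ^ (e - 1)) * (Phi ^ (2 * h') * G) = (Phi ^ (l ^ (e - 1)) * Pf ^ (l ^ (e - 1))) * (Phi ^ r * G)"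
      unfolding hv(2) power_add by (simp only: mult_ac)
    thus ?thesis by (simp add: Phi_Pf_power)
  qed
  finally have "cg e (res F) (Phi ^ r * G)" .
  thus ?thesis using that[of G] G BG unfolding wt by blast
qed

text \<open>The target of all computations: a series on the progression that is \<Phi>^r, hence
  eta^r after dilation, times a sum of forms of bounded weight, modulo l.\<close>

definition RZ :: "int \<Rightarrow> rat fps \<Rightarrow> bool" where "RZ W f \<longleftrightarrow> (\<exists>G. MZ W G \<and> cg 1 f (Phi ^ r * G))"

lemma RZ_cong: "RZ W g \<Longrightarrow> cg 1 f g \<Longrightarrow> RZ W f" unfolding RZ_def using cg_trans by blast
lemma RZ_mono: "RZ W f \<Longrightarrow> W \<le> V \<Longrightarrow> RZ V f" unfolding RZ_def using MZ_mono by blast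
lemma RZ_add: "RZ W f \<Longrightarrow> RZ W g \<Longrightarrow> RZ W (f + g)"
  unfolding RZ_def by (elim exE conjE, rule_tac x = "G + Ga" in exI) (auto intro: MZ_add cg_add simp: distrib_left)
lemma RZ_smult: "li c \<Longrightarrow> RZ W f \<Longrightarrow> RZ W (fps_const c * f)"
  unfolding RZ_def by (elim exE conjE, rule_tac x = "fps_const c * G" in exI)
    (auto intro: MZ_smult cg_smult simp: mult.left_commute[of "Phi ^ r"])
lemma RZ_0: "RZ W 0" unfolding RZ_def using MZ_0[of W] by (intro exI[of _ 0]) simp
lemma RZ_diff: "RZ W f \<Longrightarrow> RZ W g \<Longrightarrow> RZ W (f - g)"
  using RZ_add[of W f "fps_const (-1) * g"] RZ_smult[of "-1" W g] li_minus[of 1] by (simp flip: fps_const_neg)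
lemma RZ_sum: "(\<And>i. i \<in> A \<Longrightarrow> RZ W (f i)) \<Longrightarrow> RZ W (sum f A)"
  by (induction A rule: infinite_finite_induct) (auto intro: RZ_add RZ_0)

lemma res_MF: "MF W f \<Longrightarrow> RZ (int W + (int l - 2 - int r) div 2) (res f)"
proof (induction rule: MF.induct)
  case (MF_form k f)
  obtain G where G: "mform (int k + (int l ^ 1 - 1 - int l ^ (1 - 1) - int r) div 2) G" "BI G" "cg 1 (res f) (Phi ^ r * G)"
    using res_form[OF MF_form(1,2), of 1] by blast
  have "MZ (int W + (int l - 2 - int r) div 2) G"
    by (rule MZ_form[OF G(1,2)]) (use MF_form in simp)
  thus ?case unfolding RZ_def using G(3) by blast
next
  case (MF_add f g) thus ?case by (simp add: res_add RZ_add)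
qed

lemma res_MFc: "MFc W f \<Longrightarrow> RZ (int W + (int l - 2 - int r) div 2) (res f)"
  unfolding MFc_def using res_MF res_cong RZ_cong by blast

end

lemma eis_nth_0: "fps_nth (eis k) 0 = gh k" by (simp add: eis_def Sf_def)
lemma eis_nth_1: "fps_nth (eis k) 1 = 2 / fact (2 * k - 1)" by (simp add: eis_def Sf_def sig_def)

lemma Sf_eis: "Sf (2 * k - 1) = fps_const (fact (2 * k - 1) / 2) * eis k - fps_const (fact (2 * k - 1) / 2 * gh k)"
proof -
  have "fps_const (fact (2 * k - 1) / 2) * eis k = fps_const (fact (2 * k - 1) / 2 * gh k) + fps_const (fact (2 * k - 1) / 2 * (2 / fact (2 * k - 1))) * Sf (2 * k - 1)"
    unfolding eis_def distrib_left mult.assoc[symmetric] fps_const_mult ..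
  thus ?thesis by simp
qed

context rank_prime
begin

section \<open>Bernoulli numbers modulo l\<close>

definition u :: nat where "u = (l - 1) div 2"

lemma l_u: "l = 2 * u + 1" using odd_l by (auto simp: u_def elim: oddE)
lemma u_ge_2: "u \<ge> 2" using l_ge_5 l_u by simp
lemma of_u: "2 * of_nat u = (of_nat l - 1 :: rat)"
proof -
  have "of_nat l = (of_nat (2 * u + 1) :: rat)" using l_u by (rule arg_cong)
  thus ?thesis by simp
qed
lemma ndvd_int: "\<not> l dvd n \<Longrightarrow> \<not> int l dvd int n" by simp

lemma li_12: "li (- (1 / 12))" using li_minus[OF li_divide_nat[OF li_1, of 12]] ndvd_2_3[of 2 1] by simp

text \<open>The recursion divides by 2m + 3, which is smaller than l in this range.\<close>

lemma gh_li: "1 \<le> k \<Longrightarrow> k < u \<Longrightarrow> li (gh k)"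
proof (induction k rule: less_induct)
  case (less k)
  show ?case
  proof (cases "k = 1")
    case True thus ?thesis using gh_1 li_12 by simp
  next
    case False
    define m where "m = k - 1"
    have m: "m \<ge> 1" "k = m + 1" using less.prems False by (auto simp: m_def)
    have "of_nat (2 * m + 3) * gh k = (\<Sum>i=1..m. gh i * gh (m + 1 - i))" using gh_rec[of m] m by simp
    hence "gh k = (\<Sum>i=1..m. gh i * gh (m + 1 - i)) / of_nat (2 * m + 3)" by (simp add: field_simps)
    also have "li \<dots>" using m less.prems l_u
      by (intro li_divide_nat li_sum li_mult less.IH ndvd_less) auto
    finally show ?thesis .
  qed
qed

text \<open>At index u = (l - 1)/2 the divisor in the recursion is l for the first time.\<close>

lemma lgh_u: "li (of_nat l * gh u)"
proof -
  have "of_nat l * gh u = (\<Sum>i=1..u-1. gh i * gh (u - i))"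
  proof -
    have "2 * of_nat (u - 1) + 3 = (of_nat l :: rat)" using of_u u_ge_2 by (simp add: of_nat_diff)
    thus ?thesis using gh_rec[of "u - 1"] u_ge_2 by simp
  qed
  also have "li \<dots>" by (intro li_sum li_mult gh_li) auto
  finally show ?thesis .
qed

text \<open>In the next step only the two products with \<open>gh 1\<close> involve
  \<open>gh u\<close>; all other terms are integral at l.\<close>

lemma gh_next:
  obtains x where "li x" "of_nat (l + 2) * (of_nat l * gh (u + 1)) = - (1/6) * (of_nat l * gh u) + of_nat l * x"
proof -
  let ?x = "\<Sum>i=2..u-1. gh i * gh (u + 1 - i)"
  have x: "li ?x" by (intro li_sum li_mult gh_li) auto
  have "{1..u} = insert 1 (insert u {2..u-1})" using u_ge_2 by auto
  hence "(\<Sum>i=1..u. gh i * gh (u + 1 - i)) = 2 * (gh 1 * gh u) + ?x" using u_ge_2 by simp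
  moreover have "of_nat (l + 2) * gh (u + 1) = (\<Sum>i=1..u. gh i * gh (u + 1 - i))"
  proof -
    have e: "of_nat (l + 2) = (2 * of_nat u + 3 :: rat)" by (simp add: of_u)
    show ?thesis unfolding e using gh_rec[of u] u_ge_2 by simp
  qed
  ultimately have "of_nat (l + 2) * gh (u + 1) = - (1/6) * gh u + ?x" using gh_1 by simp
  hence "of_nat l * (of_nat (l + 2) * gh (u + 1)) = of_nat l * (- (1/6) * gh u + ?x)" by simp
  hence "of_nat (l + 2) * (of_nat l * gh (u + 1)) = - (1/6) * (of_nat l * gh u) + of_nat l * ?x" by (simp only: distrib_left mult_ac)
  thus ?thesis using that x by blast
qed

lemma li_6: "li (- (1 / 6))" using li_minus[OF li_divide_nat[OF li_1, of 6]] ndvd_2_3[of 1 1] by simp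

lemma lgh_u1: "li (of_nat l * gh (u + 1))"
proof -
  obtain x where x: "li x" "of_nat (l + 2) * (of_nat l * gh (u + 1)) = - (1/6) * (of_nat l * gh u) + of_nat l * x" by (rule gh_next)
  hence "of_nat l * gh (u + 1) = (- (1/6) * (of_nat l * gh u) + of_nat l * x) / of_nat (l + 2)" by (simp add: field_simps)
  also have "li \<dots>"
  proof (intro li_divide_nat li_add li_mult[OF li_6] lgh_u li_mult li_of_nat x)
    show "\<not> l dvd l + 2" unfolding dvd_add_triv_left_iff by (rule ndvd_less) (use l_gt_3 in auto)
  qed
  finally show ?thesis .
qed

text \<open>The von Staudt-Clausen congruence l B_{l-1} = -1 modulo l in this scaling. It falls out
  of the coefficient of q in the Eisenstein recursion at index u, multiplied by l!.\<close>

lemma fact_gh_u: "cgc (fact (l - 1) * (of_nat l * gh u)) 1"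
proof -
  let ?f = "\<lambda>i. fact (2 * i - 1) :: rat"
  let ?T = "\<lambda>i. gh i * (2 / ?f (u + 1 - i))"
  have fl: "fact l = (of_nat l * fact (l - 1) :: rat)" using l_pos by (simp add: fact_reduce)
  have "fps_nth (fps_const (of_nat u * (2 * of_nat u + 3)) * eis (u + 1)) 1 = fps_nth (euler_op (eis u) + fps_const (of_nat u) * (\<Sum>i=1..u. eis i * eis (u + 1 - i))) 1"
    using eis_rec[of u] u_ge_2 by simp
  hence h1: "of_nat u * (2 * of_nat u + 3) * (2 / ?f (u + 1)) = 2 / ?f u + of_nat u * (\<Sum>i=1..u. gh i * (2 / ?f (u + 1 - i)) + 2 / ?f i * gh (u + 1 - i))"
    by (simp add: fps_sum_nth fps_mult_nth eis_nth_0 eis_nth_1[unfolded One_nat_def] del: mult_Suc_right)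
  have "(\<Sum>i=1..u. 2 / ?f i * gh (u + 1 - i)) = (\<Sum>i=1..u. ?T i)"
    by (rule sum.reindex_bij_witness[of _ "\<lambda>i. u + 1 - i" "\<lambda>i. u + 1 - i"]) auto
  hence h2: "(\<Sum>i=1..u. gh i * (2 / ?f (u + 1 - i)) + 2 / ?f i * gh (u + 1 - i)) = 2 * (\<Sum>i=1..u. ?T i)"
    by (simp only: sum.distrib)
  have i1: "2 * (u + 1) - 1 = l" and i2: "2 * u - 1 = l - 2" using l_u by arith+
  have e: "of_nat u * (2 * of_nat u + 3) * (2 / fact l) = 2 / fact (l - 2) + 2 * of_nat u * (\<Sum>i=1..u. ?T i)"
    using h1 unfolding h2 i1 i2 by (simp only: mult_ac)
  have "{1..u} = insert u {1..u-1}" using u_ge_2 by auto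
  hence S: "(\<Sum>i=1..u. ?T i) = 2 * gh u + (\<Sum>i=1..u-1. ?T i)" using u_ge_2 by simp
  define y where "y = (\<Sum>i=1..u-1. ?T i)"
  have y: "li y" unfolding y_def using l_u by (intro li_sum li_mult gh_li li_div_fact) auto
  have f2: "fact l / fact (l - 2) = (of_nat l * of_nat (l - 1) :: rat)"
  proof -
    have p: "0 < l - 1" "l - 1 - 1 = l - 2" using l_gt_3 by simp_all
    have "fact (l - 1) = (of_nat (l - 1) * fact (l - 2) :: rat)" using fact_reduce[OF p(1), where 'a = rat] unfolding p(2) .
    thus ?thesis unfolding fl by simp
  qed
  define z where "z = fact (l - 1) * (of_nat l * gh u)"
  have z: "li z" unfolding z_def by (intro li_mult lgh_u) (use li_of_nat[of "fact (l - 1)"] in simp)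
  have "fact l * (of_nat u * (2 * of_nat u + 3) * (2 / fact l)) = fact l * (2 / fact (l - 2) + 2 * of_nat u * (2 * gh u + y))"
    unfolding e S y_def by simp
  hence "2 * of_nat u * (2 * of_nat u + 3) = 2 * (fact l / fact (l - 2)) + 2 * of_nat u * (2 * (fact l * gh u) + fact l * y)"
    by (simp add: algebra_simps)
  hence "2 * of_nat u * (2 * of_nat u + 3) = 2 * of_nat u * (2 * z) + of_nat l * (2 * of_nat (l - 1) + 2 * of_nat u * (fact (l - 1) * y))"
    unfolding f2 unfolding fl z_def by (simp add: algebra_simps)
  hence "of_int (2 * int u) * 2 = of_int (2 * int u) * (2 * z) + of_nat l * (2 * of_nat (l - 1) + 2 * of_nat u * (fact (l - 1) * y) - 2 * of_nat u)"
  proof -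
    have "2 * of_nat u * (2 * of_nat u + 3) = of_int (2 * int u) * 2 + of_nat l * (2 * of_nat u :: rat)"
    proof -
      have "of_nat l = (1 + 2 * of_nat u :: rat)" using of_u by simp
      thus ?thesis by (simp add: algebra_simps)
    qed
    thus ?thesis using \<open>2 * of_nat u * (2 * of_nat u + 3) = 2 * of_nat u * (2 * z) + _\<close> by (simp add: algebra_simps)
  qed
  hence "cgc (of_int (2 * int u) * 2) (of_int (2 * int u) * (2 * z))"
    by (rule cgcI[rotated]) (intro li_add li_diff li_mult y li_of_nat li_numeral; use li_of_nat[of "fact (l - 1)"] in simp)
  moreover have nd: "\<not> int l dvd 2 * int u" using ndvd_int[OF ndvd_less[of "2 * u"]] l_u u_ge_2 by simp
  ultimately have "cgc 2 (2 * z)" by (rule cgc_cancel)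
  hence "cgc (of_int 2 * 1) (of_int 2 * z)" by simp
  moreover have "\<not> int l dvd 2" using ndvd_int[OF ndvd_less[of 2]] l_gt_3 by simp
  ultimately have "cgc 1 z" by (rule cgc_cancel)
  thus ?thesis unfolding z_def by (rule cgc_sym)
qed

text \<open>Equal to -B_{l+1}/(2(l + 1)), the constant term of the Eisenstein series of weight l + 1
  whose other coefficients are \<sigma>_l(n).\<close>

definition \<gamma> :: rat where "\<gamma> = fact l / 2 * gh (u + 1)"

lemma \<gamma>_eq: "\<gamma> = fact (l - 1) / 2 * (of_nat l * gh (u + 1))"
  unfolding \<gamma>_def using l_pos by (simp add: fact_reduce)

lemma li_fact: "li (fact n)" using li_of_nat[of "fact n"] by simp

lemma li_\<gamma>: "li \<gamma>" unfolding \<gamma>_eq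
  using li_divide_nat[OF li_fact[of "l - 1"], of 2] ndvd_less[of 2] l_gt_3 by (intro li_mult lgh_u1) auto

text \<open>A Kummer congruence: B_{l+1}/(l + 1) agrees with B_2/2 modulo l.\<close>

lemma \<gamma>_cong: "cgc \<gamma> (- 1 / 24)"
proof -
  obtain x where x: "li x" "of_nat (l + 2) * (of_nat l * gh (u + 1)) = - (1/6) * (of_nat l * gh u) + of_nat l * x" by (rule gh_next)
  have "6 * fact (l - 1) * (of_nat (l + 2) * (of_nat l * gh (u + 1))) = 12 * of_nat (l + 2) * \<gamma>" unfolding \<gamma>_eq by simp
  hence "12 * of_nat (l + 2) * \<gamma> = (-1) * (fact (l - 1) * (of_nat l * gh u)) + of_nat l * (6 * fact (l - 1) * x)"
    unfolding x(2) by (simp add: algebra_simps)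
  hence "24 * \<gamma> = (-1) * (fact (l - 1) * (of_nat l * gh u)) + of_nat l * (6 * fact (l - 1) * x - 12 * \<gamma>)" by (simp add: algebra_simps)
  hence "cgc (24 * \<gamma>) ((-1) * (fact (l - 1) * (of_nat l * gh u)))"
    by (rule cgcI[rotated]) (intro li_diff li_mult li_numeral li_fact x li_\<gamma>)
  also have "cgc ((-1) * (fact (l - 1) * (of_nat l * gh u))) ((-1) * 1)" by (intro cgc_mult_left fact_gh_u li_minus li_1)
  finally have "cgc (of_int 24 * \<gamma>) (of_int 24 * (- 1 / 24))" by simp
  moreover have "\<not> int l dvd 24" using ndvd_int[OF ndvd_2_3[of 3 1]] by simp
  ultimately show ?thesis by (rule cgc_cancel)
qed

section \<open>Divisor sums and crank moments as sums of forms modulo l\<close>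

lemma BI_Sf: "BI (Sf k)" by (rule BI_int) (simp add: Sf_def)

lemma li_fact_half: "li (fact n / 2)"
  using li_divide_nat[OF li_fact[of n], of 2] ndvd_less[of 2] l_gt_3 by auto

lemma BI_eis: "1 \<le> k \<Longrightarrow> k < u \<Longrightarrow> BI (eis k)"
  unfolding eis_def using l_u by (intro BI_add BI_const gh_li BI_mult li_div_fact BI_Sf) auto

definition El :: "rat fps" where "El = fps_const (fact l / 2) * eis (u + 1)"

lemma El_eq: "El = Sf l + fps_const \<gamma>"
proof -
  have "2 * (u + 1) - 1 = l" using l_u by arith
  thus ?thesis using Sf_eis[of "u + 1"] by (simp add: El_def \<gamma>_def)
qed

lemma BI_El: "BI El" unfolding El_eq by (intro BI_add BI_Sf BI_const li_\<gamma>)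

lemma mform_El: "mform (int (l + 1)) El"
proof -
  have E: "2 * int (u + 1) = int (l + 1)" using l_u by simp
  have "u + 1 \<ge> 2" using u_ge_2 by simp
  from mform_smult[OF mform_eis[OF this], of "fact l / 2"] show ?thesis unfolding El_def E .
qed

lemma Sf_l_cong: "cg 1 (Sf l) (Sf 1)"
proof (rule cg_nth_intI)
  fix n
  have "\<exists>k::int. of_nat (d ^ l) = (of_nat (d ^ 1) + of_nat l * of_int k :: rat)" for d
  proof -
    obtain k where "int d ^ l = int d + int l * k" using fermat_int by blast
    hence "of_int (int d ^ l) = (of_int (int d + int l * k) :: rat)" by (simp only:)
    thus ?thesis by (intro exI[of _ k]) simp
  qed
  then obtain k :: "nat \<Rightarrow> int" where k: "\<And>d. of_nat (d ^ l) = (of_nat (d ^ 1) + of_nat l * of_int (k d) :: rat)" by metis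
  show "\<exists>k::int. fps_nth (Sf l) n = fps_nth (Sf 1) n + of_nat l ^ 1 * of_int k"
  proof (cases "n = 0")
    case False
    have "(\<Sum>d | d dvd n. of_nat (d ^ l)) = (\<Sum>d | d dvd n. of_nat (d ^ 1) :: rat) + of_nat l * of_int (\<Sum>d | d dvd n. k d)"
      unfolding k by (simp only: sum.distrib sum_distrib_left of_int_sum)
    thus ?thesis using False by (intro exI[of _ "\<Sum>d | d dvd n. k d"]) (simp add: Sf_def sig_def)
  qed (auto simp: Sf_def intro: exI[of _ 0])
qed

text \<open>By Fermat the quasimodular S_2 agrees modulo l with S_{l+1}, which is a form of weight l
  + 1 minus a constant.\<close>

lemma Sf_1_MFc: "MFc (l + 1) (Sf 1)"
proof -
  have "Sf l = El + fps_const (- \<gamma>)" unfolding El_eq by (simp flip: fps_const_neg)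
  moreover have "MF (l + 1) (El + fps_const (- \<gamma>))"
    by (intro MF_add MF_form[OF mform_El BI_El] MF_const li_minus li_\<gamma>) simp
  ultimately show ?thesis using MFc_cong[OF MFc_MF cg_sym[OF Sf_l_cong]] by simp
qed

text \<open>For k \<ge> 2 the weight is only 2k; the weaker bound k(l + 1) is additive and also
  covers S_2, so weights in products can be tracked by the index alone.\<close>

lemma Sf_MFc: "1 \<le> k \<Longrightarrow> k < u \<Longrightarrow> MFc (k * (l + 1)) (Sf (2 * k - 1))"
proof (cases "k = 1")
  case True thus ?thesis using Sf_1_MFc by simp
next
  case False
  assume k: "1 \<le> k" "k < u"
  have "MF (2 * k) (fps_const (fact (2 * k - 1) / 2) * eis k)"
    using mform_smult[OF mform_eis[of k]] k False by (intro MF_form[of "2 * k"] BI_smult li_fact_half BI_eis) auto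
  moreover have "MF (2 * k) (fps_const (- (fact (2 * k - 1) / 2 * gh k)))"
    using k by (intro MF_const li_minus li_mult li_fact_half gh_li) auto
  moreover have "Sf (2 * k - 1) = fps_const (fact (2 * k - 1) / 2) * eis k + fps_const (- (fact (2 * k - 1) / 2 * gh k))"
    unfolding Sf_eis by (simp flip: fps_const_neg)
  ultimately have "MFc (2 * k) (Sf (2 * k - 1))" using MFc_MF MF_add by metis
  thus ?thesis by (rule MFc_mono) (use l_gt_3 in simp)
qed

definition mterm :: "nat \<Rightarrow> nat \<Rightarrow> rat fps" where
  "mterm j t = fps_const (of_nat ((2 * j - 1) choose (2 * t - 1)) * 6) * (mu (2 * (j - t)) * Sf (2 * t - 1))"

lemma mu_even: "j \<ge> 1 \<Longrightarrow> mu (2 * j) = (\<Sum>t=1..j. mterm j t)"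
proof -
  assume j: "j \<ge> 1"
  have "mu (2 * j) = mu (Suc (2 * j - 1))" using j by simp
  also have "\<dots> = (\<Sum>i\<in>{i. i \<le> 2 * j - 1 \<and> odd i}. fps_const (of_nat ((2 * j - 1) choose i)) * mu (2 * j - 1 - i) * (6 * Sf i))"
    unfolding mu_Suc by (subst sum.inter_filter[symmetric]) (auto intro: sum.cong)
  also have "\<dots> = (\<Sum>t=1..j. mterm j t)"
  proof (rule sum.reindex_bij_witness[of _ "\<lambda>t. 2 * t - 1" "\<lambda>i. (i + 1) div 2"])
    fix i assume "i \<in> {i. i \<le> 2 * j - 1 \<and> odd i}"
    then obtain s where s: "i = 2 * s + 1" "s + 1 \<le> j" using j by (auto elim!: oddE)
    have "2 * j - 1 - i = 2 * (j - (s + 1))" using s by simp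
    thus "mterm j ((i + 1) div 2) = fps_const (of_nat ((2 * j - 1) choose i)) * mu (2 * j - 1 - i) * (6 * Sf i)"
      using s by (simp add: mterm_def fps_numeral_fps_const mult_ac flip: fps_const_mult)
  qed (auto elim!: oddE)
  finally show ?thesis .
qed

lemma mterm_MFc:
  assumes "1 \<le> t" "t \<le> j" "t < u" "MFc ((j - t) * (l + 1)) (mu (2 * (j - t)))"
  shows "MFc (j * (l + 1)) (mterm j t)"
proof -
  have "MFc ((j - t) * (l + 1) + t * (l + 1)) (mu (2 * (j - t)) * Sf (2 * t - 1))"
    by (intro MFc_mult assms Sf_MFc)
  moreover have "(j - t) * (l + 1) + t * (l + 1) = j * (l + 1)" using assms by (simp only: add_mult_distrib[symmetric]) simp
  ultimately show ?thesis unfolding mterm_def by (intro MFc_smult li_mult li_of_nat li_numeral) simp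
qed

lemma mu_MFc: "j < u \<Longrightarrow> MFc (j * (l + 1)) (mu (2 * j))"
proof (induction j rule: less_induct)
  case (less j)
  show ?case
  proof (cases "j = 0")
    case True thus ?thesis using MFc_const[OF li_1] by (simp add: mu_0)
  next
    case False
    hence "mu (2 * j) = (\<Sum>t=1..j. mterm j t)" using mu_even by simp
    also have "MFc (j * (l + 1)) \<dots>" using less by (intro MFc_sum mterm_MFc less.IH) auto
    finally show ?thesis .
  qed
qed

text \<open>Of all summands of the moment of order l - 1 only the last contains S_{l-1}, the one
  series excluded from \<open>Sf_MFc\<close>.\<close>

lemma mu_top:
  obtains R where "MFc (u * (l + 1)) R" "mu (2 * u) = 6 * Sf (l - 2) + R"
proof
  have "{1..u} = insert u {1..u-1}" using u_ge_2 by auto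
  moreover have "mterm u u = 6 * Sf (l - 2)"
  proof -
    have "2 * u - 1 = l - 2" using l_u by simp
    thus ?thesis unfolding mterm_def by (simp add: mu_0 fps_numeral_fps_const)
  qed
  ultimately show "mu (2 * u) = 6 * Sf (l - 2) + (\<Sum>t=1..u-1. mterm u t)" using mu_even[of u] u_ge_2 by simp
  show "MFc (u * (l + 1)) (\<Sum>t=1..u-1. mterm u t)" by (intro MFc_sum mterm_MFc mu_MFc) auto
qed

section \<open>Denominators of the polynomial coefficients\<close>

lemma fp_li: "b + 1 < l \<Longrightarrow> li (coeff (fp b) k)"
proof (induction b rule: less_induct)
  case (less b)
  have "li (1 / of_nat (2 * (b + 1)))"
  proof (rule li_divide_nat[OF li_1])
    show "\<not> l dvd 2 * (b + 1)" unfolding prime_dvd_mult_iff[OF prime_l]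
      using ndvd_less[of 2] ndvd_less[of "b + 1"] less.prems l_gt_3 by simp
  qed
  moreover have "li (coeff (fp (b - 2 * j)) k)" if "j \<in> {1..b div 2}" for j using that less.prems by (intro less.IH) auto
  moreover have "li (if k = b + 1 then 2 ^ (b + 1) else 0)" by (simp add: li_power li_mult del: power_Suc)
  ultimately show ?case by (subst coeff_fp) (intro li_mult li_diff li_sum li_of_nat li_numeral)
qed

section \<open>Rank moments modulo a prime\<close>

lemma fp_l_li: "li (coeff (fp l) k)"
proof -
  have "\<not> l dvd 2 * (l + 1)" unfolding prime_dvd_mult_iff[OF prime_l] dvd_add_triv_left_iff
    using ndvd_less[of 2] ndvd_less[of 1] l_gt_3 by simp
  hence "li (1 / of_nat (2 * (l + 1)))" by (rule li_divide_nat[OF li_1])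
  moreover have "li (coeff (fp (l - 2 * j)) k)" if "j \<in> {1..l div 2}" for j using that l_gt_3 by (intro fp_li) auto
  moreover have "li (if k = l + 1 then 2 ^ (l + 1) else 0)" by (simp add: li_power li_mult del: power_Suc)
  ultimately show ?thesis by (subst coeff_fp) (intro li_mult li_diff li_sum li_of_nat li_numeral)
qed

text \<open>The recursion divides by 2l here, but the binomials in it are divisible by l except for
  the one at j = u, which multiplies the monomial \<open>fp 0\<close> of degree 1. The two excluded
  positions are therefore 1 and the leading one.\<close>

lemma fp_l1_li:
  assumes "k \<noteq> 1" "k \<noteq> l"
  shows "li (coeff (fp (l - 1)) k)"
proof -
  let ?b = "l - 1"
  let ?f = "\<lambda>j. 2 * of_nat ((?b + 1) choose (2 * j + 1)) * coeff (fp (?b - 2 * j)) k :: rat"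
  have b: "?b + 1 = l" "?b div 2 = u" using l_pos by (auto simp: u_def)
  have "\<exists>x. li x \<and> ?f j = of_nat l * x" if j: "j \<in> {1..u}" for j
  proof (cases "j = u")
    case True
    have "?b - 2 * j = 0" using True l_u by simp
    moreover have "coeff (fp 0) k = 0" using assms(1) by (intro coeff_fp_eq_0) presburger
    ultimately show ?thesis by (intro exI[of _ 0]) simp
  next
    case False
    have "l dvd (l choose (2 * j + 1))" using j False l_u prime_l by (intro dvd_choose_prime) auto
    then obtain m where m: "l choose (2 * j + 1) = l * m" by auto
    have "li (coeff (fp (?b - 2 * j)) k)" using j l_gt_3 by (intro fp_li) auto
    moreover have "?f j = of_nat l * (2 * of_nat m * coeff (fp (?b - 2 * j)) k)" unfolding b m by simp
    ultimately show ?thesis using li_mult li_of_nat li_numeral by metis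
  qed
  then obtain x where x: "\<And>j. j \<in> {1..u} \<Longrightarrow> li (x j) \<and> ?f j = of_nat l * x j" by metis
  have "coeff (fp ?b) k = 1 / of_nat (2 * l) * (0 - (\<Sum>j\<in>{1..u}. ?f j))"
    using assms by (subst coeff_fp) (simp only: b if_False)
  also have "(\<Sum>j\<in>{1..u}. ?f j) = of_nat l * (\<Sum>j\<in>{1..u}. x j)" using x by (simp only: sum_distrib_left cong: sum.cong)
  also have "1 / of_nat (2 * l) * (0 - of_nat l * (\<Sum>j\<in>{1..u}. x j)) = (- (\<Sum>j\<in>{1..u}. x j)) / of_nat 2"
    using l_pos by (simp add: field_simps)
  also have "li \<dots>" using x ndvd_less[of 2] l_gt_3 by (intro li_divide_nat li_minus li_sum) auto
  finally show ?thesis .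
qed

lemma phi_li: "a + 3 < l \<Longrightarrow> li (coeff (phi_poly a) k)"
  unfolding coeff_phi_poly by (intro li_add li_diff li_mult li_numeral) (auto intro: fp_li)

text \<open>For these k the index 2k - 1 at which \<open>fp (l - 1)\<close> enters avoids both 1 and
  l.\<close>

lemma phi_l2_li:
  assumes "2 \<le> k" "k \<le> u"
  shows "li (coeff (phi_poly (l - 2)) (2 * k))"
proof -
  have i: "l - 2 + 1 = l - 1" "l - 2 + 2 = l" using l_gt_3 by simp_all
  have "li (coeff (fp (l - 1)) (2 * k - 1))" using assms l_u by (intro fp_l1_li) auto
  moreover have "li (coeff (fp (l - 2)) m)" for m using l_gt_3 by (intro fp_li) auto
  ultimately show ?thesis unfolding coeff_phi_poly i
    using assms by (intro li_add li_diff li_mult li_numeral fp_l_li) auto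
qed

definition Yf :: "nat \<Rightarrow> rat fps" where "Yf a = Abs_fps (\<lambda>N. of_int (Ym a (l * N + \<beta>)))"
definition Nf :: "nat \<Rightarrow> rat fps" where "Nf m = Abs_fps (\<lambda>N. of_int (rank_moment m (l * N + \<beta>)))"

lemma BI_Yf: "BI (Yf a)" by (rule BI_int) (simp add: Yf_def)
lemma BI_Nf: "BI (Nf a)" by (rule BI_int) (simp add: Nf_def)
lemma Nf_2: "Nf 2 = Yf 1" by (simp add: Nf_def Yf_def Ym_1)

lemma index_eq: "24 * of_nat (l * N + \<beta>) - 1 = (of_nat l * (24 * of_nat N + of_nat r) :: rat)"
proof -
  have "24 * of_nat \<beta> = (1 + of_nat l * of_nat r :: rat)" using arg_cong[OF \<beta>_r, of "of_nat :: nat \<Rightarrow> rat"] by simp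
  thus ?thesis by (simp add: algebra_simps)
qed

lemma Yf_rec: "cg 1 (Yf (a + 2)) (2 * res (Wf a))"
proof (rule cgI)
  \<comment> \<open>On the progression 24 n - 1 = l (24 N + r), so the term with \<open>Ym a\<close>
    in the recursion is l times this series.\<close>
  let ?k = "Abs_fps (\<lambda>N. - (24 * of_nat N + of_nat r) * of_int (Ym a (l * N + \<beta>))) :: rat fps"
  show "BI ?k" by (rule BI_int) auto
  show "Yf (a + 2) = 2 * res (Wf a) + fps_const (of_nat l ^ 1) * ?k"
  proof (rule fps_ext)
    fix N
    show "fps_nth (Yf (a + 2)) N = fps_nth (2 * res (Wf a) + fps_const (of_nat l ^ 1) * ?k) N"
      using Ym_rec[of "l * N + \<beta>" a] unfolding index_eq
      by (simp add: Yf_def res_def fps_numeral_fps_const algebra_simps)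
  qed
qed

abbreviation "c0 \<equiv> (int l - 2 - int r) div 2"

lemma c0: "2 * c0 = int l - 2 - int r"
  using odd_l odd_r by (intro dvd_mult_div_cancel) auto

lemma Wf_double: "odd a \<Longrightarrow> fps_const 2 * Wf a = (\<Sum>k=1..(a + 3) div 2. fps_const (coeff (phi_poly a) (2 * k)) * mu (2 * k))"
  using Wf_eq_mu[of a] by (simp add: mult.assoc[symmetric])

text \<open>In this range only moments \<open>mu (2 * k)\<close> with k < u occur, so S_{l-1} does
  not enter and all coefficients are integral at l.\<close>

lemma Yf_RZ:
  assumes "1 \<le> j" "j + 1 < u"
  shows "RZ (int ((j + 1) * (l + 1)) + c0) (Yf (2 * j + 1))"
proof -
  define a where "a = 2 * j - 1"
  have a: "odd a" "(a + 3) div 2 = j + 1" "a + 3 < l" "a + 2 = 2 * j + 1" using assms l_u by (auto simp: a_def)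
  have "MFc ((j + 1) * (l + 1)) (mu (2 * k))" if "k \<in> {1..j+1}" for k
  proof (rule MFc_mono[OF mu_MFc])
    show "k < u" using that assms by simp
    show "k * (l + 1) \<le> (j + 1) * (l + 1)" using that by (intro mult_le_mono1) simp
  qed
  hence "MFc ((j + 1) * (l + 1)) (fps_const 2 * Wf a)"
    unfolding Wf_double[OF a(1)] a(2) by (intro MFc_sum MFc_smult phi_li a(3))
  hence "RZ (int ((j + 1) * (l + 1)) + c0) (res (fps_const 2 * Wf a))" by (rule res_MFc)
  hence "RZ (int ((j + 1) * (l + 1)) + c0) (2 * res (Wf a))" by (simp add: res_smult fps_numeral_fps_const)
  from RZ_cong[OF this Yf_rec] show ?thesis unfolding a(4) .
qed

lemma Nf_decomp:
  assumes "k \<ge> 1"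
  shows "Nf (2 * k) = fps_const (4 * of_nat k / 4 ^ k) * Yf 1 + (\<Sum>j=1..k-1. fps_const (2 / 4 ^ k * of_nat ((2 * k) choose (2 * j + 1))) * Yf (2 * j + 1))"
proof (rule fps_ext)
  fix N
  let ?n = "l * N + \<beta>"
  let ?g = "\<lambda>a. of_nat ((2 * k) choose a) * of_int (Ym a ?n) :: rat"
  have "(\<Sum>a\<le>2*k. if odd a then ?g a else 0) = (\<Sum>a | a \<le> 2 * k \<and> odd a. ?g a)"
    by (subst sum.inter_filter[symmetric]) (auto intro: sum.cong)
  also have "\<dots> = (\<Sum>j=0..k-1. ?g (2 * j + 1))"
    by (rule sum.reindex_bij_witness[of _ "\<lambda>j. 2 * j + 1" "\<lambda>a. a div 2"]) (use assms in \<open>auto elim!: oddE\<close>)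
  also have "\<dots> = ?g 1 + (\<Sum>j=1..k-1. ?g (2 * j + 1))" by (subst sum.atLeast_Suc_atMost) auto
  finally have s: "(\<Sum>a\<le>2*k. if odd a then ?g a else 0) = ?g 1 + (\<Sum>j=1..k-1. ?g (2 * j + 1))" .
  have "of_int (4 ^ k * rank_moment (2 * k) ?n) = (of_int (2 * (\<Sum>a\<le>2*k. if odd a then int ((2 * k) choose a) * Ym a ?n else 0)) :: rat)"
    using rank_moment_Ym[OF assms] by simp
  also have "\<dots> = 2 * (\<Sum>a\<le>2*k. if odd a then ?g a else 0)"
    by (simp add: if_distrib[of of_int] cong: if_cong)
  finally have "of_int (rank_moment (2 * k) ?n) = (2 / 4 ^ k) * (?g 1 + (\<Sum>j=1..k-1. ?g (2 * j + 1)))"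
    unfolding s by (simp add: field_simps)
  thus "fps_nth (Nf (2 * k)) N = fps_nth (fps_const (4 * of_nat k / 4 ^ k) * Yf 1 + (\<Sum>j=1..k-1. fps_const (2 / 4 ^ k * of_nat ((2 * k) choose (2 * j + 1))) * Yf (2 * j + 1))) N"
    by (simp add: Nf_def Yf_def fps_sum_nth sum_distrib_left distrib_left mult_ac)
qed

lemma li_pow4: "li x \<Longrightarrow> li (x / 4 ^ k)"
proof -
  assume "li x"
  hence "li (x / of_nat (2 ^ (2 * k) * 3 ^ 0))" by (rule li_divide_nat[OF _ ndvd_2_3])
  thus ?thesis by (simp add: power_mult)
qed

lemma Nf_RZ:
  assumes "2 \<le> k" "k < u"
  shows "\<exists>c::int. RZ (int (k * (l + 1)) + c0) (Nf (2 * k) - fps_const (of_int c) * Nf 2)"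
proof -
  have "li (4 * of_nat k / 4 ^ k)" by (intro li_pow4 li_mult li_numeral li_of_nat)
  then obtain c :: int where c: "cgc (4 * of_nat k / 4 ^ k) (of_int c)" by (rule cgc_int)
  let ?S = "\<Sum>j=1..k-1. fps_const (2 / 4 ^ k * of_nat ((2 * k) choose (2 * j + 1))) * Yf (2 * j + 1)"
  have "RZ (int (k * (l + 1)) + c0) ?S"
  proof (intro RZ_sum RZ_smult li_mult li_pow4 li_numeral li_of_nat)
    fix j assume j: "j \<in> {1..k-1}"
    have "(j + 1) * (l + 1) \<le> k * (l + 1)" using j by (intro mult_le_mono1) auto
    thus "RZ (int (k * (l + 1)) + c0) (Yf (2 * j + 1))" using j assms by (intro RZ_mono[OF Yf_RZ]) (auto simp del: mult_Suc mult_Suc_right)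
  qed
  moreover have "cg 1 (Nf (2 * k) - fps_const (of_int c) * Nf 2) ?S"
  proof -
    have "cg 1 (fps_const (4 * of_nat k / 4 ^ k) * Yf 1 + ?S) (fps_const (of_int c) * Yf 1 + ?S)"
      by (intro cg_add cg_smult_cgc c BI_Yf cg_refl)
    from cg_diff[OF this cg_refl[of 1 "fps_const (of_int c) * Yf 1"]] show ?thesis
      using Nf_decomp[of k] assms unfolding Nf_2 by simp
  qed
  ultimately show ?thesis using RZ_cong by blast
qed

text \<open>At k = u the moment of order l - 2 involves \<open>mu (2 * u)\<close> and so, exactly
  once, the series S_{l-1}. It is kept apart, since modulo l it cannot be treated like the other
  terms.\<close>

lemma Nf_top:
  obtains c :: int and c' R where "li c'" "RZ (int (u * (l + 1)) + c0) R"
    "cg 1 (Nf (l - 1)) (fps_const (of_int c) * Nf 2 + R + fps_const c' * res (Sf (l - 2)))"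
proof -
  have lu: "l - 1 = 2 * u" using l_u by arith
  have "li (4 * of_nat u / 4 ^ u)" by (intro li_pow4 li_mult li_numeral li_of_nat)
  then obtain c :: int where c: "cgc (4 * of_nat u / 4 ^ u) (of_int c)" by (rule cgc_int)
  let ?g = "\<lambda>j. fps_const (2 / 4 ^ u * of_nat ((2 * u) choose (2 * j + 1))) * Yf (2 * j + 1)"
  let ?d = "2 / 4 ^ u * of_nat ((2 * u) choose (2 * (u - 1) + 1)) :: rat"
  have d: "li ?d" by (intro li_mult li_pow4 li_numeral li_of_nat)
  have R1: "RZ (int (u * (l + 1)) + c0) (\<Sum>j=1..u-2. ?g j)"
  proof (intro RZ_sum RZ_smult li_mult li_pow4 li_numeral li_of_nat)
    fix j assume j: "j \<in> {1..u-2}"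
    have "(j + 1) * (l + 1) \<le> u * (l + 1)" using j by (intro mult_le_mono1) auto
    thus "RZ (int (u * (l + 1)) + c0) (Yf (2 * j + 1))" using j by (intro RZ_mono[OF Yf_RZ]) (auto simp del: mult_Suc mult_Suc_right)
  qed
  define a where "a = 2 * u - 3"
  have a: "odd a" "(a + 3) div 2 = u" "a + 3 < l" "a + 2 = 2 * (u - 1) + 1" using u_ge_2 l_u by (auto simp: a_def)
  let ?p = "\<lambda>k. coeff (phi_poly a) (2 * k)"
  obtain R0 where R0: "MFc (u * (l + 1)) R0" "mu (2 * u) = 6 * Sf (l - 2) + R0" by (rule mu_top)
  let ?M = "fps_const (?p u) * R0 + (\<Sum>k=1..u-1. fps_const (?p k) * mu (2 * k))"
  have "MFc (u * (l + 1)) (mu (2 * k))" if "k \<in> {1..u-1}" for k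
  proof (rule MFc_mono[OF mu_MFc])
    show "k < u" using that u_ge_2 by auto
    show "k * (l + 1) \<le> u * (l + 1)" using that by (intro mult_le_mono1) auto
  qed
  hence M: "MFc (u * (l + 1)) ?M" using a(3) R0(1) by (intro MFc_add MFc_sum MFc_smult phi_li) auto
  have ins: "{1..u} = insert u {1..u-1}" using u_ge_2 by auto
  have "fps_const 2 * Wf a = (\<Sum>k=1..u. fps_const (?p k) * mu (2 * k))"
    using Wf_double[OF a(1)] unfolding a(2) .
  also have "\<dots> = fps_const (6 * ?p u) * Sf (l - 2) + ?M"
  proof -
    have nin: "u \<notin> {1..u-1}" using u_ge_2 by auto
    have "fps_const (?p u) * mu (2 * u) = fps_const (6 * ?p u) * Sf (l - 2) + fps_const (?p u) * R0"
      by (simp only: R0(2) distrib_left fps_numeral_fps_const mult.assoc[symmetric] fps_const_mult mult.commute[of "?p u" 6])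
    thus ?thesis by (simp only: ins sum.insert[OF _ nin] finite_atLeastAtMost add_ac)
  qed
  finally have "res (fps_const 2 * Wf a) = res (fps_const (6 * ?p u) * Sf (l - 2) + ?M)" by (rule arg_cong)
  hence W: "2 * res (Wf a) = fps_const (6 * ?p u) * res (Sf (l - 2)) + res ?M"
    unfolding res_add[of _ ?M] res_smult by (simp only: fps_numeral_fps_const)
  let ?R = "(\<Sum>j=1..u-2. ?g j) + fps_const ?d * res ?M"
  have ins2: "{1..u-1} = insert (u-1) {1..u-2}" using u_ge_2 by auto
  have "Nf (2 * u) = fps_const (4 * of_nat u / 4 ^ u) * Yf 1 + (\<Sum>j=1..u-2. ?g j) + fps_const ?d * Yf (2 * (u - 1) + 1)"
  proof -
    have nin: "u - 1 \<notin> {1..u-2}" and u1: "1 \<le> u" using u_ge_2 by auto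
    show ?thesis using Nf_decomp[OF u1] by (simp only: ins2 sum.insert[OF _ nin] finite_atLeastAtMost add_ac)
  qed
  moreover have "cg 1 (fps_const (4 * of_nat u / 4 ^ u) * Yf 1 + (\<Sum>j=1..u-2. ?g j) + fps_const ?d * Yf (2 * (u - 1) + 1))
     (fps_const (of_int c) * Yf 1 + (\<Sum>j=1..u-2. ?g j) + fps_const ?d * (2 * res (Wf a)))"
    by (intro cg_add cg_smult_cgc c BI_Yf cg_refl cg_smult d Yf_rec[of a, unfolded a(4)])
  moreover have "fps_const (of_int c) * Yf 1 + (\<Sum>j=1..u-2. ?g j) + fps_const ?d * (2 * res (Wf a)) = fps_const (of_int c) * Nf 2 + ?R + fps_const (?d * (6 * ?p u)) * res (Sf (l - 2))"
    unfolding W Nf_2 by (simp only: distrib_left mult.assoc[symmetric] fps_const_mult add_ac)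
  ultimately have "cg 1 (Nf (l - 1)) (fps_const (of_int c) * Nf 2 + ?R + fps_const (?d * (6 * ?p u)) * res (Sf (l - 2)))"
    unfolding lu by (simp only:)
  moreover have "RZ (int (u * (l + 1)) + c0) ?R" by (intro RZ_add R1 RZ_smult d res_MFc M)
  moreover have "li (?d * (6 * ?p u))" using a(3) by (intro li_mult[OF d] li_mult li_numeral phi_li)
  ultimately show ?thesis using that by blast
qed

text \<open>l S_{l-1} is a form of weight l - 1 minus a constant, both integral at l. To divide by l
  afterwards both must be restricted modulo l^2: the constant produces \<open>H1\<close>, the
  Eisenstein series \<open>H2\<close>.\<close>

lemma res_Sf_top:
  obtains H1 H2 k where "mform ((int l * (int l - 1) - int r - 1) div 2) H1" "mform ((int l * (int l + 1) - int r - 3) div 2) H2"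
    "BI H1" "BI H2" "BI k" "fps_const (of_nat l) * res (Sf (l - 2)) = Phi ^ r * (H2 - H1) + fps_const (of_nat l ^ 2) * k"
proof -
  let ?E = "fps_const (of_nat l * (fact (l - 2) / 2)) * eis u"
  let ?c = "of_nat l * (fact (l - 2) / 2) * gh u"
  have lu: "2 * u - 1 = l - 2" using l_u by arith
  have c: "li ?c" using li_mult[OF li_fact_half[of "l - 2"] lgh_u] by (simp add: mult_ac)
  have S: "fps_const (of_nat l) * Sf (l - 2) = ?E - fps_const ?c"
    using Sf_eis[of u] unfolding lu by (simp add: right_diff_distrib mult.assoc[symmetric])
  have BE: "BI ?E"
  proof -
    have "?E = fps_const (of_nat l) * Sf (l - 2) + fps_const ?c" unfolding S by simp
    thus ?thesis by (simp only:) (intro BI_add BI_smult BI_Sf BI_const c li_of_nat)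
  qed
  have E: "mform (int (l - 1)) ?E"
  proof -
    have "2 * int u = int (l - 1)" using l_u by simp
    thus ?thesis using mform_smult[OF mform_eis[OF u_ge_2]] by simp
  qed
  have C: "mform (int 0) (fps_const ?c)" using mform_const by simp
  obtain G2 where G2: "mform (int (l - 1) + (int l ^ 2 - 1 - int l ^ (2 - 1) - int r) div 2) G2" "BI G2" "cg 2 (res ?E) (Phi ^ r * G2)"
    using res_form[OF E BE, of 2] by blast
  obtain G1 where G1: "mform (int 0 + (int l ^ 2 - 1 - int l ^ (2 - 1) - int r) div 2) G1" "BI G1" "cg 2 (res (fps_const ?c)) (Phi ^ r * G1)"
    using res_form[OF C BI_const[OF c], of 2] by blast
  have w1: "int 0 + (int l ^ 2 - 1 - int l ^ (2 - 1) - int r) div 2 = (int l * (int l - 1) - int r - 1) div 2"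
    by (simp add: power2_eq_square algebra_simps)
  have w2: "int (l - 1) + (int l ^ 2 - 1 - int l ^ (2 - 1) - int r) div 2 = (int l * (int l + 1) - int r - 3) div 2"
  proof -
    have "int l * (int l + 1) - int r - 3 = (int l ^ 2 - 1 - int l ^ (2 - 1) - int r) + 2 * int (l - 1)"
      using l_gt_3 by (simp add: power2_eq_square algebra_simps of_nat_diff)
    thus ?thesis by simp
  qed
  have "cg 2 (res ?E - res (fps_const ?c)) (Phi ^ r * G2 - Phi ^ r * G1)" by (rule cg_diff[OF G2(3) G1(3)])
  moreover have "res ?E - res (fps_const ?c) = fps_const (of_nat l) * res (Sf (l - 2))" 
    using arg_cong[OF S, of res] by (simp only: res_diff res_smult)
  ultimately have "cg 2 (fps_const (of_nat l) * res (Sf (l - 2))) (Phi ^ r * (G2 - G1))" by (simp only: right_diff_distrib)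
  then obtain k where k: "BI k" "fps_const (of_nat l) * res (Sf (l - 2)) = Phi ^ r * (G2 - G1) + fps_const (of_nat l ^ 2) * k" by (auto simp: cg_def)
  show ?thesis by (rule that[OF G1(1)[unfolded w1] G2(1)[unfolded w2] G1(2) G2(2) k])
qed

section \<open>First-order corrections modulo l^2\<close>

lemma MZ_mult_MF:
  assumes "MZ W f" "MF V g"
  shows "MZ (W + int V) (f * g)"
  using assms(1)
proof (induction rule: MZ.induct)
  case (MZ_form k f)
  show ?case using assms(2)
  proof (induction rule: MF.induct)
    case (MF_form k' g)
    show ?case using MF_form MZ_form by (intro MZ.MZ_form[OF mform_mult]) (auto intro: BI_mult)
  qed (auto simp: distrib_left intro: MZ.intros)
qed (auto simp: distrib_right intro: MZ.intros)

lemma RZ_mult_MFc: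
  assumes "RZ W f" "MFc V g"
  shows "RZ (W + int V) (f * g)"
proof -
  obtain G h where G: "MZ W G" "cg 1 f (Phi ^ r * G)" and h: "MF V h" "cg 1 g h" using assms by (auto simp: RZ_def MFc_def)
  have "cg 1 (f * g) (Phi ^ r * G * h)"
    using G h by (intro cg_mult BI_mult BI_power BI_Phi) (auto intro: MZ_BI cg_BI MF_BI)
  thus ?thesis unfolding RZ_def using MZ_mult_MF[OF G(1) h(1)] by (intro exI[of _ "G * h"]) (simp add: mult.assoc)
qed

lemma E2f_MFc: "MFc (l + 1) E2f"
proof -
  have "MFc (l + 1) (fps_const 1 + fps_const (- 24) * Sf 1)"
    by (intro MFc_add MFc_const MFc_smult Sf_1_MFc li_1 li_minus li_numeral)
  moreover have "fps_const 1 + fps_const (- 24) * Sf 1 = E2f" by (simp add: E2f_def fps_numeral_fps_const flip: fps_const_neg)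
  ultimately show ?thesis by simp
qed

lemma RZ_res_1: "RZ c0 (res 1)"
  using res_MF[OF MF_const[OF li_1, of 0]] by simp

lemma RZ_E2_res_1: "RZ (c0 + int (l + 1)) (E2f * res 1)"
  using RZ_mult_MFc[OF RZ_res_1 E2f_MFc] by (simp add: mult.commute)

lemma euler_Phi_power: "euler_op (Phi ^ n) = - (of_nat n * (Phi ^ n * Sf 1))"
proof (induction n)
  case 0
  have "euler_op (1 :: rat fps) = 0" by (rule fps_ext) (simp add: euler_op_nth fps_one_nth)
  thus ?case by simp
next
  case (Suc n) thus ?case by (simp add: euler_op_mult euler_Phi algebra_simps)
qed

text \<open>On the progression 24 n = 1 + l (24 N + r), so l Q is the part by which 24 n P(n)
  differs from P(n); compare \<open>res_Sf_1\<close>.\<close>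

definition Q :: "rat fps" where "Q = 24 * euler_op (res 1) + of_nat r * res 1"

text \<open>Modulo l the series \<open>res 1\<close> is \<Phi>^r G with G of weight
  \<open>c0\<close>, and the operator 24 q d/dq + r acts on this product as twice the Serre
  derivative of G plus (2 c0 + r) E_2 = (l - 2) E_2.\<close>

lemma RZ_Q: "RZ (c0 + int (l + 1)) Q"
proof -
  have C: "mform (int 0) (fps_const 1)" using mform_const[of 1] by simp
  have c0': "int 0 + (int l ^ 1 - 1 - int l ^ (1 - 1) - int r) div 2 = c0" by simp
  obtain G where "mform (int 0 + (int l ^ 1 - 1 - int l ^ (1 - 1) - int r) div 2) G" "BI G" "cg 1 (res (fps_const 1)) (Phi ^ r * G)"
    using res_form[OF C BI_const[OF li_1], of 1] by blast
  hence G: "mform c0 G" "BI G" "cg 1 (res 1) (Phi ^ r * G)" unfolding c0' by simp_all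
  obtain k where k: "BI k" "res 1 = Phi ^ r * G + fps_const (of_nat l ^ 1) * k" using G(3) by (auto simp: cg_def)
  let ?S = "12 * euler_op G - fps_const (of_int c0) * E2f * G"
  let ?D = "\<lambda>f. 24 * euler_op f + of_nat r * f"
  have S: "MZ (c0 + 2) ?S"
    by (intro MZ_form[OF mform_serre[OF G(1)]] BI_diff BI_mult BI_numeral BI_euler G(2) BI_const li_of_int MFc_BI[OF E2f_MFc]) simp
  have e2: "of_int (2 * c0 + int r) = (of_int (int l - 2) :: rat)" using c0 by simp
  have D1: "?D (Phi ^ r * G) = fps_const 2 * (Phi ^ r * ?S) + fps_const (of_int (int l - 2)) * (E2f * (Phi ^ r * G))"
    unfolding e2[symmetric] euler_op_mult euler_Phi_power E2f_def
    by (simp add: fps_numeral_fps_const algebra_simps flip: fps_of_nat fps_const_add fps_const_mult) 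
  have D2: "?D (fps_const (of_nat l ^ 1) * k) = fps_const (of_nat l ^ 1) * ?D k"
    by (rule fps_ext) (simp add: fps_numeral_fps_const algebra_simps flip: fps_of_nat)
  have "Q = ?D (Phi ^ r * G) + fps_const (of_nat l ^ 1) * ?D k"
    unfolding D2[symmetric] Q_def k(2) euler_op_add by (simp only: distrib_left add_ac)
  hence "cg 1 Q (?D (Phi ^ r * G))"
    by (rule cgI[rotated]) (auto intro!: BI_add BI_mult BI_euler k BI_const simp flip: fps_of_nat)
  moreover have "RZ (c0 + int (l + 1)) (?D (Phi ^ r * G))" unfolding D1
  proof (intro RZ_add RZ_smult li_numeral li_of_int)
    have "RZ (c0 + 2) (Phi ^ r * ?S)" unfolding RZ_def using S cg_refl by blast
    thus "RZ (c0 + int (l + 1)) (Phi ^ r * ?S)" by (rule RZ_mono) (use l_gt_3 in simp)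
    have "RZ c0 (Phi ^ r * G)" unfolding RZ_def using MZ_form[OF G(1,2)] cg_refl by blast
    from RZ_mult_MFc[OF this E2f_MFc] show "RZ (c0 + int (l + 1)) (E2f * (Phi ^ r * G))" by (simp only: mult.commute)
  qed
  ultimately show ?thesis using RZ_cong by blast
qed

text \<open>q d/dq P = P S_2, so on the progression P S_2 has the coefficients n P(n).\<close>

lemma res_Sf_1: "res (Sf 1) = fps_const (1 / 24) * (res 1 + fps_const (of_nat l) * Q)"
proof (rule fps_ext)
  fix N
  have "fps_nth (res (Sf 1)) N = of_nat (l * N + \<beta>) * fps_nth Pf (l * N + \<beta>)"
    using arg_cong[OF euler_Pf, of "\<lambda>f. fps_nth f (l * N + \<beta>)"] by (simp add: res_def euler_op_nth)
  moreover have "of_nat (l * N + \<beta>) = (1 + of_nat l * (24 * of_nat N + of_nat r)) / (24 :: rat)" using index_eq[of N] by (simp add: field_simps)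
  ultimately have "fps_nth (res (Sf 1)) N = (1 + of_nat l * (24 * of_nat N + of_nat r)) / 24 * fps_nth Pf (l * N + \<beta>)" by (simp only:)
  thus "fps_nth (res (Sf 1)) N = fps_nth (fps_const (1 / 24) * (res 1 + fps_const (of_nat l) * Q)) N"
    by (simp add: Q_def res_def fps_numeral_fps_const algebra_simps add_divide_distrib flip: fps_of_nat)
qed

abbreviation "Wtop \<equiv> int ((u + 1) * (l + 1)) + c0"

lemma Wtop: "2 * Wtop = int l * (int l + 3) - int r - 1"
proof -
  have "2 * int ((u + 1) * (l + 1)) = (2 * int u + 2) * (int l + 1)" by (simp add: algebra_simps)
  also have "2 * int u = int l - 1" using l_u by simp
  finally show ?thesis using c0 by (simp add: algebra_simps)
qed

lemma Wtop_ge: "c0 + int (l + 1) \<le> Wtop"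
proof -
  have "1 * (l + 1) \<le> (u + 1) * (l + 1)" by (intro mult_le_mono1) simp
  hence "int (1 * (l + 1)) \<le> int ((u + 1) * (l + 1))" by (simp only: of_nat_le_iff)
  thus ?thesis by (simp only: mult_1 add.commute[of c0] add_le_cancel_right)
qed

text \<open>Modulo l^2 the Eisenstein series of weight l + 1 restricts to \<Phi>^r G. Its constant
  term contributes \<gamma> res 1 with \<gamma> = -1/24 modulo l, S_2 contributes (res 1 + l Q)/24,
  and these two main parts cancel. Hence G is divisible by l, and the quotient by l is
  explicit.\<close>

lemma RZ_Sf_l_diff: "RZ Wtop (fps_const (1 / of_nat l) * res (Sf l - Sf 1))"
proof -
  have ln: "of_nat l \<noteq> (0 :: rat)" using l_pos by simp
  obtain G where G: "mform (int (l + 1) + (int l ^ 2 - 1 - int l ^ (2 - 1) - int r) div 2) G" "BI G" "cg 2 (res El) (Phi ^ r * G)"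
    using res_form[OF mform_El BI_El, of 2] by blast
  obtain k where k: "BI k" "res El = Phi ^ r * G + fps_const (of_nat l ^ 2) * k" using G(3) by (auto simp: cg_def)
  obtain g where g: "li g" "\<gamma> = - 1 / 24 + of_nat l * g" using \<gamma>_cong by (auto simp: cgc_def)
  obtain k0 where k0: "BI k0" "Sf l = Sf 1 + fps_const (of_nat l ^ 1) * k0" using Sf_l_cong by (auto simp: cg_def)
  have BQ: "BI Q" unfolding Q_def by (auto intro!: BI_add BI_mult BI_euler res_BI BI_const simp flip: fps_of_nat)
  have res_g: "res (fps_const \<gamma>) = fps_const \<gamma> * res 1" using res_smult[of \<gamma> 1] by simp
  have "res (Sf l - Sf 1) = res El - fps_const \<gamma> * res 1 - res (Sf 1)"
    using El_eq res_g by (simp add: res_add res_diff)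
  also have "\<dots> = Phi ^ r * G + fps_const (of_nat l) * (fps_const (of_nat l) * k - fps_const g * res 1 - fps_const (1/24) * Q)"
    unfolding k(2) res_Sf_1 g(2)
    by (rule fps_ext) (simp add: power2_eq_square algebra_simps add_divide_distrib flip: fps_const_add)
  finally have e1: "res (Sf l - Sf 1) = Phi ^ r * G + fps_const (of_nat l) * (fps_const (of_nat l) * k - fps_const g * res 1 - fps_const (1/24) * Q)" .
  have e2: "res (Sf l - Sf 1) = fps_const (of_nat l) * res k0" unfolding k0(2) by (simp add: res_smult)
  define X where "X = res k0 - (fps_const (of_nat l) * k - fps_const g * res 1 - fps_const (1/24) * Q)"
  have "Phi ^ r * G = fps_const (of_nat l) * X"
    using e1 unfolding e2 X_def right_diff_distrib[of "fps_const (of_nat l)" "res k0"] by simp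
  hence "Pf ^ r * (Phi ^ r * G) = Pf ^ r * (fps_const (of_nat l) * X)" by (rule arg_cong)
  hence "(Phi ^ r * Pf ^ r) * G = fps_const (of_nat l) * (Pf ^ r * X)" by (simp only: mult_ac)
  hence "G = fps_const (of_nat l) * (Pf ^ r * X)" by (simp add: Phi_Pf_power)
  hence "fps_const (1 / of_nat l) * G = fps_const (1 / of_nat l * of_nat l) * (Pf ^ r * X)" by (simp only: mult.assoc[symmetric] fps_const_mult)
  hence G': "fps_const (1 / of_nat l) * G = Pf ^ r * X" using ln by simp
  have li24: "li (1/24)" using li_divide_nat[OF li_1 ndvd_2_3[of 3 1]] by simp
  \<comment> \<open>Division by l is legitimate because the left side S_{l+1} - S_2 is itself
    divisible by l, which forces the same for \<Phi>^r G, and \<Phi>^r is invertible.\<close>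
  have BG: "BI (fps_const (1 / of_nat l) * G)" unfolding G' X_def
    by (intro BI_mult BI_power BI_Pf BI_diff res_BI k0 BI_smult k g BI_1 li24 BQ li_of_nat)
  have "MZ Wtop (fps_const (1 / of_nat l) * G)"
  proof (rule MZ_form[OF mform_smult[OF G(1)] BG])
    have "2 * ((int l ^ 2 - 1 - int l ^ (2 - 1) - int r) div 2) = int l ^ 2 - 1 - int l ^ (2 - 1) - int r"
      using odd_l odd_r by (intro dvd_mult_div_cancel) auto
    thus "int (l + 1) + (int l ^ 2 - 1 - int l ^ (2 - 1) - int r) div 2 \<le> Wtop"
      using Wtop l_gt_3 by (simp add: power2_eq_square algebra_simps)
  qed
  hence R1: "RZ Wtop (Phi ^ r * (fps_const (1 / of_nat l) * G))" unfolding RZ_def using cg_refl by blast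
  have "fps_const (1 / of_nat l) * res (Sf l - Sf 1) = (Phi ^ r * (fps_const (1 / of_nat l) * G) - fps_const g * res 1 - fps_const (1/24) * Q) + fps_const (of_nat l ^ 1) * k"
    unfolding e1 using ln by (simp add: right_diff_distrib distrib_left mult.left_commute[of "fps_const (1 / of_nat l)"] mult.assoc[symmetric])
  hence "cg 1 (fps_const (1 / of_nat l) * res (Sf l - Sf 1)) (Phi ^ r * (fps_const (1 / of_nat l) * G) - fps_const g * res 1 - fps_const (1/24) * Q)"
    by (rule cgI[OF k(1)])
  moreover have "RZ Wtop (Phi ^ r * (fps_const (1 / of_nat l) * G) - fps_const g * res 1 - fps_const (1/24) * Q)"
    by (intro RZ_diff R1 RZ_smult g li24 RZ_mono[OF RZ_res_1] RZ_mono[OF RZ_Q]) (use Wtop_ge in auto)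
  ultimately show ?thesis using RZ_cong by blast
qed

text \<open>n d^(l-2) = (n/d) d^(l-1) is n/d modulo l unless l divides d; the missing divisors form
  the divisor sum of n/l.\<close>

lemma euler_Sf_top: "cg 1 (euler_op (Sf (l - 2))) (Sf 1 - dilate l (Sf 1))"
proof (rule cg_nth_intI)
  fix n
  show "\<exists>k::int. fps_nth (euler_op (Sf (l - 2))) n = fps_nth (Sf 1 - dilate l (Sf 1)) n + of_nat l ^ 1 * of_int k"
  proof (cases "n = 0")
    case True thus ?thesis by (intro exI[of _ 0]) (simp add: Sf_def euler_op_nth dilate_nth)
  next
    case n: False
    have fin: "finite {d. d dvd n}" using n by simp
    have t: "\<exists>k::int. int n * int d ^ (l - 2) = (if l dvd d then 0 else int (n div d)) + int l * k" if d: "d dvd n" for d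
    proof -
      obtain m where m: "n = d * m" using d by auto
      have d0: "d > 0" using m n by (cases d) auto
      have e: "int n * int d ^ (l - 2) = int m * int d ^ (l - 1)"
      proof -
        have "l - 1 = Suc (l - 2)" using l_gt_3 by simp
        thus ?thesis using m by simp
      qed
      show ?thesis
      proof (cases "l dvd d")
        case True
        hence "int l dvd int d ^ (l - 1)" using l_gt_3 by (intro dvd_trans[OF _ dvd_power]) auto
        then obtain k where "int d ^ (l - 1) = int l * k" by auto
        thus ?thesis unfolding e using True by (intro exI[of _ "int m * k"]) simp
      next
        case False
        have "[d ^ (l - 1) = 1] (mod l)" by (rule fermat_theorem[OF prime_l False])
        hence "[int d ^ (l - 1) = 1] (mod int l)" by (metis cong_int_iff of_nat_1 of_nat_power)
        then obtain k where k: "int d ^ (l - 1) = 1 + int l * k" by (metis cong_iff_lin cong_sym)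
        have "n div d = m" using m d0 by simp
        thus ?thesis unfolding e k using False by (intro exI[of _ "int m * k"]) (simp add: algebra_simps)
      qed
    qed
    then obtain k where k: "\<And>d. d dvd n \<Longrightarrow> int n * int d ^ (l - 2) = (if l dvd d then 0 else int (n div d)) + int l * k d" by metis
    have "int n * int (sig (l - 2) n) = (\<Sum>d | d dvd n. int n * int d ^ (l - 2))" by (simp add: sig_def sum_distrib_left)
    also have "\<dots> = (\<Sum>d | d dvd n. (if l dvd d then 0 else int (n div d)) + int l * k d)" using k by (intro sum.cong) auto
    also have "\<dots> = (\<Sum>d | d dvd n. int (n div d)) - (\<Sum>d | d dvd n. if l dvd d then int (n div d) else 0) + int l * (\<Sum>d | d dvd n. k d)"
      unfolding sum.distrib sum_distrib_left sum_subtractf[symmetric] by (intro arg_cong2[of _ _ _ _ "(+)"] sum.cong) auto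
    also have "(\<Sum>d | d dvd n. int (n div d)) = int (sig 1 n)"
    proof -
      have "(\<Sum>d | d dvd n. int (n div d)) = (\<Sum>d | d dvd n. int d)"
        by (rule sum.reindex_bij_witness[of _ "\<lambda>d. n div d" "\<lambda>d. n div d"]) (use n in \<open>auto simp: dvd_div_eq_iff elim!: dvdE\<close>)
      thus ?thesis by (simp add: sig_def)
    qed
    also have "(\<Sum>d | d dvd n. if l dvd d then int (n div d) else 0) = (if l dvd n then int (sig 1 (n div l)) else 0)"
    proof (cases "l dvd n")
      case True
      then obtain m where m: "n = l * m" by auto
      have m0: "m > 0" using m n by (cases m) auto
      have "(\<Sum>d | d dvd n. if l dvd d then int (n div d) else 0) = (\<Sum>d | d dvd n \<and> l dvd d. int (n div d))"
        using fin by (subst sum.inter_filter[symmetric]) (auto intro: sum.cong)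
      also have "\<dots> = (\<Sum>d | d dvd m. int d)"
        by (rule sum.reindex_bij_witness[of _ "\<lambda>d. l * (m div d)" "\<lambda>d. n div d"])
           (use m m0 l_pos in \<open>auto simp: dvd_div_eq_iff elim!: dvdE\<close>)
      finally show ?thesis using True m l_pos by (simp add: sig_def)
    next
      case False
      hence "\<not> l dvd d" if "d dvd n" for d using that dvd_trans by blast
      thus ?thesis using False by (simp add: sum.neutral)
    qed
    finally have "of_int (int n * int (sig (l - 2) n)) = (of_int (int (sig 1 n) - (if l dvd n then int (sig 1 (n div l)) else 0) + int l * (\<Sum>d | d dvd n. k d)) :: rat)" by (simp only:)
    thus ?thesis by (intro exI[of _ "\<Sum>d | d dvd n. k d"]) (auto simp: Sf_def euler_op_nth dilate_nth)
  qed
qed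

text \<open>Restricting q d/dq (P S_{l-1}) = P S_2 S_{l-1} + P q d/dq S_{l-1} to the progression,
  where 24 n = 1 modulo l: the left side becomes res S_{l-1}, and the last term is known from
  \<open>euler_Sf_top\<close>. So the product S_2 S_{l-1} costs no more than S_{l-1} itself.\<close>

lemma res_Sf_1_top: "cg 1 (24 * res (Sf 1 * Sf (l - 2))) (res (Sf (l - 2)) - E2f * res 1)"
proof -
  let ?T = "Sf (l - 2)"
  have 1: "euler_op (Pf * ?T) = Pf * (Sf 1 * ?T) + Pf * euler_op ?T"
    by (simp add: euler_op_mult euler_Pf algebra_simps)
  have 2: "cg 1 (24 * slice l \<beta> (euler_op (Pf * ?T))) (res ?T)"
  proof (rule cgI)
    let ?k = "Abs_fps (\<lambda>N. (24 * of_nat N + of_nat r) * fps_nth (res ?T) N)"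
    show "BI ?k"
    proof -
      have "?k = 24 * euler_op (res ?T) + fps_const (of_nat r) * res ?T"
        by (rule fps_ext) (simp add: euler_op_nth fps_numeral_fps_const algebra_simps)
      thus ?thesis by (simp only:) (intro BI_add BI_mult BI_numeral BI_euler res_BI BI_Sf BI_const li_of_nat)
    qed
    show "24 * slice l \<beta> (euler_op (Pf * ?T)) = res ?T + fps_const (of_nat l ^ 1) * ?k"
    proof (rule fps_ext)
      fix N
      have "24 * of_nat (l * N + \<beta>) = (1 + of_nat l * (24 * of_nat N + of_nat r) :: rat)" using index_eq[of N] by (simp add: field_simps)
      hence "24 * (of_nat (l * N + \<beta>) * x) = (x + of_nat l * ((24 * of_nat N + of_nat r) * x) :: rat)" for x
        by (metis (no_types, lifting) distrib_right mult.assoc mult_1)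
      thus "fps_nth (24 * slice l \<beta> (euler_op (Pf * ?T))) N = fps_nth (res ?T + fps_const (of_nat l ^ 1) * ?k) N"
        by (simp add: euler_op_nth fps_numeral_fps_const res_def del: of_nat_add of_nat_mult)
    qed
  qed
  have 3: "cg 1 (res (euler_op ?T)) (res (Sf 1) - Sf 1 * res 1)"
  proof -
    have "cg 1 (res (euler_op ?T)) (res (Sf 1 - dilate l (Sf 1)))" by (intro res_cong euler_Sf_top)
    moreover have "res (dilate l (Sf 1)) = Sf 1 * res 1"
      using slice_dilate_mult[OF l_pos \<beta>(2), of "Sf 1" Pf] by (simp add: res_def mult.commute)
    ultimately show ?thesis by (simp add: res_diff)
  qed
  have 4: "cg 1 (24 * res (Sf 1)) (res 1)"
  proof (rule cgI)
    show "BI Q" unfolding Q_def by (auto intro!: BI_add BI_mult BI_euler res_BI BI_const simp flip: fps_of_nat)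
    show "24 * res (Sf 1) = res 1 + fps_const (of_nat l ^ 1) * Q"
      unfolding res_Sf_1 by (simp add: fps_numeral_fps_const mult.assoc[symmetric])
  qed
  have "slice l \<beta> (euler_op (Pf * ?T)) = res (Sf 1 * ?T) + res (euler_op ?T)" unfolding 1 slice_add res_def ..
  hence "24 * res (Sf 1 * ?T) = 24 * slice l \<beta> (euler_op (Pf * ?T)) - 24 * res (euler_op ?T)" by (simp add: algebra_simps)
  also have "cg 1 \<dots> (res ?T - 24 * (res (Sf 1) - Sf 1 * res 1))"
    by (intro cg_diff 2 cg_mult_left BI_numeral 3)
  also have "res ?T - 24 * (res (Sf 1) - Sf 1 * res 1) = (res ?T + 24 * (Sf 1 * res 1)) - 24 * res (Sf 1)" by (simp add: algebra_simps)
  also have "cg 1 \<dots> ((res ?T + 24 * (Sf 1 * res 1)) - res 1)" by (intro cg_diff cg_refl 4)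
  also have "(res ?T + 24 * (Sf 1 * res 1)) - res 1 = res ?T - E2f * res 1" by (simp add: E2f_def algebra_simps)
  finally show ?thesis .
qed

end

section \<open>The second moment\<close>

lemma mu_even_nth_1: "k \<ge> 1 \<Longrightarrow> fps_nth (mu (2 * k)) 1 = 6"
proof -
  have s: "fps_nth (mu (2 * k)) 1 = cf (-1) 1 + cf 1 1" if "k \<ge> 1" for k
  proof -
    have "{- int 1..int 1} = {-1, 0, 1}" by auto
    thus ?thesis using that by (simp add: mu_def power_mult)
  qed
  have "mu (Suc 1) = 6 * Sf 1" unfolding mu_Suc by (simp add: mu_0)
  hence "fps_nth (mu (2 * 1)) 1 = 6" by (simp add: numeral_2_eq_2 fps_numeral_fps_const Sf_def sig_def)
  thus "k \<ge> 1 \<Longrightarrow> fps_nth (mu (2 * k)) 1 = 6" using s[of 1] s[of k] by simp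
qed

text \<open>\<open>Wf a\<close> has no term in q, while every even moment in its expansion has the
  coefficient 6 there. This removes the coefficient at k = 1, which \<open>phi_l2_li\<close> does
  not cover.\<close>

lemma phi_coeff_sum:
  assumes "odd a"
  shows "(\<Sum>k=1..(a + 3) div 2. coeff (phi_poly a) (2 * k)) = 0"
proof -
  have "fps_nth (Wf a) 1 = 0" by (simp add: Wf_def phi_sum_def)
  hence "(\<Sum>k=1..(a + 3) div 2. coeff (phi_poly a) (2 * k) * fps_nth (mu (2 * k)) 1) = 0"
    unfolding Wf_eq_mu[OF assms] by (simp add: fps_sum_nth)
  moreover have "(\<Sum>k=1..(a + 3) div 2. coeff (phi_poly a) (2 * k) * fps_nth (mu (2 * k)) 1) = (\<Sum>k=1..(a + 3) div 2. coeff (phi_poly a) (2 * k)) * 6"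
    unfolding sum_distrib_right by (intro sum.cong) (auto simp: mu_even_nth_1[unfolded One_nat_def])
  ultimately show ?thesis by simp
qed

context rank_prime
begin

lemma mu_2: "mu 2 = fps_const 6 * Sf 1"
proof -
  have "mu (Suc 1) = 6 * Sf 1" unfolding mu_Suc by (simp add: mu_0)
  thus ?thesis by (simp add: numeral_2_eq_2 fps_numeral_fps_const)
qed

text \<open>Fermat's theorem for the weights 2M + 1.\<close>

lemma Yf_l: "cg 1 (Yf 1) (Yf l)"
proof (rule cg_sym, rule cg_nth_intI)
  fix N
  let ?n = "l * N + \<beta>"
  obtain k where k: "\<And>a. a ^ l = a + int l * k a" using fermat_int by metis
  have "Ym l ?n = Ym 1 ?n + int l * (2 * (\<Sum>M<?n. k (2 * int M + 1) * int (rank_ge (int M + 1) ?n)))"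
    unfolding Ym_def k by (simp add: sum.distrib sum_distrib_left algebra_simps)
  hence "of_int (Ym l ?n) = (of_int (Ym 1 ?n + int l * (2 * (\<Sum>M<?n. k (2 * int M + 1) * int (rank_ge (int M + 1) ?n)))) :: rat)" by (simp only:)
  thus "\<exists>k::int. fps_nth (Yf l) N = fps_nth (Yf 1) N + of_nat l ^ 1 * of_int k"
    by (intro exI[of _ "2 * (\<Sum>M<?n. k (2 * int M + 1) * int (rank_ge (int M + 1) ?n))"]) (simp only: Yf_def fps_nth_Abs_fps of_int_add of_int_mult of_int_of_nat_eq power_one_right)
qed

text \<open>l times the leading coefficient of \<open>phi_poly (l - 2)\<close>, an l-integral
  number.\<close>

definition A' :: rat where "A' = 2 ^ (l + 1) / of_nat ((l - 1) * (l + 1))"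

lemma li_A': "li A'" unfolding A'_def
proof (intro li_divide_nat li_power li_numeral)
  show "\<not> l dvd (l - 1) * (l + 1)" unfolding prime_dvd_mult_iff[OF prime_l] dvd_add_triv_left_iff
    using ndvd_less[of "l - 1"] ndvd_less[of 1] l_gt_3 by simp
qed

abbreviation "pt k \<equiv> coeff (phi_poly (l - 2)) (2 * k)"

lemma pt_top: "pt (u + 1) = A' * (1 / of_nat l)"
proof -
  have e: "2 * (u + 1) = l + 1" "l - 2 + 1 = l - 1" "l - 2 + 2 = l" "l - 2 + 3 = l + 1" using l_u l_gt_3 by arith+
  have gen: "P / (X * L * Y) = P / (X * Y) * (1 / L)" for P X L Y :: rat by (simp add: mult_ac)
  show ?thesis using coeff_phi_top[of "l - 2"] unfolding e A'_def of_nat_mult gen .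
qed

lemma pt_u: "pt u = - (2 ^ (l - 2) / of_nat (l - 1))"
proof -
  have "2 * u = l - 2 + 1" "l - 2 + 1 = l - 1" "l - 2 \<ge> 2" using l_u l_ge_5 by arith+
  thus ?thesis using coeff_phi_next[of "l - 2"] by (simp only:)
qed

text \<open>This identity is the reason why the terms containing \<open>S\<^bsub>l-1\<^esub>\<close> cancel in the second moment.\<close>

lemma pt_cancel: "A' * (36 * (1 + of_nat u)) * (1/24) = - (6 * pt u)"
proof -
  have U: "1 + of_nat u = (of_nat (l + 1) / 2 :: rat)" using of_u by simp
  have n: "of_nat (l - 1) \<noteq> (0 :: rat)" "of_nat (l + 1) \<noteq> (0 :: rat)" using l_gt_3 by (simp_all only: of_nat_eq_0_iff)
  have p: "(2 :: rat) ^ (l + 1) = 8 * 2 ^ (l - 2)"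
  proof -
    have "l + 1 = 3 + (l - 2)" using l_gt_3 by simp
    thus ?thesis by (simp only: power_add) simp
  qed
  have gen: "8 * P / (X * Y) * (36 * (Y / 2)) * (1/24) = - (6 * - (P / X))" if "X \<noteq> 0" "Y \<noteq> 0" for P X Y :: rat
    using that by (simp add: field_simps)
  show ?thesis unfolding A'_def U pt_u p of_nat_mult by (rule gen[OF n])
qed

text \<open>The summand of \<open>mu (2 * (u + 1))\<close> with the factor l of its binomial
  coefficient divided out.\<close>

definition nterm :: "nat \<Rightarrow> rat fps" where
  "nterm t = fps_const (of_nat ((l choose (2 * t - 1)) div l) * 6) * (mu (2 * (u + 1 - t)) * Sf (2 * t - 1))"

lemma mterm_nterm: "t \<in> {1..u} \<Longrightarrow> mterm (u + 1) t = fps_const (of_nat l) * nterm t"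
proof -
  assume t: "t \<in> {1..u}"
  have "2 * (u + 1) - 1 = l" using l_u by arith
  moreover have "l dvd (l choose (2 * t - 1))" using t l_u prime_l by (intro dvd_choose_prime) auto
  hence "of_nat (l choose (2 * t - 1)) = (of_nat l * of_nat ((l choose (2 * t - 1)) div l) :: rat)"
    by (metis dvd_mult_div_cancel of_nat_mult)
  ultimately show ?thesis unfolding mterm_def nterm_def by (simp only: mult.assoc[symmetric] fps_const_mult)
qed

text \<open>S_{l-1} occurs twice: inside \<open>mu (2 * u)\<close> for t = 1 and as the explicit
  factor for t = u. The binomial coefficients divided by l are 1 and u, which gives 36 (1 +
  u).\<close>

lemma nterm_sum:
  obtains M where "MFc ((u + 1) * (l + 1)) M"
    "(\<Sum>t=1..u. nterm t) = fps_const (36 * (1 + of_nat u)) * (Sf 1 * Sf (l - 2)) + M"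
proof -
  obtain R where R: "MFc (u * (l + 1)) R" "mu (2 * u) = 6 * Sf (l - 2) + R" by (rule mu_top)
  let ?M = "fps_const 6 * (R * Sf 1) + (\<Sum>t=2..u-1. nterm t)"
  have n1: "nterm 1 = fps_const 36 * (Sf 1 * Sf (l - 2)) + fps_const 6 * (R * Sf 1)"
  proof -
    have gen: "fps_const 6 * ((fps_const 6 * T + Y) * S) = fps_const 36 * (S * T) + fps_const 6 * (Y * S)" for T Y S :: "rat fps"
    proof -
      have c: "fps_const 36 = fps_const 6 * (fps_const 6 :: rat fps)" by simp
      show ?thesis unfolding c by (simp only: distrib_left distrib_right mult_ac)
    qed
    have i: "2 * 1 - 1 = (1 :: nat)" "u + 1 - 1 = u" "(l choose 1) div l = 1" "of_nat 1 * 6 = (6 :: rat)" using l_pos by simp_all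
    show ?thesis unfolding nterm_def i R(2) fps_numeral_fps_const by (rule gen)
  qed
  have nu: "nterm u = fps_const (36 * of_nat u) * (Sf 1 * Sf (l - 2))"
  proof -
    have i: "2 * u - 1 = l - 2" "2 * (u + 1 - u) = 2" using l_u by arith+
    have "l choose (l - 2) = l choose 2" using binomial_symmetric[of 2 l] l_gt_3 by simp
    also have "\<dots> = l * (l - 1) div 2" by (rule choose_two)
    also have "l * (l - 1) = 2 * (l * u)" using l_u by (metis diff_add_inverse2 mult.assoc mult.commute)
    finally have "(l choose (l - 2)) div l = u" using l_pos by simp
    moreover have "of_nat u * 6 * 6 = (36 * of_nat u :: rat)" by simp
    ultimately show ?thesis unfolding nterm_def i mu_2 by (simp only: mult.assoc[symmetric] fps_const_mult)
  qed
  have ins: "{1..u} = insert 1 (insert u {2..u-1})" and nin: "1 \<notin> insert u {2..u-1}" "u \<notin> {2..u-1}" using u_ge_2 by auto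
  have "(\<Sum>t=1..u. nterm t) = nterm 1 + (nterm u + (\<Sum>t=2..u-1. nterm t))"
    unfolding ins by (simp only: sum.insert[OF _ nin(1)] sum.insert[OF _ nin(2)] finite_insert finite_atLeastAtMost)
  also have "\<dots> = fps_const (36 * (1 + of_nat u)) * (Sf 1 * Sf (l - 2)) + ?M"
  proof -
    have c: "fps_const (36 * (1 + of_nat u)) = fps_const 36 + (fps_const (36 * of_nat u) :: rat fps)" by (simp add: distrib_left)
    show ?thesis unfolding n1 nu c by (simp only: distrib_right add_ac)
  qed
  finally have "(\<Sum>t=1..u. nterm t) = fps_const (36 * (1 + of_nat u)) * (Sf 1 * Sf (l - 2)) + ?M" .
  moreover have "MFc ((u + 1) * (l + 1)) ?M"
  proof (intro MFc_add MFc_smult MFc_sum li_numeral)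
    show "MFc ((u + 1) * (l + 1)) (R * Sf 1)" using MFc_mult[OF R(1) Sf_1_MFc] by (simp add: algebra_simps)
    fix t assume t: "t \<in> {2..u-1}"
    have "MFc ((u + 1 - t) * (l + 1) + t * (l + 1)) (mu (2 * (u + 1 - t)) * Sf (2 * t - 1))"
      using t by (intro MFc_mult mu_MFc Sf_MFc) auto
    moreover have "(u + 1 - t) * (l + 1) + t * (l + 1) = (u + 1) * (l + 1)" using t by (simp only: add_mult_distrib[symmetric]) auto
    ultimately show "MFc ((u + 1) * (l + 1)) (nterm t)" unfolding nterm_def by (intro MFc_smult li_mult li_of_nat li_numeral) simp
  qed
  ultimately show ?thesis using that by blast
qed

text \<open>As the coefficients sum to zero, each moment may be replaced by its difference from
  \<open>mu 2\<close>. For the top moment this difference is 6 (S_{l+1} - S_2) plus l times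
  \<open>nterm\<close>, so the \<open>1/l\<close> of its coefficient is harmless: the first part is
  \<open>RZ_Sf_l_diff\<close>, the second becomes S_2 S_{l-1} plus forms.\<close>

theorem N2_RZ: "RZ Wtop (Nf 2)"
proof -
  let ?T = "Sf (l - 2)"
  let ?d = "\<lambda>k. mu (2 * k) - mu 2"
  have a: "odd (l - 2)" "(l - 2 + 3) div 2 = u + 1" "l - 2 + 2 = l" using odd_l l_gt_3 l_u by auto
  obtain R where R: "MFc (u * (l + 1)) R" "mu (2 * u) = 6 * ?T + R" by (rule mu_top)
  obtain M where M: "MFc ((u + 1) * (l + 1)) M" "(\<Sum>t=1..u. nterm t) = fps_const (36 * (1 + of_nat u)) * (Sf 1 * ?T) + M" by (rule nterm_sum)
  have up: "MFc ((u + 1) * (l + 1)) f" if "MFc (k * (l + 1)) f" "k \<le> u + 1" for k f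
    by (rule MFc_mono[OF that(1)]) (use that(2) in \<open>intro mult_le_mono1\<close>)
  have S1: "MFc ((u + 1) * (l + 1)) (Sf 1)" using up[of 1] Sf_1_MFc by simp
  have mu2: "MFc ((u + 1) * (l + 1)) (mu 2)" unfolding mu_2 by (intro MFc_smult S1 li_numeral)
  have ln: "of_nat l \<noteq> (0 :: rat)" using l_pos by simp
  have dm: "?d k = mu (2 * k) + fps_const (-1) * mu 2" for k by (simp flip: fps_const_neg)
  have ins: "{1..u+1} = insert (u + 1) (insert u (insert 1 {2..u-1}))"
    and nin: "u + 1 \<notin> insert u (insert 1 {2..u-1})" "u \<notin> insert 1 {2..u-1}" "1 \<notin> {2..u-1}" using u_ge_2 by auto
  have "fps_const 2 * Wf (l - 2) = (\<Sum>k=1..u+1. fps_const (pt k) * mu (2 * k))" using Wf_double[OF a(1)] unfolding a(2) .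
  also have "\<dots> = (\<Sum>k=1..u+1. fps_const (pt k) * ?d k) + (\<Sum>k=1..u+1. fps_const (pt k)) * mu 2"
    by (simp only: right_diff_distrib sum_subtractf sum_distrib_right diff_add_cancel)
  also have "(\<Sum>k=1..u+1. fps_const (pt k)) = 0"
  proof -
    have "(\<Sum>k\<in>B. fps_const (pt k)) = fps_const (\<Sum>k\<in>B. pt k)" for B :: "nat set"
      by (induction B rule: infinite_finite_induct) auto
    thus ?thesis using phi_coeff_sum[OF a(1)] unfolding a(2) by simp
  qed
  also have "(\<Sum>k=1..u+1. fps_const (pt k) * ?d k) + 0 * mu 2 = fps_const (pt (u + 1)) * ?d (u + 1) + (fps_const (pt u) * ?d u + (\<Sum>k=2..u-1. fps_const (pt k) * ?d k))"
    unfolding ins by (simp only: sum.insert[OF _ nin(1)] sum.insert[OF _ nin(2)] sum.insert[OF _ nin(3)] finite_insert finite_atLeastAtMost) simp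
  finally have W1: "fps_const 2 * Wf (l - 2) = fps_const (pt (u + 1)) * ?d (u + 1) + (fps_const (pt u) * ?d u + (\<Sum>k=2..u-1. fps_const (pt k) * ?d k))" .
  have D: "?d (u + 1) = fps_const 6 * (Sf l - Sf 1) + fps_const (of_nat l) * (\<Sum>t=1..u. nterm t)"
  proof -
    have "mterm (u + 1) (u + 1) = fps_const 6 * Sf l"
    proof -
      have "2 * (u + 1) - 1 = l" using l_u by arith
      thus ?thesis unfolding mterm_def by (simp add: mu_0)
    qed
    moreover have "mu (2 * (u + 1)) = mterm (u + 1) (u + 1) + (\<Sum>t=1..u. mterm (u + 1) t)" using mu_even[of "u + 1"] by simp
    moreover have "(\<Sum>t=1..u. mterm (u + 1) t) = fps_const (of_nat l) * (\<Sum>t=1..u. nterm t)"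
      unfolding sum_distrib_left by (intro sum.cong refl mterm_nterm)
    ultimately show ?thesis unfolding mu_2 by (simp add: right_diff_distrib)
  qed
  let ?M = "fps_const A' * M + (fps_const (pt u) * (R + fps_const (-1) * mu 2) + (\<Sum>k=2..u-1. fps_const (pt k) * ?d k))"
  have Mc: "MFc ((u + 1) * (l + 1)) ?M"
  proof (intro MFc_add MFc_smult MFc_sum li_A' M(1) up[OF R(1)] mu2 phi_l2_li)
    fix k assume k: "k \<in> {2..u-1}"
    have "MFc ((u + 1) * (l + 1)) (mu (2 * k))" using k by (intro up[OF mu_MFc]) auto
    thus "MFc ((u + 1) * (l + 1)) (?d k)" unfolding dm by (intro MFc_add MFc_smult mu2 li_minus li_1)
  qed (use u_ge_2 in \<open>auto intro: li_minus\<close>)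
  have W2: "fps_const 2 * Wf (l - 2) = fps_const (6 * A') * (fps_const (1 / of_nat l) * (Sf l - Sf 1)) + (fps_const (A' * (36 * (1 + of_nat u))) * (Sf 1 * ?T) + fps_const (6 * pt u) * ?T) + ?M"
  proof -
    have "fps_const (pt (u + 1)) * ?d (u + 1) = fps_const (6 * A') * (fps_const (1 / of_nat l) * (Sf l - Sf 1)) + fps_const A' * (\<Sum>t=1..u. nterm t)"
    proof -
      have "fps_const (A' * (1 / of_nat l)) * (fps_const 6 * X + fps_const (of_nat l) * Y) = fps_const (6 * A') * (fps_const (1 / of_nat l) * X) + fps_const A' * Y" for X Y :: "rat fps"
      proof -
        have "A' * (1 / of_nat l) * of_nat l = A'" "A' * (1 / of_nat l) * 6 = 6 * A' * (1 / of_nat l)" using ln by simp_all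
        thus ?thesis by (simp only: distrib_left mult.assoc[symmetric] fps_const_mult)
      qed
      thus ?thesis unfolding pt_top D .
    qed
    moreover have "fps_const A' * (\<Sum>t=1..u. nterm t) = fps_const (A' * (36 * (1 + of_nat u))) * (Sf 1 * ?T) + fps_const A' * M"
      unfolding M(2) distrib_left[of "fps_const A'"] by (simp only: mult.assoc[symmetric] fps_const_mult)
    moreover have "fps_const (pt u) * ?d u = fps_const (6 * pt u) * ?T + fps_const (pt u) * (R + fps_const (-1) * mu 2)"
    proof -
      have "?d u = fps_const 6 * ?T + (R + fps_const (-1) * mu 2)" unfolding dm[of u] unfolding R(2) by (simp only: fps_numeral_fps_const add_ac)
      thus ?thesis by (simp only: distrib_left mult.assoc[symmetric] fps_const_mult mult.commute[of "pt u" 6])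
    qed
    ultimately show ?thesis unfolding W1 by (simp only: add_ac)
  qed
  have "RZ Wtop (fps_const (6 * A') * res (fps_const (1 / of_nat l) * (Sf l - Sf 1)) + (fps_const (A' * (36 * (1 + of_nat u))) * res (Sf 1 * ?T) + fps_const (6 * pt u) * res ?T) + res ?M)"
  proof (rule RZ_add[OF RZ_add])
    show "RZ Wtop (fps_const (6 * A') * res (fps_const (1 / of_nat l) * (Sf l - Sf 1)))"
      unfolding res_smult by (intro RZ_smult RZ_Sf_l_diff li_mult li_numeral li_A')
    show "RZ Wtop (res ?M)" by (rule res_MFc[OF Mc])
    \<comment> \<open>By \<open>pt_cancel\<close> the terms in S_2 S_{l-1} and S_{l-1} combine to a
      multiple of 24 res(S_2 S_{l-1}) - res S_{l-1}, which \<open>res_Sf_1_top\<close> reduces to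
      -E_2 res 1.\<close>
    let ?x = "A' * (36 * (1 + of_nat u)) * (1/24)"
    have lix: "li ?x" unfolding pt_cancel using u_ge_2 by (intro li_minus li_mult li_numeral phi_l2_li) auto
    have "fps_const (A' * (36 * (1 + of_nat u))) * res (Sf 1 * ?T) + fps_const (6 * pt u) * res ?T = fps_const ?x * (24 * res (Sf 1 * ?T) - res ?T)"
    proof -
      have "fps_const ?x * (24 * res (Sf 1 * ?T)) = fps_const (A' * (36 * (1 + of_nat u))) * res (Sf 1 * ?T)"
        by (simp add: fps_numeral_fps_const mult.assoc[symmetric])
      moreover have "fps_const ?x * res ?T = - (fps_const (6 * pt u) * res ?T)" unfolding pt_cancel by (simp flip: fps_const_neg)
      ultimately show ?thesis by (simp only: right_diff_distrib diff_minus_eq_add)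
    qed
    moreover have "cg 1 (fps_const ?x * (24 * res (Sf 1 * ?T) - res ?T)) (fps_const ?x * ((res ?T - E2f * res 1) - res ?T))"
      by (intro cg_smult lix cg_diff res_Sf_1_top cg_refl)
    moreover have "(res ?T - E2f * res 1) - res ?T = fps_const (-1) * (E2f * res 1)" by (simp flip: fps_const_neg)
    moreover have "RZ Wtop (fps_const ?x * (fps_const (-1) * (E2f * res 1)))"
      by (intro RZ_smult lix li_minus li_1 RZ_mono[OF RZ_E2_res_1 Wtop_ge])
    ultimately show "RZ Wtop (fps_const (A' * (36 * (1 + of_nat u))) * res (Sf 1 * ?T) + fps_const (6 * pt u) * res ?T)"
      using RZ_cong by (simp only:)
  qed
  hence "RZ Wtop (res (fps_const 2 * Wf (l - 2)))" unfolding W2 res_add[of _ ?M] res_add[of "fps_const (6 * A') * _"] res_add[of "fps_const (A' * _) * _"] res_smult .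
  hence "RZ Wtop (2 * res (Wf (l - 2)))" by (simp only: res_smult fps_numeral_fps_const)
  from RZ_cong[OF this Yf_rec] have "RZ Wtop (Yf l)" unfolding a(3) .
  from RZ_cong[OF this Yf_l] show ?thesis unfolding Nf_2 .
qed

end

section \<open>Dilation by 24 and the theorem\<close>

lemma fps_power_eq_upto:
  fixes f g :: "'a :: comm_ring_1 fps"
  assumes "\<And>j. j \<le> m \<Longrightarrow> fps_nth f j = fps_nth g j"
  shows "j \<le> m \<Longrightarrow> fps_nth (f ^ r) j = fps_nth (g ^ r) j"
proof (induction r arbitrary: j)
  case (Suc r) thus ?case using assms by (simp add: fps_mult_nth)
qed simp

lemma dilate_X_power: "m > 0 \<Longrightarrow> dilate m (fps_X ^ n :: rat fps) = fps_X ^ (m * n)"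
  by (rule fps_ext) (auto simp: dilate_nth fps_X_power_nth)

lemma dilate_Phim: "m > 0 \<Longrightarrow> dilate m (Phim n) = (\<Prod>k\<in>{1..n}. 1 - fps_X ^ (m * k))"
proof (induction n)
  case 0 thus ?case by (simp add: Phim_def dilate_1)
next
  case (Suc n)
  thus ?case by (simp add: Phim_Suc dilate_mult dilate_diff dilate_1 dilate_X_power mult.commute del: power_Suc mult_Suc_right)
qed

lemma eta24_eq: "eta24 r = fps_X ^ r * dilate 24 (Phi ^ r)"
proof (rule fps_ext)
  fix m
  let ?P = "\<Prod>n\<in>{1..m}. (1 - fps_X ^ (24 * n)) :: rat fps"
  have "fps_nth (dilate 24 Phi) j = fps_nth ?P j" if "j \<le> m" for j
  proof -
    have "j div 24 \<le> m" using that by (meson div_le_dividend le_trans)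
    hence "fps_nth (dilate 24 Phi) j = fps_nth (dilate 24 (Phim m)) j" by (simp add: dilate_nth Phi_eq_Phim[of _ m])
    thus ?thesis by (simp add: dilate_Phim)
  qed
  hence "fps_nth (dilate 24 Phi ^ r) j = fps_nth (?P ^ r) j" if "j \<le> m" for j using fps_power_eq_upto[of m] that by blast
  hence "fps_nth (fps_X ^ r * dilate 24 (Phi ^ r)) m = fps_nth (fps_X ^ r * ?P ^ r) m"
    by (simp add: fps_X_power_mult_nth dilate_power)
  thus "fps_nth (eta24 r) m = fps_nth (fps_X ^ r * dilate 24 (Phi ^ r)) m" by (simp add: eta24_def)
qed

lemma dil24_eq: "dil24 g = dilate 24 (Abs_fps g)"
  by (rule fps_ext) (simp add: dil24_def dilate_nth)

context rank_prime
begin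

lemma rank_gen_eq: "rank_gen k l \<beta> r = fps_X ^ r * dilate 24 (Nf k)"
  by (rule fps_ext) (auto simp: rank_gen_def Nf_def dilate_nth fps_X_power_mult_nth not_less)

lemma cg_fps_cong:
  assumes "cg 1 A B" "BI A"
  shows "fps_cong l A B"
  unfolding fps_cong_def
proof (intro allI conjI)
  fix j
  show "li (fps_nth A j)" using BI_li assms by blast
  show "li (fps_nth B j)" using BI_li cg_BI[OF cg_sym] assms by blast
  obtain k where k: "BI k" "A = B + fps_const (of_nat l ^ 1) * k" using assms(1) by (auto simp: cg_def)
  hence "(fps_nth A j - fps_nth B j) / of_nat l = fps_nth k j" using l_pos by simp
  thus "li ((fps_nth A j - fps_nth B j) / of_nat l)" using BI_li[OF k(1)] by simp
qed

lemma cg_lift: "cg 1 f g \<Longrightarrow> cg 1 (fps_X ^ r * dilate 24 f) (fps_X ^ r * dilate 24 g)"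
proof (rule cg_mult_left)
  show "BI (fps_X ^ r)" by (intro BI_power BI_X)
  assume "cg 1 f g"
  then obtain k where k: "BI k" "f = g + fps_const (of_nat l ^ 1) * k" by (auto simp: cg_def)
  show "cg 1 (dilate 24 f) (dilate 24 g)"
  proof (rule cgI[OF BI_dilate[OF k(1)]])
    have "(24 :: nat) > 0" by simp
    thus "dilate 24 f = dilate 24 g + fps_const (of_nat l ^ 1) * dilate 24 k"
      unfolding k(2) dilate_add using dilate_mult[of 24] dilate_const[of 24] by metis
  qed
qed

lemma lift_congruence:
  assumes "cg 1 (Nf k) F"
  shows "fps_cong l (rank_gen k l \<beta> r) (fps_X ^ r * dilate 24 F)"
  unfolding rank_gen_eq using assms by (intro cg_fps_cong cg_lift) (auto intro!: BI_mult BI_power BI_X BI_dilate BI_Nf)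

lemma lift_const_mult:
  fixes F :: "rat fps"
  shows "fps_X ^ r * dilate 24 (fps_const c * F) = fps_const c * (fps_X ^ r * dilate 24 F)"
proof -
  have "dilate 24 (fps_const c * F) = fps_const c * dilate 24 F" using dilate_mult[of 24 "fps_const c" F] dilate_const[of 24 c] by simp
  thus ?thesis by (simp only: mult.left_commute)
qed

lemma lift_Phi_mult: "fps_X ^ r * dilate 24 (Phi ^ r * G) = eta24 r * dil24 (fps_nth G)"
  using dilate_mult[of 24 "Phi ^ r" G] by (simp add: eta24_eq dil24_eq fps_nth_inverse mult.assoc)

lemma lift_add:
  fixes F G :: "rat fps"
  shows "fps_X ^ r * dilate 24 (F + G) = fps_X ^ r * dilate 24 F + fps_X ^ r * dilate 24 G"
  by (simp add: dilate_add distrib_left)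

lemma sum_mf_bounded_form:
  assumes "mform k f" "\<And>n. P (fps_nth f n)" "real_of_int k \<le> W"
  shows "sum_mf_bounded P W (fps_nth f)"
  unfolding sum_mf_bounded_def
  by (intro exI[of _ "[(k, fps_nth f)]"]) (use assms mform_is_modular_form[OF assms(1)] in auto)

lemma sum_mf_bounded_add:
  assumes "sum_mf_bounded P W (fps_nth f)" "sum_mf_bounded P W (fps_nth g)"
  shows "sum_mf_bounded P W (fps_nth (f + g))"
proof -
  obtain fs where fs: "\<forall>(k, f) \<in> set fs. (\<forall>n. P (f n)) \<and> is_modular_form k (\<lambda>n. of_rat (f n)) \<and> real_of_int k \<le> W"
    "fps_nth f = (\<lambda>n. sum_list (map (\<lambda>(k, f). f n) fs))" using assms(1) unfolding sum_mf_bounded_def by blast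
  obtain gs where gs: "\<forall>(k, f) \<in> set gs. (\<forall>n. P (f n)) \<and> is_modular_form k (\<lambda>n. of_rat (f n)) \<and> real_of_int k \<le> W"
    "fps_nth g = (\<lambda>n. sum_list (map (\<lambda>(k, f). f n) gs))" using assms(2) unfolding sum_mf_bounded_def by blast
  show ?thesis unfolding sum_mf_bounded_def
  proof (intro exI[of _ "fs @ gs"] conjI ext)
    show "\<forall>(k, f) \<in> set (fs @ gs). (\<forall>n. P (f n)) \<and> is_modular_form k (\<lambda>n. of_rat (f n)) \<and> real_of_int k \<le> W"
      using fs(1) gs(1) by auto
    show "fps_nth (f + g) n = sum_list (map (\<lambda>(k, f). f n) (fs @ gs))" for n
      using fun_cong[OF fs(2), of n] fun_cong[OF gs(2), of n] by simp
  qed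
qed

lemma MZ_sum_mf: "MZ W G \<Longrightarrow> real_of_int W \<le> V \<Longrightarrow> sum_mf_bounded li V (fps_nth G)"
proof (induction rule: MZ.induct)
  case (MZ_form k f)
  have "real_of_int k \<le> real_of_int W" using MZ_form(3) by simp
  thus ?case using MZ_form by (intro sum_mf_bounded_form[OF MZ_form(1)] BI_li) auto
qed (auto intro: sum_mf_bounded_add)

text \<open>The common denominator is multiplied by its inverse modulo l, so the clearing factor is
  1 modulo l and does not change the series modulo l.\<close>

lemma BI_clear:
  assumes "BI f"
  obtains m :: int where "\<And>n. of_int (1 + int l * m) * fps_nth f n \<in> \<int>"
proof -
  obtain D where D: "\<not> int l dvd D" "\<And>n. of_int D * fps_nth f n \<in> \<int>" using assms unfolding BI_def by blast
  have "coprime D (int l)" using prime_imp_coprime[of "int l" D] prime_l D(1) by (simp add: coprime_commute)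
  then obtain i where "[D * i = 1] (mod int l)" using cong_solve_coprime_int by blast
  then obtain m where m: "D * i = 1 + int l * m" by (metis cong_iff_lin cong_sym)
  have "of_int (1 + int l * m) * fps_nth f n = of_int i * (of_int D * fps_nth f n)" for n
    unfolding m[symmetric] by simp
  thus ?thesis using that[of m] D(2) by (metis Ints_mult Ints_of_int)
qed

lemma MZ_sum_mf_int: "MZ W G \<Longrightarrow> real_of_int W \<le> V \<Longrightarrow> \<exists>G'. cg 1 G G' \<and> sum_mf_bounded (\<lambda>x. x \<in> \<int>) V (fps_nth G')"
proof (induction rule: MZ.induct)
  case (MZ_form k f)
  obtain m :: int where m: "\<And>n. of_int (1 + int l * m) * fps_nth f n \<in> \<int>" using BI_clear[OF MZ_form(2)] by blast
  let ?g = "fps_const (of_int (1 + int l * m)) * f"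
  have "cg 1 ?g f"
    by (rule cgI[of "fps_const (of_int m) * f"])
       (intro BI_smult MZ_form li_of_int, simp add: algebra_simps flip: fps_const_add fps_const_mult)
  moreover have "real_of_int k \<le> V" using MZ_form(3,4) by linarith
  hence "sum_mf_bounded (\<lambda>x. x \<in> \<int>) V (fps_nth ?g)"
    using m by (intro sum_mf_bounded_form[OF mform_smult[OF MZ_form(1)]]) (simp_all del: of_int_add of_int_mult)
  ultimately show ?case using cg_sym by blast
next
  case (MZ_add f g)
  then obtain f' g' where "cg 1 f f'" "sum_mf_bounded (\<lambda>x. x \<in> \<int>) V (fps_nth f')" "cg 1 g g'" "sum_mf_bounded (\<lambda>x. x \<in> \<int>) V (fps_nth g')" by blast
  thus ?case using cg_add sum_mf_bounded_add by blast
qed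

lemma half_real: "real_of_int (2 * x) = y \<Longrightarrow> real_of_int x \<le> y / 2" by simp

lemma second_moment_congruence: "\<exists>G. sum_mf_bounded li ((real l * (real l + 3) - real r - 1) / 2) G \<and> fps_cong l (rank_gen 2 l \<beta> r) (eta24 r * dil24 G)"
proof -
  obtain G where G: "MZ Wtop G" "cg 1 (Nf 2) (Phi ^ r * G)" using N2_RZ by (auto simp: RZ_def)
  have "real_of_int (2 * Wtop) = real l * (real l + 3) - real r - 1" unfolding Wtop by simp
  hence "real_of_int Wtop \<le> (real l * (real l + 3) - real r - 1) / 2" by (rule half_real)
  hence "sum_mf_bounded li ((real l * (real l + 3) - real r - 1) / 2) (fps_nth G)" by (rule MZ_sum_mf[OF G(1)])
  moreover have "fps_cong l (rank_gen 2 l \<beta> r) (eta24 r * dil24 (fps_nth G))"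
    using lift_congruence[OF G(2)] unfolding lift_Phi_mult .
  ultimately show ?thesis by blast
qed

lemma higher_moment_congruence:
  assumes "2 \<le> k" "real k \<le> (real l - 3) / 2"
  shows "\<exists>(c::int) G. sum_mf_bounded li (real k * (real l + 1) - 1 + (real l - real r) / 2) G \<and>
            fps_cong l (rank_gen (2 * k) l \<beta> r) (fps_const (of_int c) * rank_gen 2 l \<beta> r + eta24 r * dil24 G)"
proof -
  have "real (2 * k + 3) \<le> real l" using assms(2) by simp
  hence "2 * k + 3 \<le> l" by (simp only: of_nat_le_iff)
  hence "k < u" using l_u by linarith
  then obtain c G where G: "MZ (int (k * (l + 1)) + c0) G" "cg 1 (Nf (2 * k) - fps_const (of_int c) * Nf 2) (Phi ^ r * G)"
    using Nf_RZ[OF assms(1)] by (auto simp: RZ_def)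
  have "real_of_int (2 * c0) = real l - 2 - real r" unfolding c0 by simp
  hence "real_of_int c0 \<le> (real l - 2 - real r) / 2" by (rule half_real)
  moreover have "real_of_int (int (k * (l + 1))) = real k * (real l + 1)" by (simp add: algebra_simps)
  ultimately have "real_of_int (int (k * (l + 1)) + c0) \<le> real k * (real l + 1) + (real l - 2 - real r) / 2"
    unfolding of_int_add by (intro add_mono) simp_all
  hence "real_of_int (int (k * (l + 1)) + c0) \<le> real k * (real l + 1) - 1 + (real l - real r) / 2"
    by (simp only: diff_divide_distrib)
  hence "sum_mf_bounded li (real k * (real l + 1) - 1 + (real l - real r) / 2) (fps_nth G)" by (rule MZ_sum_mf[OF G(1)])
  moreover have "cg 1 (Nf (2 * k)) (fps_const (of_int c) * Nf 2 + Phi ^ r * G)"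
    using cg_add[OF G(2) cg_refl[of 1 "fps_const (of_int c) * Nf 2"]] by (simp add: add.commute)
  from lift_congruence[OF this] have "fps_cong l (rank_gen (2 * k) l \<beta> r) (fps_const (of_int c) * rank_gen 2 l \<beta> r + eta24 r * dil24 (fps_nth G))"
    unfolding lift_add lift_const_mult lift_Phi_mult rank_gen_eq[symmetric] .
  ultimately show ?thesis by blast
qed

text \<open>The forms of \<open>res_Sf_top\<close> are only integral at l. Both are multiplied by
  the coefficient of S_{l-1} and by one common integer that is 1 modulo l and clears both
  denominators; a common factor is essential, as their difference must remain divisible by l. The
  minus sign in \<open>K1\<close> and \<open>K2\<close> turns H2 - H1 into the required
  order.\<close>

lemma top_moment_congruence:
  "\<exists>(c::int) G H1 H2.
         sum_mf_bounded (\<lambda>x. x \<in> \<int>) ((real l * (real l + 1) - real r - 3) / 2) G \<and>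
         (\<forall>n. H1 n \<in> \<int>) \<and> (\<forall>n. H2 n \<in> \<int>) \<and>
         is_modular_form ((int l * (int l - 1) - int r - 1) div 2) (\<lambda>n. of_rat (H1 n)) \<and>
         is_modular_form ((int l * (int l + 1) - int r - 3) div 2) (\<lambda>n. of_rat (H2 n)) \<and>
         fps_cong l (Abs_fps H1) (Abs_fps H2) \<and>
         fps_cong l (rank_gen (l - 1) l \<beta> r)
           (fps_const (of_int c) * rank_gen 2 l \<beta> r + eta24 r * dil24 G
            + fps_const (1 / of_nat l) * (eta24 r * (dil24 H1 - dil24 H2)))"
proof -
  have ln: "of_nat l \<noteq> (0 :: rat)" using l_pos by simp
  obtain c :: int and c' R where R: "li c'" "RZ (int (u * (l + 1)) + c0) R"
    "cg 1 (Nf (l - 1)) (fps_const (of_int c) * Nf 2 + R + fps_const c' * res (Sf (l - 2)))" by (rule Nf_top)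
  obtain G0 where G0: "MZ (int (u * (l + 1)) + c0) G0" "cg 1 R (Phi ^ r * G0)" using R(2) by (auto simp: RZ_def)
  have "2 * real u = real l - 1" using l_u by linarith
  hence u2: "2 * real_of_int (int (u * (l + 1))) = (real l - 1) * (real l + 1)"
  proof -
    have "2 * real_of_int (int (u * (l + 1))) = 2 * real u * (real l + 1)" by (simp add: algebra_simps)
    thus ?thesis using \<open>2 * real u = real l - 1\<close> by (simp only:)
  qed
  have "real_of_int (2 * c0) = real l - 2 - real r" unfolding c0 by simp
  moreover have "real_of_int (2 * (x + y)) = a + b" if "2 * real_of_int x = a" "real_of_int (2 * y) = b" for x y :: int and a b
    using that by simp
  ultimately have "real_of_int (2 * (int (u * (l + 1)) + c0)) = (real l - 1) * (real l + 1) + (real l - 2 - real r)"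
    using u2 by blast
  hence "real_of_int (2 * (int (u * (l + 1)) + c0)) = real l * (real l + 1) - real r - 3"
    by (simp add: algebra_simps)
  hence "real_of_int (int (u * (l + 1)) + c0) \<le> (real l * (real l + 1) - real r - 3) / 2" by (rule half_real)
  then obtain G where G: "cg 1 G0 G" "sum_mf_bounded (\<lambda>x. x \<in> \<int>) ((real l * (real l + 1) - real r - 3) / 2) (fps_nth G)"
    using MZ_sum_mf_int[OF G0(1)] by blast
  obtain H1 H2 k where H: "mform ((int l * (int l - 1) - int r - 1) div 2) H1" "mform ((int l * (int l + 1) - int r - 3) div 2) H2"
    "BI H1" "BI H2" "BI k" "fps_const (of_nat l) * res (Sf (l - 2)) = Phi ^ r * (H2 - H1) + fps_const (of_nat l ^ 2) * k" by (rule res_Sf_top)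
  define \<Delta> where "\<Delta> = Pf ^ r * (res (Sf (l - 2)) - fps_const (of_nat l) * k)"
  have B\<Delta>: "BI \<Delta>" unfolding \<Delta>_def by (intro BI_mult BI_power BI_Pf BI_diff res_BI BI_Sf BI_smult H li_of_nat)
  have Hd: "H2 - H1 = fps_const (of_nat l) * \<Delta>"
  proof -
    have "Phi ^ r * (H2 - H1) = fps_const (of_nat l) * (res (Sf (l - 2)) - fps_const (of_nat l) * k)"
      using H(6) by (simp add: right_diff_distrib power2_eq_square mult.assoc[symmetric])
    hence "Pf ^ r * (Phi ^ r * (H2 - H1)) = Pf ^ r * (fps_const (of_nat l) * (res (Sf (l - 2)) - fps_const (of_nat l) * k))" by (rule arg_cong)
    hence "(Phi ^ r * Pf ^ r) * (H2 - H1) = fps_const (of_nat l) * \<Delta>" unfolding \<Delta>_def by (simp only: mult_ac)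
    thus ?thesis by (simp add: Phi_Pf_power)
  qed
  have T: "res (Sf (l - 2)) = Phi ^ r * \<Delta> + fps_const (of_nat l) * k"
    unfolding \<Delta>_def by (simp add: mult.assoc[symmetric] Phi_Pf_power)
  obtain m1 :: int where m1: "\<And>n. of_int (1 + int l * m1) * fps_nth (fps_const c' * H1) n \<in> \<int>" using BI_clear BI_smult R(1) H(3) by blast
  obtain m2 :: int where m2: "\<And>n. of_int (1 + int l * m2) * fps_nth (fps_const c' * H2) n \<in> \<int>" using BI_clear BI_smult R(1) H(4) by blast
  define D where "D = (1 + int l * m1) * (1 + int l * m2)"
  define m where "m = m1 + m2 + int l * (m1 * m2)"
  have D: "D = 1 + int l * m" by (simp add: D_def m_def algebra_simps)
  define K1 where "K1 = fps_const (- (of_int D * c')) * H1"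
  define K2 where "K2 = fps_const (- (of_int D * c')) * H2"
  have I1: "fps_nth K1 n \<in> \<int>" for n
  proof -
    have "fps_nth K1 n = - (of_int (1 + int l * m2) * (of_int (1 + int l * m1) * fps_nth (fps_const c' * H1) n))"
      by (simp add: K1_def D_def mult_ac)
    thus ?thesis using m1[of n] by (simp del: of_int_add of_int_mult fps_mult_left_const_nth)
  qed
  have I2: "fps_nth K2 n \<in> \<int>" for n
  proof -
    have "fps_nth K2 n = - (of_int (1 + int l * m1) * (of_int (1 + int l * m2) * fps_nth (fps_const c' * H2) n))"
      by (simp add: K2_def D_def mult_ac)
    thus ?thesis using m2[of n] by (simp del: of_int_add of_int_mult fps_mult_left_const_nth)
  qed
  have K: "K1 - K2 = fps_const (of_nat l) * (fps_const (of_int D * c') * \<Delta>)"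
  proof -
    have "K1 - K2 = fps_const (of_int D * c') * (H2 - H1)" unfolding K1_def K2_def by (simp add: right_diff_distrib flip: fps_const_neg)
    thus ?thesis unfolding Hd by (simp only: mult.left_commute)
  qed
  have "cg 1 K1 K2"
    by (rule cgI[of "fps_const (of_int D * c') * \<Delta>"])
       (intro BI_smult li_mult li_of_int R B\<Delta>, simp add: K[symmetric])
  hence c12: "fps_cong l (Abs_fps (fps_nth K1)) (Abs_fps (fps_nth K2))"
    using I1 by (simp add: fps_nth_inverse) (intro cg_fps_cong BI_int, simp_all)
  have "fps_const c' * res (Sf (l - 2)) = Phi ^ r * (fps_const (of_int D * c') * \<Delta>) + fps_const (of_nat l ^ 1) * (fps_const c' * k - fps_const (of_int m * c') * (Phi ^ r * \<Delta>))"
  proof -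
    have gen: "a * (P * X + L * k) = P * ((a + L * b) * X) + L * (a * k - b * (P * X))" for a b L P X k :: "rat fps"
      by (simp add: algebra_simps)
    have "fps_const (of_int D * c') = fps_const c' + fps_const (of_nat l) * fps_const (of_int m * c')" by (simp add: D algebra_simps)
    thus ?thesis unfolding T power_one_right by (simp only: gen)
  qed
  hence cT: "cg 1 (fps_const c' * res (Sf (l - 2))) (Phi ^ r * (fps_const (of_int D * c') * \<Delta>))"
    by (rule cgI[rotated]) (intro BI_diff BI_smult li_mult li_of_int R H BI_mult BI_power BI_Phi B\<Delta>)
  have cR: "cg 1 R (Phi ^ r * G)"
    using cg_trans[OF G0(2) cg_mult_left[OF BI_power[OF BI_Phi] G(1)]] .
  have "cg 1 (Nf (l - 1)) (fps_const (of_int c) * Nf 2 + Phi ^ r * G + Phi ^ r * (fps_const (of_int D * c') * \<Delta>))"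
    by (rule cg_trans[OF R(3)]) (intro cg_add cg_refl cR cT)
  also have "Phi ^ r * (fps_const (of_int D * c') * \<Delta>) = fps_const (1 / of_nat l) * (Phi ^ r * (K1 - K2))"
    unfolding K using ln by (simp add: mult.left_commute[of "Phi ^ r"] mult.assoc[symmetric])
  finally have "cg 1 (Nf (l - 1)) (fps_const (of_int c) * Nf 2 + Phi ^ r * G + fps_const (1 / of_nat l) * (Phi ^ r * (K1 - K2)))" .
  from lift_congruence[OF this] have "fps_cong l (rank_gen (l - 1) l \<beta> r) (fps_const (of_int c) * rank_gen 2 l \<beta> r + eta24 r * dil24 (fps_nth G) + fps_const (1 / of_nat l) * (eta24 r * dil24 (fps_nth (K1 - K2))))"
    unfolding lift_add lift_const_mult lift_Phi_mult rank_gen_eq[symmetric] .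
  moreover have "dil24 (fps_nth (K1 - K2)) = dil24 (fps_nth K1) - dil24 (fps_nth K2)"
    by (rule fps_ext) (simp add: dil24_def)
  moreover have "mform ((int l * (int l - 1) - int r - 1) div 2) K1" "mform ((int l * (int l + 1) - int r - 3) div 2) K2"
    unfolding K1_def K2_def by (intro mform_smult H)+
  ultimately show ?thesis using G(2) I1 I2 c12 mform_is_modular_form
    by (intro exI[of _ c] exI[of _ "fps_nth G"] exI[of _ "fps_nth K1"] exI[of _ "fps_nth K2"] conjI allI) simp_all
qed

end

theorem theorem1p4:
  fixes l \<beta> r :: nat
  assumes "prime l" and "l > 3"
    and "1 \<le> \<beta>" and "\<beta> \<le> l - 1" and "[24 * \<beta> = 1] (mod l)"
    and "r = (24 * \<beta> - 1) div l"
  shows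
   "(\<exists>G. sum_mf_bounded (l_integral l) ((real l * (real l + 3) - real r - 1) / 2) G \<and>
         fps_cong l (rank_gen 2 l \<beta> r) (eta24 r * dil24 G))
    \<and> (\<forall>k::nat. 2 \<le> k \<and> real k \<le> (real l - 3) / 2 \<longrightarrow>
         (\<exists>(c::int) G. sum_mf_bounded (l_integral l)
                (real k * (real l + 1) - 1 + (real l - real r) / 2) G \<and>
            fps_cong l (rank_gen (2 * k) l \<beta> r)
              (fps_const (of_int c) * rank_gen 2 l \<beta> r + eta24 r * dil24 G)))
    \<and> (\<exists>(c::int) G H1 H2.
         sum_mf_bounded (\<lambda>x. x \<in> \<int>) ((real l * (real l + 1) - real r - 3) / 2) G \<and>
         (\<forall>n. H1 n \<in> \<int>) \<and> (\<forall>n. H2 n \<in> \<int>) \<and>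
         is_modular_form ((int l * (int l - 1) - int r - 1) div 2) (\<lambda>n. of_rat (H1 n)) \<and>
         is_modular_form ((int l * (int l + 1) - int r - 3) div 2) (\<lambda>n. of_rat (H2 n)) \<and>
         fps_cong l (Abs_fps H1) (Abs_fps H2) \<and>
         fps_cong l (rank_gen (l - 1) l \<beta> r)
           (fps_const (of_int c) * rank_gen 2 l \<beta> r + eta24 r * dil24 G
            + fps_const (1 / of_nat l) * (eta24 r * (dil24 H1 - dil24 H2))))"
proof -
  have "l dvd 24 * \<beta> - 1" using cong_altdef_nat[of 1 "24 * \<beta>" l] assms(3,5) by (simp add: cong_altdef_nat)
  hence "24 * \<beta> - 1 = l * r" using assms(6) by simp
  hence "24 * \<beta> = 1 + l * r" using assms(3) by linarith
  then interpret rank_prime l \<beta> r using assms by unfold_locales auto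
  show ?thesis using second_moment_congruence higher_moment_congruence top_moment_congruence by blast
qed

end
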